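(* Let $N$ be a lattice of rank $r$, $\Sigma$ a complete rational polyhedral fan in $N\otimes\mathbb R$ whose toric variety $X$ is nonsingular, and $\deg\colon N\to\mathbb C$ a function linear on each cone of $\Sigma$. Let $d_1,\dots,d_s$ be the primitive generators of the one-dimensional cones of $\Sigma$, $D_i\in H^2(X,\mathbb C)$ the classes of the corresponding torus-invariant divisors, and $\alpha_i=\deg(d_i)$; assume $\alpha_i\notin\mathbb Z$ for all $i$. Then for $\tau$ in the upper half plane with $\operatorname{Im}\tau$ sufficiently large, $$f_{N,\deg}(q)=\int_X\prod_{i=1}^s\frac{(D_i/2\pi i)\,\theta(D_i/2\pi i-\alpha_i,\tau)\,\theta'(0,\tau)}{\theta(D_i/2\pi i,\tau)\,\theta(-\alpha_i,\tau)}.$$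
   Context: $q=e^{2\pi i\tau}$. $\theta(z,\tau)=\frac1i\sum_{n\in\mathbb Z}(-1)^ne^{\pi i\tau(n+1/2)^2}e^{\pi iz(2n+1)}$ and $\theta'=\partial\theta/\partial z$. For each $i$, $\Phi_i(z)=z\theta(z-\alpha_i,\tau)\theta'(0,\tau)/(\theta(z,\tau)\theta(-\alpha_i,\tau))$ is holomorphic near $z=0$; the integrand means the product of the power series $\Phi_i$ evaluated at the nilpotent classes $z=D_i/2\pi i$ in $H^{*}(X,\mathbb C)$, and $\int_X$ takes the degree-$2r$ component paired with the fundamental class. Toric form: with $M$ the dual lattice and pairing $m\cdot n$, for $C\in\Sigma$, $m\in M$ let $f_C(q,m)$ be the rational function $\sum_{n\in C\cap N}e^{2\pi i\deg(n)}x^n$ of Laurent monomials $x^n$ evaluated at $x^n=q^{m\cdot n}$ (equal to the convergent sum $\sum_{n\in C\cap N}q^{m\cdot n}e^{2\pi i\deg n}$ when $m$ is positive on $C\setminus\{0\}$, its analytic continuation in $q$ otherwise). Then $f_{N,\deg}(q)=\sum_{m\in M}\sum_{C\in\Sigma}(-1)^{r-\dim C}f_C(q,m)$, which converges absolutely for $|q|$ small. The toric variety $X$ of $\Sigma$ is obtained by gluing the affine varieties $\mathrm{Spec}\,\mathbb C[C^\vee\cap M]$, $C\in\Sigma$; it is nonsingular iff every cone is generated by part of a basis of $N$. *)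

theory Defs
  imports
    "HOL-Complex_Analysis.Complex_Analysis"
    "HOL-Homology.Homology"
    "HOL-Algebra.QuotRing"
begin

section \<open>Lattices and fans\<close>

text \<open>A lattice is the integer span of linearly independent vectors of a Euclidean space; its
  real span plays the role of the vector space spanned by it. It need not be the
  whole ambient space, so every rank, zero included, occurs.\<close>

definition lattice_basis :: "'a::euclidean_space set \<Rightarrow> 'a set \<Rightarrow> bool" where
  "lattice_basis N B \<longleftrightarrow> finite B \<and> independent B \<and>
     N = {(\<Sum>b\<in>B. of_int (c b) *\<^sub>R b) | c :: 'a \<Rightarrow> int. True}"

definition lattice_of_rank :: "'a::euclidean_space set \<Rightarrow> nat \<Rightarrow> bool" where
  "lattice_of_rank N r \<longleftrightarrow> (\<exists>B. lattice_basis N B \<and> card B = r)"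

text \<open>The dual lattice, its elements being identified with vectors of the real span of the
  lattice by means of the inner product, which then is the duality pairing.\<close>

definition dual_lattice :: "'a::euclidean_space set \<Rightarrow> 'a set" where
  "dual_lattice N = {m \<in> span N. \<forall>n\<in>N. m \<bullet> n \<in> \<int>}"

definition rational_cone :: "'a::euclidean_space set \<Rightarrow> 'a set \<Rightarrow> bool" where
  "rational_cone N C \<longleftrightarrow>
     (\<exists>S. finite S \<and> S \<subseteq> N \<and> C = convex_cone hull S) \<and> C \<inter> uminus ` C = {0}"

text \<open>The empty set, which is a face in the sense of \<^const>\<open>face_of\<close>, is not a cone.\<close>

definition fan :: "'a::euclidean_space set \<Rightarrow> 'a set set \<Rightarrow> bool" where
  "fan N \<Sigma> \<longleftrightarrow> finite \<Sigma> \<and> (\<forall>C\<in>\<Sigma>. rational_cone N C) \<and>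
     (\<forall>C\<in>\<Sigma>. \<forall>F. F face_of C \<and> F \<noteq> {} \<longrightarrow> F \<in> \<Sigma>) \<and>
     (\<forall>C\<in>\<Sigma>. \<forall>C'\<in>\<Sigma>. (C \<inter> C') face_of C \<and> (C \<inter> C') face_of C')"

definition complete_fan :: "'a::euclidean_space set \<Rightarrow> 'a set set \<Rightarrow> bool" where
  "complete_fan N \<Sigma> \<longleftrightarrow> fan N \<Sigma> \<and> \<Union>\<Sigma> = span N"

text \<open>Nonsingularity of the toric variety: each cone is generated by part of a lattice basis.\<close>

definition nonsingular_fan :: "'a::euclidean_space set \<Rightarrow> 'a set set \<Rightarrow> bool" where
  "nonsingular_fan N \<Sigma> \<longleftrightarrow>
     (\<forall>C\<in>\<Sigma>. \<exists>B S. lattice_basis N B \<and> S \<subseteq> B \<and> C = convex_cone hull S)"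

definition ray_generators :: "'a::euclidean_space set \<Rightarrow> 'a set set \<Rightarrow> 'a set" where
  "ray_generators N \<Sigma> =
     {d \<in> N. d \<noteq> 0 \<and> convex_cone hull {d} \<in> \<Sigma> \<and> (\<forall>t. 0 < t \<and> t < 1 \<longrightarrow> t *\<^sub>R d \<notin> N)}"

definition piecewise_linear ::
    "'a::euclidean_space set \<Rightarrow> 'a set set \<Rightarrow> ('a \<Rightarrow> complex) \<Rightarrow> bool" where
  "piecewise_linear N \<Sigma> dg \<longleftrightarrow> (\<forall>C\<in>\<Sigma>. \<exists>L. linear L \<and> (\<forall>n\<in>C \<inter> N. dg n = L n))"


section \<open>Toric forms\<close>

text \<open>Laurent polynomials are finitely supported functions on the lattice, and
  \<open>cone_series\<close> is a formal sum of Laurent monomials. A rational function represents that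
  sum if it is a fraction \<open>P / Q\<close> with \<open>Q\<close> times the sum equal to \<open>P\<close>.\<close>

definition laurent_poly :: "'a::euclidean_space set \<Rightarrow> ('a \<Rightarrow> complex) \<Rightarrow> bool" where
  "laurent_poly N P \<longleftrightarrow> finite {n. P n \<noteq> 0} \<and> {n. P n \<noteq> 0} \<subseteq> N"

definition laurent_eval :: "complex \<Rightarrow> 'a::euclidean_space \<Rightarrow> ('a \<Rightarrow> complex) \<Rightarrow> complex" where
  "laurent_eval q m P = (\<Sum>n | P n \<noteq> 0. P n * q powi \<lfloor>m \<bullet> n\<rfloor>)"

definition cone_series ::
    "'a::euclidean_space set \<Rightarrow> ('a \<Rightarrow> complex) \<Rightarrow> 'a set \<Rightarrow> 'a \<Rightarrow> complex" where
  "cone_series N dg C n = (if n \<in> C \<inter> N then exp (2 * pi * \<i> * dg n) else 0)"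

definition cone_function ::
    "'a::euclidean_space set \<Rightarrow> ('a \<Rightarrow> complex) \<Rightarrow> 'a set \<Rightarrow> complex \<Rightarrow> 'a \<Rightarrow> complex" where
  "cone_function N dg C q m =
     (THE v. \<exists>P Q. laurent_poly N P \<and> laurent_poly N Q \<and>
        (\<forall>n. (\<Sum>k | Q k \<noteq> 0. Q k * cone_series N dg C (n - k)) = P n) \<and>
        laurent_eval q m Q \<noteq> 0 \<and> v = laurent_eval q m P / laurent_eval q m Q)"

definition toric_form_term ::
    "'a::euclidean_space set \<Rightarrow> nat \<Rightarrow> 'a set set \<Rightarrow> ('a \<Rightarrow> complex) \<Rightarrow> complex \<Rightarrow> 'a \<Rightarrow> complex" where
  "toric_form_term N r \<Sigma> dg q m =
     (\<Sum>C\<in>\<Sigma>. (-1) ^ (r - dim C) * cone_function N dg C q m)"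

definition toric_form ::
    "'a::euclidean_space set \<Rightarrow> nat \<Rightarrow> 'a set set \<Rightarrow> ('a \<Rightarrow> complex) \<Rightarrow> complex \<Rightarrow> complex" where
  "toric_form N r \<Sigma> dg q = (\<Sum>\<^sub>\<infinity>m\<in>dual_lattice N. toric_form_term N r \<Sigma> dg q m)"


section \<open>The theta function\<close>

definition theta :: "complex \<Rightarrow> complex \<Rightarrow> complex" where
  "theta z \<tau> = 1 / \<i> * (\<Sum>\<^sub>\<infinity>n\<in>(UNIV :: int set).
     (-1) powi n * exp (pi * \<i> * \<tau> * (of_int n + 1 / 2)\<^sup>2) * exp (pi * \<i> * z * (2 * of_int n + 1)))"

text \<open>The power series at the removable singularity \<open>z = 0\<close>.\<close>

definition theta_quotient_fps :: "complex \<Rightarrow> complex \<Rightarrow> complex fps" where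
  "theta_quotient_fps \<alpha> \<tau> =
     fps_expansion
       (remove_sings (\<lambda>z. z * theta (z - \<alpha>) \<tau> * deriv (\<lambda>w. theta w \<tau>) 0 /
                           (theta z \<tau> * theta (- \<alpha>) \<tau>))) 0"


section \<open>The toric variety with its classical topology\<close>

definition dual_monoid :: "'a::euclidean_space set \<Rightarrow> 'a set \<Rightarrow> 'a set" where
  "dual_monoid N C = {m \<in> dual_lattice N. \<forall>n\<in>C. m \<bullet> n \<ge> 0}"

text \<open>Complex points of the affine toric variety, as monoid homomorphisms from the dual
  monoid to the multiplicative monoid of complex numbers. The topology of pointwise
  convergence is the classical one.\<close>

definition affine_toric_points :: "'a::euclidean_space set \<Rightarrow> 'a set \<Rightarrow> ('a \<Rightarrow> complex) set" where
  "affine_toric_points N C =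
     {x \<in> extensional (dual_monoid N C). x 0 = 1 \<and>
        (\<forall>m\<in>dual_monoid N C. \<forall>m'\<in>dual_monoid N C. x (m + m') = x m * x m')}"

definition affine_toric :: "'a::euclidean_space set \<Rightarrow> 'a set \<Rightarrow> ('a \<Rightarrow> complex) topology" where
  "affine_toric N C =
     subtopology (product_topology (\<lambda>_. euclidean) (dual_monoid N C)) (affine_toric_points N C)"

text \<open>A point of the glued space is an equivalence class of points of the charts: points of
  the charts of \<open>C\<close> and \<open>C'\<close> are identified if they come from the same point of the chart of
  \<open>C \<inter> C'\<close>.\<close>

type_synonym 'a toric_point = "('a set \<times> ('a \<Rightarrow> complex)) set"

definition glue ::
    "'a::euclidean_space set \<Rightarrow> 'a set set \<Rightarrow> 'a set \<Rightarrow> ('a \<Rightarrow> complex) \<Rightarrow> 'a toric_point" where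
  "glue N \<Sigma> C x = {(C', x'). C' \<in> \<Sigma> \<and> x' \<in> affine_toric_points N C' \<and>
     (\<exists>y\<in>affine_toric_points N (C \<inter> C').
        restrict y (dual_monoid N C) = x \<and> restrict y (dual_monoid N C') = x')}"

definition toric_points :: "'a::euclidean_space set \<Rightarrow> 'a set set \<Rightarrow> 'a toric_point set" where
  "toric_points N \<Sigma> = (\<Union>C\<in>\<Sigma>. glue N \<Sigma> C ` affine_toric_points N C)"

definition toric_variety :: "'a::euclidean_space set \<Rightarrow> 'a set set \<Rightarrow> 'a toric_point topology" where
  "toric_variety N \<Sigma> = topology (\<lambda>W. W \<subseteq> toric_points N \<Sigma> \<and>
     (\<forall>C\<in>\<Sigma>. openin (affine_toric N C) {x \<in> affine_toric_points N C. glue N \<Sigma> C x \<in> W}))"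

lemma topspace_affine_toric: "topspace (affine_toric N C) = affine_toric_points N C"
  unfolding affine_toric_def by (auto simp: affine_toric_points_def PiE_def)

lemma istopology_toric:
  "istopology (\<lambda>W. W \<subseteq> toric_points N \<Sigma> \<and>
     (\<forall>C\<in>\<Sigma>. openin (affine_toric N C) {x \<in> affine_toric_points N C. glue N \<Sigma> C x \<in> W}))"
  unfolding istopology_def
proof (intro conjI allI impI ballI)
  fix S T C
  assume "S \<subseteq> toric_points N \<Sigma> \<and>
      (\<forall>C\<in>\<Sigma>. openin (affine_toric N C) {x \<in> affine_toric_points N C. glue N \<Sigma> C x \<in> S})"
    and "T \<subseteq> toric_points N \<Sigma> \<and>
      (\<forall>C\<in>\<Sigma>. openin (affine_toric N C) {x \<in> affine_toric_points N C. glue N \<Sigma> C x \<in> T})"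
    and "C \<in> \<Sigma>"
  then have "openin (affine_toric N C)
     ({x \<in> affine_toric_points N C. glue N \<Sigma> C x \<in> S} \<inter> {x \<in> affine_toric_points N C. glue N \<Sigma> C x \<in> T})"
    by (intro openin_Int) auto
  then show "openin (affine_toric N C) {x \<in> affine_toric_points N C. glue N \<Sigma> C x \<in> S \<inter> T}"
    by (rule back_subst) auto
next
  fix \<K> C
  assume *: "\<forall>K\<in>\<K>. K \<subseteq> toric_points N \<Sigma> \<and>
      (\<forall>C\<in>\<Sigma>. openin (affine_toric N C) {x \<in> affine_toric_points N C. glue N \<Sigma> C x \<in> K})"
    and "C \<in> \<Sigma>"
  then have "openin (affine_toric N C) (\<Union>K\<in>\<K>. {x \<in> affine_toric_points N C. glue N \<Sigma> C x \<in> K})"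
    by (intro openin_clauses(3)) auto
  then show "openin (affine_toric N C) {x \<in> affine_toric_points N C. glue N \<Sigma> C x \<in> \<Union>\<K>}"
    by (rule back_subst) auto
qed auto

lemma openin_toric_variety:
  "openin (toric_variety N \<Sigma>) W \<longleftrightarrow> W \<subseteq> toric_points N \<Sigma> \<and>
     (\<forall>C\<in>\<Sigma>. openin (affine_toric N C) {x \<in> affine_toric_points N C. glue N \<Sigma> C x \<in> W})"
  unfolding toric_variety_def by (simp add: topology_inverse'[OF istopology_toric])

text \<open>The torus-invariant divisor of the ray generated by \<open>d\<close> is the union, over the cones
  \<open>C\<close> containing that ray, of the closed subvarieties of the charts whose points are the
  homomorphisms vanishing outside the hyperplane orthogonal to \<open>d\<close>.\<close>

definition toric_divisor ::
    "'a::euclidean_space set \<Rightarrow> 'a set set \<Rightarrow> 'a \<Rightarrow> 'a toric_point set" where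
  "toric_divisor N \<Sigma> d = (\<Union>C\<in>{C \<in> \<Sigma>. d \<in> C}.
     glue N \<Sigma> C ` {x \<in> affine_toric_points N C. \<forall>m\<in>dual_monoid N C. m \<bullet> d \<noteq> 0 \<longrightarrow> x m = 0})"


section \<open>The singular cohomology ring with complex coefficients\<close>

text \<open>Total cochains: \<open>a p\<close> is the component of degree \<open>p\<close>, normalised to vanish on whatever is
  not a singular \<open>p\<close>-simplex.\<close>

type_synonym 'a cochain = "nat \<Rightarrow> ((nat \<Rightarrow> real) \<Rightarrow> 'a) \<Rightarrow> complex"

definition cochains :: "'a topology \<Rightarrow> 'a cochain set" where
  "cochains X = {a. (\<forall>p \<sigma>. \<not> singular_simplex p X \<sigma> \<longrightarrow> a p \<sigma> = 0) \<and>
                    (\<exists>n. \<forall>p>n. \<forall>\<sigma>. a p \<sigma> = 0)}"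

definition cochain_eval :: "(((nat \<Rightarrow> real) \<Rightarrow> 'a) \<Rightarrow> complex) \<Rightarrow> 'a chain \<Rightarrow> complex" where
  "cochain_eval \<phi> c = (\<Sum>\<sigma>\<in>Poly_Mapping.keys c. of_int (Poly_Mapping.lookup c \<sigma>) * \<phi> \<sigma>)"

definition coboundary :: "'a topology \<Rightarrow> 'a cochain \<Rightarrow> 'a cochain" where
  "coboundary X a = (\<lambda>p \<sigma>. if p > 0 \<and> singular_simplex p X \<sigma>
     then cochain_eval (a (p - 1)) (chain_boundary p (frag_of \<sigma>)) else 0)"

definition cocycles :: "'a topology \<Rightarrow> 'a cochain set" where
  "cocycles X = {a \<in> cochains X. coboundary X a = (\<lambda>_ _. 0)}"

definition coboundaries :: "'a topology \<Rightarrow> 'a cochain set" where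
  "coboundaries X = coboundary X ` cochains X"

definition front_face :: "nat \<Rightarrow> ((nat \<Rightarrow> real) \<Rightarrow> 'a) \<Rightarrow> (nat \<Rightarrow> real) \<Rightarrow> 'a" where
  "front_face k \<sigma> = restrict \<sigma> (standard_simplex k)"

definition back_face :: "nat \<Rightarrow> nat \<Rightarrow> ((nat \<Rightarrow> real) \<Rightarrow> 'a) \<Rightarrow> (nat \<Rightarrow> real) \<Rightarrow> 'a" where
  "back_face p k \<sigma> =
     restrict (\<lambda>t. \<sigma> (\<lambda>i. if i < p - k then 0 else t (i - (p - k)))) (standard_simplex k)"

definition cup :: "'a topology \<Rightarrow> 'a cochain \<Rightarrow> 'a cochain \<Rightarrow> 'a cochain" where
  "cup X a b = (\<lambda>p \<sigma>. if singular_simplex p X \<sigma>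
     then \<Sum>k\<le>p. a k (front_face k \<sigma>) * b (p - k) (back_face p (p - k) \<sigma>) else 0)"

definition const_cochain :: "'a topology \<Rightarrow> complex \<Rightarrow> 'a cochain" where
  "const_cochain X c = (\<lambda>p \<sigma>. if p = 0 \<and> singular_simplex 0 X \<sigma> then c else 0)"

definition cocycle_ring :: "'a topology \<Rightarrow> 'a cochain ring" where
  "cocycle_ring X =
     \<lparr>carrier = cocycles X, mult = cup X, one = const_cochain X 1,
      zero = (\<lambda>_ _. 0), add = (\<lambda>a b p \<sigma>. a p \<sigma> + b p \<sigma>)\<rparr>"

definition cohomology_ring :: "'a topology \<Rightarrow> 'a cochain set ring" where
  "cohomology_ring X = cocycle_ring X Quot coboundaries X"

text \<open>The image of a complex number under the structure map of the complex algebra.\<close>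

definition cohomology_scalar :: "'a topology \<Rightarrow> complex \<Rightarrow> 'a cochain set" where
  "cohomology_scalar X c = coboundaries X +>\<^bsub>cocycle_ring X\<^esub> const_cochain X c"

text \<open>Evaluation of a power series at a class whose powers beyond the \<open>n\<close>-th vanish. For a class
  of degree 2 on a space of complex dimension \<open>r\<close>, one may take \<open>n = r\<close>.\<close>

definition cohomology_series ::
    "'a topology \<Rightarrow> nat \<Rightarrow> complex fps \<Rightarrow> 'a cochain set \<Rightarrow> 'a cochain set" where
  "cohomology_series X n F A =
     (\<Oplus>\<^bsub>cohomology_ring X\<^esub>k\<in>{..n}.
        cohomology_scalar X (fps_nth F k) \<otimes>\<^bsub>cohomology_ring X\<^esub> (A [^]\<^bsub>cohomology_ring X\<^esub> k))"

text \<open>Pairing of the component of degree \<open>p\<close> of a cohomology class with a homology class of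
  degree \<open>p\<close>: the common value of all representatives.\<close>

definition cohomology_pairing :: "nat \<Rightarrow> 'a cochain set \<Rightarrow> 'a chain set \<Rightarrow> complex" where
  "cohomology_pairing p A K = (THE v. \<forall>a\<in>A. \<forall>c\<in>K. cochain_eval (a p) c = v)"


section \<open>Fundamental class and divisor classes\<close>

text \<open>Coordinates on the chart of a cone generated by the lattice basis \<open>g 1, \<dots>, g r\<close>. The
  coordinate \<open>z j\<close> is the value at the \<open>j\<close>-th element of the dual basis.\<close>

definition toric_chart ::
    "'a::euclidean_space set \<Rightarrow> nat \<Rightarrow> 'a set \<Rightarrow> (nat \<Rightarrow> 'a) \<Rightarrow> (nat \<Rightarrow> complex) \<Rightarrow> 'a \<Rightarrow> complex" where
  "toric_chart N r C g z = restrict (\<lambda>m. \<Prod>j=1..r. z j ^ nat \<lfloor>m \<bullet> g j\<rfloor>) (dual_monoid N C)"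

text \<open>The affine \<open>2r\<close>-simplex with barycentre \<open>z\<close> in the chart. With respect to the real
  coordinates \<open>Re z 1, Im z 1, \<dots>, Re z r, Im z r\<close>, its edge vectors at the vertex 0 are the
  columns of the identity matrix plus the all-one matrix, which has positive determinant.
  The simplex therefore represents the complex orientation at \<open>z\<close>.\<close>

definition orientation_simplex ::
    "'a::euclidean_space set \<Rightarrow> nat \<Rightarrow> 'a set set \<Rightarrow> 'a set \<Rightarrow> (nat \<Rightarrow> 'a) \<Rightarrow> (nat \<Rightarrow> complex) \<Rightarrow>
     (nat \<Rightarrow> real) \<Rightarrow> 'a toric_point" where
  "orientation_simplex N r \<Sigma> C g z =
     restrict (\<lambda>t. glue N \<Sigma> C (toric_chart N r C g
        (\<lambda>j. z j + of_real (t (2 * j - 1) - t 0) + \<i> * of_real (t (2 * j) - t 0))))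
       (standard_simplex (2 * r))"

text \<open>The fundamental class restricts to the complex orientation in the local homology at each
  point of each maximal chart.\<close>

definition fundamental_class ::
    "'a::euclidean_space set \<Rightarrow> nat \<Rightarrow> 'a set set \<Rightarrow> 'a toric_point chain set \<Rightarrow> bool" where
  "fundamental_class N r \<Sigma> K \<longleftrightarrow>
     K \<in> carrier (homology_group (int (2 * r)) (toric_variety N \<Sigma>)) \<and>
     (\<forall>C\<in>\<Sigma>. \<forall>g. bij_betw g {1..r} (ray_generators N \<Sigma> \<inter> C) \<longrightarrow> (\<forall>z.
        let X = toric_variety N \<Sigma>;
            U = topspace X - {glue N \<Sigma> C (toric_chart N r C g z)}
        in hom_induced (int (2 * r)) X {} X U id K =
           homologous_rel_set (2 * r) X U (frag_of (orientation_simplex N r \<Sigma> C g z))))"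

text \<open>The boundary of the standard 2-simplex, traversed from vertex 0 over 1 and 2 back to 0.\<close>

definition simplex_edge :: "nat \<Rightarrow> nat \<Rightarrow> real \<Rightarrow> nat \<Rightarrow> real" where
  "simplex_edge a b t = (\<lambda>i. if i = a then 1 - t else if i = b then t else 0)"

definition simplex_loop :: "real \<Rightarrow> nat \<Rightarrow> real" where
  "simplex_loop = simplex_edge 0 1 +++ simplex_edge 1 2 +++ simplex_edge 2 0"

text \<open>Characters \<open>m\<close> that are local equations of the divisor of \<open>d\<close> on the chart of \<open>C\<close>: they
  have order 1 along this divisor and order 0 along the other ones meeting the chart.\<close>

definition local_equation ::
    "'a::euclidean_space set \<Rightarrow> 'a set set \<Rightarrow> 'a set \<Rightarrow> 'a \<Rightarrow> 'a \<Rightarrow> bool" where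
  "local_equation N \<Sigma> C d m \<longleftrightarrow> m \<in> dual_monoid N C \<and> m \<bullet> d = 1 \<and>
     (\<forall>d'\<in>ray_generators N \<Sigma> \<inter> C - {d}. m \<bullet> d' = 0)"

text \<open>The cohomology class of a divisor \<open>D\<close> of \<open>X\<close> is the image in the cohomology of \<open>X\<close> of the
  class in \<open>H\<^sup>2(X, X - D)\<close> (Thom class of the oriented normal bundle) that is locally the pullback,
  by a local equation, of the positive generator of \<open>H\<^sup>2(\<complex>, \<complex> - 0)\<close>. The latter takes
  a 2-simplex with boundary in the punctured plane to the winding number of its boundary.
  Here \<open>u\<close> is a relative cocycle representing this class.\<close>

definition divisor_class ::
    "'a::euclidean_space set \<Rightarrow> 'a set set \<Rightarrow> 'a \<Rightarrow> 'a toric_point cochain set \<Rightarrow> bool" where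
  "divisor_class N \<Sigma> d A \<longleftrightarrow>
     (let X = toric_variety N \<Sigma>; U = topspace X - toric_divisor N \<Sigma> d in
      A \<in> carrier (cohomology_ring X) \<and>
      (\<exists>u\<in>A. (\<forall>p. p \<noteq> 2 \<longrightarrow> (\<forall>\<sigma>. u p \<sigma> = 0)) \<and>
        (\<forall>\<sigma>. singular_simplex 2 (subtopology X U) \<sigma> \<longrightarrow> u 2 \<sigma> = 0) \<and>
        (\<forall>C\<in>\<Sigma>. d \<in> C \<longrightarrow> (\<forall>m. local_equation N \<Sigma> C d m \<longrightarrow>
           (\<forall>\<sigma>. singular_simplex 2 (affine_toric N C) \<sigma> \<and>
                (\<forall>t\<in>standard_simplex 2. t 0 = 0 \<or> t 1 = 0 \<or> t 2 = 0 \<longrightarrow> \<sigma> t m \<noteq> 0) \<longrightarrow>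
              u 2 (simplex_map 2 (glue N \<Sigma> C) \<sigma>) =
                winding_number ((\<lambda>t. \<sigma> t m) \<circ> simplex_loop) 0)))))"

text \<open>The cohomology class whose integral is taken. The factors are written in the
  order of the indices because the cohomology ring is only graded commutative; being sums of
  classes of even degree, they do commute.\<close>

definition theta_class ::
    "'a::euclidean_space set \<Rightarrow> nat \<Rightarrow> 'a set set \<Rightarrow> nat \<Rightarrow> (nat \<Rightarrow> complex) \<Rightarrow>
     (nat \<Rightarrow> 'a toric_point cochain set) \<Rightarrow> complex \<Rightarrow> 'a toric_point cochain set" where
  "theta_class N r \<Sigma> s \<alpha> D \<tau> =
     (let H = cohomology_ring (toric_variety N \<Sigma>) in
      foldr (\<lambda>i A. cohomology_series (toric_variety N \<Sigma>) r (theta_quotient_fps (\<alpha> i) \<tau>)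
                     (cohomology_scalar (toric_variety N \<Sigma>) (1 / (2 * pi * \<i>)) \<otimes>\<^bsub>H\<^esub> D i) \<otimes>\<^bsub>H\<^esub> A)
        [1..<Suc s] \<one>\<^bsub>H\<^esub>)"

end

theory Submission
  imports Defs
begin

text \<open>For a generic \<open>v\<close>, the toric form twisted by \<open>exp (2 \<pi> t (m \<bullet> v))\<close> is a sum over the maximal
  cones, and each summand is a product of series in one variable. Comparing coefficients, such a
  series times \<open>\<theta>(z)\<close> is a multiple of \<open>\<theta>(z - \<alpha>)\<close>. In the limit \<open>t \<rightarrow> 0\<close>, the toric form is therefore the
  coefficient of degree \<open>r\<close> of the fixed point sum of the products of theta quotients divided by
  the products of the weights.

  The integral has the same expansion, because intersection numbers of divisors are given by the
  fixed point formula: they are determined by the linear relations between the divisors, by the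
  vanishing for divisors without common point, and by the value 1 for the divisors meeting in a
  fixed point. These facts are proved on cochains. A cocycle vanishing on the simplices of an open
  cover is zero on cycles, by subdivision. This settles the second fact at once. For the first, the
  cocycle of the divisor of a character is on small simplices the coboundary of a cochain, which is
  constructed by filling loops that have been moved into the torus and counting their winding
  numbers. For the third, the orientation class at a fixed point is represented by a triangulated
  cube whose boundary misses the fixed point, and only one of its simplices contributes.\<close>

text \<open>Without the twist the lattice sum cannot be distributed over the maximal cones: with e =
  exp (2 \<pi> i \<alpha>), the factor 1 / (1 - e q^n) tends to 1 as n tends to infinity. Multiplied
  by exp (2 \<pi> y n), and with 1 subtracted when y > 0, it is summable for small nonzero y, and
  the alternating signs of the cones supply exactly these subtractions. Each fixed point then
  contributes a pole of order r in t. The cancellation of the poles is read off from the convergence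
  of the toric form itself, and the limit isolates the coefficient of degree r. The constant
  relating the two theta functions is found by comparing a zero and a pole at the origin. On the
  topological side, a chart sees only the coordinates of its own generators, so a relation between
  divisors is first of all a statement about each chart separately. The local statements fit
  together because winding numbers of a loop in the torus are additive in the character: the
  weighted sum over the coordinates of any maximal chart is the winding number of the given
  character.\<close>

abbreviation "cylinder Y \<equiv> prod_topology (top_of_set {0..1::real}) Y"

abbreviation "\<Delta> \<equiv> standard_simplex"

abbreviation "simplex_space n \<equiv> subtopology (powertop_real UNIV) (\<Delta> n)"

abbreviation punctured :: "((nat => real) => 'a => complex) => 'a => bool" where
  "punctured \<sigma> m \<equiv> (\<forall>t\<in>\<Delta> 2. t 0 = 0 \<or> t 1 = 0 \<or> t 2 = 0 --> \<sigma> t m \<noteq> 0)"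

abbreviation loop_winding :: "((nat => real) => 'a => complex) => 'a => complex" where
  "loop_winding \<sigma> m \<equiv> winding_number ((\<lambda>t. \<sigma> t m) \<circ> simplex_loop) 0"

section \<open>Cochains and the cup product\<close>

lemma cochain_eval_superset:
  assumes "finite A" "Poly_Mapping.keys c \<subseteq> A"
  shows "cochain_eval \<phi> c = (\<Sum>\<sigma>\<in>A. of_int (Poly_Mapping.lookup c \<sigma>) * \<phi> \<sigma>)"
  unfolding cochain_eval_def
  by (rule sum.mono_neutral_left) (use assms in \<open>auto simp: in_keys_iff\<close>)

lemma cochain_eval_0 [simp]: "cochain_eval \<phi> 0 = 0"
  by (simp add: cochain_eval_def)

lemma cochain_eval_of [simp]: "cochain_eval \<phi> (frag_of \<sigma>) = \<phi> \<sigma>"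
  by (simp add: cochain_eval_def)

lemma cochain_eval_add: "cochain_eval \<phi> (a + b) = cochain_eval \<phi> a + cochain_eval \<phi> b"
proof -
  let ?A = "Poly_Mapping.keys a \<union> Poly_Mapping.keys b"
  have "Poly_Mapping.keys (a + b) \<subseteq> ?A" by (rule keys_add)
  then show ?thesis
    by (simp add: cochain_eval_superset[of ?A] lookup_add algebra_simps sum.distrib)
qed

lemma cochain_eval_cmul: "cochain_eval \<phi> (frag_cmul k a) = of_int k * cochain_eval \<phi> a"
proof -
  let ?A = "Poly_Mapping.keys a"
  have "Poly_Mapping.keys (frag_cmul k a) \<subseteq> ?A" by (rule keys_cmul)
  then show ?thesis
    by (simp add: cochain_eval_superset[of ?A] sum_distrib_left algebra_simps)
qed

lemma cochain_eval_minus: "cochain_eval \<phi> (- a) = - cochain_eval \<phi> a"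
  using cochain_eval_cmul[of \<phi> "-1" a] by simp

lemma cochain_eval_diff: "cochain_eval \<phi> (a - b) = cochain_eval \<phi> a - cochain_eval \<phi> b"
  using cochain_eval_add[of \<phi> a "- b"] by (simp add: cochain_eval_minus)

lemma cochain_eval_sum: "cochain_eval \<phi> (sum f I) = (\<Sum>i\<in>I. cochain_eval \<phi> (f i))"
  by (induction I rule: infinite_finite_induct) (auto simp: cochain_eval_add)

lemma cochain_eval_plus_left: "cochain_eval (\<lambda>\<sigma>. \<phi> \<sigma> + \<psi> \<sigma>) c = cochain_eval \<phi> c + cochain_eval \<psi> c"
  by (simp add: cochain_eval_def algebra_simps sum.distrib)

lemma cochain_eval_mult_left: "cochain_eval (\<lambda>\<sigma>. k * \<phi> \<sigma>) c = k * cochain_eval \<phi> c"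
  by (simp add: cochain_eval_def algebra_simps sum_distrib_left)

lemma cochain_eval_sum_left: "cochain_eval (\<lambda>\<sigma>. \<Sum>i\<in>I. \<phi> i \<sigma>) c = (\<Sum>i\<in>I. cochain_eval (\<phi> i) c)"
  unfolding cochain_eval_def sum_distrib_left by (rule sum.swap)

lemma cochain_eval_zero_left: "(\<And>\<sigma>. \<sigma> \<in> Poly_Mapping.keys c ==> \<phi> \<sigma> = 0) ==> cochain_eval \<phi> c = 0"
  by (simp add: cochain_eval_def)

lemma cochain_eval_cong: "(\<And>\<sigma>. \<sigma> \<in> Poly_Mapping.keys c ==> \<phi> \<sigma> = \<psi> \<sigma>) ==> cochain_eval \<phi> c = cochain_eval \<psi> c"
  by (simp add: cochain_eval_def)

lemma cochain_eval_frag_extend: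
  "cochain_eval \<phi> (frag_extend f c) = cochain_eval (\<lambda>\<sigma>. cochain_eval \<phi> (f \<sigma>)) c"
  by (simp add: frag_extend_def cochain_eval_sum cochain_eval_cmul cochain_eval_def[of "\<lambda>\<sigma>. cochain_eval \<phi> (f \<sigma>)"])

lemma cochain_eval_boundary:
  assumes "p > 0"
  shows "cochain_eval \<phi> (chain_boundary p c) =
    cochain_eval (\<lambda>\<sigma>. \<Sum>k\<le>p. (-1) ^ k * \<phi> (singular_face p k \<sigma>)) c"
  using assms by (simp add: chain_boundary_def cochain_eval_frag_extend cochain_eval_sum cochain_eval_cmul)

lemma coboundary_simplex:
  assumes "p > 0" "singular_simplex p X \<sigma>"
  shows "coboundary X a p \<sigma> = (\<Sum>k\<le>p. (-1) ^ k * a (p - 1) (singular_face p k \<sigma>))"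
  using assms by (simp add: coboundary_def cochain_eval_boundary)

lemma coboundary_eval:
  assumes "singular_chain (Suc p) X c"
  shows "cochain_eval (coboundary X a (Suc p)) c = cochain_eval (a p) (chain_boundary (Suc p) c)"
  using assms unfolding cochain_eval_boundary[OF zero_less_Suc]
  by (intro cochain_eval_cong) (auto simp: coboundary_simplex singular_chain_def)

section \<open>Front and back faces of a simplex\<close>

definition simplex_shift :: "nat => (nat => real) => nat => real" where
  "simplex_shift m t = (\<lambda>i. if i < m then 0 else t (i - m))"

lemma simplex_shift_in:
  assumes "t \<in> \<Delta> k"
  shows "simplex_shift m t \<in> \<Delta> (m + k)"
proof -
  have "(\<Sum>i\<le>m + k. simplex_shift m t i) = (\<Sum>i\<in>{m..m + k}. simplex_shift m t i)"
    by (rule sum.mono_neutral_right) (auto simp: simplex_shift_def)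
  also have "\<dots> = (\<Sum>i\<le>k. t i)"
    by (rule sum.reindex_bij_witness[of _ "\<lambda>i. i + m" "\<lambda>i. i - m"]) (auto simp: simplex_shift_def)
  finally show ?thesis
    using assms by (auto simp: standard_simplex_def simplex_shift_def)
qed

lemma simplex_shift_in':
  "t \<in> \<Delta> k ==> k \<le> p ==> simplex_shift (p - k) t \<in> \<Delta> p"
  using simplex_shift_in[of t k "p - k"] by simp

lemma back_face_alt: "back_face p k \<sigma> = restrict (\<sigma> \<circ> simplex_shift (p - k)) (\<Delta> k)"
  by (simp add: back_face_def simplex_shift_def comp_def)

lemma continuous_map_simplex_shift:
  "k \<le> p ==> continuous_map (subtopology (powertop_real UNIV) (\<Delta> k))
     (subtopology (powertop_real UNIV) (\<Delta> p)) (simplex_shift (p - k))"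
proof -
  assume "k \<le> p"
  have "continuous_map (subtopology (powertop_real UNIV) (\<Delta> k)) euclideanreal
      (\<lambda>t. simplex_shift (p - k) t i)" for i
    by (cases "i < p - k") (auto simp: simplex_shift_def
        intro!: continuous_map_from_subtopology continuous_map_product_projection)
  then show ?thesis using \<open>k \<le> p\<close>
    by (auto simp: continuous_map_in_subtopology continuous_map_componentwise simplex_shift_in')
qed

lemma singular_simplex_front:
  assumes "singular_simplex p X \<sigma>" "k \<le> p"
  shows "singular_simplex k X (front_face k \<sigma>)"
proof -
  have "\<Delta> k \<subseteq> \<Delta> p" using assms by (simp add: standard_simplex_mono)
  then show ?thesis using assms(1) unfolding singular_simplex_def front_face_def
    by (auto intro: continuous_map_from_subtopology_mono)
qed

lemma singular_simplex_back:
  assumes "singular_simplex p X \<sigma>" "k \<le> p"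
  shows "singular_simplex k X (back_face p k \<sigma>)"
  using continuous_map_compose[OF continuous_map_simplex_shift[OF assms(2)]] assms(1)
  unfolding singular_simplex_def back_face_alt by auto

text \<open>A face omits one vertex. If that vertex lies in the front part, it can be omitted there
  after enlarging the front part by one vertex; if it lies behind, the front part does not see it.
  The lemmas on back faces are the mirror images.\<close>

lemma front_face_face:
  assumes "i \<le> k" "k < p"
  shows "front_face k (singular_face p i \<sigma>) = singular_face (Suc k) i (front_face (Suc k) \<sigma>)"
proof
  fix t
  have "\<Delta> k \<subseteq> \<Delta> (p - 1)" using assms by (intro standard_simplex_mono) auto
  moreover have "t \<in> \<Delta> k ==> simplical_face i t \<in> \<Delta> (Suc k)"
    using simplical_face_in_standard_simplex[of "Suc k" i t] assms by simp
  ultimately show "front_face k (singular_face p i \<sigma>) t = singular_face (Suc k) i (front_face (Suc k) \<sigma>) t"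
    by (auto simp: front_face_def singular_face_def)
qed

lemma simplical_face_above:
  assumes "t \<in> \<Delta> k" "k < i" shows "simplical_face i t = t"
  using assms by (auto simp: simplical_face_def standard_simplex_def fun_eq_iff)

lemma front_face_face':
  assumes "k < i" "k < p"
  shows "front_face k (singular_face p i \<sigma>) = front_face k \<sigma>"
proof
  fix t
  have "\<Delta> k \<subseteq> \<Delta> (p - 1)" using assms by (intro standard_simplex_mono) auto
  then show "front_face k (singular_face p i \<sigma>) t = front_face k \<sigma> t"
    using simplical_face_above[of t k i] assms by (auto simp: front_face_def singular_face_def)
qed

lemma back_face_face:
  assumes "i \<le> k" "k \<le> n"
  shows "back_face n (n - k) (singular_face (Suc n) i \<sigma>) = back_face (Suc n) (n - k) \<sigma>"
proof
  fix t
  have "simplical_face i (simplex_shift k t) = simplex_shift (Suc k) t"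
    using assms by (auto simp: simplical_face_def simplex_shift_def fun_eq_iff)
  then show "back_face n (n - k) (singular_face (Suc n) i \<sigma>) t = back_face (Suc n) (n - k) \<sigma> t"
    using simplex_shift_in'[of t "n - k" n] assms by (auto simp: back_face_alt singular_face_def Suc_diff_le)
qed

lemma back_face_face':
  assumes "k < i" "k \<le> n" "i \<le> Suc n"
  shows "back_face n (n - k) (singular_face (Suc n) i \<sigma>) =
    singular_face (Suc (n - k)) (i - k) (back_face (Suc n) (Suc (n - k)) \<sigma>)"
proof
  fix t
  have "simplical_face i (simplex_shift k t) = simplex_shift k (simplical_face (i - k) t)"
    using assms by (auto simp: simplical_face_def simplex_shift_def fun_eq_iff)
  moreover have "t \<in> \<Delta> (n - k) ==> simplical_face (i - k) t \<in> \<Delta> (Suc (n - k))"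
    using simplical_face_in_standard_simplex[of "Suc (n - k)" "i - k" t] assms by simp
  ultimately show "back_face n (n - k) (singular_face (Suc n) i \<sigma>) t =
      singular_face (Suc (n - k)) (i - k) (back_face (Suc n) (Suc (n - k)) \<sigma>) t"
    using simplex_shift_in'[of t "n - k" n] assms by (auto simp: back_face_alt singular_face_def)
qed

text \<open>Omitting the last vertex of a longer front part and omitting the first vertex of a
  longer back part lead to the same pair: the front face on the vertices 0, ..., k and the back face
  on the vertices from k + 1 on. These two terms cancel in the Leibniz rule.\<close>

lemma face_front_last:
  "singular_face (Suc k) (Suc k) (front_face (Suc k) \<sigma>) = front_face k \<sigma>"
proof
  fix t
  show "singular_face (Suc k) (Suc k) (front_face (Suc k) \<sigma>) t = front_face k \<sigma> t"
    using simplical_face_above[of t k "Suc k"] standard_simplex_mono[of k "Suc k"]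
    by (auto simp: front_face_def singular_face_def)
qed

lemma face_back_first:
  assumes "k < p"
  shows "singular_face (Suc k) 0 (back_face p (Suc k) \<sigma>) = back_face p k \<sigma>"
proof
  fix t
  have "simplex_shift (p - Suc k) (simplical_face 0 t) = simplex_shift (p - k) t"
    using assms by (auto simp: simplical_face_def simplex_shift_def fun_eq_iff Suc_diff_Suc)
  moreover have "t \<in> \<Delta> k ==> simplical_face 0 t \<in> \<Delta> (Suc k)"
    using simplical_face_in_standard_simplex[of "Suc k" 0 t] by simp
  ultimately show "singular_face (Suc k) 0 (back_face p (Suc k) \<sigma>) t = back_face p k \<sigma> t"
    by (auto simp: back_face_alt singular_face_def)
qed

lemma front_front: "l \<le> k ==> front_face l (front_face k \<sigma>) = front_face l \<sigma>"
  using standard_simplex_mono[of l k] by (auto simp: front_face_def fun_eq_iff)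

lemma back_front:
  assumes "l \<le> k" "k \<le> p"
  shows "back_face k (k - l) (front_face k \<sigma>) = front_face (k - l) (back_face p (p - l) \<sigma>)"
proof
  fix t
  have "\<Delta> (k - l) \<subseteq> \<Delta> (p - l)" using assms by (intro standard_simplex_mono) auto
  then show "back_face k (k - l) (front_face k \<sigma>) t = front_face (k - l) (back_face p (p - l) \<sigma>) t"
    using simplex_shift_in'[of t "k - l" k] assms by (auto simp: back_face_alt front_face_def)
qed

lemma back_back:
  assumes "l \<le> k" "k \<le> p"
  shows "back_face (p - l) (p - k) (back_face p (p - l) \<sigma>) = back_face p (p - k) \<sigma>"
proof
  fix t
  have "simplex_shift l (simplex_shift (k - l) t) = simplex_shift k t"
    using assms by (auto simp: simplex_shift_def fun_eq_iff)
  then show "back_face (p - l) (p - k) (back_face p (p - l) \<sigma>) t = back_face p (p - k) \<sigma> t"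
    using simplex_shift_in'[of t "p - k" "p - l"] assms by (auto simp: back_face_alt)
qed

text \<open>Both sides are sums over the ways to cut the vertex sequence twice, listed once by the
  second cut and once by the first.\<close>

lemma cup_assoc:
  "cup X (cup X a b) c = cup X a (cup X b c)"
proof (intro ext)
  fix p \<sigma>
  show "cup X (cup X a b) c p \<sigma> = cup X a (cup X b c) p \<sigma>"
  proof (cases "singular_simplex p X \<sigma>")
    case True
    define F where "F l j m = a l (front_face l \<sigma>) * b j (front_face j (back_face p (p - l) \<sigma>)) * c m (back_face p m \<sigma>)" for l j m
    have "cup X (cup X a b) c p \<sigma> = (\<Sum>k=0..p. \<Sum>l=0..k. F l (k - l) (p - k))"
    proof -
      have "cup X (cup X a b) c p \<sigma> = (\<Sum>k\<le>p. cup X a b k (front_face k \<sigma>) * c (p - k) (back_face p (p - k) \<sigma>))"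
        using True by (simp add: cup_def)
      also have "\<dots> = (\<Sum>k\<le>p. \<Sum>l\<le>k. F l (k - l) (p - k))"
      proof (rule sum.cong[OF refl])
        fix k assume k: "k \<in> {..p}"
        then have "cup X a b k (front_face k \<sigma>) = (\<Sum>l\<le>k. a l (front_face l (front_face k \<sigma>)) * b (k - l) (back_face k (k - l) (front_face k \<sigma>)))"
          using True by (simp add: cup_def singular_simplex_front)
        also have "\<dots> = (\<Sum>l\<le>k. a l (front_face l \<sigma>) * b (k - l) (front_face (k - l) (back_face p (p - l) \<sigma>)))"
          by (rule sum.cong[OF refl]) (use k in \<open>simp add: front_front back_front\<close>)
        finally show "cup X a b k (front_face k \<sigma>) * c (p - k) (back_face p (p - k) \<sigma>) = (\<Sum>l\<le>k. F l (k - l) (p - k))"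
          by (simp add: F_def sum_distrib_right)
      qed
      finally show ?thesis by (simp add: atLeast0AtMost)
    qed
    also have "\<dots> = (\<Sum>l=0..p. \<Sum>j=0..p - l. F l j (p - l - j))"
      by (rule fps_mult_assoc_lemma)
    also have "\<dots> = cup X a (cup X b c) p \<sigma>"
    proof -
      have bb: "back_face (p - l) (p - l - j) (back_face p (p - l) \<sigma>) = back_face p (p - l - j) \<sigma>" if "l \<le> p" "j \<le> p - l" for l j
        using back_back[of l "l + j" p \<sigma>] that by simp
      have "cup X a (cup X b c) p \<sigma> = (\<Sum>l\<le>p. a l (front_face l \<sigma>) * cup X b c (p - l) (back_face p (p - l) \<sigma>))"
        using True by (simp add: cup_def)
      also have "\<dots> = (\<Sum>l\<le>p. \<Sum>j\<le>p - l. F l j (p - l - j))"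
      proof (rule sum.cong[OF refl])
        fix l assume l: "l \<in> {..p}"
        then have "cup X b c (p - l) (back_face p (p - l) \<sigma>) = (\<Sum>j\<le>p - l. b j (front_face j (back_face p (p - l) \<sigma>)) * c (p - l - j) (back_face (p - l) (p - l - j) (back_face p (p - l) \<sigma>)))"
          using True by (simp add: cup_def singular_simplex_back)
        also have "\<dots> = (\<Sum>j\<le>p - l. b j (front_face j (back_face p (p - l) \<sigma>)) * c (p - l - j) (back_face p (p - l - j) \<sigma>))"
          by (rule sum.cong[OF refl]) (use l bb in simp)
        finally show "a l (front_face l \<sigma>) * cup X b c (p - l) (back_face p (p - l) \<sigma>) = (\<Sum>j\<le>p - l. F l j (p - l - j))"
          by (simp add: F_def sum_distrib_left mult.assoc)
      qed
      finally show ?thesis by (simp add: atLeast0AtMost)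
    qed
    finally show ?thesis .
  qed (simp add: cup_def)
qed

lemma coboundary_cup:
  "coboundary X (cup X a b) p \<sigma> =
     cup X (coboundary X a) b p \<sigma> + cup X (\<lambda>k \<sigma>. (-1) ^ k * a k \<sigma>) (coboundary X b) p \<sigma>"
proof (cases "singular_simplex p X \<sigma> \<and> p > 0")
  case False
  then show ?thesis
    by (auto simp: coboundary_def cup_def)
next
  case True
  then obtain n where p: "p = Suc n" by (cases p) auto
  have s: "singular_simplex (Suc n) X \<sigma>" using True p by simp
  have sf: "singular_simplex n X (singular_face (Suc n) i \<sigma>)" if "i \<le> Suc n" for i
    using singular_simplex_singular_face[OF s] that by simp
  \<comment> \<open>\<open>A k i\<close> is the contribution of face i of the front part,
    \<open>B k j\<close> that of face j of the back part. The terms \<open>A k (Suc k)\<close> and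
    \<open>B k 0\<close> do not come from faces of the simplex, but they cancel, so both sums may be
    completed.\<close>
  define A where "A k i = (-1) ^ i * a k (singular_face (Suc k) i (front_face (Suc k) \<sigma>)) * b (n - k) (back_face (Suc n) (n - k) \<sigma>)" for k i
  define B where "B k j = (-1) ^ (k + j) * a k (front_face k \<sigma>) * b (n - k) (singular_face (Suc (n - k)) j (back_face (Suc n) (Suc (n - k)) \<sigma>))" for k j
  have 0: "(-1) ^ i * (a k (front_face k (singular_face (Suc n) i \<sigma>)) * b (n - k) (back_face n (n - k) (singular_face (Suc n) i \<sigma>)))
      = (if i \<le> k then A k i else B k (i - k))" if "k \<le> n" "i \<le> Suc n" for k i
    using that by (auto simp: A_def B_def front_face_face front_face_face' back_face_face back_face_face')
  have "coboundary X (cup X a b) (Suc n) \<sigma> = (\<Sum>i\<le>Suc n. \<Sum>k\<le>n. if i \<le> k then A k i else B k (i - k))"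
  proof -
    have "coboundary X (cup X a b) (Suc n) \<sigma> = (\<Sum>i\<le>Suc n. (-1) ^ i * cup X a b n (singular_face (Suc n) i \<sigma>))"
      using s by (simp add: coboundary_simplex del: sum.atMost_Suc)
    also have "\<dots> = (\<Sum>i\<le>Suc n. \<Sum>k\<le>n. if i \<le> k then A k i else B k (i - k))"
    proof (rule sum.cong[OF refl])
      fix i assume i: "i \<in> {..Suc n}"
      then have "(-1) ^ i * cup X a b n (singular_face (Suc n) i \<sigma>) = (\<Sum>k\<le>n. (-1) ^ i * (a k (front_face k (singular_face (Suc n) i \<sigma>)) * b (n - k) (back_face n (n - k) (singular_face (Suc n) i \<sigma>))))"
        using sf by (simp add: cup_def sum_distrib_left)
      also have "\<dots> = (\<Sum>k\<le>n. if i \<le> k then A k i else B k (i - k))"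
        by (rule sum.cong[OF refl]) (use i in \<open>simp only: 0 atMost_iff\<close>)
      finally show "(-1) ^ i * cup X a b n (singular_face (Suc n) i \<sigma>) = (\<Sum>k\<le>n. if i \<le> k then A k i else B k (i - k))" .
    qed
    finally show ?thesis .
  qed
  also have "\<dots> = (\<Sum>k\<le>n. \<Sum>i\<le>Suc n. if i \<le> k then A k i else B k (i - k))"
    by (rule sum.swap)
  also have "\<dots> = (\<Sum>k\<le>n. (\<Sum>i\<le>Suc k. A k i) + (\<Sum>j\<le>Suc (n - k). B k j))"
  proof (rule sum.cong[OF refl])
    fix k assume k: "k \<in> {..n}"
    have "(\<Sum>i\<le>Suc n. if i \<le> k then A k i else B k (i - k)) =
        (\<Sum>i\<in>{..k}. A k i) + (\<Sum>i\<in>{Suc k..Suc n}. B k (i - k))"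
    proof -
      have "{..Suc n} \<inter> {i. i \<le> k} = {..k}" "{..Suc n} \<inter> - {i. i \<le> k} = {Suc k..Suc n}" using k by auto
      then show ?thesis by (simp add: sum.If_cases del: sum.atMost_Suc)
    qed
    also have "(\<Sum>i\<in>{Suc k..Suc n}. B k (i - k)) = (\<Sum>j\<in>{1..Suc (n - k)}. B k j)"
      by (rule sum.reindex_bij_witness[of _ "\<lambda>j. j + k" "\<lambda>i. i - k"]) (use k in auto)
    also have "\<dots> = (\<Sum>j\<le>Suc (n - k). B k j) - B k 0"
    proof -
      have "{..Suc (n - k)} = insert 0 {1..Suc (n - k)}" by auto
      then show ?thesis by simp
    qed
    also have "B k 0 = - A k (Suc k)"
      using k by (simp add: A_def B_def face_front_last face_back_first)
    finally show "(\<Sum>i\<le>Suc n. if i \<le> k then A k i else B k (i - k)) =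
       (\<Sum>i\<le>Suc k. A k i) + (\<Sum>j\<le>Suc (n - k). B k j)" by simp
  qed
  also have "\<dots> = (\<Sum>k\<le>n. \<Sum>i\<le>Suc k. A k i) + (\<Sum>k\<le>n. \<Sum>j\<le>Suc (n - k). B k j)"
    by (simp add: sum.distrib)
  also have "(\<Sum>k\<le>n. \<Sum>i\<le>Suc k. A k i) = cup X (coboundary X a) b (Suc n) \<sigma>"
  proof -
    have "cup X (coboundary X a) b (Suc n) \<sigma> =
       (\<Sum>k\<le>Suc n. coboundary X a k (front_face k \<sigma>) * b (Suc n - k) (back_face (Suc n) (Suc n - k) \<sigma>))"
      using s by (simp add: cup_def)
    also have "\<dots> = (\<Sum>k\<le>n. coboundary X a (Suc k) (front_face (Suc k) \<sigma>) * b (n - k) (back_face (Suc n) (n - k) \<sigma>))"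
      by (subst sum.atMost_Suc_shift) (simp add: coboundary_def)
    also have "\<dots> = (\<Sum>k\<le>n. \<Sum>i\<le>Suc k. A k i)"
      using singular_simplex_front[OF s]
      by (intro sum.cong refl) (simp add: coboundary_simplex A_def sum_distrib_right del: sum.atMost_Suc)
    finally show ?thesis by simp
  qed
  also have "(\<Sum>k\<le>n. \<Sum>j\<le>Suc (n - k). B k j) = cup X (\<lambda>k \<sigma>. (-1) ^ k * a k \<sigma>) (coboundary X b) (Suc n) \<sigma>"
  proof -
    have "cup X (\<lambda>k \<sigma>. (-1) ^ k * a k \<sigma>) (coboundary X b) (Suc n) \<sigma> =
       (\<Sum>k\<le>Suc n. (-1) ^ k * a k (front_face k \<sigma>) * coboundary X b (Suc n - k) (back_face (Suc n) (Suc n - k) \<sigma>))"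
      using s by (simp add: cup_def)
    also have "\<dots> = (\<Sum>k\<le>n. (-1) ^ k * a k (front_face k \<sigma>) * coboundary X b (Suc (n - k)) (back_face (Suc n) (Suc (n - k)) \<sigma>))"
    proof -
      have "(\<Sum>k\<le>Suc n. (-1) ^ k * a k (front_face k \<sigma>) * coboundary X b (Suc n - k) (back_face (Suc n) (Suc n - k) \<sigma>)) =
          (\<Sum>k\<le>n. (-1) ^ k * a k (front_face k \<sigma>) * coboundary X b (Suc n - k) (back_face (Suc n) (Suc n - k) \<sigma>))"
        by (simp add: coboundary_def[of X b])
      also have "\<dots> = (\<Sum>k\<le>n. (-1) ^ k * a k (front_face k \<sigma>) * coboundary X b (Suc (n - k)) (back_face (Suc n) (Suc (n - k)) \<sigma>))"
        by (rule sum.cong[OF refl]) (simp add: Suc_diff_le)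
      finally show ?thesis .
    qed
    also have "\<dots> = (\<Sum>k\<le>n. \<Sum>j\<le>Suc (n - k). B k j)"
      using singular_simplex_back[OF s]
      by (intro sum.cong refl) (simp add: coboundary_simplex B_def sum_distrib_left power_add mult_ac del: sum.atMost_Suc)
    finally show ?thesis by simp
  qed
  finally show ?thesis unfolding p .
qed

section \<open>The cohomology ring\<close>

lemma cochains_0 [simp]: "(\<lambda>_ _. 0) \<in> cochains X"
  by (simp add: cochains_def)

lemma cochains_add: "a \<in> cochains X ==> b \<in> cochains X ==> (\<lambda>p \<sigma>. a p \<sigma> + b p \<sigma>) \<in> cochains X"
proof -
  assume a: "a \<in> cochains X" and b: "b \<in> cochains X"
  obtain n m where "\<forall>p>n. \<forall>\<sigma>. a p \<sigma> = 0" "\<forall>p>m. \<forall>\<sigma>. b p \<sigma> = 0" using a b by (auto simp: cochains_def)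
  then have "\<exists>n. \<forall>p>n. \<forall>\<sigma>. a p \<sigma> + b p \<sigma> = 0" by (intro exI[of _ "max n m"]) simp
  then show ?thesis using a b by (auto simp: cochains_def)
qed

lemma cochains_deg_mult: "a \<in> cochains X ==> (\<lambda>p \<sigma>. f p * a p \<sigma>) \<in> cochains X"
  unfolding cochains_def by fastforce

lemma cochains_mult: "a \<in> cochains X ==> (\<lambda>p \<sigma>. k * a p \<sigma>) \<in> cochains X"
  by (rule cochains_deg_mult)

lemma cochains_cup: "a \<in> cochains X ==> b \<in> cochains X ==> cup X a b \<in> cochains X"
proof -
  assume a: "a \<in> cochains X" and b: "b \<in> cochains X"
  obtain n m where n: "\<forall>p>n. \<forall>\<sigma>. a p \<sigma> = 0" and m: "\<forall>p>m. \<forall>\<sigma>. b p \<sigma> = 0" using a b by (auto simp: cochains_def)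
  have "cup X a b p \<sigma> = 0" if "p > n + m" for p \<sigma>
  proof -
    have "a k (front_face k \<sigma>) * b (p - k) (back_face p (p - k) \<sigma>) = 0" for k
      using that n m by (cases "k > n") auto
    then show ?thesis unfolding cup_def by (simp only: sum.neutral_const if_cancel)
  qed
  then have "\<exists>n. \<forall>p>n. \<forall>\<sigma>. cup X a b p \<sigma> = 0" by blast
  then show ?thesis by (auto simp: cochains_def cup_def)
qed

lemma cochains_const: "const_cochain X c \<in> cochains X"
  by (auto simp: cochains_def const_cochain_def)

lemma cochains_coboundary: "a \<in> cochains X ==> coboundary X a \<in> cochains X"
proof -
  assume a: "a \<in> cochains X"
  then obtain n where "\<forall>p>n. \<forall>\<sigma>. a p \<sigma> = 0" by (auto simp: cochains_def)
  then have "\<exists>n. \<forall>p>n. \<forall>\<sigma>. coboundary X a p \<sigma> = 0"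
    by (intro exI[of _ "Suc n"]) (auto simp: coboundary_def intro!: cochain_eval_zero_left)
  then show ?thesis by (auto simp: cochains_def coboundary_def)
qed

lemma coboundary_add: "coboundary X (\<lambda>p \<sigma>. a p \<sigma> + b p \<sigma>) = (\<lambda>p \<sigma>. coboundary X a p \<sigma> + coboundary X b p \<sigma>)"
  by (auto simp: coboundary_def fun_eq_iff cochain_eval_plus_left)

lemma coboundary_deg_mult:
  "coboundary X (\<lambda>p \<sigma>. f p * a p \<sigma>) = (\<lambda>p \<sigma>. f (p - 1) * coboundary X a p \<sigma>)"
  by (auto simp: coboundary_def fun_eq_iff cochain_eval_mult_left)

lemma coboundary_mult: "coboundary X (\<lambda>p \<sigma>. k * a p \<sigma>) = (\<lambda>p \<sigma>. k * coboundary X a p \<sigma>)"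
  by (rule coboundary_deg_mult)

lemma coboundary_0 [simp]: "coboundary X (\<lambda>_ _. 0) = (\<lambda>_ _. 0)"
  using coboundary_mult[of X 0 "\<lambda>_ _. 0"] by simp

lemma coboundary_coboundary: "coboundary X (coboundary X a) = (\<lambda>_ _. 0)"
proof (intro ext)
  fix p \<sigma>
  show "coboundary X (coboundary X a) p \<sigma> = 0"
  proof (cases "p > 1 \<and> singular_simplex p X \<sigma>")
    case True
    then obtain n where p: "p = Suc (Suc n)" by (metis One_nat_def less_imp_Suc_add add_Suc)
    have "singular_chain (Suc (Suc n)) X (frag_of \<sigma>)" using True p by (simp add: singular_chain_of)
    then have "singular_chain (Suc n) X (chain_boundary (Suc (Suc n)) (frag_of \<sigma>))"
      and "chain_boundary (Suc n) (chain_boundary (Suc (Suc n)) (frag_of \<sigma>)) = 0"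
      by (auto simp: singular_chain_boundary_alt chain_boundary_boundary_alt)
    then show ?thesis using True coboundary_eval[of n X _ a] p by (simp add: coboundary_def[of X "coboundary X a"])
  next
    case False
    then have "p \<le> 1 \<or> \<not> singular_simplex p X \<sigma>" by auto
    then show ?thesis by (auto simp: coboundary_def intro!: cochain_eval_zero_left)
  qed
qed

lemma cup_add_left: "cup X (\<lambda>p \<sigma>. a p \<sigma> + b p \<sigma>) c = (\<lambda>p \<sigma>. cup X a c p \<sigma> + cup X b c p \<sigma>)"
  by (auto simp: cup_def fun_eq_iff algebra_simps sum.distrib)

lemma cup_add_right: "cup X a (\<lambda>p \<sigma>. b p \<sigma> + c p \<sigma>) = (\<lambda>p \<sigma>. cup X a b p \<sigma> + cup X a c p \<sigma>)"
  by (auto simp: cup_def fun_eq_iff algebra_simps sum.distrib)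

lemma cup_mult_left: "cup X (\<lambda>p \<sigma>. k * a p \<sigma>) c = (\<lambda>p \<sigma>. k * cup X a c p \<sigma>)"
  by (auto simp: cup_def fun_eq_iff algebra_simps sum_distrib_left)

lemma cup_mult_right: "cup X a (\<lambda>p \<sigma>. k * b p \<sigma>) = (\<lambda>p \<sigma>. k * cup X a b p \<sigma>)"
  by (auto simp: cup_def fun_eq_iff algebra_simps sum_distrib_left)

lemma cup_0_left [simp]: "cup X (\<lambda>_ _. 0) a = (\<lambda>_ _. 0)" and cup_0_right [simp]: "cup X a (\<lambda>_ _. 0) = (\<lambda>_ _. 0)"
  by (auto simp: cup_def fun_eq_iff)

lemma front_face_self: "singular_simplex p X \<sigma> ==> front_face p \<sigma> = \<sigma>"
  by (simp add: front_face_def singular_simplex_def extensional_restrict)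

lemma back_face_self: "singular_simplex p X \<sigma> ==> back_face p p \<sigma> = \<sigma>"
  by (simp add: back_face_def singular_simplex_def extensional_restrict cong: restrict_cong)

lemma cup_const_left: "a \<in> cochains X ==> cup X (const_cochain X k) a = (\<lambda>p \<sigma>. k * a p \<sigma>)"
proof (intro ext)
  fix p \<sigma> assume a: "a \<in> cochains X"
  show "cup X (const_cochain X k) a p \<sigma> = k * a p \<sigma>"
  proof (cases "singular_simplex p X \<sigma>")
    case True
    have "cup X (const_cochain X k) a p \<sigma> = (\<Sum>j\<le>p. const_cochain X k j (front_face j \<sigma>) * a (p - j) (back_face p (p - j) \<sigma>))"
      using True by (simp add: cup_def)
    also have "\<dots> = (\<Sum>j\<in>{0}. const_cochain X k j (front_face j \<sigma>) * a (p - j) (back_face p (p - j) \<sigma>))"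
      by (rule sum.mono_neutral_right) (auto simp: const_cochain_def)
    finally show ?thesis using singular_simplex_front[OF True, of 0] back_face_self[OF True] by (simp add: const_cochain_def)
  qed (use a in \<open>auto simp: cup_def cochains_def\<close>)
qed

lemma cup_const_right: "a \<in> cochains X ==> cup X a (const_cochain X k) = (\<lambda>p \<sigma>. k * a p \<sigma>)"
proof (intro ext)
  fix p \<sigma> assume a: "a \<in> cochains X"
  show "cup X a (const_cochain X k) p \<sigma> = k * a p \<sigma>"
  proof (cases "singular_simplex p X \<sigma>")
    case True
    have "cup X a (const_cochain X k) p \<sigma> = (\<Sum>j\<le>p. a j (front_face j \<sigma>) * const_cochain X k (p - j) (back_face p (p - j) \<sigma>))"
      using True by (simp add: cup_def)
    also have "\<dots> = (\<Sum>j\<in>{p}. a j (front_face j \<sigma>) * const_cochain X k (p - j) (back_face p (p - j) \<sigma>))"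
      by (rule sum.mono_neutral_right) (auto simp: const_cochain_def)
    finally show ?thesis using singular_simplex_back[OF True, of 0] front_face_self[OF True] by (simp add: const_cochain_def)
  qed (use a in \<open>auto simp: cup_def cochains_def\<close>)
qed

lemma coboundary_const [simp]: "coboundary X (const_cochain X k) = (\<lambda>_ _. 0)"
proof (intro ext)
  fix p \<sigma>
  show "coboundary X (const_cochain X k) p \<sigma> = 0"
  proof (cases "p > 0 \<and> singular_simplex p X \<sigma>")
    case True
    show ?thesis
    proof (cases "p = 1")
      case p: True
      have "singular_simplex 0 X (singular_face 1 0 \<sigma>)" "singular_simplex 0 X (singular_face 1 1 \<sigma>)"
        using singular_simplex_singular_face[of 1 X \<sigma> 0] singular_simplex_singular_face[of 1 X \<sigma> 1] True p by simp_all
      then show ?thesis using True p by (simp add: coboundary_simplex const_cochain_def)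
    next
      case False
      then have "p - 1 \<noteq> 0" using True by simp
      then show ?thesis using True by (simp add: coboundary_simplex const_cochain_def del: diff_is_0_eq')
    qed
  qed (auto simp: coboundary_def)
qed

lemma cocycles_coboundary: "a \<in> cochains X ==> coboundary X a \<in> cocycles X"
  by (simp add: cocycles_def cochains_coboundary coboundary_coboundary)

lemma coboundaries_subset: "coboundaries X \<subseteq> cocycles X"
  by (auto simp: coboundaries_def cocycles_coboundary)

lemma cocycles_cochains: "a \<in> cocycles X ==> a \<in> cochains X"
  by (simp add: cocycles_def)

lemma cocycles_D: "a \<in> cocycles X ==> coboundary X a = (\<lambda>_ _. 0)"
  by (simp add: cocycles_def)

lemma cocycles_0 [simp]: "(\<lambda>_ _. 0) \<in> cocycles X"
  by (simp add: cocycles_def)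

lemma cocycles_add: "a \<in> cocycles X ==> b \<in> cocycles X ==> (\<lambda>p \<sigma>. a p \<sigma> + b p \<sigma>) \<in> cocycles X"
  by (simp add: cocycles_def cochains_add coboundary_add)

lemma cocycles_deg_mult: "a \<in> cocycles X ==> (\<lambda>p \<sigma>. f p * a p \<sigma>) \<in> cocycles X"
  by (simp add: cocycles_def cochains_deg_mult coboundary_deg_mult)

lemma cocycles_mult: "a \<in> cocycles X ==> (\<lambda>p \<sigma>. k * a p \<sigma>) \<in> cocycles X"
  by (rule cocycles_deg_mult)

lemma cocycles_const: "const_cochain X k \<in> cocycles X"
  by (simp add: cocycles_def cochains_const)

lemma cocycles_cup: "a \<in> cocycles X ==> b \<in> cocycles X ==> cup X a b \<in> cocycles X"
  by (simp add: cocycles_def cochains_cup coboundary_cup fun_eq_iff)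
    (simp add: cup_0_left cup_0_right flip: fun_eq_iff)

lemma coboundaries_cup_right:
  assumes "a \<in> coboundaries X" "b \<in> cocycles X" shows "cup X a b \<in> coboundaries X"
proof -
  obtain c where c: "c \<in> cochains X" "a = coboundary X c" using assms by (auto simp: coboundaries_def)
  have "cup X a b = coboundary X (cup X c b)"
    using assms(2) by (intro ext) (simp add: coboundary_cup c cocycles_D)
  then show ?thesis using c assms by (auto simp: coboundaries_def cochains_cup cocycles_cochains)
qed

text \<open>The Leibniz rule puts the sign (-1)^k on the first factor. Twisting \<open>b\<close> by
  this sign before taking the coboundary removes it, and the twist of a cocycle is again a
  cocycle.\<close>

lemma coboundaries_cup_left:
  assumes "a \<in> coboundaries X" "b \<in> cocycles X" shows "cup X b a \<in> coboundaries X"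
proof -
  obtain c where c: "c \<in> cochains X" "a = coboundary X c" using assms by (auto simp: coboundaries_def)
  let ?b = "\<lambda>p \<sigma>. (-1) ^ p * b p \<sigma>"
  have b: "?b \<in> cocycles X" using assms by (intro cocycles_deg_mult)
  have "(\<lambda>k \<sigma>. (- 1) ^ k * ?b k \<sigma>) = b" by (simp add: fun_eq_iff flip: mult.assoc power_mult_distrib)
  then have "cup X b a = coboundary X (cup X ?b c)"
    using b by (intro ext) (simp only: coboundary_cup c cocycles_D cup_0_left, simp)
  then show ?thesis using c b by (auto simp: coboundaries_def cochains_cup cocycles_cochains)
qed

lemma coboundaries_add: "a \<in> coboundaries X ==> b \<in> coboundaries X ==> (\<lambda>p \<sigma>. a p \<sigma> + b p \<sigma>) \<in> coboundaries X"
  unfolding coboundaries_def by (auto simp: image_iff intro!: bexI[OF _ cochains_add] simp: coboundary_add)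

lemma coboundaries_mult: "a \<in> coboundaries X ==> (\<lambda>p \<sigma>. k * a p \<sigma>) \<in> coboundaries X"
  unfolding coboundaries_def by (auto simp: image_iff intro!: bexI[OF _ cochains_mult] simp: coboundary_mult)

lemma cocycle_ring_simps [simp]:
  "carrier (cocycle_ring X) = cocycles X" "a \<otimes>\<^bsub>cocycle_ring X\<^esub> b = cup X a b" "\<one>\<^bsub>cocycle_ring X\<^esub> = const_cochain X 1"
  "\<zero>\<^bsub>cocycle_ring X\<^esub> = (\<lambda>_ _. 0)" "a \<oplus>\<^bsub>cocycle_ring X\<^esub> b = (\<lambda>p \<sigma>. a p \<sigma> + b p \<sigma>)"
  by (simp_all add: cocycle_ring_def)

lemma ring_cocycle_ring: "ring (cocycle_ring X)"
proof (rule ringI)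
  show "abelian_group (cocycle_ring X)"
  proof (rule abelian_groupI)
    fix x assume "x \<in> carrier (cocycle_ring X)"
    then show "\<exists>y\<in>carrier (cocycle_ring X). y \<oplus>\<^bsub>cocycle_ring X\<^esub> x = \<zero>\<^bsub>cocycle_ring X\<^esub>"
      using cocycles_mult[of x X "-1"] by (intro bexI[of _ "\<lambda>p \<sigma>. -1 * x p \<sigma>"]) auto
  qed (auto simp: cocycles_add add_ac)
  show "monoid (cocycle_ring X)"
    by (rule monoidI) (auto simp: cocycles_cup cocycles_const cup_assoc cup_const_left cup_const_right cocycles_cochains)
qed (auto simp: cup_add_left cup_add_right)

lemma ideal_coboundaries: "ideal (coboundaries X) (cocycle_ring X)"
proof (rule idealI[OF ring_cocycle_ring])
  interpret R: ring "cocycle_ring X" by (rule ring_cocycle_ring)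
  show "subgroup (coboundaries X) (add_monoid (cocycle_ring X))"
  proof (rule group.subgroupI[OF R.a_group])
    show "coboundaries X \<subseteq> carrier (add_monoid (cocycle_ring X))" by (simp add: coboundaries_subset)
    show "coboundaries X \<noteq> {}" by (auto simp: coboundaries_def intro: cochains_0)
    fix a assume a: "a \<in> coboundaries X"
    have "\<ominus>\<^bsub>cocycle_ring X\<^esub> a = (\<lambda>p \<sigma>. -1 * a p \<sigma>)"
      using a coboundaries_subset[of X] cocycles_mult[of a X "-1"] by (intro R.minus_equality) auto
    then show "inv\<^bsub>add_monoid (cocycle_ring X)\<^esub> a \<in> coboundaries X"
      using coboundaries_mult[OF a, of "-1"] unfolding a_inv_def by metis
  next
    fix a b assume "a \<in> coboundaries X" "b \<in> coboundaries X"
    then show "a \<otimes>\<^bsub>add_monoid (cocycle_ring X)\<^esub> b \<in> coboundaries X" using coboundaries_add by simp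
  qed
next
  fix a x assume "a \<in> coboundaries X" "x \<in> carrier (cocycle_ring X)"
  then show "x \<otimes>\<^bsub>cocycle_ring X\<^esub> a \<in> coboundaries X" "a \<otimes>\<^bsub>cocycle_ring X\<^esub> x \<in> coboundaries X"
    by (simp_all add: coboundaries_cup_left coboundaries_cup_right)
qed

lemma cocycle_eval_boundary:
  assumes "a \<in> cocycles X" "singular_chain (Suc p) X c"
  shows "cochain_eval (a p) (chain_boundary (Suc p) c) = 0"
  using coboundary_eval[OF assms(2), of a] cocycles_D[OF assms(1)] by (simp add: cochain_eval_zero_left)

lemma coboundary_eval_cycle:
  assumes "a \<in> coboundaries X" "singular_chain p X c" "chain_boundary p c = 0"
  shows "cochain_eval (a p) c = 0"
proof -
  obtain b where b: "a = coboundary X b" using assms by (auto simp: coboundaries_def)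
  show ?thesis
  proof (cases p)
    case 0 then show ?thesis by (simp add: b coboundary_def cochain_eval_zero_left)
  next
    case (Suc n) then show ?thesis using coboundary_eval[of n X c b] assms by (simp add: b)
  qed
qed

text \<open>Another cocycle of the class differs by a coboundary, which vanishes on cycles; another
  cycle differs by a boundary, on which cocycles vanish. So the definite description of the pairing
  has a value, and the integral can be computed from one cocycle and one cycle.\<close>

lemma cohomology_pairing_coset:
  assumes a: "a \<in> cocycles X" and c: "singular_relcycle p X {} c"
  shows "cohomology_pairing p (coboundaries X +>\<^bsub>cocycle_ring X\<^esub> a) (homologous_rel_set p X {} c) = cochain_eval (a p) c"
proof -
  have cyc: "singular_chain p X c" "chain_boundary p c = 0" using c by (auto simp: singular_cycle)
  have 0: "cochain_eval (b p) c' = cochain_eval (a p) c"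
    if b: "b \<in> coboundaries X +>\<^bsub>cocycle_ring X\<^esub> a" and c': "homologous_rel p X {} c c'" for b c'
  proof -
    obtain e where e: "e \<in> coboundaries X" "b = (\<lambda>p \<sigma>. e p \<sigma> + a p \<sigma>)"
      using b by (auto simp: a_r_coset_def')
    obtain d where d: "singular_chain (Suc p) X d" "chain_boundary (Suc p) d = c - c'"
      using c' by (auto simp: homologous_rel_def singular_boundary)
    have bz: "b \<in> cocycles X" using e a coboundaries_subset[of X] by (auto intro!: cocycles_add)
    have "cochain_eval (b p) c - cochain_eval (b p) c' = 0"
      using cocycle_eval_boundary[OF bz d(1)] d(2) by (simp add: cochain_eval_diff)
    moreover have "cochain_eval (b p) c = cochain_eval (a p) c"
      using coboundary_eval_cycle[OF e(1) cyc] by (simp add: e(2) cochain_eval_plus_left)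
    ultimately show ?thesis by simp
  qed
  \<comment> \<open>Both classes are inhabited, which makes the common value unique.\<close>
  have "a \<in> coboundaries X +>\<^bsub>cocycle_ring X\<^esub> a"
  proof -
    interpret ideal "coboundaries X" "cocycle_ring X" by (rule ideal_coboundaries)
    show ?thesis using a a_rcos_self by simp
  qed
  moreover have "c \<in> homologous_rel_set p X {} c" by simp
  ultimately have mem: "a \<in> coboundaries X +>\<^bsub>cocycle_ring X\<^esub> a" "c \<in> homologous_rel_set p X {} c" .
  show ?thesis
    unfolding cohomology_pairing_def
  proof (rule the_equality)
    show "\<forall>b\<in>coboundaries X +>\<^bsub>cocycle_ring X\<^esub> a. \<forall>c'\<in>homologous_rel_set p X {} c. cochain_eval (b p) c' = cochain_eval (a p) c"
      using 0 by simp
    show "v = cochain_eval (a p) c"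
      if "\<forall>b\<in>coboundaries X +>\<^bsub>cocycle_ring X\<^esub> a. \<forall>c'\<in>homologous_rel_set p X {} c. cochain_eval (b p) c' = v" for v
      using that mem by auto
  qed
qed

section \<open>Power series of degree 2 classes\<close>

abbreviation coh_class :: "'a topology => 'a cochain => 'a cochain set" where
  "coh_class X a \<equiv> coboundaries X +>\<^bsub>cocycle_ring X\<^esub> a"

lemma ring_cohomology_ring: "ring (cohomology_ring X)"
  unfolding cohomology_ring_def by (rule ideal.quotient_is_ring[OF ideal_coboundaries])

lemma coh_class_hom: "coh_class X \<in> ring_hom (cocycle_ring X) (cohomology_ring X)"
  unfolding cohomology_ring_def by (rule ideal.rcos_ring_hom[OF ideal_coboundaries])

lemma coh_class_closed: "a \<in> cocycles X ==> coh_class X a \<in> carrier (cohomology_ring X)"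
  using ring_hom_closed[OF coh_class_hom, of a] by simp

lemma coh_class_mult:
  "a \<in> cocycles X ==> b \<in> cocycles X ==>
    coh_class X a \<otimes>\<^bsub>cohomology_ring X\<^esub> coh_class X b = coh_class X (cup X a b)"
  using ring_hom_mult[OF coh_class_hom, of a X b] by simp

lemma coh_class_add:
  "a \<in> cocycles X ==> b \<in> cocycles X ==>
    coh_class X a \<oplus>\<^bsub>cohomology_ring X\<^esub> coh_class X b = coh_class X (\<lambda>p \<sigma>. a p \<sigma> + b p \<sigma>)"
  using ring_hom_add[OF coh_class_hom, of a X b] by simp

lemma coh_class_one: "\<one>\<^bsub>cohomology_ring X\<^esub> = coh_class X (const_cochain X 1)"
  using ring_hom_one[OF coh_class_hom, of X] by simp

text \<open>A divisor class is given as a set of cochains with a distinguished member; this lets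
  that member stand for the class.\<close>

lemma coh_class_rep:
  assumes "A \<in> carrier (cohomology_ring X)" "u \<in> A"
  shows "u \<in> cocycles X" "A = coh_class X u"
proof -
  interpret I: ideal "coboundaries X" "cocycle_ring X" by (rule ideal_coboundaries)
  obtain a where a: "a \<in> cocycles X" "A = coh_class X a"
    using assms(1) by (auto simp: cohomology_ring_def FactRing_def A_RCOSETS_def')
  then show u: "u \<in> cocycles X"
    using assms(2) coboundaries_subset[of X] by (auto simp: a_r_coset_def' intro!: cocycles_add)
  show "A = coh_class X u"
    using I.a_repr_independence[where x=a and y=u and H="coboundaries X"] a assms(2) I.a_subgroup by simp
qed

primrec cup_power :: "'a topology => 'a cochain => nat => 'a cochain" where
  "cup_power X a 0 = const_cochain X 1"
| "cup_power X a (Suc k) = cup X (cup_power X a k) a"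

lemma cocycles_cup_power: "a \<in> cocycles X ==> cup_power X a k \<in> cocycles X"
  by (induction k) (auto simp: cocycles_const cocycles_cup)

lemma cup_power_mult: "a \<in> cochains X ==> cup_power X (\<lambda>p \<sigma>. c * a p \<sigma>) k = (\<lambda>p \<sigma>. c ^ k * cup_power X a k p \<sigma>)"
  by (induction k) (auto simp: cup_mult_left cup_mult_right mult_ac)

lemma coh_class_power:
  assumes "a \<in> cocycles X"
  shows "coh_class X a [^]\<^bsub>cohomology_ring X\<^esub> (k::nat) = coh_class X (cup_power X a k)"
proof -
  interpret H: ring "cohomology_ring X" by (rule ring_cohomology_ring)
  show ?thesis
    by (induction k) (auto simp: coh_class_one coh_class_mult cocycles_cup_power assms)
qed

definition cocycle_series :: "'a topology => nat => complex fps => 'a cochain => 'a cochain" where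
  "cocycle_series X n F a = (\<lambda>p \<sigma>. \<Sum>k\<le>n. fps_nth F k * cup_power X a k p \<sigma>)"

lemma cocycles_series: "a \<in> cocycles X ==> cocycle_series X n F a \<in> cocycles X"
proof (induction n)
  case 0
  have "cocycle_series X 0 F a = (\<lambda>p \<sigma>. fps_nth F 0 * cup_power X a 0 p \<sigma>)" by (simp add: cocycle_series_def)
  then show ?case by (simp only: cocycles_mult cocycles_cup_power 0)
next
  case (Suc n)
  have "cocycle_series X (Suc n) F a = (\<lambda>p \<sigma>. cocycle_series X n F a p \<sigma> + fps_nth F (Suc n) * cup_power X a (Suc n) p \<sigma>)"
    by (simp add: cocycle_series_def)
  then show ?case by (simp only: cocycles_mult cocycles_cup_power Suc cocycles_add)
qed

lemma coh_class_scalar_mult: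
  "a \<in> cocycles X ==> cohomology_scalar X c \<otimes>\<^bsub>cohomology_ring X\<^esub> coh_class X a = coh_class X (\<lambda>p \<sigma>. c * a p \<sigma>)"
  by (simp add: cohomology_scalar_def coh_class_mult cocycles_const cup_const_left cocycles_cochains)

lemma coh_class_series:
  assumes "a \<in> cocycles X"
  shows "cohomology_series X n F (coh_class X a) = coh_class X (cocycle_series X n F a)"
proof -
  interpret H: ring "cohomology_ring X" by (rule ring_cohomology_ring)
  have 1: "cohomology_scalar X (fps_nth F k) \<otimes>\<^bsub>cohomology_ring X\<^esub> (coh_class X a [^]\<^bsub>cohomology_ring X\<^esub> k)
      = coh_class X (\<lambda>p \<sigma>. fps_nth F k * cup_power X a k p \<sigma>)" for k
    by (simp add: coh_class_power assms coh_class_scalar_mult cocycles_cup_power)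
  have 2: "coh_class X (\<lambda>p \<sigma>. fps_nth F k * cup_power X a k p \<sigma>) \<in> carrier (cohomology_ring X)" for k
    by (intro coh_class_closed cocycles_mult cocycles_cup_power assms)
  show ?thesis unfolding cohomology_series_def 1
  proof (induction n)
    case 0
    have "(\<Oplus>\<^bsub>cohomology_ring X\<^esub>k\<in>{..0}. coh_class X (\<lambda>p \<sigma>. fps_nth F k * cup_power X a k p \<sigma>)) =
        coh_class X (\<lambda>p \<sigma>. fps_nth F 0 * cup_power X a 0 p \<sigma>)"
    proof -
      define f where "f = (\<lambda>k. coh_class X (\<lambda>p \<sigma>. fps_nth F k * cup_power X a k p \<sigma>))"
      have f: "f k \<in> carrier (cohomology_ring X)" for k using 2 by (simp add: f_def)
      have "{..0::nat} = {0}" by auto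
      moreover have "(\<Oplus>\<^bsub>cohomology_ring X\<^esub>k\<in>{0::nat}. f k) = f 0"
        using H.finsum_insert[of "{}" 0 f] f by (simp add: Pi_def)
      ultimately show ?thesis by (simp add: f_def)
    qed
    then show ?case by (simp add: cocycle_series_def)
  next
    case (Suc n)
    have "(\<Oplus>\<^bsub>cohomology_ring X\<^esub>k\<in>{..Suc n}. coh_class X (\<lambda>p \<sigma>. fps_nth F k * cup_power X a k p \<sigma>)) =
        coh_class X (\<lambda>p \<sigma>. fps_nth F (Suc n) * cup_power X a (Suc n) p \<sigma>) \<oplus>\<^bsub>cohomology_ring X\<^esub>
        (\<Oplus>\<^bsub>cohomology_ring X\<^esub>k\<in>{..n}. coh_class X (\<lambda>p \<sigma>. fps_nth F k * cup_power X a k p \<sigma>))"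
      by (rule H.finsum_Suc) (use 2 in auto)
    also have "\<dots> = coh_class X (\<lambda>p \<sigma>. fps_nth F (Suc n) * cup_power X a (Suc n) p \<sigma> + cocycle_series X n F a p \<sigma>)"
      unfolding Suc by (intro coh_class_add cocycles_mult cocycles_cup_power cocycles_series assms)
    finally show ?case by (simp add: cocycle_series_def add.commute)
  qed
qed

text \<open>Monomials are words, since cup products of cochains depend on the order of the factors.
  Relations will be applied to a letter in the middle of a word.\<close>

primrec cup_word :: "'a topology => ('i => 'a cochain) => 'i list => 'a cochain" where
  "cup_word X u [] = const_cochain X 1"
| "cup_word X u (i # w) = cup X (u i) (cup_word X u w)"

lemma cocycles_cup_word: "(\<And>i. i \<in> set w ==> u i \<in> cocycles X) ==> cup_word X u w \<in> cocycles X"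
  by (induction w) (auto simp: cocycles_const cocycles_cup)

lemma cup_word_append:
  "(\<And>i. i \<in> set w' ==> u i \<in> cocycles X) ==> cup_word X u (w @ w') = cup X (cup_word X u w) (cup_word X u w')"
  by (induction w) (auto simp: cup_assoc cup_const_left cocycles_cup_word cocycles_cochains)

lemma cup_power_word: "u i \<in> cocycles X ==> cup_power X (u i) k = cup_word X u (replicate k i)"
proof (induction k)
  case (Suc k)
  have "cup_word X u (replicate k i @ [i]) = cup X (cup_word X u (replicate k i)) (u i)"
    using Suc.prems by (subst cup_word_append) (auto simp: cup_const_right cocycles_cochains)
  then show ?case using Suc by (simp add: replicate_append_same)
qed simp

lemma cup_word_degree:
  assumes "\<And>i p \<sigma>. i \<in> set w ==> p \<noteq> 2 ==> u i p \<sigma> = 0" "p \<noteq> 2 * length w"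
  shows "cup_word X u w p \<sigma> = 0"
  using assms
proof (induction w arbitrary: p \<sigma>)
  case Nil then show ?case by (simp add: const_cochain_def)
next
  case (Cons i w)
  have "u i k (front_face k \<sigma>) * cup_word X u w (p - k) (back_face p (p - k) \<sigma>) = 0" if "k \<le> p" for k
    using Cons.IH[of "p - k"] Cons.prems that by (cases "k = 2") auto
  then have "(\<Sum>k\<le>p. u i k (front_face k \<sigma>) * cup_word X u w (p - k) (back_face p (p - k) \<sigma>)) = 0"
    by (intro sum.neutral) blast
  then show ?case by (simp add: cup_def)
qed

text \<open>The iterated product of \<open>theta_class\<close>, carried out with representatives
  instead of classes.\<close>

definition theta_cocycle :: "'a topology => nat => (nat => complex fps) => (nat => 'a cochain) => complex => nat list => 'a cochain" where
  "theta_cocycle X r F u c L = foldr (\<lambda>i A. cup X (cocycle_series X r (F i) (\<lambda>p \<sigma>. c * u i p \<sigma>)) A) L (const_cochain X 1)"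

lemma cocycles_theta_cocycle: "(\<And>i. i \<in> set L ==> u i \<in> cocycles X) ==> theta_cocycle X r F u c L \<in> cocycles X"
  unfolding theta_cocycle_def
  by (induction L) (auto simp: cocycles_const intro!: cocycles_cup cocycles_series cocycles_mult)

lemma theta_class_coset:
  fixes N :: "'a::euclidean_space set"
  assumes "\<And>i. i \<in> {1..s} ==> u i \<in> cocycles (toric_variety N \<Sigma>)"
    and "\<And>i. i \<in> {1..s} ==> D i = coh_class (toric_variety N \<Sigma>) (u i)"
  shows "theta_class N r \<Sigma> s \<alpha> D \<tau> = coh_class (toric_variety N \<Sigma>)
     (theta_cocycle (toric_variety N \<Sigma>) r (\<lambda>i. theta_quotient_fps (\<alpha> i) \<tau>) u (1 / (2 * pi * \<i>)) [1..<Suc s])"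
proof -
  let ?X = "toric_variety N \<Sigma>"
  have "foldr (\<lambda>i A. cohomology_series ?X r (theta_quotient_fps (\<alpha> i) \<tau>)
           (cohomology_scalar ?X (1 / (2 * pi * \<i>)) \<otimes>\<^bsub>cohomology_ring ?X\<^esub> D i) \<otimes>\<^bsub>cohomology_ring ?X\<^esub> A) L \<one>\<^bsub>cohomology_ring ?X\<^esub>
     = coh_class ?X (theta_cocycle ?X r (\<lambda>i. theta_quotient_fps (\<alpha> i) \<tau>) u (1 / (2 * pi * \<i>)) L)"
    if "set L \<subseteq> {1..s}" for L
    using that
  proof (induction L)
    case Nil
    then show ?case by (simp add: theta_cocycle_def coh_class_one)
  next
    case (Cons i L)
    have i: "i \<in> {1..s}" and L: "set L \<subseteq> {1..s}" using Cons.prems by auto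
    have u: "u i \<in> cocycles ?X" and D: "D i = coh_class ?X (u i)" using assms i by auto
    have t: "theta_cocycle ?X r (\<lambda>i. theta_quotient_fps (\<alpha> i) \<tau>) u (1 / (2 * pi * \<i>)) L \<in> cocycles ?X"
      using L assms by (intro cocycles_theta_cocycle) auto
    show ?case
      unfolding foldr.simps o_apply Cons.IH[OF L] D coh_class_scalar_mult[OF u] coh_class_series[OF cocycles_mult[OF u]]
        coh_class_mult[OF cocycles_series[OF cocycles_mult[OF u]] t]
      by (simp add: theta_cocycle_def)
  qed
  then show ?thesis unfolding theta_class_def Let_def by force
qed

text \<open>The product is multiplied out from the left, and \<open>w\<close> collects the letters
  chosen so far. If every word of length r is evaluated by a sum over \<open>M\<close> of products
  of numbers \<open>y S i\<close>, then the sum over all choices is, for each \<open>S\<close>, a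
  coefficient of a product of power series.\<close>

lemma theta_cocycle_eval:
  fixes u :: "nat => 'a cochain" and y :: "'s => nat => complex" and M :: "'s set"
  assumes u: "\<And>i. i \<in> V ==> u i \<in> cocycles X"
    and deg: "\<And>i p \<sigma>. i \<in> V ==> p \<noteq> 2 ==> u i p \<sigma> = 0"
    and base: "\<And>w. set w \<subseteq> V ==> length w = r ==>
       cochain_eval (cup_word X u w (2 * r)) c = (\<Sum>S\<in>M. A S * (\<Prod>i\<leftarrow>w. y S i))"
    and "set L \<subseteq> V" "set w \<subseteq> V" "length w \<le> r"
  shows "cochain_eval (cup X (cup_word X u w) (theta_cocycle X r F u \<kappa> L) (2 * r)) c =
    (\<Sum>S\<in>M. A S * (\<Prod>i\<leftarrow>w. y S i) *
       fps_nth (\<Prod>i\<leftarrow>L. Abs_fps (\<lambda>n. (\<kappa> * y S i) ^ n * fps_nth (F i) n)) (r - length w))"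
  using assms(4-6)
proof (induction L arbitrary: w)
  case Nil
  have w: "cup_word X u w \<in> cocycles X" using u Nil.prems by (intro cocycles_cup_word) auto
  show ?case
  proof (cases "length w = r")
    case True
    then show ?thesis using base[of w] Nil w by (simp add: theta_cocycle_def cup_const_right cocycles_cochains)
  next
    case False
    have "cup_word X u w (2 * r) = (\<lambda>_. 0)"
      using False Nil.prems deg by (intro ext cup_word_degree) auto
    then show ?thesis using False Nil.prems w
      by (simp add: theta_cocycle_def cup_const_right cocycles_cochains cochain_eval_zero_left)
  qed
next
  case (Cons i L)
  let ?n = "r - length w"
  let ?T = "theta_cocycle X r F u \<kappa> L"
  let ?R = "\<lambda>S. \<Prod>i\<leftarrow>L. Abs_fps (\<lambda>n. (\<kappa> * y S i) ^ n * fps_nth (F i) n)"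
  have i: "i \<in> V" "set L \<subseteq> V" using Cons.prems by auto
  have ui: "u i \<in> cocycles X" using u i by simp
  have ap: "cup_word X u (w @ replicate k i) = cup X (cup_word X u w) (cup_word X u (replicate k i))" for k
    by (rule cup_word_append) (use ui in \<open>auto split: if_splits\<close>)
  have E: "cup X (cup_word X u w) (theta_cocycle X r F u \<kappa> (i # L)) (2 * r) \<sigma> =
      (\<Sum>k\<le>r. fps_nth (F i) k * \<kappa> ^ k * cup X (cup_word X u (w @ replicate k i)) ?T (2 * r) \<sigma>)" for \<sigma>
  proof -
    have 1: "cocycle_series X r (F i) (\<lambda>p \<sigma>. \<kappa> * u i p \<sigma>) = (\<lambda>p \<sigma>. \<Sum>k\<le>r. fps_nth (F i) k * \<kappa> ^ k * cup_word X u (replicate k i) p \<sigma>)"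
      by (simp add: cocycle_series_def cup_power_mult cocycles_cochains ui cup_power_word mult.assoc)
    have 2: "cup X a (cup X (\<lambda>p \<sigma>. \<Sum>k\<le>n. f k * b k p \<sigma>) d) = (\<lambda>p \<sigma>. \<Sum>k\<le>n. f k * cup X a (cup X (b k) d) p \<sigma>)"
      for a b d f and n :: nat
    proof (induction n)
      case 0 then show ?case by (simp add: cup_mult_left cup_mult_right)
    next
      case (Suc n)
      have "(\<lambda>p \<sigma>. \<Sum>k\<le>Suc n. f k * b k p \<sigma>) = (\<lambda>p \<sigma>. (\<Sum>k\<le>n. f k * b k p \<sigma>) + f (Suc n) * b (Suc n) p \<sigma>)" by simp
      then show ?case by (simp add: cup_add_left cup_add_right cup_mult_left cup_mult_right Suc)
    qed
    have "theta_cocycle X r F u \<kappa> (i # L) = cup X (cocycle_series X r (F i) (\<lambda>p \<sigma>. \<kappa> * u i p \<sigma>)) ?T"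
      by (simp add: theta_cocycle_def)
    then show ?thesis unfolding 1 by (simp add: 2 ap cup_assoc)
  qed
  \<comment> \<open>More than \<open>?n\<close> further letters push the degree beyond 2 r, so the
    sum up to r may be cut at \<open>?n\<close>.\<close>
  have big: "cup X (cup_word X u (w @ replicate k i)) ?T (2 * r) \<sigma> = 0" if "k > ?n" for k \<sigma>
  proof -
    have "cup_word X u (w @ replicate k i) j (front_face j \<sigma>) = 0" if "j \<le> 2 * r" for j
      using \<open>k > ?n\<close> that Cons.prems deg i by (intro cup_word_degree) (auto split: if_splits)
    then show ?thesis by (simp add: cup_def)
  qed
  have "cochain_eval (cup X (cup_word X u w) (theta_cocycle X r F u \<kappa> (i # L)) (2 * r)) c =
      (\<Sum>k\<le>r. fps_nth (F i) k * \<kappa> ^ k * cochain_eval (cup X (cup_word X u (w @ replicate k i)) ?T (2 * r)) c)"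
    unfolding E[abs_def] by (simp add: cochain_eval_sum_left cochain_eval_mult_left)
  also have "\<dots> = (\<Sum>k\<le>?n. fps_nth (F i) k * \<kappa> ^ k * cochain_eval (cup X (cup_word X u (w @ replicate k i)) ?T (2 * r)) c)"
    by (rule sum.mono_neutral_right) (auto simp: big cochain_eval_zero_left not_le)
  also have "\<dots> = (\<Sum>k\<le>?n. fps_nth (F i) k * \<kappa> ^ k * (\<Sum>S\<in>M. A S * (\<Prod>i\<leftarrow>w. y S i) * y S i ^ k * fps_nth (?R S) (?n - k)))"
  proof (rule sum.cong[OF refl])
    fix k assume k: "k \<in> {..?n}"
    have "cochain_eval (cup X (cup_word X u (w @ replicate k i)) ?T (2 * r)) c =
       (\<Sum>S\<in>M. A S * (\<Prod>i\<leftarrow>w @ replicate k i. y S i) * fps_nth (?R S) (r - length (w @ replicate k i)))"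
      using k Cons.prems i by (intro Cons.IH) (auto split: if_splits)
    then show "fps_nth (F i) k * \<kappa> ^ k * cochain_eval (cup X (cup_word X u (w @ replicate k i)) ?T (2 * r)) c =
       fps_nth (F i) k * \<kappa> ^ k * (\<Sum>S\<in>M. A S * (\<Prod>i\<leftarrow>w. y S i) * y S i ^ k * fps_nth (?R S) (?n - k))"
      by (simp add: prod_list_replicate mult.assoc)
  qed
  also have "\<dots> = (\<Sum>S\<in>M. A S * (\<Prod>i\<leftarrow>w. y S i) * (\<Sum>k\<le>?n. (\<kappa> * y S i) ^ k * fps_nth (F i) k * fps_nth (?R S) (?n - k)))"
    unfolding sum_distrib_left by (subst sum.swap) (simp add: power_mult_distrib mult_ac)
  also have "\<dots> = (\<Sum>S\<in>M. A S * (\<Prod>i\<leftarrow>w. y S i) *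
       fps_nth (\<Prod>i\<leftarrow>i # L. Abs_fps (\<lambda>n. (\<kappa> * y S i) ^ n * fps_nth (F i) n)) ?n)"
    by (simp add: fps_mult_nth atLeast0AtMost)
  finally show ?case .
qed

section \<open>Small simplices\<close>

text \<open>The boundary pieces are required to lie in single members of the cover: then the subdivision
  homotopy does not move them out of it.\<close>

lemma cocycle_eval_small:
  assumes a: "a \<in> cocycles X"
    and cover: "\<And>U. U \<in> \<U> ==> openin Y U" "topspace Y \<subseteq> \<Union>\<U>"
    and Y: "Y = subtopology X T"
    and van: "\<And>U q \<sigma>. U \<in> \<U> ==> singular_simplex p X \<sigma> ==> \<sigma> ` \<Delta> p \<subseteq> U ==> a p \<sigma> = 0"
    and c: "singular_chain p Y c"
    and bd: "chain_boundary p c = (\<Sum>i\<in>I. e i)"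
      "\<And>i. i \<in> I ==> \<exists>q U. p = Suc q \<and> U \<in> \<U> \<and> singular_chain q (subtopology X U) (e i)"
  shows "cochain_eval (a p) c = 0"
proof -
  have cX: "singular_chain p X c" using c by (simp add: Y singular_chain_subtopology)
  obtain n where n: "\<And>m f. \<lbrakk>n \<le> m; f \<in> Poly_Mapping.keys ((singular_subdivision p ^^ m) c)\<rbrakk>
                      \<Longrightarrow> \<exists>V \<in> \<U>. f \<in> (\<Delta> p) \<rightarrow> V"
    using sufficient_iterated_singular_subdivision_exists[OF cover c] by metis
  obtain h where h: "\<And>p. h p 0 = (0 :: 'a chain)"
        "\<And>p c1 c2. h p (c1-c2) = h p c1 - h p c2"
        "\<And>p X c. singular_chain p X c ==> singular_chain (Suc p) X (h p c)"
        "\<And>p X c. singular_chain p X c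
                 ==> chain_boundary (Suc p) (h p c) + h (p - Suc 0) (chain_boundary p c)
                   = (singular_subdivision p ^^ n) c - c"
    using chain_homotopic_iterated_singular_subdivision by blast
  \<comment> \<open>The homotopy is only known to respect differences; sums follow by way of the
    zero chain.\<close>
  have hadd: "h p (c1 + c2) = h p c1 + h p c2" for p c1 c2
  proof -
    have "h p (c1 + c2) = h p c1 - h p (0 - c2)" by (simp flip: h(2))
    also have "h p (0 - c2) = - h p c2" by (simp only: h(1,2)) simp
    finally show ?thesis by simp
  qed
  have hsum: "h p (\<Sum>i\<in>J. e i) = (\<Sum>i\<in>J. h p (e i))" for p J
    by (induction J rule: infinite_finite_induct) (auto simp: h(1) hadd)
  \<comment> \<open>The homotopy equation itself exhibits the subdivided chain as a chain in
    \<open>X\<close>.\<close>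
  have sd: "singular_chain p X ((singular_subdivision p ^^ n) c)"
  proof -
    have "singular_chain p X ((singular_subdivision p ^^ n) c - c)"
    proof -
      have "singular_chain p X (h (p - Suc 0) (chain_boundary p c))"
        using h(3)[OF singular_chain_boundary[OF cX]] by (cases p) (auto simp: chain_boundary_def h(1))
      moreover have "singular_chain p X (chain_boundary (Suc p) (h p c))"
        using h(3)[OF cX] by (rule singular_chain_boundary_alt)
      ultimately show ?thesis unfolding h(4)[OF cX, symmetric] by (intro singular_chain_add)
    qed
    from singular_chain_add[OF this cX] show ?thesis by simp
  qed
  have z1: "cochain_eval (a p) ((singular_subdivision p ^^ n) c) = 0"
  proof (rule cochain_eval_zero_left)
    fix \<sigma> assume s: "\<sigma> \<in> Poly_Mapping.keys ((singular_subdivision p ^^ n) c)"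
    then obtain V where "V \<in> \<U>" "\<sigma> \<in> \<Delta> p \<rightarrow> V" using n by blast
    then show "a p \<sigma> = 0" using van[of V \<sigma>] s sd by (auto simp: singular_chain_def)
  qed
  have z2: "cochain_eval (a p) (h (p - Suc 0) (chain_boundary p c)) = 0"
  proof -
    have "cochain_eval (a p) (h (p - Suc 0) (e i)) = 0" if i: "i \<in> I" for i
    proof -
      obtain q U where q: "p = Suc q" "U \<in> \<U>" "singular_chain q (subtopology X U) (e i)" using bd(2)[OF i] by blast
      have "singular_chain p (subtopology X U) (h q (e i))" using h(3)[OF q(3)] q(1) by simp
      then show ?thesis
        using van[OF q(2)] q(1) by (intro cochain_eval_zero_left) (auto simp: singular_chain_def singular_simplex_subtopology)
    qed
    then show ?thesis by (simp add: bd(1) hsum cochain_eval_sum)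
  qed
  have "cochain_eval (a p) (chain_boundary (Suc p) (h p c)) = 0"
    using cocycle_eval_boundary[OF a h(3)[OF cX]] .
  then have "cochain_eval (a p) ((singular_subdivision p ^^ n) c - c) = 0"
    using z2 by (simp add: cochain_eval_add flip: h(4)[OF cX])
  then show ?thesis using z1 by (simp add: cochain_eval_diff)
qed

lemma cocycle_eval_small_cycle:
  assumes "a \<in> cocycles X"
    and "\<And>U. U \<in> \<U> ==> openin X U" "topspace X \<subseteq> \<Union>\<U>"
    and "\<And>U \<sigma>. U \<in> \<U> ==> singular_simplex p X \<sigma> ==> \<sigma> ` \<Delta> p \<subseteq> U ==> a p \<sigma> = 0"
    and "singular_chain p X c" "chain_boundary p c = 0"
  shows "cochain_eval (a p) c = 0"
  using cocycle_eval_small[where \<U>=\<U> and X=X and Y=X and T="topspace X" and I="{}" and e="\<lambda>_. 0" and p=p and c=c and a=a] assms by simp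

lemma image_front_face: "k \<le> p ==> front_face k \<sigma> ` \<Delta> k \<subseteq> \<sigma> ` \<Delta> p"
  using standard_simplex_mono[of k p] by (auto simp: front_face_def)

lemma image_back_face: "k \<le> p ==> back_face p k \<sigma> ` \<Delta> k \<subseteq> \<sigma> ` \<Delta> p"
  using simplex_shift_in'[of _ k p] by (auto simp: back_face_alt)

definition vanishes_on :: "'a topology => 'a cochain => 'a set => bool" where
  "vanishes_on X a U \<longleftrightarrow> (\<forall>p \<sigma>. singular_simplex p X \<sigma> --> \<sigma> ` \<Delta> p \<subseteq> U --> a p \<sigma> = 0)"

lemma vanishes_on_cup_left: "vanishes_on X a U ==> vanishes_on X (cup X a b) U"
  unfolding vanishes_on_def cup_def
  by (auto intro!: sum.neutral) (meson image_front_face order_trans singular_simplex_front)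

lemma vanishes_on_cup_right: "vanishes_on X b U ==> vanishes_on X (cup X a b) U"
  unfolding vanishes_on_def cup_def
  by (auto intro!: sum.neutral) (meson diff_le_self image_back_face order_trans singular_simplex_back)

lemma vanishes_on_cup_word: "i \<in> set w ==> vanishes_on X (u i) U ==> vanishes_on X (cup_word X u w) U"
  by (induction w) (auto intro: vanishes_on_cup_left vanishes_on_cup_right)

text \<open>A simplex inside \<open>U i\<close> is killed by the factor \<open>u i\<close>, hence by
  the whole word, and subdivision makes every simplex that small.\<close>

lemma cup_word_eval_disjoint:
  assumes "\<And>i. i \<in> set w ==> u i \<in> cocycles X"
    and "\<And>i. i \<in> set w ==> openin X (U i)" "\<And>i. i \<in> set w ==> vanishes_on X (u i) (U i)"
    and "topspace X \<subseteq> (\<Union>i\<in>set w. U i)"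
    and "singular_chain p X c" "chain_boundary p c = 0"
  shows "cochain_eval (cup_word X u w p) c = 0"
proof (rule cocycle_eval_small_cycle[where \<U>="U ` set w" and X=X and p=p])
  fix V \<sigma> assume "V \<in> U ` set w" "singular_simplex p X \<sigma>" "\<sigma> ` \<Delta> p \<subseteq> V"
  then obtain i where "i \<in> set w" "V = U i" by auto
  then show "cup_word X u w p \<sigma> = 0"
    using vanishes_on_cup_word[of i w X u "U i"] assms(3)[of i] \<open>singular_simplex p X \<sigma>\<close> \<open>\<sigma> ` \<Delta> p \<subseteq> V\<close>
    by (auto simp: vanishes_on_def)
qed (use assms cocycles_cup_word[of w u X] in auto)

text \<open>The relation is known only on small simplices. Subtracting the coboundary of one global
  cochain turns the linear combination into a cocycle that vanishes on small simplices, even after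
  multiplication by words on both sides; the subtracted coboundary does not change the value on a
  cycle.\<close>

lemma cup_word_eval_relation:
  fixes X :: "'a topology"
  assumes u: "\<And>i. i \<in> V ==> u i \<in> cocycles X" "\<And>i p \<sigma>. i \<in> V ==> p \<noteq> 2 ==> u i p \<sigma> = 0"
    and V: "finite V" "set w1 \<subseteq> V" "set w2 \<subseteq> V"
    and \<phi>: "\<And>U \<sigma>. U \<in> \<U> ==> singular_simplex 2 X \<sigma> ==> \<sigma> ` \<Delta> 2 \<subseteq> U ==>
       (\<Sum>i\<in>V. k i * u i 2 \<sigma>) = \<phi> (singular_face 2 0 \<sigma>) - \<phi> (singular_face 2 1 \<sigma>) + \<phi> (singular_face 2 2 \<sigma>)"
    and cover: "\<And>U. U \<in> \<U> ==> openin X U" "topspace X \<subseteq> \<Union>\<U>"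
    and c: "singular_chain p X c" "chain_boundary p c = 0"
  shows "(\<Sum>i\<in>V. k i * cochain_eval (cup_word X u (w1 @ i # w2) p) c) = 0"
proof -
  define f :: "'a cochain" where "f = (\<lambda>p \<sigma>. if p = 1 \<and> singular_simplex 1 X \<sigma> then \<phi> \<sigma> else 0)"
  define w where "w = (\<lambda>p \<sigma>. \<Sum>i\<in>V. k i * u i p \<sigma>)"
  define w' where "w' = (\<lambda>p \<sigma>. w p \<sigma> + -1 * coboundary X f p \<sigma>)"
  let ?a = "cup_word X u w1" and ?b = "cup_word X u w2"
  have a: "?a \<in> cocycles X" and b: "?b \<in> cocycles X" using u V by (auto intro!: cocycles_cup_word)
  have f: "f \<in> cochains X" by (auto simp: cochains_def f_def)
  have wz: "(\<lambda>p \<sigma>. \<Sum>i\<in>J. k i * u i p \<sigma>) \<in> cocycles X" if "J \<subseteq> V" for J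
    using finite_subset[OF that V(1)] that
    by (induction J rule: finite_induct) (auto intro!: cocycles_add cocycles_mult[OF u(1)])
  have cob: "coboundary X f \<in> coboundaries X" using f by (auto simp: coboundaries_def)
  have w': "w' \<in> cocycles X"
    unfolding w'_def using wz[of V] cob coboundaries_subset[of X]
    by (intro cocycles_add cocycles_mult) (auto simp: w_def)
  have van: "w' p \<sigma> = 0" if "U \<in> \<U>" "singular_simplex p X \<sigma>" "\<sigma> ` \<Delta> p \<subseteq> U" for U p \<sigma>
  proof (cases "p = 2")
    case True
    have "singular_simplex 1 X (singular_face 2 i \<sigma>)" if "i \<le> 2" for i
      using singular_simplex_singular_face[of 2 X \<sigma> i] \<open>singular_simplex p X \<sigma>\<close> True that by simp
    moreover have "{..2::nat} = {0,1,2}" by auto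
    ultimately show ?thesis using that True \<phi>[of U \<sigma>]
      by (simp add: w'_def w_def coboundary_simplex f_def)
  next
    case False
    then have "coboundary X f p \<sigma> = 0" by (auto simp: coboundary_def f_def intro!: cochain_eval_zero_left)
    then show ?thesis using False u(2) by (simp add: w'_def w_def)
  qed
  have z: "cochain_eval (cup X ?a (cup X w' ?b) p) c = 0"
  proof (rule cocycle_eval_small_cycle[where \<U>=\<U> and X=X and p=p])
    fix U \<sigma> assume U: "U \<in> \<U>" and s: "singular_simplex p X \<sigma>" "\<sigma> ` \<Delta> p \<subseteq> U"
    have "vanishes_on X w' U" using van U by (auto simp: vanishes_on_def)
    then have "vanishes_on X (cup X ?a (cup X w' ?b)) U" by (intro vanishes_on_cup_left vanishes_on_cup_right)
    then show "cup X ?a (cup X w' ?b) p \<sigma> = 0" using s by (auto simp: vanishes_on_def)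
  qed (use cover c a b w' in \<open>auto intro!: cocycles_cup\<close>)
  have "cup X ?a (cup X (coboundary X f) ?b) \<in> coboundaries X"
    by (intro coboundaries_cup_left coboundaries_cup_right cob a b)
  from coboundary_eval_cycle[OF this c] have "cochain_eval (cup X ?a (cup X (coboundary X f) ?b) p) c = 0" .
  moreover have "cup X ?a (cup X w' ?b) = (\<lambda>p \<sigma>. cup X ?a (cup X w ?b) p \<sigma> + -1 * cup X ?a (cup X (coboundary X f) ?b) p \<sigma>)"
    unfolding w'_def by (simp only: cup_add_left cup_add_right cup_mult_left cup_mult_right)
  ultimately have "cochain_eval (cup X ?a (cup X w ?b) p) c = 0"
    using z by (simp only: cochain_eval_plus_left cochain_eval_mult_left) simp
  moreover have "cup X ?a (cup X (\<lambda>p \<sigma>. \<Sum>i\<in>J. k i * u i p \<sigma>) ?b) = (\<lambda>p \<sigma>. \<Sum>i\<in>J. k i * cup X ?a (cup X (u i) ?b) p \<sigma>)"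
    if "finite J" for J
    using that by induction (auto simp: cup_add_left cup_add_right cup_mult_left cup_mult_right)
  moreover have "cup_word X u (w1 @ i # w2) = cup X ?a (cup X (u i) ?b)" if "i \<in> V" for i
    using cup_word_append[of "i # w2" u X w1] u V that by fastforce
  ultimately show ?thesis
    using V(1) by (simp add: w_def cochain_eval_sum_left cochain_eval_mult_left cong: sum.cong)
qed

section \<open>Smooth complete fans\<close>

lemma sum_scaleR_in_span: "S \<subseteq> B ==> (\<Sum>b\<in>S. c b *\<^sub>R b) \<in> span (B :: 'a::real_vector set)"
  by (intro span_sum span_scale span_base) auto

lemma lattice_basis_props:
  assumes "lattice_basis N B"
  shows lattice_basis_finite: "finite B" and lattice_basis_indep: "independent B"
    and lattice_basis_subset: "B \<subseteq> N" and lattice_basis_span: "span N = span B"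
    and lattice_basis_zero: "0 \<in> N" and lattice_basis_card: "card B = dim (span N)"
proof -
  show fin: "finite B" and ind: "independent B" using assms by (auto simp: lattice_basis_def)
  have N: "N = {(\<Sum>b\<in>B. of_int (c b) *\<^sub>R b) | c :: 'a => int. True}" using assms by (simp add: lattice_basis_def)
  show B: "B \<subseteq> N"
  proof
    fix b assume "b \<in> B"
    have "(\<Sum>b'\<in>B. of_int (if b' = b then 1 else 0) *\<^sub>R b') = (\<Sum>b'\<in>B. if b' = b then b' else 0)"
      by (rule sum.cong) auto
    also have "\<dots> = b" using fin \<open>b \<in> B\<close> by simp
    finally show "b \<in> N" unfolding N by (auto intro!: exI[of _ "\<lambda>b'. if b' = b then 1 else 0"])
  qed
  have "N \<subseteq> span B" unfolding N using sum_scaleR_in_span[OF order_refl, of _ B] by auto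
  then show sp: "span N = span B" using B by (simp add: span_eq span_superset subset_trans[OF B span_superset])
  show "0 \<in> N" unfolding N by (auto intro!: exI[of _ "\<lambda>_. 0"])
  show "card B = dim (span N)" by (metis ind sp indep_card_eq_dim_span)
qed

lemma lattice_basis_sum: "lattice_basis N B ==> (\<Sum>b\<in>B. of_int (c b) *\<^sub>R b) \<in> N"
  by (auto simp: lattice_basis_def)

lemma dual_vectors_exist:
  fixes B :: "'a::euclidean_space set"
  assumes "finite B" "independent B"
  shows "\<exists>u. \<forall>b\<in>B. u b \<in> span B \<and> (\<forall>b'\<in>B. u b \<bullet> b' = (if b' = b then 1 else 0))"
proof -
  have "\<exists>w. w \<in> span B \<and> (\<forall>b'\<in>B. w \<bullet> b' = (if b' = b then 1 else 0))" if "b \<in> B" for b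
  proof -
    obtain f :: "'a => real" where f: "linear f" "\<forall>x\<in>B. f x = (if x = b then 1 else 0)"
      using linear_independent_extend[OF assms(2), of "\<lambda>x. if x = b then 1 else 0"] by auto
    \<comment> \<open>The vector that represents \<open>f\<close> under the inner product. It may
      leave the span of \<open>B\<close> when this is a proper subspace, hence the orthogonal
      projection.\<close>
    define m where "m = adjoint f 1"
    have m: "m \<bullet> x = f x" for x using adjoint_works[OF f(1), of x 1] by (simp add: m_def inner_commute)
    obtain y z where yz: "y \<in> span B" "\<And>w. w \<in> span B ==> orthogonal z w" "m = y + z"
      using orthogonal_subspace_decomp_exists[of B m] by metis
    have "y \<bullet> x = f x" if "x \<in> B" for x
      using m[of x] yz(2)[of x] that by (simp add: yz(3) orthogonal_def inner_add_left span_base)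
    then show ?thesis using yz(1) f(2) by auto
  qed
  then show ?thesis by metis
qed

definition dual_vector :: "'a::euclidean_space set => 'a => 'a" where
  "dual_vector B = (SOME u. \<forall>b\<in>B. u b \<in> span B \<and> (\<forall>b'\<in>B. u b \<bullet> b' = (if b' = b then 1 else 0)))"

lemma dual_vector:
  fixes B :: "'a::euclidean_space set"
  assumes "finite B" "independent B" "b \<in> B"
  shows dual_vector_span: "dual_vector B b \<in> span B"
    and dual_vector_inner: "b' \<in> B ==> dual_vector B b \<bullet> b' = (if b' = b then 1 else 0)"
  using someI_ex[OF dual_vectors_exist[OF assms(1,2)]] assms(3) unfolding dual_vector_def by auto

lemma dual_vector_expand:
  fixes B :: "'a::euclidean_space set"
  assumes B: "finite B" "independent B" and x: "x \<in> span B"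
  shows "x = (\<Sum>b\<in>B. (dual_vector B b \<bullet> x) *\<^sub>R b)" and "x = (\<Sum>b\<in>B. (x \<bullet> b) *\<^sub>R dual_vector B b)"
proof -
  obtain c where c: "x = (\<Sum>b\<in>B. c b *\<^sub>R b)" using x by (auto simp: span_finite[OF B(1)])
  have cb: "dual_vector B b \<bullet> x = c b" if "b \<in> B" for b
  proof -
    have "dual_vector B b \<bullet> x = (\<Sum>b'\<in>B. if b' = b then c b' else 0)"
      unfolding c inner_sum_right by (rule sum.cong) (use that in \<open>auto simp: dual_vector_inner[OF B]\<close>)
    then show ?thesis using that B by simp
  qed
  show e1: "x = (\<Sum>b\<in>B. (dual_vector B b \<bullet> x) *\<^sub>R b)" using cb c by simp
  let ?y = "x - (\<Sum>b\<in>B. (x \<bullet> b) *\<^sub>R dual_vector B b)"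
  have y: "?y \<in> span B" using x dual_vector_span[OF B] by (intro span_diff span_sum span_scale) auto
  have "?y \<bullet> b' = 0" if "b' \<in> B" for b'
  proof -
    have "(\<Sum>b\<in>B. (x \<bullet> b) *\<^sub>R dual_vector B b) \<bullet> b' = (\<Sum>b\<in>B. if b = b' then x \<bullet> b else 0)"
      unfolding inner_sum_left by (rule sum.cong) (use that in \<open>auto simp: dual_vector_inner[OF B]\<close>)
    then show ?thesis using that B by (simp add: inner_diff_left)
  qed
  then have "B \<subseteq> {z. ?y \<bullet> z = 0}" by auto
  then have "span B \<subseteq> {z. ?y \<bullet> z = 0}" by (rule span_minimal) (rule subspace_hyperplane)
  then have "?y \<bullet> ?y = 0" using y by blast
  then show "x = (\<Sum>b\<in>B. (x \<bullet> b) *\<^sub>R dual_vector B b)" by simp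
qed

lemma lattice_basis_mem_iff:
  assumes "lattice_basis N B"
  shows "x \<in> N \<longleftrightarrow> x \<in> span B \<and> (\<forall>b\<in>B. dual_vector B b \<bullet> x \<in> \<int>)"
proof
  note B = lattice_basis_finite[OF assms] lattice_basis_indep[OF assms]
  assume "x \<in> N"
  then obtain c :: "'a => int" where c: "x = (\<Sum>b\<in>B. of_int (c b) *\<^sub>R b)" using assms by (auto simp: lattice_basis_def)
  have "dual_vector B b \<bullet> x = of_int (c b)" if "b \<in> B" for b
  proof -
    have "dual_vector B b \<bullet> x = (\<Sum>b'\<in>B. if b' = b then of_int (c b') else 0)"
      unfolding c inner_sum_right by (rule sum.cong) (use that in \<open>auto simp: dual_vector_inner[OF B]\<close>)
    then show ?thesis using that B by simp
  qed
  moreover have "x \<in> span B" unfolding c by (rule sum_scaleR_in_span) simp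
  ultimately show "x \<in> span B \<and> (\<forall>b\<in>B. dual_vector B b \<bullet> x \<in> \<int>)" by simp
next
  note B = lattice_basis_finite[OF assms] lattice_basis_indep[OF assms]
  assume *: "x \<in> span B \<and> (\<forall>b\<in>B. dual_vector B b \<bullet> x \<in> \<int>)"
  have "x = (\<Sum>b\<in>B. of_int \<lfloor>dual_vector B b \<bullet> x\<rfloor> *\<^sub>R b)"
    by (subst dual_vector_expand(1)[OF B, of x]) (use * in \<open>auto intro!: sum.cong simp: floor_of_int elim!: Ints_cases\<close>)
  then show "x \<in> N" using lattice_basis_sum[OF assms, of "\<lambda>b. \<lfloor>dual_vector B b \<bullet> x\<rfloor>"] by simp
qed

lemma dual_lattice_iff:
  assumes "lattice_basis N B"
  shows "m \<in> dual_lattice N \<longleftrightarrow> m \<in> span B \<and> (\<forall>b\<in>B. m \<bullet> b \<in> \<int>)"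
proof -
  have "m \<bullet> n \<in> \<int>" if m: "\<forall>b\<in>B. m \<bullet> b \<in> \<int>" and n: "n \<in> N" for n
  proof -
    obtain c :: "'a => int" where c: "n = (\<Sum>b\<in>B. of_int (c b) *\<^sub>R b)" using assms n by (auto simp: lattice_basis_def)
    show ?thesis unfolding c inner_sum_right inner_scaleR_right using m by (intro Ints_sum Ints_mult) auto
  qed
  then show ?thesis
    using lattice_basis_subset[OF assms] by (auto simp: dual_lattice_def lattice_basis_span[OF assms])
qed

lemma dual_vector_dual_lattice:
  assumes "lattice_basis N B" "b \<in> B"
  shows "dual_vector B b \<in> dual_lattice N"
  using dual_vector[OF lattice_basis_finite[OF assms(1)] lattice_basis_indep[OF assms(1)] assms(2)]
  by (auto simp: dual_lattice_iff[OF assms(1)])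

lemma convex_cone_hull_finite:
  fixes S :: "'a::euclidean_space set"
  assumes "finite S"
  shows "convex_cone hull S = {(\<Sum>b\<in>S. c b *\<^sub>R b) | c. \<forall>b\<in>S. 0 \<le> c b}" (is "_ = ?T")
proof
  have "convex_cone ?T"
    unfolding convex_cone_iff
  proof (intro conjI ballI allI impI)
    show "0 \<in> ?T" by (auto intro: exI[of _ "\<lambda>_. 0"])
    fix x y assume "x \<in> ?T" "y \<in> ?T"
    then obtain c e where "x = (\<Sum>b\<in>S. c b *\<^sub>R b)" "y = (\<Sum>b\<in>S. e b *\<^sub>R b)" "\<forall>b\<in>S. 0 \<le> c b" "\<forall>b\<in>S. 0 \<le> e b" by auto
    then show "x + y \<in> ?T" by (auto intro!: exI[of _ "\<lambda>b. c b + e b"] simp: scaleR_add_left sum.distrib)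
  next
    fix x and t :: real assume "x \<in> ?T" "0 \<le> t"
    then obtain c where "x = (\<Sum>b\<in>S. c b *\<^sub>R b)" "\<forall>b\<in>S. 0 \<le> c b" by auto
    then show "t *\<^sub>R x \<in> ?T" using \<open>0 \<le> t\<close> by (auto intro!: exI[of _ "\<lambda>b. t * c b"] simp: scaleR_sum_right)
  qed
  moreover have "S \<subseteq> ?T"
  proof
    fix b assume "b \<in> S"
    have "(\<Sum>b'\<in>S. (if b' = b then 1 else 0) *\<^sub>R b') = (\<Sum>b'\<in>S. if b' = b then b' else 0)"
      by (rule sum.cong) auto
    also have "\<dots> = b" using assms \<open>b \<in> S\<close> by simp
    finally show "b \<in> ?T" by (auto intro!: exI[of _ "\<lambda>b'. if b' = b then 1 else (0::real)"])
  qed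
  ultimately show "convex_cone hull S \<subseteq> ?T" by (rule hull_minimal[rotated])
  show "?T \<subseteq> convex_cone hull S"
  proof
    fix x assume "x \<in> ?T"
    then obtain c where c: "x = (\<Sum>b\<in>S. c b *\<^sub>R b)" "\<forall>b\<in>S. 0 \<le> c b" by auto
    have "(\<Sum>b\<in>S'. c b *\<^sub>R b) \<in> convex_cone hull S" if "S' \<subseteq> S" for S'
      using finite_subset[OF that assms] that
      by induction (auto simp: convex_cone_hull_contains_0 c(2) hull_inc intro!: convex_cone_hull_add convex_cone_hull_mul)
    then show "x \<in> convex_cone hull S" using c by simp
  qed
qed

lemma cone_mem_iff:
  fixes B :: "'a::euclidean_space set"
  assumes B: "finite B" "independent B" and S: "S \<subseteq> B"
  shows "x \<in> convex_cone hull S \<longleftrightarrow> x \<in> span B \<and> (\<forall>b\<in>S. 0 \<le> dual_vector B b \<bullet> x) \<and> (\<forall>b\<in>B - S. dual_vector B b \<bullet> x = 0)"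
proof
  have fS: "finite S" using B S finite_subset by blast
  assume "x \<in> convex_cone hull S"
  then obtain c where c: "x = (\<Sum>b\<in>S. c b *\<^sub>R b)" "\<forall>b\<in>S. 0 \<le> c b" using convex_cone_hull_finite[OF fS] by auto
  have "dual_vector B b \<bullet> x = (if b \<in> S then c b else 0)" if "b \<in> B" for b
  proof -
    have "dual_vector B b \<bullet> x = (\<Sum>b'\<in>S. if b' = b then c b' else 0)"
      unfolding c inner_sum_right by (rule sum.cong) (use that S in \<open>auto simp: dual_vector_inner[OF B]\<close>)
    then show ?thesis using fS by simp
  qed
  moreover have "x \<in> span B" unfolding c(1) by (rule sum_scaleR_in_span[OF S])
  ultimately show "x \<in> span B \<and> (\<forall>b\<in>S. 0 \<le> dual_vector B b \<bullet> x) \<and> (\<forall>b\<in>B - S. dual_vector B b \<bullet> x = 0)"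
    using c(2) S by auto
next
  have fS: "finite S" using B S finite_subset by blast
  assume *: "x \<in> span B \<and> (\<forall>b\<in>S. 0 \<le> dual_vector B b \<bullet> x) \<and> (\<forall>b\<in>B - S. dual_vector B b \<bullet> x = 0)"
  have "x = (\<Sum>b\<in>B. (dual_vector B b \<bullet> x) *\<^sub>R b)" using * by (intro dual_vector_expand(1)[OF B]) auto
  also have "\<dots> = (\<Sum>b\<in>S. (dual_vector B b \<bullet> x) *\<^sub>R b)"
    by (rule sum.mono_neutral_right) (use B S * in auto)
  finally show "x \<in> convex_cone hull S" unfolding convex_cone_hull_finite[OF fS] using * by auto
qed

text \<open>The coordinates of the generators outside \<open>S'\<close> are nonnegative on the cone;
  if they vanish at an inner point of a segment, they vanish at both ends.\<close>

lemma cone_face_of: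
  fixes B :: "'a::euclidean_space set"
  assumes B: "finite B" "independent B" and S: "S \<subseteq> B" "S' \<subseteq> S"
  shows "(convex_cone hull S') face_of (convex_cone hull S)"
  unfolding face_of_def
proof (intro conjI ballI impI)
  show "convex_cone hull S' \<subseteq> convex_cone hull S" by (rule hull_mono[OF S(2)])
  show "convex (convex_cone hull S')" by (rule convex_convex_cone_hull)
  have S': "S' \<subseteq> B" using S by auto
  fix a b x assume a: "a \<in> convex_cone hull S" and b: "b \<in> convex_cone hull S"
    and x: "x \<in> convex_cone hull S'" "x \<in> open_segment a b"
  obtain t where t: "0 < t" "t < 1" "x = (1 - t) *\<^sub>R a + t *\<^sub>R b" using x(2) by (auto simp: in_segment)
  have "dual_vector B j \<bullet> a = 0 \<and> dual_vector B j \<bullet> b = 0" if j: "j \<in> S - S'" for j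
  proof -
    have "0 \<le> dual_vector B j \<bullet> a" "0 \<le> dual_vector B j \<bullet> b" "dual_vector B j \<bullet> x = 0"
      using a b x(1) j S S' unfolding cone_mem_iff[OF B S(1)] cone_mem_iff[OF B S'] by auto
    moreover have "dual_vector B j \<bullet> x = (1 - t) * (dual_vector B j \<bullet> a) + t * (dual_vector B j \<bullet> b)"
      by (simp add: t(3) inner_add_right)
    ultimately have "(1 - t) * (dual_vector B j \<bullet> a) = 0 \<and> t * (dual_vector B j \<bullet> b) = 0"
      using t by (metis add_nonneg_eq_0_iff diff_ge_0_iff_ge less_eq_real_def mult_nonneg_nonneg)
    then show ?thesis using t by auto
  qed
  moreover have "j \<in> B - S' ==> j \<in> S - S' \<or> j \<in> B - S" for j using S by auto
  ultimately show "a \<in> convex_cone hull S'" "b \<in> convex_cone hull S'"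
    using a b S S' unfolding cone_mem_iff[OF B S(1)] cone_mem_iff[OF B S'] by (meson DiffE subsetD)+
qed


section \<open>Faces of convex cones\<close>

lemma face_of_cone_scale:
  fixes K :: "'a::euclidean_space set"
  assumes F: "F face_of K" and K: "convex_cone K" and x: "x \<in> F" and t: "0 \<le> t"
  shows "t *\<^sub>R x \<in> F"
proof (cases "x = 0")
  case False
  \<comment> \<open>Far enough out for \<open>x\<close> to be an inner point, and
    \<open>t *\<^sub>R x\<close> a point, of the segment from 0 to
    \<open>T *\<^sub>R x\<close>.\<close>
  define T where "T = 2 + t"
  have xK: "x \<in> K" "convex F" using F x by (auto simp: face_of_def)
  have "0 \<in> K" "T *\<^sub>R x \<in> K" using K xK t by (auto simp: T_def convex_cone_contains_0 intro!: convex_cone_scaleR)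
  moreover have "x \<in> open_segment 0 (T *\<^sub>R x)"
    using False t by (auto simp: in_segment T_def intro!: exI[of _ "1 / (2 + t)"])
  ultimately have "0 \<in> F" "T *\<^sub>R x \<in> F" using F x unfolding face_of_def by blast+
  moreover have "t *\<^sub>R x = (1 - t / T) *\<^sub>R 0 + (t / T) *\<^sub>R (T *\<^sub>R x)" "0 \<le> t / T" "t / T \<le> 1" using t by (auto simp: T_def)
  ultimately show ?thesis using xK(2) unfolding convex_alt by metis
qed (use x in simp)

text \<open>The sum is the midpoint of 2 y and 2 z, so a face through it contains both ends. For y =
  z the open segment is empty and scaling takes over.\<close>

lemma face_of_cone_summand:
  fixes K :: "'a::euclidean_space set"
  assumes F: "F face_of K" and K: "convex_cone K" and x: "y + z \<in> F" "y \<in> K" "z \<in> K"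
  shows "y \<in> F"
proof (cases "y = z")
  case True
  then have "y = (1/2) *\<^sub>R (y + z)" by (simp flip: scaleR_2)
  then show ?thesis using face_of_cone_scale[OF F K x(1), of "1/2"] by simp
next
  case False
  have "y + z \<in> open_segment (2 *\<^sub>R y) (2 *\<^sub>R z)"
  proof -
    have "y + z = (1 - 1/2) *\<^sub>R (2 *\<^sub>R y) + (1/2) *\<^sub>R (2 *\<^sub>R z)" by simp
    then show ?thesis using False unfolding in_segment by (intro conjI exI[of _ "1/2"]) auto
  qed
  moreover have "2 *\<^sub>R y \<in> K" "2 *\<^sub>R z \<in> K" using K x by (auto intro: convex_cone_scaleR)
  ultimately have "2 *\<^sub>R y \<in> F" using F x(1) unfolding face_of_def by blast
  from face_of_cone_scale[OF F K this, of "1/2"] show ?thesis by simp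
qed

lemma face_of_cone_generators:
  fixes S :: "'a::euclidean_space set"
  assumes F: "F face_of (convex_cone hull S)" and S: "finite S"
    and x: "(\<Sum>b\<in>S. c b *\<^sub>R b) \<in> F" "\<And>b. b \<in> S ==> 0 \<le> c b" and j: "j \<in> S" "0 < c j"
  shows "j \<in> F"
proof -
  note K = convex_cone_convex_cone_hull[of S]
  have "(\<Sum>b\<in>S - {j}. c b *\<^sub>R b) \<in> convex_cone hull S"
  proof -
    have "(\<Sum>b\<in>S'. c b *\<^sub>R b) \<in> convex_cone hull S" if "S' \<subseteq> S" for S'
      using finite_subset[OF that S] that
      by induction (auto simp: convex_cone_hull_contains_0 x(2) hull_inc intro!: convex_cone_hull_add convex_cone_hull_mul)
    then show ?thesis by blast
  qed
  moreover have "c j *\<^sub>R j + (\<Sum>b\<in>S - {j}. c b *\<^sub>R b) \<in> F" using x(1) S j by (simp add: sum.remove)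
  moreover have "c j *\<^sub>R j \<in> convex_cone hull S" using j by (intro convex_cone_hull_mul hull_inc) auto
  ultimately have "c j *\<^sub>R j \<in> F"
    using face_of_cone_summand[OF F K, of "c j *\<^sub>R j" "\<Sum>b\<in>S - {j}. c b *\<^sub>R b"] by blast
  from face_of_cone_scale[OF F K this, of "1 / c j"] show ?thesis using j by simp
qed

section \<open>Cones of the fan and their generators\<close>

locale smooth_complete_fan =
  fixes N :: "'a::euclidean_space set" and r :: nat and \<Sigma> :: "'a set set"
  assumes rank: "lattice_of_rank N r" and complete: "complete_fan N \<Sigma>" and nonsingular: "nonsingular_fan N \<Sigma>"
begin

abbreviation "\<M> \<equiv> dual_lattice N"

definition gens :: "'a set => 'a set" where "gens C = ray_generators N \<Sigma> \<inter> C"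

definition max_cones :: "'a set set" where "max_cones = {C \<in> \<Sigma>. card (gens C) = r}"

abbreviation dv :: "'a set => 'a => 'a" where "dv C \<equiv> dual_vector (gens C)"

lemma fan: "fan N \<Sigma>" and union: "\<Union>\<Sigma> = span N"
  using complete by (auto simp: complete_fan_def)

lemma finite_fan: "finite \<Sigma>" using fan by (simp add: fan_def)

lemma face_in_fan: "C \<in> \<Sigma> ==> F face_of C ==> F \<noteq> {} ==> F \<in> \<Sigma>"
  using fan by (auto simp: fan_def)

lemma Int_face: "C \<in> \<Sigma> ==> C' \<in> \<Sigma> ==> (C \<inter> C') face_of C" "C \<in> \<Sigma> ==> C' \<in> \<Sigma> ==> (C \<inter> C') face_of C'"
  using fan by (auto simp: fan_def)

lemma dim_span_N: "dim (span N) = r"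
  using rank unfolding lattice_of_rank_def by (metis lattice_basis_card)

lemma basis_card: "lattice_basis N B ==> card B = r"
  using lattice_basis_card dim_span_N by metis

lemma zero_in_cone: "C \<in> \<Sigma> ==> 0 \<in> C"
  using nonsingular by (auto simp: nonsingular_fan_def convex_cone_hull_contains_0)

lemma Int_in_fan: "C \<in> \<Sigma> ==> C' \<in> \<Sigma> ==> C \<inter> C' \<in> \<Sigma>"
  using Int_face(1)[of C C'] face_in_fan[of C] zero_in_cone by blast

text \<open>Nonsingularity only provides some generating part of a basis. This part is determined by
  the cone: it consists of the primitive ray generators of the fan in it, so that everything can be
  indexed by \<open>gens C\<close>.\<close>

lemma gens_basis:
  assumes C: "C \<in> \<Sigma>"
  obtains B where "lattice_basis N B" "gens C \<subseteq> B" "C = convex_cone hull (gens C)"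
proof -
  obtain B S where B: "lattice_basis N B" "S \<subseteq> B" "C = convex_cone hull S"
    using nonsingular C by (auto simp: nonsingular_fan_def)
  note fB = lattice_basis_finite[OF B(1)] lattice_basis_indep[OF B(1)]
  have fS: "finite S" using fB(1) B(2) finite_subset by blast
  have "gens C = S"
  proof
    show "S \<subseteq> gens C"
    proof
      fix b assume b: "b \<in> S"
      have bB: "b \<in> B" using b B by auto
      have "b \<in> N" using bB lattice_basis_subset[OF B(1)] by auto
      moreover have "b \<noteq> 0" using bB fB(2) dependent_zero by blast
      moreover have "convex_cone hull {b} \<in> \<Sigma>"
        using face_in_fan[OF C, of "convex_cone hull {b}"] cone_face_of[OF fB B(2), of "{b}"] b B(3) by (simp add: convex_cone_hull_nonempty)
      moreover have "t *\<^sub>R b \<notin> N" if "0 < t" "t < 1" for t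
      proof
        assume "t *\<^sub>R b \<in> N"
        then have "dual_vector B b \<bullet> (t *\<^sub>R b) \<in> \<int>" using lattice_basis_mem_iff[OF B(1)] bB by blast
        then have "t \<in> \<int>" using dual_vector_inner[OF fB bB bB] by simp
        then obtain k where "t = of_int k" by (auto elim: Ints_cases)
        then show False using that by simp
      qed
      ultimately show "b \<in> gens C" using b B(3) by (auto simp: gens_def ray_generators_def hull_inc)
    qed
    show "gens C \<subseteq> S"
    proof
      fix d assume d: "d \<in> gens C"
      then have dN: "d \<in> N" "d \<noteq> 0" "convex_cone hull {d} \<in> \<Sigma>" "\<And>t. 0 < t ==> t < 1 ==> t *\<^sub>R d \<notin> N" "d \<in> C"
        by (auto simp: gens_def ray_generators_def)
      have "convex_cone hull {d} \<subseteq> C" using dN(5) unfolding B(3) by (intro hull_minimal) (auto simp: convex_cone_convex_cone_hull)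
      \<comment> \<open>Two cones of a fan meet in a face of both; here the intersection is the ray
        of \<open>d\<close> itself.\<close>
      then have face: "(convex_cone hull {d}) face_of (convex_cone hull S)"
        using Int_face(2)[OF dN(3) C] B(3) by (simp add: Int_absorb2)
      obtain c where c: "d = (\<Sum>b\<in>S. c b *\<^sub>R b)" "\<forall>b\<in>S. 0 \<le> c b" using dN(5) convex_cone_hull_finite[OF fS] B(3) by auto
      obtain b where b: "b \<in> S" "c b \<noteq> 0" using c(1) dN(2) by (metis (no_types, lifting) scale_eq_0_iff sum.neutral)
      have "b \<in> convex_cone hull {d}"
        using c b by (intro face_of_cone_generators[OF face fS, of c b]) (auto simp: hull_inc less_le)
      then obtain t where t: "b = t *\<^sub>R d" "0 \<le> t" by (auto simp: convex_cone_hull_finite)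
      have bB: "b \<in> B" using b B by auto
      have "b \<noteq> 0" using bB fB(2) dependent_zero by blast
      then have t0: "t > 0" using t by auto
      have "dual_vector B b \<bullet> d \<in> \<int>" using lattice_basis_mem_iff[OF B(1)] bB dN(1) by blast
      moreover have "t * (dual_vector B b \<bullet> d) = 1" using dual_vector_inner[OF fB bB bB] t(1) by (metis inner_scaleR_right)
      \<comment> \<open>\<open>t\<close> is the inverse of an integer because \<open>b\<close>
        belongs to a lattice basis, and it is at least 1 because \<open>d\<close> is
        primitive.\<close>
      ultimately obtain k :: int where k: "t * of_int k = 1" by (auto elim: Ints_cases)
      have "k \<ge> 1" using k t0 by (metis int_one_le_iff_zero_less less_numeral_extra(1) of_int_0_less_iff zero_less_mult_pos)
      moreover have "\<not> t < 1" using dN(4)[of t] t0 t(1) bB lattice_basis_subset[OF B(1)] by auto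
      ultimately have "t = 1" using k t0 by (smt (verit) mult_le_cancel_left1 of_int_1_le_iff mult_cancel_left2)
      then show "d \<in> S" using t b by simp
    qed
  qed
  then show ?thesis using B that by blast
qed

lemma gens_props:
  assumes "C \<in> \<Sigma>"
  shows gens_finite: "finite (gens C)" and gens_indep: "independent (gens C)"
    and cone_gens: "convex_cone hull (gens C) = C" and gens_card_le: "card (gens C) \<le> r"
    and gens_subset_N: "gens C \<subseteq> N"
proof -
  obtain B where B: "lattice_basis N B" "gens C \<subseteq> B" "C = convex_cone hull (gens C)" using gens_basis[OF assms] .
  note fB = lattice_basis_finite[OF B(1)] lattice_basis_indep[OF B(1)]
  show "finite (gens C)" "independent (gens C)" "convex_cone hull (gens C) = C" "card (gens C) \<le> r" "gens C \<subseteq> N"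
    using B fB basis_card[OF B(1)] lattice_basis_subset[OF B(1)] by (auto simp: finite_subset independent_mono card_mono)
qed

lemma gens_inj: "C \<in> \<Sigma> ==> C' \<in> \<Sigma> ==> gens C = gens C' ==> C = C'"
  using cone_gens by metis

lemma gens_Int: "gens (C \<inter> C') = gens C \<inter> gens C'" by (auto simp: gens_def)

lemma gens_mono_iff: "C \<in> \<Sigma> ==> C' \<in> \<Sigma> ==> gens C \<subseteq> gens C' \<longleftrightarrow> C \<subseteq> C'"
  using hull_mono[of "gens C" "gens C'" convex_cone] cone_gens by (auto simp: gens_def)

text \<open>The generators are independent, so every set of them spans a face; a further generator
  in that face would be a linear combination of the others.\<close>

lemma subset_gens_cone:
  assumes "C \<in> \<Sigma>" "S \<subseteq> gens C"
  shows "convex_cone hull S \<in> \<Sigma>" "gens (convex_cone hull S) = S"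
proof -
  note g = gens_finite[OF assms(1)] gens_indep[OF assms(1)]
  have f: "(convex_cone hull S) face_of C" using cone_face_of[OF g order_refl assms(2)] cone_gens[OF assms(1)] by simp
  show *: "convex_cone hull S \<in> \<Sigma>" using face_in_fan[OF assms(1) f] by (simp add: convex_cone_hull_nonempty)
  have "S \<subseteq> gens (convex_cone hull S)" using assms by (auto simp: gens_def hull_inc)
  moreover have "gens (convex_cone hull S) \<subseteq> S"
  proof
    fix x assume x: "x \<in> gens (convex_cone hull S)"
    have "gens (convex_cone hull S) \<subseteq> gens C" using face_of_imp_subset[OF f] by (auto simp: gens_def)
    then have xC: "x \<in> gens C" using x by auto
    have "x \<in> convex_cone hull S" using x by (auto simp: gens_def)
    moreover have "finite S" using assms(2) g(1) finite_subset by blast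
    ultimately have "x \<in> span S" by (auto simp: convex_cone_hull_finite intro!: sum_scaleR_in_span)
    show "x \<in> S"
    proof (rule ccontr)
      assume "x \<notin> S"
      then have "S \<subseteq> gens C - {x}" using assms by auto
      then have "x \<in> span (gens C - {x})" using \<open>x \<in> span S\<close> span_mono by blast
      then show False using g(2) xC by (auto simp: dependent_def)
    qed
  qed
  ultimately show "gens (convex_cone hull S) = S" by simp
qed

lemma span_cone: "C \<in> \<Sigma> ==> span C = span (gens C)"
proof -
  assume C: "C \<in> \<Sigma>"
  have "C \<subseteq> span (gens C)"
  proof
    fix x assume "x \<in> C"
    then have "x \<in> convex_cone hull (gens C)" using cone_gens[OF C] by simp
    then show "x \<in> span (gens C)" by (auto simp: convex_cone_hull_finite gens_finite[OF C] intro!: sum_scaleR_in_span)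
  qed
  moreover have "gens C \<subseteq> span C" by (auto simp: gens_def span_base)
  ultimately show ?thesis by (simp add: span_eq)
qed

lemma dim_cone: "C \<in> \<Sigma> ==> dim C = card (gens C)"
  using span_cone[of C] gens_indep[of C] by (metis dim_span dim_eq_card_independent)

lemma max_cone_basis:
  assumes "C \<in> max_cones" shows "lattice_basis N (gens C)"
proof -
  have C: "C \<in> \<Sigma>" "card (gens C) = r" using assms by (auto simp: max_cones_def)
  obtain B where B: "lattice_basis N B" "gens C \<subseteq> B" using gens_basis[OF C(1)] by metis
  then have "gens C = B" using card_subset_eq[of B "gens C"] lattice_basis_finite[OF B(1)] basis_card[OF B(1)] C by simp
  then show ?thesis using B by simp
qed

lemma max_cone_in: "C \<in> max_cones ==> C \<in> \<Sigma>" by (simp add: max_cones_def)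

lemma finite_max_cones: "finite max_cones" using finite_fan by (simp add: max_cones_def)

lemma dv_inner:
  "C \<in> \<Sigma> ==> b \<in> gens C ==> b' \<in> gens C ==> dv C b \<bullet> b' = (if b' = b then 1 else 0)"
  using dual_vector_inner gens_finite gens_indep by blast

lemma max_span: "C \<in> max_cones ==> span (gens C) = span N"
  using lattice_basis_span[OF max_cone_basis] by simp

lemma dual_expand:
  "C \<in> max_cones ==> m \<in> span N ==> m = (\<Sum>b\<in>gens C. (m \<bullet> b) *\<^sub>R dv C b)"
  using dual_vector_expand(2)[of "gens C" m] max_span gens_finite gens_indep max_cone_in by metis

lemma vector_expand:
  "C \<in> max_cones ==> x \<in> span N ==> x = (\<Sum>b\<in>gens C. (dv C b \<bullet> x) *\<^sub>R b)"
  using dual_vector_expand(1)[of "gens C" x] max_span gens_finite gens_indep max_cone_in by metis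

lemma dv_dual: "C \<in> max_cones ==> b \<in> gens C ==> dv C b \<in> \<M>"
  using dual_vector_dual_lattice[OF max_cone_basis] by blast

text \<open>The point is in the relative interior of \<open>C\<close>, so the face that
  \<open>C'\<close> cuts out of \<open>C\<close> contains it only if it is all of
  \<open>C\<close>.\<close>

lemma face_contains_gens:
  assumes "C \<in> \<Sigma>" "C' \<in> \<Sigma>" "(\<Sum>b\<in>gens C. c b *\<^sub>R b) \<in> C'" "\<And>b. b \<in> gens C ==> 0 < c b"
  shows "gens C \<subseteq> gens C'"
proof
  fix b assume b: "b \<in> gens C"
  have f: "(C \<inter> C') face_of (convex_cone hull (gens C))" using Int_face(1)[OF assms(1,2)] cone_gens[OF assms(1)] by simp
  have "(\<Sum>b\<in>gens C. c b *\<^sub>R b) \<in> convex_cone hull (gens C)"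
    using assms(4) by (auto simp: convex_cone_hull_finite gens_finite[OF assms(1)] less_imp_le intro!: exI[of _ c])
  then have "(\<Sum>b\<in>gens C. c b *\<^sub>R b) \<in> C \<inter> C'" using assms(3) cone_gens[OF assms(1)] by simp
  then have "b \<in> C \<inter> C'"
    by (rule face_of_cone_generators[OF f gens_finite[OF assms(1)]]) (use assms(4) b in \<open>auto simp: less_imp_le\<close>)
  then show "b \<in> gens C'" using b by (auto simp: gens_def)
qed

text \<open>Such a \<open>v\<close> lies on no wall of the fan, so none of its coordinates in a
  maximal cone vanishes. These coordinates serve as weights at the fixed points, where they occur as
  denominators, and as the rates of the twist.\<close>

definition generic :: "'a => bool" where
  "generic v \<longleftrightarrow> v \<in> span N \<and> (\<forall>C\<in>\<Sigma>. card (gens C) < r --> v \<notin> span C)"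

text \<open>If the vector found for the other subspaces lies in the new one, it is used as a
  direction: \<open>w + s *\<^sub>R v\<close> with \<open>w\<close> outside the new subspace never
  enters it, and meets each of the others for at most one \<open>s\<close>.\<close>

lemma avoid_subspaces:
  fixes V :: "'b::real_vector set"
  assumes V: "subspace V" and "finite W" "\<And>U. U \<in> W ==> subspace U \<and> \<not> V \<subseteq> U"
  shows "\<exists>v\<in>V. \<forall>U\<in>W. v \<notin> U"
  using assms(2,3)
proof (induction W)
  case empty
  then show ?case using subspace_0[OF V] by auto
next
  case (insert U W)
  then obtain v where v: "v \<in> V" "\<forall>U\<in>W. v \<notin> U" by auto
  show ?case
  proof (cases "v \<in> U")
    case False
    then show ?thesis using v by auto
  next
    case True
    obtain w where w: "w \<in> V" "w \<notin> U" using insert.prems by auto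
    have "\<exists>t. {s::real. w + s *\<^sub>R v \<in> U'} \<subseteq> {t}" if U': "U' \<in> W" for U'
    proof (cases "\<exists>t::real. w + t *\<^sub>R v \<in> U'")
      case True
      then obtain t :: real where t: "w + t *\<^sub>R v \<in> U'" by auto
      have "s = t" if "w + s *\<^sub>R v \<in> U'" for s
      proof (rule ccontr)
        assume "s \<noteq> t"
        have s: "subspace U'" using insert.prems U' by auto
        have "(w + s *\<^sub>R v) - (w + t *\<^sub>R v) \<in> U'" using t that s by (intro subspace_diff)
        then have "(s - t) *\<^sub>R v \<in> U'" by (simp add: algebra_simps)
        then have "(1 / (s - t)) *\<^sub>R (s - t) *\<^sub>R v \<in> U'" by (rule subspace_scale[OF s])
        then show False using v U' \<open>s \<noteq> t\<close> by simp
      qed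
      then show ?thesis by blast
    qed auto
    then have "finite (\<Union>U'\<in>W. {s::real. w + s *\<^sub>R v \<in> U'})"
      using insert.hyps(1) by (auto intro: finite_subset)
    then obtain s :: real where s: "s \<notin> (\<Union>U'\<in>W. {s. w + s *\<^sub>R v \<in> U'})"
      using ex_new_if_finite[OF infinite_UNIV_char_0] by blast
    have "w + s *\<^sub>R v \<notin> U"
    proof
      assume "w + s *\<^sub>R v \<in> U"
      then have "(w + s *\<^sub>R v) - s *\<^sub>R v \<in> U" using True insert.prems by (intro subspace_diff subspace_scale) auto
      then show False using w by simp
    qed
    moreover have "w + s *\<^sub>R v \<in> V" using V v w by (intro subspace_add subspace_scale)
    ultimately show ?thesis using s by auto
  qed
qed

lemma generic_exists: "\<exists>v. generic v"
proof -
  have "\<not> span N \<subseteq> span C" if "C \<in> \<Sigma>" "card (gens C) < r" for C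
  proof
    assume "span N \<subseteq> span C"
    then have "dim (span N) \<le> dim (span C)" by (rule dim_subset)
    then show False using that dim_span_N dim_cone[of C] by simp
  qed
  then have "\<exists>v\<in>span N. \<forall>U\<in>span ` {C\<in>\<Sigma>. card (gens C) < r}. v \<notin> U"
    using finite_fan by (intro avoid_subspaces) auto
  then show ?thesis by (auto simp: generic_def)
qed

lemma generic_minus: "generic v ==> generic (- v)"
  unfolding generic_def using span_neg by fastforce

lemma generic_dv_nonzero:
  assumes v: "generic v" and S: "S \<in> max_cones" and j: "j \<in> gens S"
  shows "dv S j \<bullet> v \<noteq> 0"
proof
  assume 0: "dv S j \<bullet> v = 0"
  have SS: "S \<in> \<Sigma>" using S max_cone_in by simp
  let ?F = "convex_cone hull (gens S - {j})"
  have F: "?F \<in> \<Sigma>" "gens ?F = gens S - {j}" using subset_gens_cone[OF SS, of "gens S - {j}"] by auto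
  have "card (gens S) = r" using S by (simp add: max_cones_def)
  then have "card (gens ?F) < r" using F(2) j gens_finite[OF SS] by (metis card_Diff1_less)
  moreover have "v \<in> span ?F"
  proof -
    have "v = (\<Sum>b\<in>gens S. (dv S b \<bullet> v) *\<^sub>R b)" using v S by (intro vector_expand) (auto simp: generic_def)
    also have "\<dots> = (\<Sum>b\<in>gens S - {j}. (dv S b \<bullet> v) *\<^sub>R b)"
      using gens_finite[OF SS] j 0 by (simp add: sum.remove)
    finally show ?thesis using span_cone[OF F(1)] F(2) by (metis (no_types, lifting) span_sum span_scale span_base)
  qed
  ultimately show False using v F(1) by (auto simp: generic_def)
qed

text \<open>Start at a relative interior point \<open>p\<close> of \<open>C\<close> and move
  slightly in direction \<open>v\<close>. The maximal cone entered is the one described: near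
  \<open>p\<close> the coordinates of the generators of \<open>C\<close> stay positive, and the
  others have the sign given by \<open>v\<close>.\<close>

lemma star_unique:
  assumes C: "C \<in> \<Sigma>" and v: "generic v"
  shows "\<exists>!S. S \<in> max_cones \<and> gens C \<subseteq> gens S \<and> (\<forall>j\<in>gens S - gens C. dv S j \<bullet> v > 0)"
proof -
  define p where "p = (\<Sum>b\<in>gens C. 1 *\<^sub>R b)"
  have vN: "v \<in> span N" using v by (simp add: generic_def)
  have pN: "p \<in> span N" unfolding p_def using gens_subset_N[OF C] by (intro span_sum span_scale span_base) auto
  have up: "dv S j \<bullet> p = (if j \<in> gens C then 1 else 0)" if "S \<in> \<Sigma>" "gens C \<subseteq> gens S" "j \<in> gens S" for S j
  proof -
    have "dv S j \<bullet> p = (\<Sum>b\<in>gens C. if b = j then 1 else 0)"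
      unfolding p_def inner_sum_right by (rule sum.cong) (use that dv_inner in auto)
    then show ?thesis using gens_finite[OF C] by simp
  qed
  have ex: "\<exists>S. S \<in> max_cones \<and> gens C \<subseteq> gens S \<and> (\<forall>j\<in>gens S - gens C. dv S j \<bullet> v > 0)"
  proof -
    define x where "x n = p + (1 / real (Suc n)) *\<^sub>R v" for n
    have "x n \<in> \<Union>\<Sigma>" for n unfolding union x_def using vN pN by (intro span_add span_scale)
    then have "\<forall>n. \<exists>C. C \<in> \<Sigma> \<and> x n \<in> C" by auto
    then obtain f where f: "\<And>n. f n \<in> \<Sigma>" "\<And>n. x n \<in> f n" by metis
    \<comment> \<open>Some cone contains \<open>x n\<close> for infinitely many \<open>n\<close>;
      being closed, it contains the limit \<open>p\<close>.\<close>
    have "finite (range f)" using f(1) finite_fan by (meson finite_subset image_subsetI)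
    then obtain n0 where inf: "infinite {n. f n = f n0}" using pigeonhole_infinite[of UNIV f] by auto
    define S where "S = f n0"
    have S: "S \<in> \<Sigma>" using f by (simp add: S_def)
    have "closed S" using closed_convex_cone_hull[OF gens_finite[OF S]] cone_gens[OF S] by simp
    have pS: "p \<in> S"
    proof (rule ccontr)
      assume "p \<notin> S"
      moreover have "x \<longlonglongrightarrow> p + 0 *\<^sub>R v" unfolding x_def
        by (intro tendsto_intros LIMSEQ_Suc[OF lim_1_over_n, THEN tendsto_eq_rhs]) auto
      ultimately have "\<forall>\<^sub>F n in sequentially. x n \<in> - S"
        using \<open>closed S\<close> by (intro topological_tendstoD) auto
      then obtain n1 where "\<And>n. n \<ge> n1 ==> x n \<notin> S" by (auto simp: eventually_sequentially)
      moreover obtain n where "n \<ge> n1" "f n = S" using inf unfolding infinite_nat_iff_unbounded_le S_def by blast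
      ultimately show False using f(2)[of n] by auto
    qed
    have sub: "gens C \<subseteq> gens S" using face_contains_gens[OF C S, of "\<lambda>_. 1"] pS p_def by simp
    have xS: "x n0 \<in> S" using f(2) by (simp add: S_def)
    have "card (gens S) = r"
    proof (rule ccontr)
      assume "card (gens S) \<noteq> r"
      then have lt: "card (gens S) < r" using gens_card_le[OF S] by simp
      have "v = real (Suc n0) *\<^sub>R (x n0 - p)" by (simp add: x_def)
      also have "\<dots> \<in> span S" using xS pS by (intro span_scale span_diff span_base)
      finally show False using v S lt by (auto simp: generic_def)
    qed
    then have Sm: "S \<in> max_cones" using S by (simp add: max_cones_def)
    have "dv S j \<bullet> v > 0" if j: "j \<in> gens S - gens C" for j
    proof -
      have "0 \<le> dv S j \<bullet> x n0"
        using cone_mem_iff[OF gens_finite[OF S] gens_indep[OF S] order_refl, of "x n0"] xS cone_gens[OF S] j by auto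
      also have "\<dots> = (1 / real (Suc n0)) * (dv S j \<bullet> v)"
        using up[OF S sub, of j] j by (simp add: x_def inner_add_right)
      finally have "dv S j \<bullet> v \<ge> 0" by (simp add: zero_le_divide_iff)
      then show ?thesis using generic_dv_nonzero[OF v Sm, of j] j by auto
    qed
    then show ?thesis using Sm sub by auto
  qed
  have uq: "S = S'" if *: "S \<in> max_cones \<and> gens C \<subseteq> gens S \<and> (\<forall>j\<in>gens S - gens C. dv S j \<bullet> v > 0)"
    "S' \<in> max_cones \<and> gens C \<subseteq> gens S' \<and> (\<forall>j\<in>gens S' - gens C. dv S' j \<bullet> v > 0)" for S S'
  proof -
  define b where "b = Max (insert 0 ((\<lambda>j. \<bar>dv S j \<bullet> v\<bar>) ` gens S \<union> (\<lambda>j. \<bar>dv S' j \<bullet> v\<bar>) ` gens S'))"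
  have SS: "S \<in> \<Sigma>" "S' \<in> \<Sigma>" using * max_cone_in by auto
  have fin: "finite (insert 0 ((\<lambda>j. \<bar>dv S j \<bullet> v\<bar>) ` gens S \<union> (\<lambda>j. \<bar>dv S' j \<bullet> v\<bar>) ` gens S'))"
    using gens_finite SS by simp
  have b0: "b \<ge> 0" unfolding b_def using fin by (intro Max_ge) auto
  have b1: "\<bar>dv S j \<bullet> v\<bar> \<le> b" if "j \<in> gens S" for j unfolding b_def using fin that by (intro Max_ge) auto
  have b2: "\<bar>dv S' j \<bullet> v\<bar> \<le> b" if "j \<in> gens S'" for j unfolding b_def using fin that by (intro Max_ge) auto
  \<comment> \<open>Chosen so that \<open>e * b < 1\<close>: the coordinates of \<open>p\<close>
    equal to 1 stay positive, and \<open>x\<close> is interior to both candidates.\<close>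
  define e where "e = 1 / (2 * (b + 1))"
  have e: "e > 0" "e * b < 1" using b0 by (auto simp: e_def field_simps)
  define x where "x = p + e *\<^sub>R v"
  have pos: "dv T j \<bullet> x > 0"
    if T: "T \<in> max_cones" "gens C \<subseteq> gens T" "\<forall>j\<in>gens T - gens C. dv T j \<bullet> v > 0" "j \<in> gens T" "\<bar>dv T j \<bullet> v\<bar> \<le> b" for T j
  proof (cases "j \<in> gens C")
    case True
    have "dv T j \<bullet> x = 1 + e * (dv T j \<bullet> v)" using up[of T j] T True max_cone_in by (simp add: x_def inner_add_right)
    moreover have "\<bar>e * (dv T j \<bullet> v)\<bar> \<le> e * b" using T(5) e by (simp add: abs_mult)
    ultimately show ?thesis using e by linarith
  next
    case False
    then have "dv T j \<bullet> x = e * (dv T j \<bullet> v)" using up[of T j] T max_cone_in by (simp add: x_def inner_add_right)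
    then show ?thesis using T False e by simp
  qed
  have xN: "x \<in> span N" unfolding x_def using vN pN by (intro span_add span_scale)
  have xT: "x \<in> T" if T: "T \<in> max_cones" "\<And>j. j \<in> gens T ==> dv T j \<bullet> x > 0" for T
    using cone_mem_iff[OF gens_finite[OF max_cone_in[OF T(1)]] gens_indep[OF max_cone_in[OF T(1)]] order_refl, of x] cone_gens[OF max_cone_in[OF T(1)]] T xN max_span[OF T(1)]
    by (auto simp: less_imp_le)
  have "x \<in> S'" using * pos b2 by (intro xT) auto
  have "gens S \<subseteq> gens S'"
    using \<open>x \<in> S'\<close> * pos b1 vector_expand[of S x] xN SS
    by (intro face_contains_gens[of S S' "\<lambda>j. dv S j \<bullet> x"]) auto
  then have "gens S = gens S'" using * gens_finite SS by (intro card_subset_eq) (auto simp: max_cones_def)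
  then show "S = S'" using SS gens_inj by blast
  qed
  show ?thesis using ex uq by metis
qed

lemma max_cone_above: "C \<in> \<Sigma> ==> \<exists>S\<in>max_cones. gens C \<subseteq> gens S"
  using generic_exists star_unique by blast

text \<open>Expanding the products on the right, the cone \<open>C\<close> occurs once for each maximal cone
  containing it on which \<open>v\<close> has positive coordinates outside \<open>C\<close>, that is, exactly once.\<close>

lemma alternating_sum_max_cones:
  fixes h :: "'a => complex"
  assumes v: "generic v"
  shows "(\<Sum>C\<in>\<Sigma>. (-1) ^ (r - card (gens C)) * (\<Prod>j\<in>gens C. h j)) =
    (\<Sum>S\<in>max_cones. \<Prod>j\<in>gens S. (h j - (if dv S j \<bullet> v > 0 then 1 else 0)))"
proof -
  define e where "e S j = (if dv S j \<bullet> v > 0 then -1 else (0::complex))" for S j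
  have "(\<Sum>S\<in>max_cones. \<Prod>j\<in>gens S. (h j - (if dv S j \<bullet> v > 0 then 1 else 0))) =
      (\<Sum>S\<in>max_cones. \<Prod>j\<in>gens S. (h j + e S j))"
    by (intro sum.cong prod.cong) (auto simp: e_def)
  also have "\<dots> = (\<Sum>S\<in>max_cones. \<Sum>B\<in>Pow (gens S). (\<Prod>j\<in>B. h j) * (\<Prod>j\<in>gens S - B. e S j))"
    by (intro sum.cong refl prod_add gens_finite max_cone_in)
  also have "\<dots> = (\<Sum>S\<in>max_cones. \<Sum>C\<in>{C\<in>\<Sigma>. gens C \<subseteq> gens S}. (\<Prod>j\<in>gens C. h j) * (\<Prod>j\<in>gens S - gens C. e S j))"
  proof (rule sum.cong[OF refl])
    fix S assume S: "S \<in> max_cones"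
    show "(\<Sum>B\<in>Pow (gens S). (\<Prod>j\<in>B. h j) * (\<Prod>j\<in>gens S - B. e S j)) =
        (\<Sum>C\<in>{C\<in>\<Sigma>. gens C \<subseteq> gens S}. (\<Prod>j\<in>gens C. h j) * (\<Prod>j\<in>gens S - gens C. e S j))"
    proof -
      have 1: "convex_cone hull B \<in> \<Sigma> \<and> gens (convex_cone hull B) = B" if "B \<subseteq> gens S" for B
        using subset_gens_cone[OF max_cone_in[OF S] that] by simp
      show ?thesis
        by (rule sum.reindex_bij_witness[of _ gens "\<lambda>B. convex_cone hull B"]) (auto simp: 1 cone_gens)
    qed
  qed
  also have "\<dots> = (\<Sum>S\<in>max_cones. \<Sum>C\<in>\<Sigma>. if gens C \<subseteq> gens S then (\<Prod>j\<in>gens C. h j) * (\<Prod>j\<in>gens S - gens C. e S j) else 0)"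
    by (rule sum.cong[OF refl]) (rule sum.inter_filter[OF finite_fan])
  also have "\<dots> = (\<Sum>C\<in>\<Sigma>. \<Sum>S\<in>max_cones. if gens C \<subseteq> gens S then (\<Prod>j\<in>gens C. h j) * (\<Prod>j\<in>gens S - gens C. e S j) else 0)"
    by (rule sum.swap)
  also have "\<dots> = (\<Sum>C\<in>\<Sigma>. (-1) ^ (r - card (gens C)) * (\<Prod>j\<in>gens C. h j))"
  proof (rule sum.cong[OF refl])
    fix C assume C: "C \<in> \<Sigma>"
    obtain S0 where S0: "S0 \<in> max_cones" "gens C \<subseteq> gens S0" "\<forall>j\<in>gens S0 - gens C. dv S0 j \<bullet> v > 0"
      and uq: "\<And>S. S \<in> max_cones ==> gens C \<subseteq> gens S ==> (\<forall>j\<in>gens S - gens C. dv S j \<bullet> v > 0) ==> S = S0"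
      using star_unique[OF C v] by metis
    have "(\<Sum>S\<in>max_cones. if gens C \<subseteq> gens S then (\<Prod>j\<in>gens C. h j) * (\<Prod>j\<in>gens S - gens C. e S j) else 0)
       = (\<Sum>S\<in>{S0}. if gens C \<subseteq> gens S then (\<Prod>j\<in>gens C. h j) * (\<Prod>j\<in>gens S - gens C. e S j) else 0)"
    proof (rule sum.mono_neutral_right)
      show "\<forall>S\<in>max_cones - {S0}. (if gens C \<subseteq> gens S then (\<Prod>j\<in>gens C. h j) * (\<Prod>j\<in>gens S - gens C. e S j) else 0) = 0"
      proof
        fix S assume S: "S \<in> max_cones - {S0}"
        show "(if gens C \<subseteq> gens S then (\<Prod>j\<in>gens C. h j) * (\<Prod>j\<in>gens S - gens C. e S j) else 0) = 0"
        proof (cases "gens C \<subseteq> gens S")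
          case True
          then obtain j where "j \<in> gens S - gens C" "\<not> dv S j \<bullet> v > 0" using uq[of S] S by auto
          then have "e S j = 0" by (simp add: e_def)
          then have "(\<Prod>j\<in>gens S - gens C. e S j) = 0"
            using \<open>j \<in> gens S - gens C\<close> gens_finite[OF max_cone_in, of S] S by (intro prod_zero) auto
          then show ?thesis by simp
        qed simp
      qed
    qed (use S0 finite_max_cones in auto)
    also have "\<dots> = (\<Prod>j\<in>gens C. h j) * (\<Prod>j\<in>gens S0 - gens C. -1)"
      using S0 by (simp add: e_def)
    also have "card (gens S0 - gens C) = r - card (gens C)"
      using S0 gens_finite[OF C] by (simp add: card_Diff_subset max_cones_def)
    then have "(\<Prod>j\<in>gens S0 - gens C. -1 :: complex) = (-1) ^ (r - card (gens C))" by simp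
    finally show "(\<Sum>S\<in>max_cones. if gens C \<subseteq> gens S then (\<Prod>j\<in>gens C. h j) * (\<Prod>j\<in>gens S - gens C. e S j) else 0)
       = (-1) ^ (r - card (gens C)) * (\<Prod>j\<in>gens C. h j)" by simp
  qed
  finally show ?thesis by simp
qed

end

section \<open>Rational functions of cones\<close>

text \<open>A Laurent polynomial acting on an arbitrary formal sum, which may have infinite support
  and is not evaluated itself.\<close>

definition laurent_times :: "('a::euclidean_space => complex) => ('a => complex) => 'a => complex" where
  "laurent_times Q F n = (\<Sum>k | Q k \<noteq> 0. Q k * F (n - k))"

lemma laurent_times_superset: "finite W ==> {k. Q k \<noteq> 0} \<subseteq> W ==> laurent_times Q F n = (\<Sum>k\<in>W. Q k * F (n - k))"
  unfolding laurent_times_def by (rule sum.mono_neutral_left) auto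

abbreviation qpow :: "complex => 'a::euclidean_space => 'a => complex" where
  "qpow q m n \<equiv> q powi \<lfloor>m \<bullet> n\<rfloor>"

lemma laurent_eval_superset:
  "finite W ==> {k. Q k \<noteq> 0} \<subseteq> W ==> laurent_eval q m Q = (\<Sum>k\<in>W. Q k * qpow q m k)"
  unfolding laurent_eval_def by (rule sum.mono_neutral_left) auto

lemma laurent_times_commute: "laurent_times Q (laurent_times Q' F) = laurent_times Q' (laurent_times Q F)"
proof
  fix n
  have "laurent_times Q (laurent_times Q' F) n = (\<Sum>k | Q k \<noteq> 0. \<Sum>l | Q' l \<noteq> 0. Q k * (Q' l * F (n - k - l)))"
    by (simp add: laurent_times_def sum_distrib_left)
  also have "\<dots> = (\<Sum>l | Q' l \<noteq> 0. \<Sum>k | Q k \<noteq> 0. Q k * (Q' l * F (n - k - l)))" by (rule sum.swap)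
  also have "\<dots> = (\<Sum>l | Q' l \<noteq> 0. \<Sum>k | Q k \<noteq> 0. Q' l * (Q k * F (n - l - k)))"
  proof (rule sum.cong[OF refl], rule sum.cong[OF refl])
    fix l k
    have e: "n - k - l = n - l - k" by simp
    show "Q k * (Q' l * F (n - k - l)) = Q' l * (Q k * F (n - l - k))" unfolding e by (rule mult.left_commute)
  qed
  also have "\<dots> = laurent_times Q' (laurent_times Q F) n" by (simp add: laurent_times_def sum_distrib_left)
  finally show "laurent_times Q (laurent_times Q' F) n = laurent_times Q' (laurent_times Q F) n" .
qed

lemma floor_powi_add:
  fixes q :: complex and x y :: real
  shows "q \<noteq> 0 ==> x \<in> \<int> ==> y \<in> \<int> ==> q powi \<lfloor>x + y\<rfloor> = q powi \<lfloor>x\<rfloor> * q powi \<lfloor>y\<rfloor>"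
  by (auto elim!: Ints_cases simp: power_int_add simp flip: of_int_add)

lemma laurent_eval_times:
  assumes Q: "laurent_poly N Q" and P: "laurent_poly N P" and q: "q \<noteq> 0" and m: "\<And>n. n \<in> N ==> m \<bullet> n \<in> \<int>"
  shows "laurent_eval q m (laurent_times Q P) = laurent_eval q m Q * laurent_eval q m P"
proof -
  let ?S = "{k. Q k \<noteq> 0}" and ?R = "{k. P k \<noteq> 0}"
  let ?W = "(\<lambda>(k, l). k + l) ` (?S \<times> ?R)"
  have f: "finite ?S" "finite ?R" "?S \<subseteq> N" "?R \<subseteq> N" using Q P by (auto simp: laurent_poly_def)
  have "{n. laurent_times Q P n \<noteq> 0} \<subseteq> ?W"
  proof
    fix n assume "n \<in> {n. laurent_times Q P n \<noteq> 0}"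
    then obtain k where "Q k \<noteq> 0" "P (n - k) \<noteq> 0" unfolding laurent_times_def mem_Collect_eq by (metis (mono_tags, lifting) mem_Collect_eq mult_zero_right sum.not_neutral_contains_not_neutral)
    then show "n \<in> ?W" by (intro image_eqI[of _ _ "(k, n - k)"]) auto
  qed
  then have "laurent_eval q m (laurent_times Q P) = (\<Sum>n\<in>?W. laurent_times Q P n * qpow q m n)" using f by (intro laurent_eval_superset) auto
  also have "\<dots> = (\<Sum>n\<in>?W. \<Sum>k\<in>?S. Q k * P (n - k) * qpow q m n)" by (simp add: laurent_times_def sum_distrib_right)
  also have "\<dots> = (\<Sum>k\<in>?S. \<Sum>n\<in>?W. Q k * P (n - k) * qpow q m n)" by (rule sum.swap)
  also have "\<dots> = (\<Sum>k\<in>?S. Q k * qpow q m k * laurent_eval q m P)"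
  proof (rule sum.cong[OF refl])
    fix k assume k: "k \<in> ?S"
    have "(\<Sum>n\<in>?W. Q k * P (n - k) * qpow q m n) = (\<Sum>n\<in>(+) k ` ?R. Q k * P (n - k) * qpow q m n)"
    proof (rule sum.mono_neutral_right)
      show "\<forall>n\<in>?W - (+) k ` ?R. Q k * P (n - k) * qpow q m n = 0"
      proof
        fix n assume "n \<in> ?W - (+) k ` ?R"
        then have n: "n \<notin> (+) k ` ?R" by blast
        have "P (n - k) = 0"
        proof (rule ccontr)
          assume "P (n - k) \<noteq> 0"
          then have "n \<in> (+) k ` ?R" by (intro image_eqI[of _ _ "n - k"]) auto
          then show False using n by blast
        qed
        then show "Q k * P (n - k) * qpow q m n = 0" by simp
      qed
      show "(+) k ` ?R \<subseteq> ?W" using k by (auto intro!: image_eqI[of _ _ "(k, _)"])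
    qed (use f in auto)
    also have "\<dots> = (\<Sum>l\<in>?R. Q k * P l * q powi \<lfloor>m \<bullet> (k + l)\<rfloor>)"
      by (subst sum.reindex) (auto simp: o_def)
    also have "\<dots> = (\<Sum>l\<in>?R. Q k * qpow q m k * (P l * qpow q m l))"
    proof (rule sum.cong[OF refl])
      fix l assume "l \<in> ?R"
      then have "q powi \<lfloor>m \<bullet> (k + l)\<rfloor> = qpow q m k * qpow q m l"
        unfolding inner_add_right using f k by (intro floor_powi_add q m) auto
      then show "Q k * P l * q powi \<lfloor>m \<bullet> (k + l)\<rfloor> = Q k * qpow q m k * (P l * qpow q m l)" by simp
    qed
    finally show "(\<Sum>n\<in>?W. Q k * P (n - k) * qpow q m n) = Q k * qpow q m k * laurent_eval q m P"
      by (simp add: laurent_eval_def sum_distrib_left)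
  qed
  finally show ?thesis by (simp add: laurent_eval_def sum_distrib_right)
qed

text \<open>Two fractions P / Q and P' / Q' for the same formal sum satisfy Q P' = Q' P, because the
  actions of Q and Q' commute. Evaluating this identity shows that the definite description has only
  one candidate.\<close>

lemma cone_function_eqI:
  assumes P: "laurent_poly N P" and Q: "laurent_poly N Q" and q: "q \<noteq> 0" and m: "\<And>n. n \<in> N ==> m \<bullet> n \<in> \<int>"
    and PQ: "laurent_times Q (cone_series N dg C) = P" and nz: "laurent_eval q m Q \<noteq> 0"
  shows "cone_function N dg C q m = laurent_eval q m P / laurent_eval q m Q"
  unfolding cone_function_def laurent_times_def[symmetric]
proof (rule the_equality)
  show "\<exists>P' Q'. laurent_poly N P' \<and> laurent_poly N Q' \<and> (\<forall>n. laurent_times Q' (cone_series N dg C) n = P' n) \<and>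
       laurent_eval q m Q' \<noteq> 0 \<and> laurent_eval q m P / laurent_eval q m Q = laurent_eval q m P' / laurent_eval q m Q'"
    using P Q PQ nz by (intro exI[of _ P] exI[of _ Q]) auto
  fix v assume "\<exists>P' Q'. laurent_poly N P' \<and> laurent_poly N Q' \<and> (\<forall>n. laurent_times Q' (cone_series N dg C) n = P' n) \<and>
       laurent_eval q m Q' \<noteq> 0 \<and> v = laurent_eval q m P' / laurent_eval q m Q'"
  then obtain P' Q' where P': "laurent_poly N P'" "laurent_poly N Q'" "\<forall>n. laurent_times Q' (cone_series N dg C) n = P' n"
    "laurent_eval q m Q' \<noteq> 0" "v = laurent_eval q m P' / laurent_eval q m Q'" by blast
  have "laurent_times Q' (cone_series N dg C) = P'" using P'(3) by (intro ext) simp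
  then have "laurent_times Q P' = laurent_times Q' P" using laurent_times_commute[of Q Q' "cone_series N dg C"] PQ by simp
  then have "laurent_eval q m Q * laurent_eval q m P' = laurent_eval q m Q' * laurent_eval q m P"
    using laurent_eval_times[OF Q P'(1) q m] laurent_eval_times[OF P'(2) P q m] by simp
  then show "v = laurent_eval q m P / laurent_eval q m Q" using P' nz by (simp add: frac_eq_eq mult.commute)
qed

definition laurent_one :: "'a::euclidean_space => complex" where "laurent_one n = (if n = 0 then 1 else 0)"

lemma laurent_one_support: "{n. laurent_one n \<noteq> 0} = {0}" by (auto simp: laurent_one_def)

lemma laurent_one_times: "laurent_times laurent_one F = F" by (rule ext) (simp add: laurent_times_def laurent_one_support, simp add: laurent_one_def)

lemma laurent_eval_one: "laurent_eval q m laurent_one = 1" by (simp add: laurent_eval_def laurent_one_support, simp add: laurent_one_def)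

lemma lattice_closed:
  assumes "lattice_basis N B"
  shows "0 \<in> N" "x \<in> N ==> y \<in> N ==> x + y \<in> N" "x \<in> N ==> y \<in> N ==> x - y \<in> N"
  using lattice_basis_mem_iff[OF assms]
  by (auto simp: span_zero span_add span_diff inner_add_right inner_diff_right)

lemma laurent_poly_one: "lattice_basis N B ==> laurent_poly N laurent_one"
  using lattice_closed(1) by (auto simp: laurent_poly_def laurent_one_support)

text \<open>\<open>Q'\<close> is the product of \<open>Q\<close> with the binomial 1 - e x^d. The
  last part moves the binomial from the polynomial to the formal sum.\<close>

lemma multiply_binomial:
  fixes Q :: "'a::euclidean_space => complex" and e :: complex
  assumes B: "lattice_basis N B" and Q: "laurent_poly N Q" and d: "d \<in> N" and q: "q \<noteq> 0" and m: "\<And>n. n \<in> N ==> m \<bullet> n \<in> \<int>"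
  defines "Q' \<equiv> (\<lambda>n. Q n - e * Q (n - d))"
  shows "laurent_poly N Q'" "laurent_eval q m Q' = laurent_eval q m Q * (1 - e * qpow q m d)"
    "laurent_times Q' F n = laurent_times Q (\<lambda>n. F n - e * F (n - d)) n"
proof -
  let ?S = "{k. Q k \<noteq> 0}"
  let ?W = "?S \<union> (\<lambda>k. k + d) ` ?S"
  have f: "finite ?S" "?S \<subseteq> N" using Q by (auto simp: laurent_poly_def)
  have W: "finite ?W" "{k. Q' k \<noteq> 0} \<subseteq> ?W" "?W \<subseteq> N"
  proof -
    show "finite ?W" using f by simp
    show "?W \<subseteq> N" using f d lattice_closed(2)[OF B] by auto
    show "{k. Q' k \<noteq> 0} \<subseteq> ?W"
    proof
      fix k assume "k \<in> {k. Q' k \<noteq> 0}"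
      then have "Q k \<noteq> 0 \<or> Q (k - d) \<noteq> 0" by (auto simp: Q'_def)
      then show "k \<in> ?W" by (auto intro!: image_eqI[of _ _ "k - d"])
    qed
  qed
  then show "laurent_poly N Q'" by (auto simp: laurent_poly_def intro: finite_subset)
  have sh: "(\<Sum>k\<in>?W. Q (k - d) * f k) = (\<Sum>k\<in>?S. Q k * f (k + d))" for f :: "'a => complex"
  proof -
    have "(\<Sum>k\<in>?W. Q (k - d) * f k) = (\<Sum>k\<in>(\<lambda>k. k + d) ` ?S. Q (k - d) * f k)"
    proof (rule sum.mono_neutral_right)
      show "\<forall>i\<in>?W - (\<lambda>k. k + d) ` ?S. Q (i - d) * f i = 0"
      proof
        fix i assume "i \<in> ?W - (\<lambda>k. k + d) ` ?S"
        then have i: "i \<notin> (\<lambda>k. k + d) ` ?S" by blast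
        have "Q (i - d) = 0"
        proof (rule ccontr)
          assume "Q (i - d) \<noteq> 0"
          then have "i \<in> (\<lambda>k. k + d) ` ?S" by (intro image_eqI[of _ _ "i - d"]) auto
          then show False using i by blast
        qed
        then show "Q (i - d) * f i = 0" by simp
      qed
    qed (use W in auto)
    also have "\<dots> = (\<Sum>k\<in>?S. Q k * f (k + d))" by (subst sum.reindex) (auto simp: o_def)
    finally show ?thesis .
  qed
  have S: "(\<Sum>k\<in>?W. Q k * f k) = (\<Sum>k\<in>?S. Q k * f k)" for f :: "'a => complex"
    by (rule sum.mono_neutral_right) (use W in auto)
  have "laurent_eval q m Q' = (\<Sum>k\<in>?W. Q' k * qpow q m k)" by (rule laurent_eval_superset[OF W(1,2)])
  also have "\<dots> = (\<Sum>k\<in>?W. Q k * qpow q m k) - e * (\<Sum>k\<in>?W. Q (k - d) * qpow q m k)"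
    by (simp add: Q'_def left_diff_distrib sum_subtractf sum_distrib_left mult.assoc)
  also have "\<dots> = (\<Sum>k\<in>?S. Q k * qpow q m k) - e * (\<Sum>k\<in>?S. Q k * (qpow q m k * qpow q m d))"
  proof -
    have "(\<Sum>k\<in>?S. Q k * q powi \<lfloor>m \<bullet> (k + d)\<rfloor>) = (\<Sum>k\<in>?S. Q k * (qpow q m k * qpow q m d))"
      unfolding inner_add_right using f d by (intro sum.cong refl arg_cong2[where f="(*)"] floor_powi_add q m) auto
    then show ?thesis by (simp only: S sh)
  qed
  also have "\<dots> = laurent_eval q m Q * (1 - e * qpow q m d)"
  proof -
    have "(\<Sum>k\<in>?S. Q k * (qpow q m k * qpow q m d)) = laurent_eval q m Q * qpow q m d"
      by (simp add: laurent_eval_def sum_distrib_right mult.assoc)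
    moreover have "x - e * (x * y) = x * (1 - e * y)" for x y by (simp add: right_diff_distrib mult_ac)
    ultimately show ?thesis by (simp add: laurent_eval_def)
  qed
  finally show "laurent_eval q m Q' = laurent_eval q m Q * (1 - e * qpow q m d)" .
  have "laurent_times Q' F n = (\<Sum>k\<in>?W. Q' k * F (n - k))" by (rule laurent_times_superset[OF W(1,2)])
  also have "\<dots> = (\<Sum>k\<in>?W. Q k * F (n - k)) - e * (\<Sum>k\<in>?W. Q (k - d) * F (n - k))"
    by (simp add: Q'_def left_diff_distrib sum_subtractf sum_distrib_left mult.assoc)
  also have "\<dots> = (\<Sum>k\<in>?S. Q k * F (n - k)) - e * (\<Sum>k\<in>?S. Q k * F (n - (k + d)))" by (simp only: S sh)
  also have "\<dots> = laurent_times Q (\<lambda>n. F n - e * F (n - d)) n"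
    by (simp add: laurent_times_def right_diff_distrib sum_subtractf sum_distrib_left mult_ac diff_diff_eq)
  finally show "laurent_times Q' F n = laurent_times Q (\<lambda>n. F n - e * F (n - d)) n" .
qed

text \<open>Translation by \<open>d\<close> maps the lattice points of the larger cone onto those
  whose coordinate along \<open>d\<close> is at least 1. By integrality only the points with
  coordinate 0 are left over, and linearity of the degree on \<open>C\<close> makes the coefficients
  match.\<close>

lemma cone_series_insert:
  fixes B :: "'a::euclidean_space set"
  assumes B: "lattice_basis N B" and J: "insert d J \<subseteq> B" "d \<notin> J"
    and C: "convex_cone hull (insert d J) \<subseteq> C" and L: "linear L" "\<And>n. n \<in> C \<inter> N ==> dg n = L n"
  shows "cone_series N dg (convex_cone hull (insert d J)) n - exp (2 * pi * \<i> * dg d) * cone_series N dg (convex_cone hull (insert d J)) (n - d) =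
    cone_series N dg (convex_cone hull J) n"
proof -
  note fB = lattice_basis_finite[OF B] lattice_basis_indep[OF B]
  let ?c = "\<lambda>b x. dual_vector B b \<bullet> x"
  let ?K = "convex_cone hull (insert d J)"
  have dB: "d \<in> B" "J \<subseteq> B" using J by auto
  have mem: "x \<in> ?K \<longleftrightarrow> x \<in> span B \<and> 0 \<le> ?c d x \<and> (\<forall>b\<in>J. 0 \<le> ?c b x) \<and> (\<forall>b\<in>B - insert d J. ?c b x = 0)" for x
    using cone_mem_iff[OF fB J(1)] by auto
  have memJ: "x \<in> convex_cone hull J \<longleftrightarrow> x \<in> span B \<and> ?c d x = 0 \<and> (\<forall>b\<in>J. 0 \<le> ?c b x) \<and> (\<forall>b\<in>B - insert d J. ?c b x = 0)" for x
    using cone_mem_iff[OF fB dB(2)] dB J(2) by auto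
  have cd: "?c b d = (if b = d then 1 else 0)" if "b \<in> B" for b
    using dual_vector_inner[OF fB that dB(1)] by auto
  have dN: "d \<in> N" using lattice_basis_mem_iff[OF B] cd dB span_base by auto
  have dC: "d \<in> C \<inter> N" using C dN hull_inc[of d "insert d J" convex_cone] by auto
  have shift: "?c b (n - d) = ?c b n - (if b = d then 1 else 0)" if "b \<in> B" for b n
    using cd[OF that] by (simp add: inner_diff_right)
  have sp: "n - d \<in> span B \<longleftrightarrow> n \<in> span B" for n
    using span_base[OF dB(1)] by (metis diff_add_cancel span_add span_diff)
  have Nd: "n - d \<in> N \<longleftrightarrow> n \<in> N" for n using lattice_closed[OF B] dN by (metis diff_add_cancel)
  have nd: "n - d \<in> ?K \<longleftrightarrow> n \<in> span B \<and> 1 \<le> ?c d n \<and> (\<forall>b\<in>J. 0 \<le> ?c b n) \<and> (\<forall>b\<in>B - insert d J. ?c b n = 0)" for n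
  proof -
    have "(\<forall>b\<in>J. 0 \<le> ?c b (n - d)) \<longleftrightarrow> (\<forall>b\<in>J. 0 \<le> ?c b n)" 
    proof -
      have "?c b (n - d) = ?c b n" if "b \<in> J" for b using shift[of b] that dB J(2) by auto
      then show ?thesis by simp
    qed
    moreover have "(\<forall>b\<in>B - insert d J. ?c b (n - d) = 0) \<longleftrightarrow> (\<forall>b\<in>B - insert d J. ?c b n = 0)" using shift by (intro ball_cong refl) auto
    moreover have "0 \<le> ?c d (n - d) \<longleftrightarrow> 1 \<le> ?c d n" using shift[OF dB(1)] by auto
    ultimately show ?thesis by (simp only: mem sp)
  qed
  have dich: "?c d n = 0 \<or> 1 \<le> ?c d n" if "n \<in> N" "0 \<le> ?c d n" for n
  proof -
    have "?c d n \<in> \<int>" using lattice_basis_mem_iff[OF B] that dB by auto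
    then show ?thesis using that(2) by (auto elim!: Ints_cases)
  qed
  show ?thesis
  proof (cases "n \<in> N")
    case False
    then show ?thesis using Nd by (simp add: cone_series_def)
  next
    case True
    show ?thesis
    proof (cases "n - d \<in> ?K")
      case K: True
      then have "n \<in> ?K" "n \<notin> convex_cone hull J" using nd mem memJ by auto
      moreover have "dg n = dg d + dg (n - d)"
      proof -
        have "n \<in> C \<inter> N" "n - d \<in> C \<inter> N" using K \<open>n \<in> ?K\<close> C True Nd by auto
        then show ?thesis using L dC linear_add[OF L(1), of d "n - d"] by simp
      qed
      ultimately show ?thesis using K True Nd by (simp add: cone_series_def distrib_left exp_add)
    next
      case K: False
      then have "n \<in> ?K \<longleftrightarrow> n \<in> convex_cone hull J" using nd[of n] mem[of n] memJ[of n] dich[OF True] by auto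
      then show ?thesis using K by (simp add: cone_series_def)
    qed
  qed
qed

context smooth_complete_fan begin

text \<open>Removing the generators one at a time, each at the price of one binomial, reduces the
  series to that of the zero cone, which is 1.\<close>

lemma cone_denominator:
  assumes C: "C \<in> \<Sigma>" and dg: "piecewise_linear N \<Sigma> dg" and q: "q \<noteq> 0" and m: "m \<in> \<M>" and J: "J \<subseteq> gens C"
  shows "\<exists>Q. laurent_poly N Q \<and> laurent_times Q (cone_series N dg (convex_cone hull J)) = laurent_one \<and>
     laurent_eval q m Q = (\<Prod>d\<in>J. 1 - exp (2 * pi * \<i> * dg d) * qpow q m d)"
proof -
  obtain B where B: "lattice_basis N B" "gens C \<subseteq> B" using gens_basis[OF C] by metis
  obtain L where L: "linear L" "\<And>n. n \<in> C \<inter> N ==> dg n = L n" using dg C unfolding piecewise_linear_def by blast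
  have mN: "m \<bullet> n \<in> \<int>" if "n \<in> N" for n using m that by (simp add: dual_lattice_def)
  show ?thesis
    using finite_subset[OF J gens_finite[OF C]] J
  proof (induction J rule: finite_induct)
    case empty
    have "0 \<in> C \<inter> N" using zero_in_cone[OF C] lattice_closed(1)[OF B(1)] by simp
    then have "dg 0 = 0" using L linear_0 by metis
    then have "cone_series N dg (convex_cone hull {}) = laurent_one"
      using lattice_closed(1)[OF B(1)] by (auto simp: cone_series_def laurent_one_def fun_eq_iff)
    then show ?case using laurent_poly_one[OF B(1)] by (intro exI[of _ laurent_one]) (simp add: laurent_one_times laurent_eval_one)
  next
    case (insert d J)
    then obtain Q where Q: "laurent_poly N Q" "laurent_times Q (cone_series N dg (convex_cone hull J)) = laurent_one"
      "laurent_eval q m Q = (\<Prod>d\<in>J. 1 - exp (2 * pi * \<i> * dg d) * qpow q m d)" by auto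
    have dN: "d \<in> N" using insert gens_subset_N[OF C] by auto
    let ?e = "exp (2 * pi * \<i> * dg d)"
    note mb = multiply_binomial[OF B(1) Q(1) dN q mN, where e="?e"]
    have sub: "convex_cone hull (insert d J) \<subseteq> C"
      using hull_mono[OF insert.prems, of convex_cone] cone_gens[OF C] by auto
    have "(\<lambda>n. cone_series N dg (convex_cone hull (insert d J)) n - ?e * cone_series N dg (convex_cone hull (insert d J)) (n - d)) =
      cone_series N dg (convex_cone hull J)"
      using insert.prems B(2) by (intro ext cone_series_insert[OF B(1) _ insert.hyps(2) sub L]) auto
    then have "laurent_times (\<lambda>n. Q n - ?e * Q (n - d)) (cone_series N dg (convex_cone hull (insert d J))) = laurent_one"
      using mb(3) Q(2) by (intro ext) simp
    then show ?case using mb(1,2) Q(3) insert.hyps by (intro exI[of _ "\<lambda>n. Q n - ?e * Q (n - d)"]) (simp add: mult.commute)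
  qed
qed

lemma cone_function_product:
  assumes C: "C \<in> \<Sigma>" and dg: "piecewise_linear N \<Sigma> dg" and q: "q \<noteq> 0" and m: "m \<in> \<M>"
    and nz: "\<And>d. d \<in> gens C ==> 1 - exp (2 * pi * \<i> * dg d) * qpow q m d \<noteq> 0"
  shows "cone_function N dg C q m = (\<Prod>d\<in>gens C. 1 / (1 - exp (2 * pi * \<i> * dg d) * qpow q m d))"
proof -
  obtain Q where Q: "laurent_poly N Q" "laurent_times Q (cone_series N dg C) = laurent_one"
    "laurent_eval q m Q = (\<Prod>d\<in>gens C. 1 - exp (2 * pi * \<i> * dg d) * qpow q m d)"
    using cone_denominator[OF C dg q m order_refl] cone_gens[OF C] by auto
  obtain B where B: "lattice_basis N B" using gens_basis[OF C] by metis
  have "laurent_eval q m Q \<noteq> 0" using nz gens_finite[OF C] unfolding Q(3) by simp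
  then have "cone_function N dg C q m = laurent_eval q m laurent_one / laurent_eval q m Q"
    using m by (intro cone_function_eqI[OF laurent_poly_one[OF B] Q(1) q _ Q(2)]) (simp add: dual_lattice_def)
  then show ?thesis by (simp add: laurent_eval_one Q(3) prod_dividef)
qed

end

section \<open>Topology of the toric variety\<close>

lemma continuous_map_mult:
  fixes f g :: "'b => 'c::real_normed_algebra"
  shows "continuous_map Y euclidean f ==> continuous_map Y euclidean g ==> continuous_map Y euclidean (\<lambda>x. f x * g x)"
  by (simp add: continuous_map_atin tendsto_mult)

lemma continuous_map_power:
  fixes f :: "'b => 'c::real_normed_field"
  shows "continuous_map Y euclidean f ==> continuous_map Y euclidean (\<lambda>x. f x ^ n)"
  by (simp add: continuous_map_atin tendsto_power)

lemma continuous_map_divide: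
  fixes f g :: "'b => 'c::real_normed_field"
  shows "continuous_map Y euclidean f ==> continuous_map Y euclidean g ==> (\<And>x. x \<in> topspace Y ==> g x \<noteq> 0) ==>
    continuous_map Y euclidean (\<lambda>x. f x / g x)"
  by (simp add: continuous_map_atin tendsto_divide)

lemma continuous_map_prod:
  fixes f :: "'i => 'b => 'c::real_normed_field"
  shows "(\<And>i. i \<in> I ==> continuous_map Y euclidean (f i)) ==> continuous_map Y euclidean (\<lambda>x. \<Prod>i\<in>I. f i x)"
  by (simp add: continuous_map_atin tendsto_prod)

lemma dual_lattice_0 [simp]: "0 \<in> dual_lattice N"
  by (simp add: dual_lattice_def span_zero)

lemma dual_lattice_add: "m \<in> dual_lattice N ==> m' \<in> dual_lattice N ==> m + m' \<in> dual_lattice N"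
  by (auto simp: dual_lattice_def span_add inner_add_left)

lemma dual_lattice_diff: "m \<in> dual_lattice N ==> m' \<in> dual_lattice N ==> m - m' \<in> dual_lattice N"
  by (auto simp: dual_lattice_def span_diff inner_diff_left)

lemma dual_lattice_scale: "m \<in> dual_lattice N ==> c \<in> \<int> ==> c *\<^sub>R m \<in> dual_lattice N"
  by (auto simp: dual_lattice_def span_scale)

lemma dual_lattice_sum: "(\<And>i. i \<in> I ==> f i \<in> dual_lattice N) ==> sum f I \<in> dual_lattice N"
  by (induction I rule: infinite_finite_induct) (auto simp: dual_lattice_add)

lemma dual_lattice_Ints: "m \<in> dual_lattice N ==> n \<in> N ==> m \<bullet> n \<in> \<int>"
  by (simp add: dual_lattice_def)

lemma dual_monoid_0 [simp]: "0 \<in> dual_monoid N C"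
  by (simp add: dual_monoid_def)

lemma dual_monoid_add: "m \<in> dual_monoid N C ==> m' \<in> dual_monoid N C ==> m + m' \<in> dual_monoid N C"
  by (auto simp: dual_monoid_def dual_lattice_add inner_add_left)

lemma dual_monoid_scale: "m \<in> dual_monoid N C ==> of_nat k *\<^sub>R m \<in> dual_monoid N C"
  by (auto simp: dual_monoid_def intro!: dual_lattice_scale)

lemma dual_monoid_mono: "F \<subseteq> C ==> dual_monoid N C \<subseteq> dual_monoid N F"
  by (auto simp: dual_monoid_def)

lemma affine_pointsD:
  assumes "x \<in> affine_toric_points N C"
  shows "x 0 = 1" "m \<in> dual_monoid N C ==> m' \<in> dual_monoid N C ==> x (m + m') = x m * x m'"
    "x \<in> extensional (dual_monoid N C)"
  using assms by (auto simp: affine_toric_points_def)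

lemma affine_points_scale:
  assumes "x \<in> affine_toric_points N C" "m \<in> dual_monoid N C"
  shows "x (of_nat k *\<^sub>R m) = x m ^ k"
proof (induction k)
  case (Suc k)
  have "x (of_nat (Suc k) *\<^sub>R m) = x (m + of_nat k *\<^sub>R m)" by (simp add: scaleR_add_left)
  also have "\<dots> = x m * x m ^ k" by (simp add: affine_pointsD(2)[OF assms(1)] assms(2) dual_monoid_scale Suc)
  finally show ?case by simp
qed (simp add: affine_pointsD[OF assms(1)])

lemma affine_points_sum:
  assumes "x \<in> affine_toric_points N C" "\<And>i. i \<in> I ==> f i \<in> dual_monoid N C"
  shows "sum f I \<in> dual_monoid N C \<and> x (sum f I) = (\<Prod>i\<in>I. x (f i))"
  using assms(2)
  by (induction I rule: infinite_finite_induct)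
    (auto simp: affine_pointsD[OF assms(1)] dual_monoid_add)

lemma continuous_map_affine_toric:
  "continuous_map Y (affine_toric N C) f \<longleftrightarrow>
     f \<in> topspace Y \<rightarrow> affine_toric_points N C \<and> (\<forall>m\<in>dual_monoid N C. continuous_map Y euclidean (\<lambda>t. f t m))"
proof -
  have "f \<in> topspace Y \<rightarrow> affine_toric_points N C ==> f \<in> topspace Y \<rightarrow> extensional (dual_monoid N C)"
    by (auto simp: affine_toric_points_def)
  then show ?thesis
    by (auto simp: affine_toric_def continuous_map_in_subtopology continuous_map_componentwise)
qed

lemma continuous_map_affine_coordinate:
  "m \<in> dual_monoid N C ==> continuous_map (affine_toric N C) euclidean (\<lambda>x. x m)"
  using continuous_map_affine_toric[of "affine_toric N C" N C id] by simp

lemma openin_affine_nonzero: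
  "m \<in> dual_monoid N C ==> openin (affine_toric N C) {x \<in> affine_toric_points N C. x m \<noteq> 0}"
proof -
  assume m: "m \<in> dual_monoid N C"
  have "openin euclidean (- {0 :: complex})" by (simp add: open_Compl)
  from openin_continuous_map_preimage[OF continuous_map_affine_coordinate[OF m] this] show ?thesis
    by (simp add: topspace_affine_toric)
qed

context smooth_complete_fan begin

abbreviation "A C \<equiv> affine_toric_points N C"
abbreviation "dm C \<equiv> dual_monoid N C"
abbreviation "X \<equiv> toric_variety N \<Sigma>"
abbreviation "gl \<equiv> glue N \<Sigma>"

lemma dual_monoid_iff: "C \<in> \<Sigma> ==> m \<in> dm C \<longleftrightarrow> m \<in> \<M> \<and> (\<forall>d\<in>gens C. 0 \<le> m \<bullet> d)"
proof -
  assume C: "C \<in> \<Sigma>"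
  have "0 \<le> m \<bullet> n" if "\<forall>d\<in>gens C. 0 \<le> m \<bullet> d" "n \<in> C" for n
  proof -
    have "n \<in> convex_cone hull (gens C)" using that C cone_gens by simp
    then obtain c where "n = (\<Sum>b\<in>gens C. c b *\<^sub>R b)" "\<forall>b\<in>gens C. 0 \<le> c b" by (auto simp: convex_cone_hull_finite gens_finite[OF C])
    then show ?thesis using that by (auto simp: inner_sum_right intro!: sum_nonneg)
  qed
  then show ?thesis by (auto simp: dual_monoid_def gens_def)
qed

lemma dv_dual_monoid: "S \<in> max_cones ==> b \<in> gens S ==> dv S b \<in> dm S"
  using dv_inner[OF max_cone_in] by (auto simp: dual_monoid_iff max_cone_in dv_dual)

text \<open>The character whose nonvanishing cuts the chart of \<open>F\<close> out of the chart of
  \<open>C\<close>: it has order 0 along the generators of \<open>F\<close> and order 1 along the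
  remaining ones of \<open>C\<close>.\<close>

definition loc :: "'a set => 'a set => 'a" where
  "loc C F = (SOME m. m \<in> \<M> \<and> (\<forall>d\<in>gens F. m \<bullet> d = 0) \<and> (\<forall>d\<in>gens C - gens F. m \<bullet> d = 1))"

lemma loc:
  assumes "C \<in> \<Sigma>" "F \<in> \<Sigma>" "F \<subseteq> C"
  shows "loc C F \<in> \<M>" "d \<in> gens F ==> loc C F \<bullet> d = 0" "d \<in> gens C - gens F ==> loc C F \<bullet> d = 1"
    "loc C F \<in> dm C" "loc C F \<in> dm F" "- loc C F \<in> dm F"
proof -
  obtain B where B: "lattice_basis N B" "gens C \<subseteq> B" using gens_basis[OF assms(1)] by metis
  note fB = lattice_basis_finite[OF B(1)] lattice_basis_indep[OF B(1)]
  define m where "m = (\<Sum>b\<in>gens C - gens F. dual_vector B b)"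
  have "m \<in> \<M>" unfolding m_def using B dual_vector_dual_lattice[OF B(1)] by (intro dual_lattice_sum) auto
  moreover have "m \<bullet> d = (if d \<in> gens F then 0 else 1)" if "d \<in> gens C" for d
  proof -
    have "m \<bullet> d = (\<Sum>b\<in>gens C - gens F. if b = d then 1 else 0)"
      unfolding m_def inner_sum_left
    proof (rule sum.cong[OF refl])
      fix b assume "b \<in> gens C - gens F"
      then show "dual_vector B b \<bullet> d = (if b = d then 1 else 0)"
        using dual_vector_inner[OF fB, of b d] that B by (auto simp: subset_iff)
    qed
    then show ?thesis using gens_finite[OF assms(1)] that by simp
  qed
  moreover have sub: "gens F \<subseteq> gens C" using assms(3) by (auto simp: gens_def)
  ultimately have "\<exists>m. m \<in> \<M> \<and> (\<forall>d\<in>gens F. m \<bullet> d = 0) \<and> (\<forall>d\<in>gens C - gens F. m \<bullet> d = 1)"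
    by (intro exI[of _ m]) auto
  from someI_ex[OF this] have *: "loc C F \<in> \<M> \<and> (\<forall>d\<in>gens F. loc C F \<bullet> d = 0) \<and> (\<forall>d\<in>gens C - gens F. loc C F \<bullet> d = 1)"
    unfolding loc_def .
  then show "loc C F \<in> \<M>" "d \<in> gens F ==> loc C F \<bullet> d = 0" "d \<in> gens C - gens F ==> loc C F \<bullet> d = 1" by auto
  show "loc C F \<in> dm C" "loc C F \<in> dm F" using * assms dual_monoid_iff by (auto, metis DiffI order_refl zero_le_one)
  show "- loc C F \<in> dm F" using * assms dual_monoid_iff dual_lattice_scale[of "loc C F" N "-1"] by auto
qed

text \<open>Only generators of \<open>C\<close> outside \<open>F\<close> can make \<open>m\<close>
  negative, and on those each copy of \<open>loc C F\<close> adds 1. The sum of the absolute values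
  bounds all of them at once.\<close>

lemma loc_shift:
  assumes "C \<in> \<Sigma>" "F \<in> \<Sigma>" "F \<subseteq> C" "m \<in> dm F"
  shows "\<exists>k::nat. m + of_nat k *\<^sub>R loc C F \<in> dm C"
proof -
  define k where "k = nat \<lceil>\<Sum>d\<in>gens C. \<bar>m \<bullet> d\<bar>\<rceil>"
  have m: "m \<in> \<M>" using assms by (auto simp: dual_monoid_def)
  have "0 \<le> (m + of_nat k *\<^sub>R loc C F) \<bullet> d" if d: "d \<in> gens C" for d
  proof (cases "d \<in> gens F")
    case True
    then show ?thesis using loc(2)[OF assms(1-3) True] dual_monoid_iff[OF assms(2)] assms(4) by (simp add: inner_add_left)
  next
    case False
    have "\<bar>m \<bullet> d\<bar> \<le> (\<Sum>d\<in>gens C. \<bar>m \<bullet> d\<bar>)" using d gens_finite[OF assms(1)] by (intro member_le_sum) auto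
    also have "\<dots> \<le> of_nat k" unfolding k_def by linarith
    finally show ?thesis using loc(3)[OF assms(1-3), of d] d False by (simp add: inner_add_left)
  qed
  then show ?thesis
    using m loc(1)[OF assms(1-3)] by (auto simp: dual_monoid_iff[OF assms(1)] intro!: exI[of _ k] dual_lattice_add dual_lattice_scale)
qed

definition loc_exp :: "'a set => 'a set => 'a => nat" where
  "loc_exp C F m = (SOME k. m + of_nat k *\<^sub>R loc C F \<in> dm C)"

lemma loc_exp: "C \<in> \<Sigma> ==> F \<in> \<Sigma> ==> F \<subseteq> C ==> m \<in> dm F ==> m + of_nat (loc_exp C F m) *\<^sub>R loc C F \<in> dm C"
  using someI_ex[OF loc_shift] unfolding loc_exp_def by blast

text \<open>Inverse to restricting a point from the chart of \<open>F\<close> to that of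
  \<open>C\<close>: multiplicativity forces the value at \<open>m\<close> to be a quotient by a
  power of the value at \<open>loc C F\<close>.\<close>

definition extend_point :: "'a set => 'a set => ('a => complex) => 'a => complex" where
  "extend_point C F x = (\<lambda>m\<in>dm F. x (m + of_nat (loc_exp C F m) *\<^sub>R loc C F) / x (loc C F) ^ loc_exp C F m)"

lemma restrict_point:
  assumes "F \<subseteq> C" "y \<in> A F" shows "restrict y (dm C) \<in> A C"
  using assms dual_monoid_mono[OF assms(1), of N] unfolding affine_toric_points_def
  by (auto simp: dual_monoid_add subset_iff)

lemma loc_nonzero:
  assumes "C \<in> \<Sigma>" "F \<in> \<Sigma>" "F \<subseteq> C" "y \<in> A F" shows "y (loc C F) \<noteq> 0"
proof -
  have "y (loc C F) * y (- loc C F) = y 0"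
    using affine_pointsD(2)[OF assms(4), of "loc C F" "- loc C F"] loc[OF assms(1-3)] by simp
  then show ?thesis using affine_pointsD(1)[OF assms(4)] by auto
qed

lemma point_loc:
  assumes "C \<in> \<Sigma>" "F \<in> \<Sigma>" "F \<subseteq> C" "y \<in> A F" "m \<in> dm F"
  shows "y m = y (m + of_nat k *\<^sub>R loc C F) / y (loc C F) ^ k"
  using loc_nonzero[OF assms(1-4)] affine_points_scale[OF assms(4), of "loc C F" k] loc(5)[OF assms(1-3)]
    affine_pointsD(2)[OF assms(4,5), of "of_nat k *\<^sub>R loc C F"] by (simp add: dual_monoid_scale)

lemma extend_restrict:
  assumes "C \<in> \<Sigma>" "F \<in> \<Sigma>" "F \<subseteq> C" "y \<in> A F"
  shows "extend_point C F (restrict y (dm C)) = y"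
proof
  fix m show "extend_point C F (restrict y (dm C)) m = y m"
    using loc_exp[OF assms(1-3), of m] point_loc[OF assms, of m "loc_exp C F m"] loc(4)[OF assms(1-3)] affine_pointsD(3)[OF assms(4)]
    by (auto simp: extend_point_def extensional_def)
qed

text \<open>The quotient does not depend on the exponent, as cross multiplication shows. With that
  freedom, multiplicativity is checked with the sum of the exponents of the two characters.\<close>

lemma extend_point:
  assumes "C \<in> \<Sigma>" "F \<in> \<Sigma>" "F \<subseteq> C" "x \<in> A C" "x (loc C F) \<noteq> 0"
  shows "extend_point C F x \<in> A F" "restrict (extend_point C F x) (dm C) = x"
proof -
  let ?m = "loc C F" and ?y = "extend_point C F x"
  have *: "?y m = x (m + of_nat k *\<^sub>R ?m) / x ?m ^ k" if "m \<in> dm F" "m + of_nat k *\<^sub>R ?m \<in> dm C" for m k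
  proof -
    let ?l = "loc_exp C F m"
    have "x (m + of_nat ?l *\<^sub>R ?m) * x ?m ^ k = x ((m + of_nat ?l *\<^sub>R ?m) + of_nat k *\<^sub>R ?m)"
      using affine_pointsD(2)[OF assms(4) loc_exp[OF assms(1-3) that(1)] dual_monoid_scale[OF loc(4)[OF assms(1-3)]]]
        affine_points_scale[OF assms(4) loc(4)[OF assms(1-3)]] by simp
    also have "\<dots> = x ((m + of_nat k *\<^sub>R ?m) + of_nat ?l *\<^sub>R ?m)" by (simp add: add_ac)
    also have "\<dots> = x (m + of_nat k *\<^sub>R ?m) * x ?m ^ ?l"
      using affine_pointsD(2)[OF assms(4) that(2) dual_monoid_scale[OF loc(4)[OF assms(1-3)]]]
        affine_points_scale[OF assms(4) loc(4)[OF assms(1-3)]] by simp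
    finally show ?thesis using assms(5) that by (simp add: extend_point_def frac_eq_eq)
  qed
  have sub: "dm C \<subseteq> dm F" by (rule dual_monoid_mono[OF assms(3)])
  have y0: "?y m = x m" if "m \<in> dm C" for m using *[of m 0] that sub by auto
  have "?y (m + m') = ?y m * ?y m'" if m: "m \<in> dm F" "m' \<in> dm F" for m m'
  proof -
    let ?k = "loc_exp C F m" and ?l = "loc_exp C F m'"
    have e: "(m + m') + of_nat (?k + ?l) *\<^sub>R ?m = (m + of_nat ?k *\<^sub>R ?m) + (m' + of_nat ?l *\<^sub>R ?m)"
      by (simp add: scaleR_add_left)
    have d: "m + of_nat ?k *\<^sub>R ?m \<in> dm C" "m' + of_nat ?l *\<^sub>R ?m \<in> dm C" using loc_exp[OF assms(1-3)] m by auto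
    have "?y (m + m') = x ((m + m') + of_nat (?k + ?l) *\<^sub>R ?m) / x ?m ^ (?k + ?l)"
      using m d by (intro *) (auto simp only: dual_monoid_add e)
    also have "\<dots> = ?y m * ?y m'" unfolding e affine_pointsD(2)[OF assms(4) d] using m by (simp add: extend_point_def power_add)
    finally show ?thesis .
  qed
  then show "?y \<in> A F" using y0[of 0] affine_pointsD(1)[OF assms(4)] by (auto simp: affine_toric_points_def extend_point_def)
  show "restrict ?y (dm C) = x" using y0 affine_pointsD(3)[OF assms(4)] by (auto simp: extensional_def restrict_def fun_eq_iff)
qed

definition glue_rel :: "'a set => ('a => complex) => 'a set => ('a => complex) => bool" where
  "glue_rel C x C' x' \<longleftrightarrow> (\<exists>y\<in>A (C \<inter> C'). restrict y (dm C) = x \<and> restrict y (dm C') = x')"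

lemma glue_rel_sym: "glue_rel C x C' x' ==> glue_rel C' x' C x"
  by (auto simp: glue_rel_def Int_commute)

lemma restrict_restrict_dm: "F \<subseteq> C ==> restrict (restrict y (dm F)) (dm C) = restrict y (dm C)"
  using dual_monoid_mono[of F C N] by (auto simp: restrict_def fun_eq_iff)

text \<open>The point of the middle chart lies over both pairwise intersections and therefore over
  the triple one. From there it restricts to a point of the chart of the intersection of the two
  outer cones.\<close>

lemma glue_rel_trans:
  assumes C: "C \<in> \<Sigma>" "C' \<in> \<Sigma>" "C'' \<in> \<Sigma>" and r1: "glue_rel C x C' x'" and r2: "glue_rel C' x' C'' x''"
  shows "glue_rel C x C'' x''"
proof -
  obtain y where y: "y \<in> A (C \<inter> C')" "restrict y (dm C) = x" "restrict y (dm C') = x'" using r1 by (auto simp: glue_rel_def)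
  obtain w where w: "w \<in> A (C' \<inter> C'')" "restrict w (dm C') = x'" "restrict w (dm C'') = x''" using r2 by (auto simp: glue_rel_def)
  let ?F1 = "C \<inter> C'" and ?F2 = "C' \<inter> C''" and ?G = "C \<inter> C' \<inter> C''"
  have F: "?F1 \<in> \<Sigma>" "?F2 \<in> \<Sigma>" "?G \<in> \<Sigma>" using C Int_in_fan by auto
  have x': "x' \<in> A C'" using restrict_point[of ?F1 C' y] y by auto
  have n1: "x' (loc C' ?F1) \<noteq> 0"
    using loc_nonzero[OF C(2) F(1) _ y(1)] y(3) loc(4)[OF C(2) F(1)] by auto
  have n2: "x' (loc C' ?F2) \<noteq> 0"
    using loc_nonzero[OF C(2) F(2) _ w(1)] w(2) loc(4)[OF C(2) F(2)] by auto
  have G: "?G \<subseteq> C'" "?G \<subseteq> ?F1" "?G \<subseteq> ?F2" by auto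
  let ?m1 = "loc C' ?F1 + loc C' ?F2"
  have l: "loc C' ?F1 \<in> dm C'" "loc C' ?F2 \<in> dm C'" "loc C' ?G \<in> dm C'"
    using loc(4)[OF C(2) F(1)] loc(4)[OF C(2) F(2)] loc(4)[OF C(2) F(3)] by auto
  \<comment> \<open>A generator of \<open>C'\<close> outside the triple intersection is outside one
    of the pairwise ones. So \<open>loc C' ?G\<close> divides \<open>?m1\<close> in the monoid and
    cannot vanish where \<open>?m1\<close> does not.\<close>
  have d: "?m1 - loc C' ?G \<in> dm C'"
    unfolding dual_monoid_iff[OF C(2)]
  proof (intro conjI ballI)
    show "?m1 - loc C' ?G \<in> \<M>" using l by (auto simp: dual_monoid_def intro!: dual_lattice_add dual_lattice_diff)
    fix d assume d: "d \<in> gens C'"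
    have "0 \<le> loc C' ?F1 \<bullet> d" "0 \<le> loc C' ?F2 \<bullet> d" using l d dual_monoid_iff[OF C(2)] by auto
    moreover have "loc C' ?G \<bullet> d = 0 \<or> (loc C' ?G \<bullet> d = 1 \<and> (loc C' ?F1 \<bullet> d = 1 \<or> loc C' ?F2 \<bullet> d = 1))"
      using loc(2,3)[OF C(2) F(3) G(1), of d] loc(3)[OF C(2) F(1), of d] loc(3)[OF C(2) F(2), of d] d by (auto simp: gens_def)
    ultimately show "0 \<le> (?m1 - loc C' ?G) \<bullet> d" by (auto simp: inner_diff_left inner_add_left)
  qed
  have "x' ?m1 \<noteq> 0" using affine_pointsD(2)[OF x' l(1,2)] n1 n2 by simp
  moreover have "x' ?m1 = x' (loc C' ?G) * x' (?m1 - loc C' ?G)" using affine_pointsD(2)[OF x' l(3) d] by simp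
  ultimately have n: "x' (loc C' ?G) \<noteq> 0" by auto
  define y0 where "y0 = extend_point C' ?G x'"
  have y0: "y0 \<in> A ?G" "restrict y0 (dm C') = x'" using extend_point[OF C(2) F(3) G(1) x' n] by (auto simp: y0_def)
  have e1: "restrict y0 (dm ?F1) = y"
  proof -
    have "extend_point C' ?F1 (restrict (restrict y0 (dm ?F1)) (dm C')) = restrict y0 (dm ?F1)"
      using y0 restrict_point[OF G(2)] by (intro extend_restrict C F) auto
    moreover have "extend_point C' ?F1 (restrict y (dm C')) = y" using y by (intro extend_restrict C F) auto
    moreover have "restrict (restrict y0 (dm ?F1)) (dm C') = x'" using restrict_restrict_dm[of ?F1 C' y0] y0 by simp
    ultimately show ?thesis using y(3) by simp
  qed
  have e2: "restrict y0 (dm ?F2) = w"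
  proof -
    have "extend_point C' ?F2 (restrict (restrict y0 (dm ?F2)) (dm C')) = restrict y0 (dm ?F2)"
      using y0 restrict_point[OF G(3)] by (intro extend_restrict C F) auto
    moreover have "extend_point C' ?F2 (restrict w (dm C')) = w" using w by (intro extend_restrict C F) auto
    moreover have "restrict (restrict y0 (dm ?F2)) (dm C') = x'" using restrict_restrict_dm[of ?F2 C' y0] y0 by simp
    ultimately show ?thesis using w(2) by simp
  qed
  have "restrict y0 (dm (C \<inter> C'')) \<in> A (C \<inter> C'')" by (rule restrict_point[OF _ y0(1)]) auto
  moreover have "restrict (restrict y0 (dm (C \<inter> C''))) (dm C) = x"
    using restrict_restrict_dm[of "C \<inter> C''" C y0] restrict_restrict_dm[of ?F1 C y0] e1 y by simp
  moreover have "restrict (restrict y0 (dm (C \<inter> C''))) (dm C'') = x''"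
    using restrict_restrict_dm[of "C \<inter> C''" C'' y0] restrict_restrict_dm[of ?F2 C'' y0] e2 w by simp
  ultimately show ?thesis unfolding glue_rel_def by blast
qed

lemma glue_alt: "gl C x = {(C', x'). C' \<in> \<Sigma> \<and> x' \<in> A C' \<and> glue_rel C x C' x'}"
  by (simp add: glue_def glue_rel_def)

lemma glue_rel_refl: "x \<in> A C ==> glue_rel C x C x"
  by (auto simp: glue_rel_def affine_toric_points_def extensional_restrict)

lemma glue_eq_iff:
  assumes "C \<in> \<Sigma>" "C' \<in> \<Sigma>" "x \<in> A C" "x' \<in> A C'"
  shows "gl C x = gl C' x' \<longleftrightarrow> glue_rel C x C' x'"
proof
  assume "gl C x = gl C' x'"
  moreover have "(C', x') \<in> gl C' x'" using assms glue_rel_refl by (simp add: glue_alt)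
  ultimately show "glue_rel C x C' x'" by (auto simp: glue_alt)
next
  assume r: "glue_rel C x C' x'"
  show "gl C x = gl C' x'"
    unfolding glue_alt using glue_rel_trans[OF assms(1,2) _ r] glue_rel_trans[OF assms(2,1) _ glue_rel_sym[OF r]] by auto
qed

lemma glue_restrict:
  assumes "C \<in> \<Sigma>" "F \<in> \<Sigma>" "F \<subseteq> C" "y \<in> A F"
  shows "gl C (restrict y (dm C)) = gl F y"
proof -
  have "glue_rel C (restrict y (dm C)) F y"
    using assms affine_pointsD(3)[OF assms(4)] unfolding glue_rel_def
    by (auto simp: Int_absorb1 extensional_restrict intro!: bexI[of _ y])
  then show ?thesis using glue_eq_iff assms restrict_point by blast
qed

lemma inj_glue: "C \<in> \<Sigma> ==> inj_on (gl C) (A C)"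
  by (rule inj_onI) (auto simp: glue_eq_iff glue_rel_def affine_toric_points_def extensional_restrict)

section \<open>Charts as open subsets of the glued space\<close>

definition U :: "'a set => 'a toric_point set" where "U C = gl C ` A C"

definition co :: "'a set => 'a toric_point => 'a => complex" where "co C = inv_into (A C) (gl C)"

lemma co_glue [simp]: "C \<in> \<Sigma> ==> x \<in> A C ==> co C (gl C x) = x"
  by (simp add: co_def inj_glue inv_into_f_f)

lemma glue_co [simp]: "p \<in> U C ==> gl C (co C p) = p"
  by (simp add: co_def U_def f_inv_into_f)

lemma co_in: "p \<in> U C ==> co C p \<in> A C"
  unfolding co_def U_def by (rule inv_into_into)

lemma U_Int:
  assumes "C \<in> \<Sigma>" "C' \<in> \<Sigma>" shows "U C \<inter> U C' = U (C \<inter> C')"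
proof
  have F: "C \<inter> C' \<in> \<Sigma>" using assms Int_in_fan by simp
  show "U C \<inter> U C' \<subseteq> U (C \<inter> C')"
  proof
    fix p assume p: "p \<in> U C \<inter> U C'"
    then have "gl C (co C p) = gl C' (co C' p)" by simp
    then have "glue_rel C (co C p) C' (co C' p)" using glue_eq_iff assms co_in p by blast
    then obtain y where y: "y \<in> A (C \<inter> C')" "restrict y (dm C) = co C p" by (auto simp: glue_rel_def)
    then have "p = gl (C \<inter> C') y" using glue_restrict[OF assms(1) F _ y(1)] p by simp
    then show "p \<in> U (C \<inter> C')" using y by (auto simp: U_def)
  qed
  show "U (C \<inter> C') \<subseteq> U C \<inter> U C'"
    using glue_restrict[OF assms(1) F] glue_restrict[OF assms(2) F] restrict_point[of "C \<inter> C'"]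
    by (auto simp: U_def image_iff) (metis inf_le1, metis inf_le2)
qed

lemma U_mono: "C \<in> \<Sigma> ==> F \<in> \<Sigma> ==> F \<subseteq> C ==> U F \<subseteq> U C"
  using U_Int[of C F] by (auto simp: Int_absorb1)

lemma co_face:
  assumes "C \<in> \<Sigma>" "F \<in> \<Sigma>" "F \<subseteq> C" "p \<in> U F" shows "co C p = restrict (co F p) (dm C)"
proof -
  have "gl C (restrict (co F p) (dm C)) = p" using glue_restrict[OF assms(1-3) co_in[OF assms(4)]] assms(4) by simp
  then show ?thesis using co_glue[OF assms(1) restrict_point[OF assms(3) co_in[OF assms(4)]]] by simp
qed

lemma U_face_iff:
  assumes "C \<in> \<Sigma>" "F \<in> \<Sigma>" "F \<subseteq> C" "p \<in> U C"
  shows "p \<in> U F \<longleftrightarrow> co C p (loc C F) \<noteq> 0"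
proof
  assume p: "p \<in> U F"
  show "co C p (loc C F) \<noteq> 0"
    using loc_nonzero[OF assms(1-3) co_in[OF p]] co_face[OF assms(1-3) p] loc(4)[OF assms(1-3)] by simp
next
  assume n: "co C p (loc C F) \<noteq> 0"
  note e = extend_point[OF assms(1-3) co_in[OF assms(4)] n]
  have "gl F (extend_point C F (co C p)) = p" using glue_restrict[OF assms(1-3) e(1)] e(2) assms(4) by simp
  then show "p \<in> U F" using e(1) by (auto simp: U_def)
qed

lemma topspace_X: "topspace X = (\<Union>C\<in>\<Sigma>. U C)"
proof -
  have "openin X (toric_points N \<Sigma>)"
  proof -
    have "{x \<in> A C. gl C x \<in> toric_points N \<Sigma>} = topspace (affine_toric N C)" if "C \<in> \<Sigma>" for C
      using that by (auto simp: topspace_affine_toric toric_points_def)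
    then show ?thesis by (auto simp: openin_toric_variety)
  qed
  moreover have "W \<subseteq> toric_points N \<Sigma>" if "openin X W" for W using that by (simp add: openin_toric_variety)
  ultimately have "topspace X = toric_points N \<Sigma>" by (metis openin_topspace openin_subset subset_antisym)
  then show ?thesis by (simp add: toric_points_def U_def)
qed

lemma continuous_map_glue: "C \<in> \<Sigma> ==> continuous_map (affine_toric N C) X (gl C)"
  by (auto simp: continuous_map_def topspace_affine_toric topspace_X U_def openin_toric_variety)

lemma continuous_map_restrict:
  "F \<subseteq> C ==> continuous_map (affine_toric N F) (affine_toric N C) (\<lambda>y. restrict y (dm C))"
  using dual_monoid_mono[of F C N]
  by (auto simp: continuous_map_affine_toric topspace_affine_toric restrict_point subset_iff intro!: continuous_map_affine_coordinate)

lemma continuous_map_extend: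
  assumes "C \<in> \<Sigma>" "F \<in> \<Sigma>" "F \<subseteq> C"
  shows "continuous_map (subtopology (affine_toric N C) {x. x (loc C F) \<noteq> 0}) (affine_toric N F) (extend_point C F)"
  unfolding continuous_map_affine_toric
proof (intro conjI ballI)
  show "extend_point C F \<in> topspace (subtopology (affine_toric N C) {x. x (loc C F) \<noteq> 0}) \<rightarrow> A F"
    using extend_point(1)[OF assms] by (auto simp: topspace_affine_toric)
  fix m assume m: "m \<in> dm F"
  have "continuous_map (subtopology (affine_toric N C) {x. x (loc C F) \<noteq> 0}) euclidean
     (\<lambda>x. x (m + of_nat (loc_exp C F m) *\<^sub>R loc C F) / x (loc C F) ^ loc_exp C F m)"
    using continuous_map_affine_coordinate[OF loc_exp[OF assms m]] continuous_map_affine_coordinate[OF loc(4)[OF assms]]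
    by (intro continuous_map_divide continuous_map_power continuous_map_from_subtopology) auto
  then show "continuous_map (subtopology (affine_toric N C) {x. x (loc C F) \<noteq> 0}) euclidean (\<lambda>x. extend_point C F x m)"
    using m by (simp add: extend_point_def)
qed

text \<open>Seen from another chart, the image lies in the open set where the character of the
  common face does not vanish, and there it is a preimage under the continuous change of
  charts.\<close>

lemma open_glue:
  assumes C: "C \<in> \<Sigma>" and W: "openin (affine_toric N C) W"
  shows "openin X (gl C ` W)"
  unfolding openin_toric_variety
proof (intro conjI ballI)
  have WA: "W \<subseteq> A C" using openin_subset[OF W] by (simp add: topspace_affine_toric)
  then show "gl C ` W \<subseteq> toric_points N \<Sigma>" using C by (auto simp: toric_points_def)
  fix C' assume C': "C' \<in> \<Sigma>"
  let ?F = "C \<inter> C'"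
  have F: "?F \<in> \<Sigma>" "?F \<subseteq> C" "?F \<subseteq> C'" using Int_in_fan C C' by auto
  let ?V = "{x \<in> A C'. x (loc C' ?F) \<noteq> 0}"
  let ?f = "\<lambda>x. restrict (extend_point C' ?F x) (dm C)"
  have oV: "openin (affine_toric N C') ?V" using openin_affine_nonzero[OF loc(4)[OF C' F(1,3)]] .
  have eqV: "subtopology (affine_toric N C') {x. x (loc C' ?F) \<noteq> 0} = subtopology (affine_toric N C') ?V"
  proof -
    have "?V = topspace (affine_toric N C') \<inter> {x. x (loc C' ?F) \<noteq> 0}" by (auto simp: topspace_affine_toric)
    then show ?thesis by (simp only: subtopology_restrict)
  qed
  have cf: "continuous_map (subtopology (affine_toric N C') ?V) (affine_toric N C) ?f"
    using continuous_map_compose[OF continuous_map_extend[OF C' F(1,3)] continuous_map_restrict[OF F(2)]]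
    by (simp add: o_def eqV)
  have "{x \<in> A C'. gl C' x \<in> gl C ` W} = {x \<in> topspace (subtopology (affine_toric N C') ?V). ?f x \<in> W}"
  proof (rule subset_antisym; rule subsetI)
    fix x assume "x \<in> {x \<in> A C'. gl C' x \<in> gl C ` W}"
    then obtain w where w: "x \<in> A C'" "w \<in> W" "gl C' x = gl C w" by auto
    then have "glue_rel C w C' x" using glue_eq_iff[OF C C', of w x] WA by auto
    then obtain y where y: "y \<in> A ?F" "restrict y (dm C) = w" "restrict y (dm C') = x" by (auto simp: glue_rel_def)
    have "x (loc C' ?F) \<noteq> 0" using loc_nonzero[OF C' F(1,3) y(1)] y(3) loc(4)[OF C' F(1,3)] by auto
    moreover have "extend_point C' ?F x = y" using extend_restrict[OF C' F(1,3) y(1)] y(3) by simp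
    ultimately show "x \<in> {x \<in> topspace (subtopology (affine_toric N C') ?V). ?f x \<in> W}" using w y by (simp add: topspace_affine_toric)
  next
    fix x assume "x \<in> {x \<in> topspace (subtopology (affine_toric N C') ?V). ?f x \<in> W}"
    then have x: "x \<in> A C'" "x (loc C' ?F) \<noteq> 0" "?f x \<in> W" by (auto simp: topspace_affine_toric)
    note e = extend_point[OF C' F(1,3) x(1,2)]
    have "gl C' x = gl ?F (extend_point C' ?F x)" using glue_restrict[OF C' F(1,3) e(1)] e(2) by simp
    also have "\<dots> = gl C (?f x)" using glue_restrict[OF C F(1,2) e(1)] by simp
    finally show "x \<in> {x \<in> A C'. gl C' x \<in> gl C ` W}" using x by auto
  qed
  moreover have "openin (subtopology (affine_toric N C') ?V) {x \<in> topspace (subtopology (affine_toric N C') ?V). ?f x \<in> W}"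
    by (rule openin_continuous_map_preimage[OF cf W])
  ultimately show "openin (affine_toric N C') {x \<in> A C'. gl C' x \<in> gl C ` W}"
    using oV openin_trans_full by fastforce
qed

lemma open_U: "C \<in> \<Sigma> ==> openin X (U C)"
  using open_glue[of C "topspace (affine_toric N C)"] by (metis U_def openin_topspace topspace_affine_toric)

lemma continuous_map_co: "C \<in> \<Sigma> ==> continuous_map (subtopology X (U C)) (affine_toric N C) (co C)"
  unfolding continuous_map_def
proof (intro conjI allI impI)
  assume C: "C \<in> \<Sigma>"
  have top: "topspace (subtopology X (U C)) = U C" using C by (auto simp: topspace_X)
  show "co C \<in> topspace (subtopology X (U C)) \<rightarrow> topspace (affine_toric N C)"
    unfolding top by (simp add: topspace_affine_toric co_in)
  fix W assume W: "openin (affine_toric N C) W"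
  have WA: "W \<subseteq> A C" using openin_subset[OF W] by (simp add: topspace_affine_toric)
  have "{x \<in> U C. co C x \<in> W} = U C \<inter> gl C ` W"
  proof (rule subset_antisym; rule subsetI)
    fix p assume "p \<in> {x \<in> U C. co C x \<in> W}"
    then show "p \<in> U C \<inter> gl C ` W" using glue_co[of p C] by (metis (mono_tags, lifting) IntI imageI mem_Collect_eq)
  next
    fix p assume p: "p \<in> U C \<inter> gl C ` W"
    then obtain w where "w \<in> W" "p = gl C w" by auto
    then show "p \<in> {x \<in> U C. co C x \<in> W}" using p WA C by auto
  qed
  then show "openin (subtopology X (U C)) {x \<in> topspace (subtopology X (U C)). co C x \<in> W}"
    unfolding top using open_glue[OF C W] by (auto simp: openin_subtopology Int_commute)
qed

lemma max_cover: "topspace X = (\<Union>S\<in>max_cones. U S)"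
proof -
  have "U C \<subseteq> (\<Union>S\<in>max_cones. U S)" if C: "C \<in> \<Sigma>" for C
  proof -
    obtain S where "S \<in> max_cones" "gens C \<subseteq> gens S" using max_cone_above[OF C] by auto
    then show ?thesis using U_mono[of S C] gens_mono_iff[of C S] C max_cone_in by auto
  qed
  then show ?thesis using max_cone_in by (auto simp: topspace_X)
qed

text \<open>The divisor is a union over all cones that contain the ray. Membership is carried from
  an arbitrary one of them to the chart of \<open>S\<close> through the common face; in that chart
  the divisor is a coordinate hyperplane.\<close>

lemma divisor_chart:
  assumes S: "S \<in> max_cones" and d: "d \<in> ray_generators N \<Sigma>" and p: "p \<in> U S"
  shows "p \<in> toric_divisor N \<Sigma> d \<longleftrightarrow> d \<in> gens S \<and> co S p (dv S d) = 0"
proof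
  note SS = max_cone_in[OF S]
  assume "p \<in> toric_divisor N \<Sigma> d"
  then obtain C x where C: "C \<in> \<Sigma>" "d \<in> C" and x: "x \<in> A C" "\<forall>m\<in>dm C. m \<bullet> d \<noteq> 0 --> x m = 0" "p = gl C x"
    by (auto simp: toric_divisor_def)
  let ?F = "C \<inter> S"
  have F: "?F \<in> \<Sigma>" "?F \<subseteq> C" "?F \<subseteq> S" using Int_in_fan C SS by auto
  have dC: "d \<in> gens C" using d C by (simp add: gens_def)
  have "p \<in> U C" using x by (auto simp: U_def)
  then have pF: "p \<in> U ?F" using U_Int[OF C(1) SS] p by auto
  have cx: "co C p = x" using x C by simp
  have l: "loc C ?F \<in> dm C" "x (loc C ?F) \<noteq> 0" using loc(4)[OF C(1) F(1,2)] U_face_iff[OF C(1) F(1,2), of p] pF cx \<open>p \<in> U C\<close> by auto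
  \<comment> \<open>Otherwise the localizing character has order 1 along \<open>d\<close> and
    vanishes at the point, although the point lies over the common face.\<close>
  have dF: "d \<in> gens ?F"
  proof (rule ccontr)
    assume "d \<notin> gens ?F"
    then have "loc C ?F \<bullet> d = 1" using loc(3)[OF C(1) F(1,2)] dC by simp
    then show False using x(2) l by auto
  qed
  then have dS: "d \<in> gens S" by (auto simp: gens_def)
  have m: "dv S d \<in> dm ?F" using dv_dual_monoid[OF S dS] dual_monoid_mono[OF F(3)] by auto
  obtain k :: nat where k: "dv S d + of_nat k *\<^sub>R loc C ?F \<in> dm C" using loc_shift[OF C(1) F(1,2) m] by auto
  have "(dv S d + of_nat k *\<^sub>R loc C ?F) \<bullet> d \<noteq> 0"
    using loc(2)[OF C(1) F(1,2) dF] dv_inner[OF SS dS dS] by (simp add: inner_add_left)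
  then have "x (dv S d + of_nat k *\<^sub>R loc C ?F) = 0" using x(2) k by blast
  then have "co ?F p (dv S d + of_nat k *\<^sub>R loc C ?F) = 0"
    using co_face[OF C(1) F(1,2) pF] cx k by auto
  then have "co ?F p (dv S d) = 0" using point_loc[OF C(1) F(1,2) co_in[OF pF] m, of k] by simp
  then show "d \<in> gens S \<and> co S p (dv S d) = 0" using co_face[OF SS F(1,3) pF] dS dv_dual_monoid[OF S dS] by simp
next
  note SS = max_cone_in[OF S]
  assume *: "d \<in> gens S \<and> co S p (dv S d) = 0"
  have "co S p m = 0" if m: "m \<in> dm S" "m \<bullet> d \<noteq> 0" for m
  proof -
    have mM: "m \<in> \<M>" "\<forall>d\<in>gens S. 0 \<le> m \<bullet> d" using m dual_monoid_iff[OF SS] by auto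
    have "m \<bullet> d \<in> \<int>" using dual_lattice_Ints[OF mM(1)] gens_subset_N[OF SS] * by auto
    moreover have "0 < m \<bullet> d" using mM m * by force
    ultimately have "1 \<le> m \<bullet> d" by (auto elim!: Ints_cases)
    \<comment> \<open>The pairing of \<open>m\<close> with \<open>d\<close> is a positive integer,
      so \<open>m\<close> is divisible by the coordinate of \<open>d\<close>.\<close>
    then have "m - dv S d \<in> dm S"
      using mM * dv_inner[OF SS, of d] dv_dual[OF S, of d]
      by (auto simp: dual_monoid_iff[OF SS] dual_lattice_diff inner_diff_left)
    then have "co S p (dv S d + (m - dv S d)) = co S p (dv S d) * co S p (m - dv S d)"
      using affine_pointsD(2)[OF co_in[OF p]] dv_dual_monoid[OF S] * by blast
    then show ?thesis using * by simp
  qed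
  then have "p \<in> gl S ` {x \<in> A S. \<forall>m\<in>dm S. m \<bullet> d \<noteq> 0 --> x m = 0}"
    using co_in[OF p] p by (intro image_eqI[of _ _ "co S p"]) auto
  then show "p \<in> toric_divisor N \<Sigma> d" using SS * by (auto simp: toric_divisor_def gens_def)
qed

definition V :: "'a => 'a toric_point set" where "V d = topspace X - toric_divisor N \<Sigma> d"

lemma V_chart: "S \<in> max_cones ==> d \<in> ray_generators N \<Sigma> ==> p \<in> U S ==>
    p \<in> V d \<longleftrightarrow> (d \<in> gens S --> co S p (dv S d) \<noteq> 0)"
  using divisor_chart[of S d p] by (auto simp: V_def max_cover)

lemma open_V:
  assumes d: "d \<in> ray_generators N \<Sigma>" shows "openin X (V d)"
proof -
  have "V d = (\<Union>S\<in>max_cones. gl S ` {x \<in> A S. d \<in> gens S --> x (dv S d) \<noteq> 0})"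
  proof (rule subset_antisym; rule subsetI)
    fix p assume p: "p \<in> V d"
    then obtain S where S: "S \<in> max_cones" "p \<in> U S" by (auto simp: V_def max_cover)
    then show "p \<in> (\<Union>S\<in>max_cones. gl S ` {x \<in> A S. d \<in> gens S --> x (dv S d) \<noteq> 0})"
      using V_chart[OF S(1) d S(2)] p co_in[OF S(2)] by (auto intro!: bexI[of _ S] image_eqI[of _ _ "co S p"])
  next
    fix p assume "p \<in> (\<Union>S\<in>max_cones. gl S ` {x \<in> A S. d \<in> gens S --> x (dv S d) \<noteq> 0})"
    then obtain S x where S: "S \<in> max_cones" "x \<in> A S" "d \<in> gens S --> x (dv S d) \<noteq> 0" "p = gl S x" by auto
    then have "p \<in> U S" "co S p = x" by (auto simp: U_def max_cone_in)
    then show "p \<in> V d" using V_chart[OF S(1) d] S by simp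
  qed
  moreover have "openin (affine_toric N S) {x \<in> A S. d \<in> gens S --> x (dv S d) \<noteq> 0}" if "S \<in> max_cones" for S
  proof (cases "d \<in> gens S")
    case True
    then show ?thesis using openin_affine_nonzero[OF dv_dual_monoid[OF that True]] by simp
  next
    case False
    then have "{x \<in> A S. d \<in> gens S --> x (dv S d) \<noteq> 0} = topspace (affine_toric N S)" by (simp add: topspace_affine_toric)
    then show ?thesis by simp
  qed
  ultimately show ?thesis using open_glue max_cone_in by (auto intro!: openin_Union)
qed

text \<open>A point outside the union lies on all the divisors, and in a maximal chart around it
  each of them must be a coordinate hyperplane.\<close>

lemma V_common_gens:
  assumes "I \<subseteq> ray_generators N \<Sigma>" "\<not> topspace X \<subseteq> (\<Union>d\<in>I. V d)"
  shows "\<exists>S\<in>max_cones. I \<subseteq> gens S"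
proof -
  obtain p where p: "p \<in> topspace X" "\<And>d. d \<in> I ==> p \<notin> V d" using assms(2) by auto
  obtain S where "S \<in> max_cones" "p \<in> U S" using p by (auto simp: max_cover)
  then show ?thesis using V_chart[of S] p(2) assms(1) by blast
qed

text \<open>The point with coordinates \<open>z b\<close>: a maximal chart is an affine space with
  one coordinate for each generator.\<close>

definition mk :: "'a set => ('a => complex) => 'a => complex" where
  "mk S z = (\<lambda>m\<in>dm S. \<Prod>b\<in>gens S. z b ^ nat \<lfloor>m \<bullet> b\<rfloor>)"

lemma nat_floor_add: "x \<in> \<int> ==> y \<in> \<int> ==> 0 \<le> x ==> 0 \<le> y ==> nat \<lfloor>x + y\<rfloor> = nat \<lfloor>x\<rfloor> + nat \<lfloor>y\<rfloor>" for x y :: real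
  by (auto elim!: Ints_cases simp flip: of_int_add)

lemma mk_in: "S \<in> \<Sigma> ==> mk S z \<in> A S"
proof -
  assume S: "S \<in> \<Sigma>"
  have "nat \<lfloor>(m + m') \<bullet> b\<rfloor> = nat \<lfloor>m \<bullet> b\<rfloor> + nat \<lfloor>m' \<bullet> b\<rfloor>" if "m \<in> dm S" "m' \<in> dm S" "b \<in> gens S" for m m' b
    unfolding inner_add_left using that dual_monoid_iff[OF S] dual_lattice_Ints gens_subset_N[OF S]
    by (intro nat_floor_add) blast+
  then show ?thesis
    by (auto simp: affine_toric_points_def mk_def dual_monoid_add power_add prod.distrib)
qed

lemma mk_coordinate:
  assumes "S \<in> max_cones" "b \<in> gens S" shows "mk S z (dv S b) = z b"
proof -
  have "(\<Prod>b'\<in>gens S. z b' ^ nat \<lfloor>dv S b \<bullet> b'\<rfloor>) = (\<Prod>b'\<in>gens S. if b' = b then z b' else 1)"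
    by (rule prod.cong) (use dv_inner[OF max_cone_in] assms in auto)
  then show ?thesis using assms dv_dual_monoid gens_finite[OF max_cone_in] by (simp add: mk_def)
qed

lemma point_eq_mk:
  assumes S: "S \<in> max_cones" and x: "x \<in> A S" shows "x = mk S (\<lambda>b. x (dv S b))"
proof
  fix m
  show "x m = mk S (\<lambda>b. x (dv S b)) m"
  proof (cases "m \<in> dm S")
    case True
    note SS = max_cone_in[OF S]
    have mM: "m \<in> \<M>" "\<And>d. d \<in> gens S ==> 0 \<le> m \<bullet> d" using True dual_monoid_iff[OF SS] by auto
    have "m = (\<Sum>b\<in>gens S. (m \<bullet> b) *\<^sub>R dv S b)" using dual_expand[OF S] mM by (simp add: dual_lattice_def)
    also have "\<dots> = (\<Sum>b\<in>gens S. of_nat (nat \<lfloor>m \<bullet> b\<rfloor>) *\<^sub>R dv S b)"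
    proof (rule sum.cong[OF refl])
      fix b assume b: "b \<in> gens S"
      have "m \<bullet> b \<in> \<int>" using dual_lattice_Ints[OF mM(1)] gens_subset_N[OF SS] b by auto
      then show "(m \<bullet> b) *\<^sub>R dv S b = of_nat (nat \<lfloor>m \<bullet> b\<rfloor>) *\<^sub>R dv S b" using mM(2)[OF b] by (auto elim!: Ints_cases)
    qed
    finally have e: "m = (\<Sum>b\<in>gens S. of_nat (nat \<lfloor>m \<bullet> b\<rfloor>) *\<^sub>R dv S b)" .
    have "x (\<Sum>b\<in>gens S. of_nat (nat \<lfloor>m \<bullet> b\<rfloor>) *\<^sub>R dv S b) = (\<Prod>b\<in>gens S. x (of_nat (nat \<lfloor>m \<bullet> b\<rfloor>) *\<^sub>R dv S b))"
      using affine_points_sum[OF x, of "gens S" "\<lambda>b. of_nat (nat \<lfloor>m \<bullet> b\<rfloor>) *\<^sub>R dv S b"] dv_dual_monoid[OF S] dual_monoid_scale by blast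
    also have "\<dots> = (\<Prod>b\<in>gens S. x (dv S b) ^ nat \<lfloor>m \<bullet> b\<rfloor>)"
      by (intro prod.cong refl affine_points_scale[OF x] dv_dual_monoid[OF S])
    finally show ?thesis using e True by (simp add: mk_def)
  next
    case False
    then show ?thesis using affine_pointsD(3)[OF x] by (simp add: mk_def extensional_def)
  qed
qed

lemma continuous_map_mk:
  "S \<in> \<Sigma> ==> (\<And>b. b \<in> gens S ==> continuous_map Y euclidean (\<lambda>t. z t b)) ==> continuous_map Y (affine_toric N S) (\<lambda>t. mk S (z t))"
proof -
  assume S: "S \<in> \<Sigma>" and z: "\<And>b. b \<in> gens S ==> continuous_map Y euclidean (\<lambda>t. z t b)"
  have "continuous_map Y euclidean (\<lambda>t. mk S (z t) m)" if "m \<in> dm S" for m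
  proof -
    have "continuous_map Y euclidean (\<lambda>t. \<Prod>b\<in>gens S. z t b ^ nat \<lfloor>m \<bullet> b\<rfloor>)"
      by (intro continuous_map_prod continuous_map_power z)
    then show ?thesis using that by (simp add: mk_def)
  qed
  then show ?thesis using mk_in[OF S] by (simp add: continuous_map_affine_toric)
qed

end

section \<open>Localization at the fixed points\<close>

context smooth_complete_fan begin

text \<open>The restriction of the divisor class of a ray to the fixed point of a maximal cone.\<close>

definition yv :: "'a => 'a set => 'a => real" where
  "yv v S i = (if i \<in> gens S then dv S i \<bullet> v else 0)"

text \<open>The fixed point formula for the intersection number of the divisors in \<open>w\<close>:
  restrictions to the fixed points, divided by the product of the tangent weights.\<close>

definition J :: "'a => 'a list => real" where
  "J v w = (\<Sum>S\<in>max_cones. (\<Prod>i\<leftarrow>w. yv v S i) / (\<Prod>j\<in>gens S. dv S j \<bullet> v))"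

definition rays :: "'a set" where "rays = ray_generators N \<Sigma>"

lemma gens_rays: "gens C \<subseteq> rays" by (auto simp: gens_def rays_def)

lemma rays_union: "rays = (\<Union>S\<in>max_cones. gens S)"
proof
  show "rays \<subseteq> (\<Union>S\<in>max_cones. gens S)"
  proof
    fix d assume d: "d \<in> rays"
    then have "convex_cone hull {d} \<in> \<Sigma>" by (auto simp: rays_def ray_generators_def)
    moreover from this have "d \<in> gens (convex_cone hull {d})" using d by (auto simp: gens_def rays_def hull_inc)
    ultimately show "d \<in> (\<Union>S\<in>max_cones. gens S)" using max_cone_above by blast
  qed
qed (use gens_rays in auto)

lemma finite_rays: "finite rays"
  unfolding rays_union using finite_max_cones gens_finite max_cone_in by auto

text \<open>At every fixed point, the divisor of the character \<open>m\<close> restricts to the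
  same number \<open>m \<bullet> v\<close>. The formula thus satisfies the linear relations only up
  to a value on a shorter word.\<close>

lemma J_relation:
  assumes v: "generic v" and m: "m \<in> \<M>"
  shows "(\<Sum>i\<in>rays. (m \<bullet> i) * J v (w1 @ i # w2)) = (m \<bullet> v) * J v (w1 @ w2)"
proof -
  have "(\<Sum>i\<in>rays. (m \<bullet> i) * yv v S i) = m \<bullet> v" if S: "S \<in> max_cones" for S
  proof -
    have "(\<Sum>i\<in>rays. (m \<bullet> i) * yv v S i) = (\<Sum>i\<in>gens S. (m \<bullet> i) * (dv S i \<bullet> v))"
      by (rule sum.mono_neutral_cong_right) (use finite_rays gens_rays in \<open>auto simp: yv_def\<close>)
    also have "\<dots> = m \<bullet> (\<Sum>i\<in>gens S. (dv S i \<bullet> v) *\<^sub>R i)" by (simp add: inner_sum_right mult.commute)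
    also have "\<dots> = m \<bullet> v" using vector_expand[OF S, of v] v by (simp add: generic_def)
    finally show ?thesis .
  qed
  then have "(\<Sum>S\<in>max_cones. (\<Sum>i\<in>rays. (m \<bullet> i) * yv v S i) * ((\<Prod>i\<leftarrow>w1 @ w2. yv v S i) / (\<Prod>j\<in>gens S. dv S j \<bullet> v)))
     = (m \<bullet> v) * J v (w1 @ w2)" by (simp add: J_def sum_distrib_left)
  moreover have "(\<Sum>i\<in>rays. (m \<bullet> i) * J v (w1 @ i # w2)) =
      (\<Sum>S\<in>max_cones. (\<Sum>i\<in>rays. (m \<bullet> i) * yv v S i) * ((\<Prod>i\<leftarrow>w1 @ w2. yv v S i) / (\<Prod>j\<in>gens S. dv S j \<bullet> v)))"
    unfolding J_def sum_distrib_left sum_distrib_right by (subst sum.swap) (simp add: mult_ac)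
  ultimately show ?thesis by simp
qed

lemma J_non_cone:
  assumes "\<And>S. S \<in> max_cones ==> \<not> set w \<subseteq> gens S" shows "J v w = 0"
proof -
  have "(\<Prod>i\<leftarrow>w. yv v S i) = 0" if "S \<in> max_cones" for S
  proof -
    obtain i where "i \<in> set w" "i \<notin> gens S" using assms[OF \<open>S \<in> max_cones\<close>] by auto
    then show ?thesis by (auto simp: prod_list_zero_iff yv_def image_iff intro: bexI[of _ i])
  qed
  then show ?thesis by (simp add: J_def)
qed

lemma max_cone_unique: "S \<in> max_cones ==> S' \<in> max_cones ==> gens S \<subseteq> gens S' ==> S = S'"
  using card_subset_eq[of "gens S'" "gens S"] by (metis max_cone_in gens_props(1) gens_inj max_cone_basis basis_card)

lemma J_full:
  assumes v: "generic v" and S: "S \<in> max_cones" and w: "distinct w" "set w = gens S"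
  shows "J v w = 1"
proof -
  have "J v w = (\<Sum>S'\<in>{S}. (\<Prod>i\<leftarrow>w. yv v S' i) / (\<Prod>j\<in>gens S'. dv S' j \<bullet> v))"
    unfolding J_def
  proof (rule sum.mono_neutral_right)
    show "\<forall>S'\<in>max_cones - {S}. (\<Prod>i\<leftarrow>w. yv v S' i) / (\<Prod>j\<in>gens S'. dv S' j \<bullet> v) = 0"
    proof
      fix S' assume S': "S' \<in> max_cones - {S}"
      then obtain i where "i \<in> set w" "i \<notin> gens S'" using max_cone_unique[OF S, of S'] w by auto
      then have "(\<Prod>i\<leftarrow>w. yv v S' i) = 0" by (auto simp: prod_list_zero_iff yv_def image_iff intro: bexI[of _ i])
      then show "(\<Prod>i\<leftarrow>w. yv v S' i) / (\<Prod>j\<in>gens S'. dv S' j \<bullet> v) = 0" by simp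
    qed
  qed (use S finite_max_cones in auto)
  also have "\<dots> = (\<Prod>i\<leftarrow>w. yv v S i) / (\<Prod>j\<in>gens S. dv S j \<bullet> v)" by simp
  also have "(\<Prod>i\<leftarrow>w. yv v S i) = (\<Prod>j\<in>gens S. dv S j \<bullet> v)"
    using w by (simp add: prod.distinct_set_conv_list[symmetric] yv_def)
  finally show ?thesis using generic_dv_nonzero[OF v S] gens_finite[OF max_cone_in[OF S]] by simp
qed

lemma cone_of_subset:
  assumes "S \<in> max_cones" "I \<subseteq> gens S"
  obtains C where "C \<in> \<Sigma>" "gens C = I"
  using subset_gens_cone[OF max_cone_in[OF assms(1)] assms(2)] by blast

lemma prod_gens_split:
  assumes S: "S \<in> max_cones" and v: "generic v" and w: "distinct w" "set w \<subseteq> gens S"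
  shows "(\<Prod>i\<leftarrow>w. yv v S i) / (\<Prod>j\<in>gens S. dv S j \<bullet> v) = 1 / (\<Prod>j\<in>gens S - set w. dv S j \<bullet> v)"
proof -
  have "(\<Prod>i\<leftarrow>w. yv v S i) = (\<Prod>i\<in>set w. yv v S i)" by (rule prod.distinct_set_conv_list[OF w(1), symmetric])
  also have "\<dots> = (\<Prod>i\<in>set w. dv S i \<bullet> v)" by (rule prod.cong) (use w in \<open>auto simp: yv_def\<close>)
  finally have 1: "(\<Prod>i\<leftarrow>w. yv v S i) = (\<Prod>i\<in>set w. dv S i \<bullet> v)" .
  have "(\<Prod>j\<in>gens S. dv S j \<bullet> v) = (\<Prod>j\<in>gens S - set w. dv S j \<bullet> v) * (\<Prod>i\<in>set w. dv S i \<bullet> v)"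
    by (rule prod.subset_diff[OF w(2) gens_finite[OF max_cone_in[OF S]]])
  moreover have "(\<Prod>i\<in>set w. dv S i \<bullet> v) \<noteq> 0" using generic_dv_nonzero[OF v S] w by auto
  ultimately show ?thesis by (simp add: 1)
qed

text \<open>Exactly two maximal cones contain a cone of dimension \<open>r - 1\<close>, and the linear forms that
  vanish on it are opposite.\<close>

lemma J_wall:
  assumes v: "generic v" and w: "distinct w" "Suc (length w) = r" and S0: "S0 \<in> max_cones" "set w \<subseteq> gens S0"
  shows "J v w = 0"
proof -
  obtain C where C: "C \<in> \<Sigma>" "gens C = set w" using cone_of_subset[OF S0] by blast
  define T where "T = {S \<in> max_cones. set w \<subseteq> gens S}"
  have cw: "card (set w) = r - 1" using w distinct_card[OF w(1)] by simp
  have one: "\<exists>j. gens S - set w = {j}" if "S \<in> T" for S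
  proof -
    have "card (gens S - set w) = 1" using that cw w by (subst card_Diff_subset) (auto simp: T_def max_cones_def)
    then show ?thesis by (rule card_1_singletonE) auto
  qed
  \<comment> \<open>The directions \<open>v\<close> and \<open>- v\<close> lead from the wall into
    the two maximal cones on its sides.\<close>
  obtain S1 where S1: "S1 \<in> max_cones" "set w \<subseteq> gens S1" "\<forall>j\<in>gens S1 - set w. dv S1 j \<bullet> v > 0"
    and uq1: "\<And>S. S \<in> max_cones ==> set w \<subseteq> gens S ==> \<forall>j\<in>gens S - set w. dv S j \<bullet> v > 0 ==> S = S1"
    using star_unique[OF C(1) v] unfolding C(2) by metis
  obtain S2 where S2: "S2 \<in> max_cones" "set w \<subseteq> gens S2" "\<forall>j\<in>gens S2 - set w. dv S2 j \<bullet> - v > 0"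
    and uq2: "\<And>S. S \<in> max_cones ==> set w \<subseteq> gens S ==> \<forall>j\<in>gens S - set w. dv S j \<bullet> - v > 0 ==> S = S2"
    using star_unique[OF C(1) generic_minus[OF v]] unfolding C(2) by metis
  have T12: "S1 \<in> T" "S2 \<in> T" using S1 S2 by (auto simp: T_def)
  obtain j1 where j1: "gens S1 - set w = {j1}" using one[OF T12(1)] by auto
  obtain j2 where j2: "gens S2 - set w = {j2}" using one[OF T12(2)] by auto
  have p1: "dv S1 j1 \<bullet> v > 0" and p2: "dv S2 j2 \<bullet> v < 0" using S1(3) S2(3) j1 j2 by auto
  have g1: "j1 \<in> gens S1" "j1 \<notin> set w" and g2: "j2 \<in> gens S2" "j2 \<notin> set w" using j1 j2 by auto
  have ne: "S1 \<noteq> S2"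
  proof
    assume "S1 = S2"
    then have "j1 = j2" using j1 j2 by auto
    then show False using p1 p2 \<open>S1 = S2\<close> by simp
  qed
  have "T = {S1, S2}"
  proof -
    have "S = S1 \<or> S = S2" if S: "S \<in> T" for S
    proof -
      obtain j where j: "gens S - set w = {j}" using one[OF S] by auto
      have Sm: "S \<in> max_cones" "set w \<subseteq> gens S" using S by (auto simp: T_def)
      have "dv S j \<bullet> v \<noteq> 0" using generic_dv_nonzero[OF v Sm(1), of j] j by auto
      then consider "dv S j \<bullet> v > 0" | "dv S j \<bullet> - v > 0" by fastforce
      then show ?thesis using uq1[OF Sm] uq2[OF Sm] j by cases auto
    qed
    then show ?thesis using T12 by auto
  qed
  moreover have "J v w = (\<Sum>S\<in>T. (\<Prod>i\<leftarrow>w. yv v S i) / (\<Prod>j\<in>gens S. dv S j \<bullet> v))"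
    unfolding J_def
  proof (rule sum.mono_neutral_right)
    show "\<forall>S\<in>max_cones - T. (\<Prod>i\<leftarrow>w. yv v S i) / (\<Prod>j\<in>gens S. dv S j \<bullet> v) = 0"
    proof
      fix S assume "S \<in> max_cones - T"
      then obtain i where "i \<in> set w" "i \<notin> gens S" by (auto simp: T_def)
      then have "(\<Prod>i\<leftarrow>w. yv v S i) = 0" by (auto simp: prod_list_zero_iff yv_def image_iff intro: bexI[of _ i])
      then show "(\<Prod>i\<leftarrow>w. yv v S i) / (\<Prod>j\<in>gens S. dv S j \<bullet> v) = 0" by simp
    qed
  qed (auto simp: T_def finite_max_cones)
  ultimately have J: "J v w = 1 / (dv S1 j1 \<bullet> v) + 1 / (dv S2 j2 \<bullet> v)"
    using ne prod_gens_split[OF S1(1) v w(1) S1(2)] prod_gens_split[OF S2(1) v w(1) S2(2)] j1 j2 by simp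
  have z1: "dv S1 j1 \<bullet> b = 0" if "b \<in> set w" for b
    using dv_inner[OF max_cone_in[OF S1(1)] g1(1), of b] that S1(2) g1(2) by auto
  have z2: "dv S2 j2 \<bullet> b = 0" if "b \<in> set w" for b
    using dv_inner[OF max_cone_in[OF S2(1)] g2(1), of b] that S2(2) g2(2) by auto
  have ins1: "gens S1 = insert j1 (set w)" using j1 S1(2) by auto
  have ins2: "gens S2 = insert j2 (set w)" using j2 S2(2) by auto
  \<comment> \<open>Both forms vanish on the wall, so one is \<open>k\<close> times the other. Both
    are integral, which makes \<open>k\<close> a unit of the integers, and the signs at
    \<open>v\<close> leave only -1.\<close>
  define k where "k = dv S2 j2 \<bullet> j1"
  have kv: "dv S2 j2 \<bullet> x = k * (dv S1 j1 \<bullet> x)" if x: "x \<in> span N" for x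
  proof -
    have "dv S2 j2 \<bullet> x = (\<Sum>b\<in>gens S1. (dv S1 b \<bullet> x) * (dv S2 j2 \<bullet> b))"
      by (subst vector_expand[OF S1(1) x]) (simp add: inner_sum_right)
    also have "\<dots> = (dv S1 j1 \<bullet> x) * k" using z2 g1 by (simp add: ins1 k_def)
    finally show ?thesis by simp
  qed
  have j2N: "j2 \<in> N" "j1 \<in> N" using g1 g2 gens_subset_N max_cone_in S1 S2 by blast+
  have "k * (dv S1 j1 \<bullet> j2) = 1" using kv[of j2] j2N dv_inner[OF max_cone_in[OF S2(1)] g2(1) g2(1)] by (simp add: span_base)
  moreover have "k \<in> \<int>" "dv S1 j1 \<bullet> j2 \<in> \<int>"
    unfolding k_def using dv_dual[OF S2(1) g2(1)] dv_dual[OF S1(1) g1(1)] j2N by (auto simp: dual_lattice_def)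
  ultimately obtain a b :: int where ab: "k = of_int a" "of_int a * of_int b = (1::real)" by (auto elim!: Ints_cases)
  then have "a * b = 1" by (metis of_int_1 of_int_eq_iff of_int_mult)
  then have "a = 1 \<or> a = -1" by (auto simp: zmult_eq_1_iff)
  moreover have "dv S2 j2 \<bullet> v = k * (dv S1 j1 \<bullet> v)" using kv v by (simp add: generic_def)
  ultimately have "dv S2 j2 \<bullet> v = - (dv S1 j1 \<bullet> v)" using p1 p2 ab(1) by auto
  then show ?thesis using p1 by (simp add: J)
qed

lemma perp_vector:
  assumes S: "S \<in> max_cones" and I: "I \<subset> gens S" and v: "generic v"
  obtains j where "j \<in> gens S - I" "dv S j \<in> \<M>" "\<And>b. b \<in> I ==> dv S j \<bullet> b = 0" "dv S j \<bullet> v \<noteq> 0"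
proof -
  obtain j where j: "j \<in> gens S" "j \<notin> I" using I by auto
  have "dv S j \<bullet> b = 0" if "b \<in> I" for b
    using dv_inner[OF max_cone_in[OF S] j(1), of b] that I j(2) by (metis psubsetD)
  then show ?thesis using that[of j] dv_dual[OF S j(1)] j generic_dv_nonzero[OF v S j(1)] by simp
qed

text \<open>A character that vanishes on the letters of \<open>w\<close> but not at \<open>v\<close>
  turns the relation into a formula for \<open>J v w\<close> by words with one more distinct letter.
  The process ends at words of length r - 1, that is, at walls.\<close>

lemma J_short_distinct:
  assumes v: "generic v"
  shows "distinct w ==> length w < r ==> set w \<subseteq> rays ==> J v w = 0"
proof (induction "r - length w" arbitrary: w rule: less_induct)
  case less
  show ?case
  proof (cases "\<exists>S\<in>max_cones. set w \<subseteq> gens S")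
    case False
    then show ?thesis using J_non_cone by blast
  next
    case True
    then obtain S where S: "S \<in> max_cones" "set w \<subseteq> gens S" by auto
    show ?thesis
    proof (cases "Suc (length w) = r")
      case True
      then show ?thesis using J_wall[OF v less.prems(1) _ S] by simp
    next
      case False
      then have len: "Suc (length w) < r" using less.prems by simp
      have "set w \<noteq> gens S" using S less.prems distinct_card[OF less.prems(1)] by (auto simp: max_cones_def)
      then obtain j where j: "dv S j \<in> \<M>" "\<And>b. b \<in> set w ==> dv S j \<bullet> b = 0" "dv S j \<bullet> v \<noteq> 0"
        using perp_vector[OF S(1) _ v, of "set w"] S by blast
      have "(\<Sum>i\<in>rays. (dv S j \<bullet> i) * J v ([] @ i # w)) = (dv S j \<bullet> v) * J v ([] @ w)"
        by (rule J_relation[OF v j(1)])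
      moreover have "(dv S j \<bullet> i) * J v ([] @ i # w) = 0" if i: "i \<in> rays" for i
      proof (cases "i \<in> set w")
        case False
        then have "J v (i # w) = 0" using less.prems len i by (intro less.hyps) auto
        then show ?thesis by simp
      qed (simp add: j)
      then have "(\<Sum>i\<in>rays. (dv S j \<bullet> i) * J v ([] @ i # w)) = 0" by (rule sum.neutral[OF ballI])
      ultimately show ?thesis using j(3) by simp
    qed
  qed
qed

text \<open>Linear relations remove a repeated letter at the price of enlarging the set of letters.\<close>

lemma word_split:
  assumes "\<not> distinct w" obtains w1 i w2 where "w = w1 @ i # w2" "i \<in> set (w1 @ w2)"
  using assms not_distinct_decomp[of w] by fastforce

text \<open>For a repeated letter \<open>i\<close>, the relation of the coordinate
  \<open>dv S i\<close> isolates \<open>w\<close>: its other letters have coefficient 0, and every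
  new letter increases the number of distinct ones. The length \<open>n\<close> is kept free,
  because the lemma is also applied to words shorter than r.\<close>

lemma word_functional_unique:
  fixes I1 I2 :: "'a list => complex"
  assumes v: "generic v"
    and rel1: "\<And>m w1 w2. m \<in> \<M> ==> set w1 \<subseteq> rays ==> set w2 \<subseteq> rays ==> Suc (length w1 + length w2) = n ==>
       (\<Sum>i\<in>rays. of_real (m \<bullet> i) * I1 (w1 @ i # w2)) = 0"
    and nc: "\<And>w. set w \<subseteq> rays ==> length w = n ==> (\<And>S. S \<in> max_cones ==> \<not> set w \<subseteq> gens S) ==> I1 w = 0"
    and base: "\<And>w S. distinct w ==> length w = n ==> S \<in> max_cones ==> set w \<subseteq> gens S ==> I1 w = 0"
    and n: "n \<le> r" and w: "set w \<subseteq> rays" "length w = n"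
  shows "I1 w = 0"
  using w
proof (induction "n - card (set w)" arbitrary: w rule: less_induct)
  case less
  show ?case
  proof (cases "\<exists>S\<in>max_cones. set w \<subseteq> gens S")
    case False
    then show ?thesis using nc less.prems by blast
  next
    case True
    then obtain S where S: "S \<in> max_cones" "set w \<subseteq> gens S" by auto
    show ?thesis
    proof (cases "distinct w")
      case True
      then show ?thesis using base S less.prems by blast
    next
      case False
      obtain w1 i w2 where w: "w = w1 @ i # w2" "i \<in> set (w1 @ w2)" using word_split[OF False] .
      have iS: "i \<in> gens S" using S w by auto
      note SS = max_cone_in[OF S(1)]
      have lt: "card (set w) < n" using False less.prems card_length[of w] card_distinct[of w] by (cases "card (set w) = length w") auto
      have "(\<Sum>j\<in>rays. of_real (dv S i \<bullet> j) * I1 (w1 @ j # w2)) = 0"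
        using rel1[OF dv_dual[OF S(1) iS], of w1 w2] less.prems w by auto
      moreover have "of_real (dv S i \<bullet> j) * I1 (w1 @ j # w2) = (if j = i then I1 w else 0)" if j: "j \<in> rays" for j
      proof (cases "j \<in> set w")
        case True
        then have "dv S i \<bullet> j = (if j = i then 1 else 0)" using dv_inner[OF SS iS] S by auto
        then show ?thesis using w by simp
      next
        case False
        have "set (w1 @ j # w2) = insert j (set w)" using w by auto
        then have "card (set (w1 @ j # w2)) = Suc (card (set w))" using False by simp
        then have "I1 (w1 @ j # w2) = 0" using less.prems w j lt by (intro less.hyps) auto
        moreover have "j \<noteq> i" using False w by auto
        ultimately show ?thesis by simp
      qed
      moreover have "i \<in> rays" using iS gens_rays by auto
      ultimately show ?thesis using finite_rays by (simp cong: sum.cong)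
    qed
  qed
qed

text \<open>By induction on the length, the error term in \<open>J_relation\<close> vanishes. Then
  \<open>J\<close> satisfies the genuine relations for words of this length, and its values on
  distinct words are known.\<close>

lemma J_short:
  assumes v: "generic v"
  shows "length w < r ==> set w \<subseteq> rays ==> J v w = 0"
proof (induction "length w" arbitrary: w rule: less_induct)
  case less
  have "complex_of_real (J v w) = 0"
  proof (rule word_functional_unique[OF v, where n="length w" and ?I1.0="\<lambda>w. complex_of_real (J v w)"])
    fix m w1 w2 assume m: "m \<in> \<M>" "set w1 \<subseteq> rays" "set w2 \<subseteq> rays" "Suc (length w1 + length w2) = length w"
    have "J v (w1 @ w2) = 0" using m less.prems by (intro less.hyps) auto
    then have "complex_of_real (\<Sum>i\<in>rays. (m \<bullet> i) * J v (w1 @ i # w2)) = 0" using J_relation[OF v m(1), of w1 w2] by simp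
    then show "(\<Sum>i\<in>rays. complex_of_real (m \<bullet> i) * complex_of_real (J v (w1 @ i # w2))) = 0" by simp
  next
    fix w' S assume "distinct w'" "length w' = length w" "S \<in> max_cones" "set w' \<subseteq> gens S"
    then show "complex_of_real (J v w') = 0" using J_short_distinct[OF v, of w'] less.prems gens_rays[of S] by auto
  qed (use less.prems J_non_cone in auto)
  then show ?case by simp
qed

lemma word_functional_eq_J:
  fixes I :: "'a list => complex"
  assumes v: "generic v"
    and rel: "\<And>m w1 w2. m \<in> \<M> ==> set w1 \<subseteq> rays ==> set w2 \<subseteq> rays ==> Suc (length w1 + length w2) = r ==>
       (\<Sum>i\<in>rays. of_real (m \<bullet> i) * I (w1 @ i # w2)) = 0"
    and nc: "\<And>w. set w \<subseteq> rays ==> length w = r ==> (\<And>S. S \<in> max_cones ==> \<not> set w \<subseteq> gens S) ==> I w = 0"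
    and full: "\<And>w S. distinct w ==> S \<in> max_cones ==> set w = gens S ==> I w = 1"
    and w: "set w \<subseteq> rays" "length w = r"
  shows "I w = of_real (J v w)"
proof -
  have "I w - of_real (J v w) = 0"
  proof (rule word_functional_unique[OF v, where n=r and ?I1.0="\<lambda>w. I w - of_real (J v w)"])
    fix m w1 w2 assume m: "m \<in> \<M>" "set w1 \<subseteq> rays" "set w2 \<subseteq> rays" "Suc (length w1 + length w2) = r"
    have "J v (w1 @ w2) = 0" using m by (intro J_short[OF v]) auto
    then have "complex_of_real (\<Sum>i\<in>rays. (m \<bullet> i) * J v (w1 @ i # w2)) = 0" using J_relation[OF v m(1), of w1 w2] by simp
    then show "(\<Sum>i\<in>rays. complex_of_real (m \<bullet> i) * (I (w1 @ i # w2) - of_real (J v (w1 @ i # w2)))) = 0"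
      using rel[OF m] by (simp add: right_diff_distrib sum_subtractf)
  next
    fix w' S assume w': "distinct w'" "length w' = r" "S \<in> max_cones" "set w' \<subseteq> gens S"
    have "set w' = gens S" using w' distinct_card[of w'] by (simp add: card_seteq gens_card_le gens_finite max_cone_in)
    then show "I w' - of_real (J v w') = 0" using full J_full[OF v] w' by simp
  qed (use nc J_non_cone w in auto)
  then show ?thesis by simp
qed

end

section \<open>The theta function\<close>

lemma summable_int_exp:
  assumes "c > 0" shows "(\<lambda>n::int. exp (- c * \<bar>of_int n\<bar> :: real)) summable_on UNIV"
proof -
  have s: "(\<lambda>n::nat. exp (- c * real n)) summable_on UNIV"
  proof (rule norm_summable_imp_summable_on)
    have "(\<lambda>n. exp (- c) ^ n) = (\<lambda>n. norm (exp (- c * real n)))" by (simp add: exp_of_nat_mult[symmetric] mult.commute fun_eq_iff)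
    moreover have "summable (\<lambda>n. exp (- c) ^ n)" using assms by (intro summable_geometric) simp
    ultimately show "summable (\<lambda>n. norm (exp (- c * real n)))" by simp
  qed
  have "(\<lambda>n::int. exp (- c * \<bar>of_int n\<bar> :: real)) summable_on range int"
    using s by (subst summable_on_reindex) (auto simp: o_def)
  moreover have "(\<lambda>n::int. exp (- c * \<bar>of_int n\<bar> :: real)) summable_on range (\<lambda>n. - int n)"
    using s by (subst summable_on_reindex) (auto simp: o_def inj_on_def)
  ultimately have "(\<lambda>n::int. exp (- c * \<bar>of_int n\<bar> :: real)) summable_on (range int \<union> range (\<lambda>n. - int n))"
    by (rule summable_on_union)
  moreover have "range int \<union> range (\<lambda>n. - int n) = UNIV"
  proof -
    have "n \<in> range int \<union> range (\<lambda>n. - int n)" for n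
      by (cases "n \<ge> 0") (auto simp: image_iff intro: exI[of _ "nat n"] exI[of _ "nat (- n)"])
    then show ?thesis by auto
  qed
  ultimately show ?thesis by simp
qed

lemma abs_summable_int_exp:
  fixes f :: "int => complex"
  assumes "c > 0" "\<And>n. norm (f n) \<le> K * exp (- c * \<bar>of_int n\<bar>)"
  shows "(\<lambda>n. norm (f n)) summable_on UNIV"
proof (rule summable_on_comparison_test[of "\<lambda>n. K * exp (- c * \<bar>of_int n\<bar>)"])
  show "(\<lambda>n::int. K * exp (- c * \<bar>of_int n\<bar>)) summable_on UNIV"
    by (intro summable_on_cmult_right summable_int_exp assms)
qed (use assms in auto)

text \<open>Completing the square; the constant comes from the vertex of the parabola. A Gaussian
  with a linear perturbation is thus reduced to a geometric series.\<close>

lemma gauss_bound: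
  fixes x a b :: real
  assumes "b > 0" shows "exp (- b * x\<^sup>2 + a * \<bar>x\<bar>) \<le> exp ((a + 1)\<^sup>2 / (4 * b)) * exp (- \<bar>x\<bar>)"
proof -
  have "0 \<le> (2 * b * \<bar>x\<bar> - (a + 1))\<^sup>2" by simp
  also have "\<dots> = (4 * b) * (b * x\<^sup>2 - (a + 1) * \<bar>x\<bar> + (a + 1)\<^sup>2 / (4 * b))"
  proof -
    have "x\<^sup>2 = \<bar>x\<bar>\<^sup>2" by simp
    then show ?thesis using assms by (simp only:) (simp add: power2_eq_square field_simps)
  qed
  finally have "0 \<le> b * x\<^sup>2 - (a + 1) * \<bar>x\<bar> + (a + 1)\<^sup>2 / (4 * b)" using assms by (simp add: zero_le_mult_iff)
  then show ?thesis by (simp add: algebra_simps flip: exp_add)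
qed

lemma abs_summable_gauss:
  fixes f :: "int => complex"
  assumes "b > 0" "K \<ge> 0" "\<And>n. norm (f n) \<le> K * exp (- b * (of_int n + s)\<^sup>2 + a * \<bar>of_int n + s\<bar>)"
  shows "(\<lambda>n. norm (f n)) summable_on UNIV"
proof (rule abs_summable_int_exp[of 1 _ "K * exp ((a + 1)\<^sup>2 / (4 * b)) * exp \<bar>s\<bar>"])
  fix n
  have "norm (f n) \<le> K * exp (- b * (of_int n + s)\<^sup>2 + a * \<bar>of_int n + s\<bar>)" by (rule assms)
  also have "\<dots> \<le> K * (exp ((a + 1)\<^sup>2 / (4 * b)) * exp (- \<bar>of_int n + s\<bar>))"
    by (intro mult_left_mono gauss_bound assms)
  also have "\<dots> \<le> K * (exp ((a + 1)\<^sup>2 / (4 * b)) * (exp \<bar>s\<bar> * exp (- 1 * \<bar>of_int n\<bar>)))"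
    unfolding exp_add[symmetric] using assms(2) by (intro mult_left_mono) auto
  finally show "norm (f n) \<le> K * exp ((a + 1)\<^sup>2 / (4 * b)) * exp \<bar>s\<bar> * exp (- 1 * \<bar>of_int n\<bar>)" by (simp add: mult.assoc)
qed simp

lemma continuous_on_infsum:
  fixes f :: "'i => 'b::topological_space => complex"
  assumes "\<And>i. continuous_on A (f i)" "\<And>i y. y \<in> A ==> norm (f i y) \<le> M i" "M summable_on UNIV"
  shows "continuous_on A (\<lambda>y. \<Sum>\<^sub>\<infinity>i. f i y)"
proof (rule uniform_limit_theorem)
  show "uniform_limit A (\<lambda>X y. \<Sum>x\<in>X. f x y) (\<lambda>y. \<Sum>\<^sub>\<infinity>x. f x y) (finite_subsets_at_top UNIV)"
    by (rule Weierstrass_m_test_general[where M=M]) (use assms in auto)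
  show "\<forall>\<^sub>F X in finite_subsets_at_top UNIV. continuous_on A (\<lambda>y. \<Sum>x\<in>X. f x y)"
    by (intro always_eventually allI continuous_on_sum assms)
qed simp

definition theta_coeff :: "complex => int => complex" where
  "theta_coeff \<tau> n = exp (pi * \<i> * \<tau> * (of_int n + 1 / 2)\<^sup>2)"

definition theta_term :: "complex => complex => int => complex" where
  "theta_term z \<tau> n = (-1) powi n * theta_coeff \<tau> n * exp (pi * \<i> * z * (2 * of_int n + 1))"

lemma theta_altdef: "theta z \<tau> = - \<i> * (\<Sum>\<^sub>\<infinity>n. theta_term z \<tau> n)"
  by (simp add: theta_def theta_term_def theta_coeff_def)

lemma norm_powi_minus_one [simp]: "norm ((-1 :: complex) powi n) = 1"
  by (simp add: norm_power_int)

lemma norm_theta_coeff: "norm (theta_coeff \<tau> n) = exp (- (pi * Im \<tau>) * (of_int n + 1 / 2)\<^sup>2)"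
proof -
  have "(of_int n + 1 / 2 :: complex)\<^sup>2 = of_real ((of_int n + 1 / 2)\<^sup>2)" by simp
  then have "Re (pi * \<i> * \<tau> * (of_int n + 1 / 2)\<^sup>2) = - (pi * Im \<tau>) * (of_int n + 1 / 2)\<^sup>2"
    by (simp only: Re_complex_of_real Im_complex_of_real times_complex.sel) simp
  then show ?thesis by (simp add: theta_coeff_def)
qed

lemma theta_term_summable:
  assumes "Im \<tau> > 0" shows "(\<lambda>n. norm (theta_term z \<tau> n)) summable_on UNIV"
proof (rule abs_summable_gauss[where b="pi * Im \<tau>" and K=1 and s="1/2" and a="2 * pi * \<bar>Im z\<bar>"])
  fix n
  have "norm (exp (pi * \<i> * z * (2 * of_int n + 1))) = exp (- 2 * pi * Im z * (of_int n + 1 / 2))"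
    by (simp add: algebra_simps)
  also have "\<dots> \<le> exp (2 * pi * \<bar>Im z\<bar> * \<bar>of_int n + 1 / 2\<bar>)"
  proof -
    have "- Im z * (of_int n + 1 / 2) \<le> \<bar>Im z\<bar> * \<bar>of_int n + 1 / 2\<bar>"
      by (metis abs_ge_self abs_minus_cancel abs_mult)
    then have "pi * (- Im z * (of_int n + 1 / 2)) \<le> pi * (\<bar>Im z\<bar> * \<bar>of_int n + 1 / 2\<bar>)" by (rule mult_left_mono) simp
    then show ?thesis by (simp add: algebra_simps)
  qed
  finally have "exp (- (pi * Im \<tau>) * (of_int n + 1 / 2)\<^sup>2) * norm (exp (pi * \<i> * z * (2 * of_int n + 1)))
     \<le> exp (- (pi * Im \<tau>) * (of_int n + 1 / 2)\<^sup>2) * exp (2 * pi * \<bar>Im z\<bar> * \<bar>of_int n + 1 / 2\<bar>)"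
    by (rule mult_left_mono) simp
  moreover have "norm (theta_term z \<tau> n) = exp (- (pi * Im \<tau>) * (of_int n + 1 / 2)\<^sup>2) * norm (exp (pi * \<i> * z * (2 * of_int n + 1)))"
    unfolding theta_term_def norm_mult norm_theta_coeff norm_powi_minus_one by (simp only: mult_1_left)
  ultimately show "norm (theta_term z \<tau> n) \<le> 1 * exp (- (pi * Im \<tau>) * (of_int n + 1 / 2)\<^sup>2 + 2 * pi * \<bar>Im z\<bar> * \<bar>of_int n + 1 / 2\<bar>)"
    by (simp only: mult_1_left exp_add)
qed (use assms in auto)

lemma norm_odd: "norm (2 * of_nat n + 1 :: complex) = 2 * real n + 1"
proof -
  have "2 * of_nat n + 1 = (of_nat (2 * n + 1) :: complex)" by simp
  then show ?thesis by (metis norm_of_nat of_nat_1 of_nat_add of_nat_mult of_nat_numeral)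
qed

text \<open>The pairing of n with - n - 1 is the symmetry of (n + 1/2)^2, so that two terms of the
  theta series can be combined.\<close>

lemma int_split_infsum:
  fixes f :: "int => complex"
  assumes "(\<lambda>n. norm (f n)) summable_on UNIV"
  shows "(\<lambda>n::nat. f (int n) + f (- int n - 1)) sums (\<Sum>\<^sub>\<infinity>n. f n)"
proof -
  have sm: "f summable_on S" for S using summable_on_subset[OF abs_summable_summable[OF assms], of S] by simp
  have U: "UNIV = range int \<union> range (\<lambda>n. - int n - 1)"
  proof -
    have "n \<in> range int \<union> range (\<lambda>n. - int n - 1)" for n
      by (cases "n \<ge> 0") (auto simp: image_iff intro: exI[of _ "nat n"] exI[of _ "nat (- n - 1)"])
    then show ?thesis by auto
  qed
  have "(\<Sum>\<^sub>\<infinity>n. f n) = (\<Sum>\<^sub>\<infinity>n\<in>range int. f n) + (\<Sum>\<^sub>\<infinity>n\<in>range (\<lambda>n. - int n - 1). f n)"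
  proof -
    have "(\<Sum>\<^sub>\<infinity>n\<in>range int \<union> range (\<lambda>n. - int n - 1). f n) = (\<Sum>\<^sub>\<infinity>n\<in>range int. f n) + (\<Sum>\<^sub>\<infinity>n\<in>range (\<lambda>n. - int n - 1). f n)"
    proof (rule infsum_Un_disjoint[OF sm sm])
      show "range int \<inter> range (\<lambda>n. - int n - 1) = {}"
      proof (rule equals0I)
        fix x assume "x \<in> range int \<inter> range (\<lambda>n. - int n - 1)"
        then obtain a b where "x = int a" "x = - int b - 1" by blast
        then show False by linarith
      qed
    qed
    then show ?thesis using U by metis
  qed
  also have "\<dots> = (\<Sum>\<^sub>\<infinity>n::nat. f (int n)) + (\<Sum>\<^sub>\<infinity>n::nat. f (- int n - 1))"
    by (subst (1 2) infsum_reindex) (auto simp: o_def inj_on_def)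
  finally have e: "(\<Sum>\<^sub>\<infinity>n. f n) = (\<Sum>\<^sub>\<infinity>n::nat. f (int n)) + (\<Sum>\<^sub>\<infinity>n::nat. f (- int n - 1))" .
  have "(\<lambda>n::nat. f (int n)) summable_on UNIV" using sm[of "range int"] by (subst (asm) summable_on_reindex) (auto simp: o_def)
  moreover have "(\<lambda>n::nat. f (- int n - 1)) summable_on UNIV"
    using sm[of "range (\<lambda>n. - int n - 1)"] by (subst (asm) summable_on_reindex) (auto simp: o_def inj_on_def)
  ultimately show ?thesis unfolding e
    by (intro sums_add has_sum_imp_sums) (auto simp: summable_iff_has_sum_infsum)
qed

text \<open>The terms n and - n - 1 of the theta series combined. In this form the zero at the
  origin is visible, and differentiation gives a cosine series.\<close>

definition theta_sin :: "complex => nat => complex => complex" where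
  "theta_sin \<tau> n z = 2 * (-1) ^ n * theta_coeff \<tau> (int n) * sin (of_real pi * (2 * of_nat n + 1) * z)"

lemma theta_sums: "Im \<tau> > 0 ==> (\<lambda>n. theta_sin \<tau> n z) sums theta z \<tau>"
proof -
  assume t: "Im \<tau> > 0"
  have "- \<i> * (theta_term z \<tau> (int n) + theta_term z \<tau> (- int n - 1)) = theta_sin \<tau> n z" for n
  proof -
    have 1: "theta_coeff \<tau> (- int n - 1) = theta_coeff \<tau> (int n)"
      unfolding theta_coeff_def by (rule arg_cong[where f=exp]) (simp add: power2_eq_square algebra_simps)
    have 2: "(-1 :: complex) powi (- int n - 1) = - ((-1) ^ n)"
    proof -
      have "(-1 :: complex) powi (- int n - 1) = (-1) powi (- int n) * (-1) powi (-1)"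
        by (subst power_int_add[symmetric]) auto
      also have "(-1 :: complex) powi (- int n) = (-1) ^ n" by (simp add: power_int_minus flip: power_inverse)
      finally show ?thesis by simp
    qed
    have 3: "sin (of_real pi * (2 * of_nat n + 1) * z) = - \<i> / 2 * (exp (pi * \<i> * z * (2 * of_int (int n) + 1)) - exp (pi * \<i> * z * (2 * of_int (- int n - 1) + 1)))"
      by (simp add: sin_exp_eq algebra_simps) (simp add: field_simps)
    show ?thesis unfolding theta_term_def theta_sin_def 1 2 3 by (simp add: algebra_simps)
  qed
  then show ?thesis
    using sums_mult[OF int_split_infsum[OF theta_term_summable[OF t, of z]], of "- \<i>"] by (simp add: theta_altdef)
qed

definition theta_cos :: "complex => nat => complex => complex" where
  "theta_cos \<tau> n z = 2 * (-1) ^ n * theta_coeff \<tau> (int n) * (of_real pi * (2 * of_nat n + 1)) * cos (of_real pi * (2 * of_nat n + 1) * z)"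

lemma theta_has_derivative:
  assumes t: "Im \<tau> > 0"
  shows "((\<lambda>z. theta z \<tau>) has_field_derivative (suminf (\<lambda>n. theta_cos \<tau> n z))) (at z)"
proof -
  define R where "R = norm z + 1"
  \<comment> \<open>The bound of \<open>gauss_bound\<close>; the summand 2 in the exponent absorbs
    the factor 2 n + 1 produced by differentiation.\<close>
  define M where "M n = 4 * pi * exp ((2 * pi * R + 2 + 1)\<^sup>2 / (4 * (pi * Im \<tau>))) * exp (- (real n + 1 / 2))" for n :: nat
  have R: "R > 0" by (simp add: R_def add_nonneg_pos)
  have bound: "norm (theta_cos \<tau> n w) \<le> M n" if w: "w \<in> ball 0 R" for n w
  proof -
    let ?x = "real n + 1 / 2"
    let ?a = "complex_of_real pi * (2 * of_nat n + 1) * w"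
    have "norm ?a = 2 * pi * ?x * norm w" unfolding norm_mult norm_odd by simp
    also have "\<dots> \<le> 2 * pi * ?x * R" using w by (intro mult_left_mono) auto
    finally have na: "norm ?a \<le> 2 * pi * R * ?x" by (simp add: mult_ac)
    have "norm (cos ?a) \<le> exp (norm ?a)"
      by (rule norm_cos_le)
    also have "\<dots> \<le> exp (2 * pi * R * ?x)" using na by simp
    finally have c: "norm (cos ?a) \<le> exp (2 * pi * R * ?x)" .
    have n1: "norm (complex_of_real pi * (2 * of_nat n + 1)) = 2 * pi * ?x"
      unfolding norm_mult norm_odd by simp
    have x: "?x \<le> exp (2 * ?x)" using exp_ge_add_one_self[of "2 * ?x"] by simp
    have "norm (theta_cos \<tau> n w) = 2 * exp (- (pi * Im \<tau>) * ?x\<^sup>2) * (2 * pi * ?x) * norm (cos ?a)"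
      using n1 by (simp add: theta_cos_def norm_mult norm_power norm_theta_coeff)
    also have "\<dots> \<le> 2 * exp (- (pi * Im \<tau>) * ?x\<^sup>2) * (2 * pi * exp (2 * ?x)) * exp (2 * pi * R * ?x)"
      using c x by (intro mult_mono mult_left_mono) auto
    also have "\<dots> = 4 * pi * exp (- (pi * Im \<tau>) * ?x\<^sup>2 + (2 * pi * R + 2) * \<bar>?x\<bar>)"
      by (simp add: exp_add[symmetric] algebra_simps)
    also have "\<dots> \<le> 4 * pi * (exp ((2 * pi * R + 2 + 1)\<^sup>2 / (4 * (pi * Im \<tau>))) * exp (- \<bar>?x\<bar>))"
      using t by (intro mult_left_mono gauss_bound) auto
    finally show ?thesis by (simp add: M_def mult.assoc)
  qed
  have sM: "summable M"
  proof -
    have "summable (\<lambda>n. exp (- 1 :: real) ^ n)" by (rule summable_geometric) simp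
    then have "summable (\<lambda>n. (4 * pi * exp ((2 * pi * R + 2 + 1)\<^sup>2 / (4 * (pi * Im \<tau>))) * exp (- 1 / 2)) * exp (- 1 :: real) ^ n)"
      by (rule summable_mult)
    moreover have "M n = (4 * pi * exp ((2 * pi * R + 2 + 1)\<^sup>2 / (4 * (pi * Im \<tau>))) * exp (- 1 / 2)) * exp (- 1 :: real) ^ n" for n
    proof -
      have "exp (- (real n + 1 / 2)) = exp (- 1 / 2) * exp (-1) ^ n"
        by (simp add: exp_of_nat_mult[symmetric] exp_add[symmetric])
      then show ?thesis by (simp add: M_def)
    qed
    ultimately show ?thesis by presburger
  qed
  have "((\<lambda>z. suminf (\<lambda>n. theta_sin \<tau> n z)) has_field_derivative (suminf (\<lambda>n. theta_cos \<tau> n z))) (at z)"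
  proof (rule has_field_derivative_series'(2)[where S="ball 0 R" and ?x0.0=0 and f="theta_sin \<tau>" and f'="theta_cos \<tau>"])
    show "(theta_sin \<tau> n has_field_derivative theta_cos \<tau> n w) (at w within ball 0 R)" for n w
      unfolding theta_sin_def[abs_def] theta_cos_def by (auto intro!: derivative_eq_intros)
    show "uniformly_convergent_on (ball 0 R) (\<lambda>n x. \<Sum>i<n. theta_cos \<tau> i x)"
      by (rule Weierstrass_m_test'[OF bound sM])
    show "summable (\<lambda>n. theta_sin \<tau> n 0)" by (simp add: theta_sin_def)
  qed (use R in \<open>auto simp: R_def\<close>)
  moreover have "(\<lambda>z. suminf (\<lambda>n. theta_sin \<tau> n z)) = (\<lambda>z. theta z \<tau>)" using theta_sums[OF t] by (auto simp: sums_iff)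
  ultimately show ?thesis by simp
qed

lemma theta_holomorphic: "Im \<tau> > 0 ==> (\<lambda>z. theta z \<tau>) holomorphic_on S"
  using theta_has_derivative by (auto simp: holomorphic_on_def field_differentiable_def intro: has_field_derivative_at_within)

lemma theta_zero: "Im \<tau> > 0 ==> theta 0 \<tau> = 0"
  using theta_sums[of \<tau> 0] by (auto simp: theta_sin_def sums_iff)

text \<open>The first term of the derivative series has norm \<open>K\<close>, and the remaining
  ones add up to at most K / 2.\<close>

lemma deriv_theta_nonzero:
  assumes t: "Im \<tau> \<ge> 1" shows "deriv (\<lambda>w. theta w \<tau>) 0 \<noteq> 0"
proof -
  have t0: "Im \<tau> > 0" using t by simp
  define c where "c n = theta_cos \<tau> n 0" for n
  define K where "K = 2 * pi * exp (- (pi * Im \<tau>) / 4)"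
  have K: "K > 0" by (simp add: K_def)
  have n: "norm (c n) = K * ((2 * real n + 1) * exp (- (pi * Im \<tau>) * (real n * (real n + 1))))" for n
  proof -
    have "norm (complex_of_real pi * (2 * of_nat n + 1)) = pi * (2 * real n + 1)"
      by (simp add: norm_mult norm_odd)
    then have "norm (c n) = 2 * exp (- (pi * Im \<tau>) * (real n + 1 / 2)\<^sup>2) * (pi * (2 * real n + 1))"
      by (simp add: c_def theta_cos_def norm_mult norm_power norm_theta_coeff)
    also have "- (pi * Im \<tau>) * (real n + 1 / 2)\<^sup>2 = - (pi * Im \<tau>) / 4 + - (pi * Im \<tau>) * (real n * (real n + 1))"
      by (simp add: power2_eq_square algebra_simps)
    finally show ?thesis unfolding exp_add by (simp add: K_def)
  qed
  have b: "norm (c (Suc n)) \<le> K * (1 / 4) * (1 / 2) ^ n" for n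
  proof -
    \<comment> \<open>Since \<pi> Im \<tau> is at least 3, the exponent is at least 6 (n + 1), and a
      factor of at least 64 for each step outweighs the growth of 2 n + 3.\<close>
    have e3: "exp (3 :: real) \<ge> 8"
      using exp_lower_Taylor_quadratic[of "3::real"] by simp
    have p: "3 * real (Suc n) * (real n + 1 + 1) \<le> (pi * Im \<tau>) * (real (Suc n) * (real (Suc n) + 1))"
    proof -
      have "3 * 1 \<le> pi * Im \<tau>" using t pi_gt3 by (intro mult_mono) auto
      then have "3 * (real (Suc n) * (real (Suc n) + 1)) \<le> (pi * Im \<tau>) * (real (Suc n) * (real (Suc n) + 1))"
        by (intro mult_right_mono) auto
      then show ?thesis by (metis Num.of_nat_simps(3) add.commute more_arith_simps(11))
    qed
    have "(2 * real (Suc n) + 1) * exp (- (pi * Im \<tau>) * (real (Suc n) * (real (Suc n) + 1)))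
        \<le> (3 * 2 ^ n) * exp (- (6 * real (Suc n)))"
    proof (intro mult_mono)
      show "2 * real (Suc n) + 1 \<le> 3 * 2 ^ n"
      proof (induction n)
        case (Suc n)
        have "(1::real) \<le> 2 ^ n" by simp
        then show ?case using Suc by simp
      qed simp
      have "6 * real (Suc n) \<le> 3 * real (Suc n) * (real n + 1 + 1)" by (simp add: algebra_simps)
      then show "exp (- (pi * Im \<tau>) * (real (Suc n) * (real (Suc n) + 1))) \<le> exp (- (6 * real (Suc n)))"
        using p by (smt (verit, best) exp_le_cancel_iff more_arith_simps(7))
    qed auto
    also have "exp (- (6 * real (Suc n))) \<le> (1 / 64) ^ Suc n"
    proof -
      have "inverse (exp 3 * exp 3) = exp (- 6 :: real)" by (simp add: exp_minus flip: exp_add)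
      moreover have "exp (- (6 * real (Suc n))) = exp (real (Suc n) * - 6)" by (simp only: mult_minus_right mult.commute)
      ultimately have "exp (- (6 * real (Suc n))) = (inverse (exp 3 * exp 3)) ^ Suc n"
        by (simp only: exp_of_nat_mult)
      also have "\<dots> \<le> (1 / 64) ^ Suc n"
      proof (rule power_mono)
        have "(8::real) * 8 \<le> exp 3 * exp 3" using e3 by (intro mult_mono) auto
        then show "inverse (exp 3 * exp 3) \<le> (1 / 64 :: real)" by (simp add: field_simps)
      qed simp
      finally show ?thesis .
    qed
    then have "(3 * 2 ^ n) * exp (- (6 * real (Suc n))) \<le> (3 * 2 ^ n) * (1 / 64) ^ Suc n" by (rule mult_left_mono) simp
    also have "\<dots> = (3 / 64) * (1 / 32) ^ n" by (simp flip: power_mult_distrib)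
    also have "\<dots> \<le> (1 / 4) * (1 / 2) ^ n" by (intro mult_mono power_mono) auto
    finally show ?thesis unfolding n using K by (simp add: mult.assoc)
  qed
  have sg: "(\<lambda>n. K * (1 / 4) * (1 / 2) ^ n) sums (K * (1 / 4) * 2)"
    using geometric_sums[of "1 / 2 :: real"] by (intro sums_mult) simp
  have sc: "summable (\<lambda>n. norm (c (Suc n)))"
    by (rule summable_comparison_test'[OF sums_summable[OF sg]]) (use b in auto)
  have "norm (suminf (\<lambda>n. c (Suc n))) \<le> suminf (\<lambda>n. norm (c (Suc n)))" by (rule summable_norm[OF sc])
  also have "\<dots> \<le> suminf (\<lambda>n. K * (1 / 4) * (1 / 2) ^ n)" by (rule suminf_le[OF b sc sums_summable[OF sg]])
  also have "\<dots> = K / 2" using sg by (simp add: sums_iff)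
  finally have r: "norm (suminf (\<lambda>n. c (Suc n))) \<le> K / 2" .
  have "summable c" using sc summable_norm_cancel summable_Suc_iff by blast
  then have "suminf (\<lambda>n. c n) = c 0 + suminf (\<lambda>n. c (Suc n))" using suminf_split_head[of c] by simp
  moreover have "norm (c 0) = K" by (simp add: n)
  ultimately have "suminf (\<lambda>n. c n) \<noteq> 0" using r K by (metis add_eq_0_iff field_sum_of_halves norm_minus_cancel add_le_same_cancel1 not_le half_gt_zero_iff)
  then show ?thesis using theta_has_derivative[OF t0, of 0] by (simp add: DERIV_imp_deriv c_def)
qed

section \<open>Kronecker series\<close>

text \<open>The substitution k = N + n sorts the product of two two-sided series by the difference N
  of the indices; absolute convergence of the double series permits it.\<close>

lemma infsum_product_nested:
  fixes a s :: "int => complex"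
  assumes a: "(\<lambda>n. norm (a n)) summable_on UNIV" and s: "(\<lambda>n. norm (s n)) summable_on UNIV"
  shows "(\<Sum>\<^sub>\<infinity>k. a k) * (\<Sum>\<^sub>\<infinity>n. s n) = (\<Sum>\<^sub>\<infinity>N. \<Sum>\<^sub>\<infinity>n. a (N + n) * s n)"
proof -
  have "(\<lambda>p. norm (case p of (k, n) => a k * s n)) summable_on UNIV \<times> UNIV"
    unfolding Infinite_Sum.abs_summable_on_Sigma_iff
  proof (intro conjI ballI)
    fix k
    show "(\<lambda>n. norm (case (k, n) of (k, n) => a k * s n)) summable_on UNIV"
      unfolding prod.case norm_mult by (rule summable_on_cmult_right[OF s])
    have "(\<lambda>k. norm (a k) * (\<Sum>\<^sub>\<infinity>n. norm (s n))) summable_on UNIV" by (rule summable_on_cmult_left[OF a])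
    moreover have "norm (\<Sum>\<^sub>\<infinity>n. norm (case (k, n) of (k, n) => a k * s n)) = norm (a k) * (\<Sum>\<^sub>\<infinity>n. norm (s n))" for k
      using infsum_nonneg[of UNIV "\<lambda>n. norm (s n)"] unfolding prod.case norm_mult infsum_cmult_right' by (simp add: abs_mult)
    ultimately show "(\<lambda>k. norm (\<Sum>\<^sub>\<infinity>n. norm (case (k, n) of (k, n) => a k * s n))) summable_on UNIV" by presburger
  qed
  then have sm: "(\<lambda>(k, n). a k * s n) summable_on UNIV \<times> UNIV" by (rule abs_summable_summable)
  have b: "bij_betw (\<lambda>(N, n). (N + n, n)) (UNIV :: (int \<times> int) set) UNIV"
    by (rule bij_betwI[of _ _ _ "\<lambda>(k, n). (k - n, n)"]) auto
  have sm2: "(\<lambda>(N, n). a (N + n) * s n) summable_on UNIV \<times> UNIV"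
    using sm summable_on_reindex_bij_betw[OF b, of "\<lambda>(k, n). a k * s n"] by (simp add: case_prod_unfold)
  have "(\<Sum>\<^sub>\<infinity>k. a k) * (\<Sum>\<^sub>\<infinity>n. s n) = (\<Sum>\<^sub>\<infinity>k. \<Sum>\<^sub>\<infinity>n. a k * s n)"
    by (simp add: infsum_cmult_right' infsum_cmult_left')
  also have "\<dots> = (\<Sum>\<^sub>\<infinity>(k, n)\<in>UNIV \<times> UNIV. a k * s n)"
    by (rule infsum_Sigma'_banach[OF sm])
  also have "\<dots> = (\<Sum>\<^sub>\<infinity>(N, n)\<in>UNIV \<times> UNIV. a (N + n) * s n)"
    using infsum_reindex_bij_betw[OF b, of "\<lambda>(k, n). a k * s n"] by (simp add: case_prod_unfold)
  also have "\<dots> = (\<Sum>\<^sub>\<infinity>N. \<Sum>\<^sub>\<infinity>n. a (N + n) * s n)"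
    by (rule infsum_Sigma'_banach[OF sm2, symmetric])
  finally show ?thesis .
qed

text \<open>The bound on Im \<tau> keeps the norm of \<open>e * q n\<close> below 1/2 for n > 0 and
  above 2 for n < 0, so that a zero denominator could occur only at n = 0, where \<alpha> is not an
  integer. It also puts \<tau> in the range of \<open>deriv_theta_nonzero\<close>.\<close>

locale kronecker =
  fixes \<alpha> \<tau> :: complex
  assumes not_int: "\<alpha> \<notin> \<int>" and Im_tau: "Im \<tau> > \<bar>Im \<alpha>\<bar> + 1"
begin

definition e :: complex where "e = exp (2 * pi * \<i> * \<alpha>)"
definition q :: "int => complex" where "q n = exp (2 * pi * \<i> * \<tau> * of_int n)"
definition h :: "int => complex" where "h n = 1 / (1 - e * q n)"

lemma tau_pos: "Im \<tau> > 0" using Im_tau by linarith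

lemma norm_eq: "norm (e * q n) = exp (- 2 * pi * (Im \<alpha> + of_int n * Im \<tau>))"
  by (simp add: e_def q_def norm_mult algebra_simps flip: exp_add)

lemma exp_2pi: "exp (2 * pi) > (2::real)"
proof -
  have "1 + 2 * pi \<le> exp (2 * pi)" by (rule exp_ge_add_one_self)
  then show ?thesis using pi_gt3 by linarith
qed

lemma norm_eq_pos: "n > 0 ==> norm (e * q n) < 1 / 2"
proof -
  assume n: "n > 0"
  have "1 * Im \<tau> \<le> of_int n * Im \<tau>" using n tau_pos by (intro mult_right_mono) auto
  then have "1 \<le> Im \<alpha> + of_int n * Im \<tau>" using Im_tau by linarith
  then have "exp (- 2 * pi * (Im \<alpha> + of_int n * Im \<tau>)) \<le> exp (- (2 * pi))" by simp
  also have "\<dots> < 1 / 2" using exp_2pi by (simp add: exp_minus field_simps)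
  finally show ?thesis by (simp only: norm_eq)
qed

lemma norm_eq_neg: "n < 0 ==> norm (e * q n) > 2"
proof -
  assume n: "n < 0"
  have "of_int n * Im \<tau> \<le> -1 * Im \<tau>" using n tau_pos by (intro mult_right_mono) auto
  then have "1 \<le> - (Im \<alpha> + of_int n * Im \<tau>)" using Im_tau by linarith
  then have "2 * pi * 1 \<le> 2 * pi * - (Im \<alpha> + of_int n * Im \<tau>)" by (intro mult_left_mono) auto
  then have "exp (2 * pi) \<le> exp (- 2 * pi * (Im \<alpha> + of_int n * Im \<tau>))"
    by (smt (verit, del_insts) exp_le_cancel_iff more_arith_simps(7,8))
  then show ?thesis using exp_2pi unfolding norm_eq by linarith
qed

lemma e_not_1: "e \<noteq> 1"
proof
  assume "e = 1"
  then obtain n :: int where n: "Re (2 * pi * \<i> * \<alpha>) = 0" "Im (2 * pi * \<i> * \<alpha>) = of_int (2 * n) * pi"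
    unfolding e_def exp_eq_1 by blast
  then have "\<alpha> = of_int n" by (auto simp: complex_eq_iff)
  then show False using not_int by simp
qed

lemma denominator_nonzero: "1 - e * q n \<noteq> 0"
proof
  assume *: "1 - e * q n = 0"
  then have "norm (e * q n) = 1" by simp
  then have "n = 0" using norm_eq_pos[of n] norm_eq_neg[of n] by (cases n "0::int" rule: linorder_cases) auto
  then show False using * e_not_1 by (simp add: q_def)
qed

lemma h_rel: "h n - 1 = e * q n * h n" "h n * (e * q n - 1) = -1"
  using denominator_nonzero[of n] by (auto simp: h_def field_simps)

definition H :: real where "H = norm (h 0) + 2"

lemma norm_h: "norm (h n) \<le> H"
proof (cases n "0::int" rule: linorder_cases)
  case less
  have "norm (e * q n) - 1 \<le> norm (1 - e * q n)" using norm_triangle_ineq2[of "e * q n" 1] by (simp add: norm_minus_commute)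
  then have "1 \<le> norm (1 - e * q n)" using norm_eq_neg[OF less] by linarith
  then have "1 / norm (1 - e * q n) \<le> 1 / 1" by (intro frac_le) auto
  then have "norm (h n) \<le> 1" by (simp add: h_def norm_divide)
  then show ?thesis unfolding H_def by (smt (verit) norm_ge_zero)
next
  case greater
  have "1 - norm (e * q n) \<le> norm (1 - e * q n)" using norm_triangle_ineq2[of 1 "e * q n"] by simp
  then have "1 / 2 \<le> norm (1 - e * q n)" using norm_eq_pos[OF greater] by linarith
  then have "1 / norm (1 - e * q n) \<le> 1 / (1 / 2)" by (intro frac_le) auto
  then have "norm (h n) \<le> 2" by (simp add: h_def norm_divide)
  then show ?thesis unfolding H_def by (smt (verit) norm_ge_zero)
qed (simp add: H_def)

lemma H_pos: "H \<ge> 2" by (simp add: H_def)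

lemma e_nonzero: "e \<noteq> 0" by (simp add: e_def)

lemma norm_q: "norm (q n) = exp (- (2 * pi * Im \<tau>) * of_int n)"
  by (simp add: q_def algebra_simps)

definition K :: real where "K = norm e * H + (H + 1) / norm e + H + 1"

lemma K_bounds: "norm e * H \<le> K" "(H + 1) / norm e \<le> K" "H + 1 \<le> K" "K \<ge> 0"
  using H_pos e_nonzero by (auto simp: K_def add_nonneg_nonneg)

lemma norm_h_minus_one: "norm (h n - 1) \<le> K * exp (- (2 * pi * Im \<tau>) * of_int n)"
proof -
  have "norm (h n - 1) = norm e * norm (h n) * norm (q n)" by (simp add: h_rel norm_mult)
  also have "\<dots> \<le> K * norm (q n)"
    using norm_h[of n] K_bounds(1) by (intro mult_right_mono order_trans[OF mult_left_mono K_bounds(1)]) auto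
  finally show ?thesis by (simp add: norm_q)
qed

lemma norm_h_minus_one': "norm (h n - 1) \<le> K"
  using norm_triangle_ineq4[of "h n" 1] norm_h[of n] K_bounds(3) by (simp del: norm_triangle_ineq4)

lemma norm_h': "norm (h n) \<le> K * exp (2 * pi * Im \<tau> * of_int n)"
proof -
  have "h n = (h n - 1) / (e * q n)" using h_rel(1)[of n] e_nonzero by (simp add: q_def)
  then have "norm (h n) = norm (h n - 1) / (norm e * norm (q n))" by (metis norm_divide norm_mult)
  also have "\<dots> = norm (h n - 1) / norm e * exp (2 * pi * Im \<tau> * of_int n)"
    by (simp add: norm_q exp_minus field_simps)
  also have "norm (h n - 1) / norm e \<le> K"
  proof -
    have "norm (h n - 1) \<le> H + 1" using norm_triangle_ineq4[of "h n" 1] norm_h[of n] by simp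
    then show ?thesis using K_bounds(2) e_nonzero by (intro order_trans[OF divide_right_mono K_bounds(2)]) auto
  qed
  then have "norm (h n - 1) / norm e * exp (2 * pi * Im \<tau> * of_int n) \<le> K * exp (2 * pi * Im \<tau> * of_int n)"
    by (rule mult_right_mono) simp
  finally show ?thesis .
qed

text \<open>With z = i y, the factor in front is exp (- 2 \<pi> i n z). Since \<open>h n\<close>
  tends to 1 at plus infinity and to 0 at minus infinity, the growing exponential for y > 0 is
  compensated only after 1 has been subtracted.\<close>

definition s :: "real => int => complex" where
  "s y n = exp (of_real (2 * pi * y * of_int n)) * (h n - (if y > 0 then 1 else 0))"

lemma s_summable:
  assumes "y \<noteq> 0" "\<bar>y\<bar> < Im \<tau>"
  shows "(\<lambda>n. norm (s y n)) summable_on UNIV"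
\<comment> \<open>On one half-line the exponential decays at rate |y|; on the other, the decay of
  \<open>h\<close> or \<open>h - 1\<close> at rate Im \<tau> leaves Im \<tau> - |y|.\<close>
proof (rule abs_summable_int_exp[where c="2 * pi * min \<bar>y\<bar> (Im \<tau> - \<bar>y\<bar>)" and K=K])
  show "2 * pi * min \<bar>y\<bar> (Im \<tau> - \<bar>y\<bar>) > 0" using assms by simp
  fix n
  let ?c = "min \<bar>y\<bar> (Im \<tau> - \<bar>y\<bar>)"
  have ns: "norm (s y n) = exp (2 * pi * (y * of_int n)) * norm (h n - (if y > 0 then 1 else 0))"
    by (simp add: s_def norm_mult mult.assoc)
  have fin: "exp (2 * pi * (y * of_int n)) * (K * exp (2 * pi * t)) \<le> K * exp (- (2 * pi * ?c) * \<bar>of_int n\<bar>)"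
    if "y * of_int n + t \<le> - (?c * \<bar>of_int n\<bar>)" for t
  proof -
    have "exp (2 * pi * (y * of_int n)) * exp (2 * pi * t) \<le> exp (2 * pi * - (?c * \<bar>of_int n\<bar>))"
    proof -
      have "2 * pi * (y * of_int n + t) \<le> 2 * pi * - (?c * \<bar>of_int n\<bar>)" by (rule mult_left_mono[OF that]) simp
      then show ?thesis by (simp only: exp_add[symmetric] distrib_left[symmetric] exp_le_cancel_iff)
    qed
    then have "K * (exp (2 * pi * (y * of_int n)) * exp (2 * pi * t)) \<le> K * exp (2 * pi * - (?c * \<bar>of_int n\<bar>))"
      using K_bounds(4) by (rule mult_left_mono)
    then show ?thesis by (simp add: mult_ac)
  qed
  have c1: "?c * \<bar>of_int n\<bar> \<le> \<bar>y\<bar> * \<bar>of_int n\<bar>" "?c * \<bar>of_int n\<bar> \<le> (Im \<tau> - \<bar>y\<bar>) * \<bar>of_int n\<bar>"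
    by (auto intro!: mult_right_mono)
  show "norm (s y n) \<le> K * exp (- (2 * pi * ?c) * \<bar>of_int n\<bar>)"
  proof (cases "y > 0"; cases "n \<ge> 0")
    assume y: "y > 0" and n: "n \<ge> 0"
    have "norm (s y n) \<le> exp (2 * pi * (y * of_int n)) * (K * exp (2 * pi * - (Im \<tau> * of_int n)))"
      unfolding ns using norm_h_minus_one[of n] y by (intro mult_left_mono) (auto simp: mult_ac)
    also have "\<dots> \<le> K * exp (- (2 * pi * ?c) * \<bar>of_int n\<bar>)"
      using c1(2) y n by (intro fin) (simp add: algebra_simps)
    finally show ?thesis .
  next
    assume y: "y > 0" and n: "\<not> n \<ge> 0"
    have "norm (s y n) \<le> exp (2 * pi * (y * of_int n)) * (K * exp (2 * pi * 0))"
      unfolding ns using norm_h_minus_one'[of n] y by (intro mult_left_mono) auto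
    also have "\<dots> \<le> K * exp (- (2 * pi * ?c) * \<bar>of_int n\<bar>)"
      using c1(1) y n by (intro fin) (simp add: algebra_simps)
    finally show ?thesis .
  next
    assume y: "\<not> y > 0" and n: "n \<ge> 0"
    have "norm (h n) \<le> K" using norm_h[of n] K_bounds(3) by linarith
    then have "norm (s y n) \<le> exp (2 * pi * (y * of_int n)) * (K * exp (2 * pi * 0))"
      unfolding ns using y by (intro mult_left_mono) auto
    also have "\<dots> \<le> K * exp (- (2 * pi * ?c) * \<bar>of_int n\<bar>)"
      using c1(1) y n by (intro fin) (simp add: algebra_simps)
    finally show ?thesis .
  next
    assume y: "\<not> y > 0" and n: "\<not> n \<ge> 0"
    have "norm (s y n) \<le> exp (2 * pi * (y * of_int n)) * (K * exp (2 * pi * (Im \<tau> * of_int n)))"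
      unfolding ns using norm_h'[of n] y by (intro mult_left_mono) (auto simp: mult_ac)
    also have "\<dots> \<le> K * exp (- (2 * pi * ?c) * \<bar>of_int n\<bar>)"
      using c1(2) y n by (intro fin) (simp add: algebra_simps)
    finally show ?thesis .
  qed
qed

text \<open>The quotient of the signed theta coefficients of index N + n and N. Multiplying a series
  by the theta function amounts to a convolution with these numbers.\<close>

definition p :: "int => int => complex" where
  "p N n = (-1) powi n * exp (2 * pi * \<i> * \<tau> * of_int n * (of_int N + 1 / 2) + pi * \<i> * \<tau> * (of_int n)\<^sup>2)"

lemma p_summable:
  assumes "\<And>n. norm (g n) \<le> M"
  shows "(\<lambda>n. norm (p N n * g n)) summable_on UNIV"
proof (rule abs_summable_gauss[where b="pi * Im \<tau>" and s=0 and K=M and a="2 * pi * Im \<tau> * \<bar>of_int N + 1 / 2\<bar>"])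
  show "pi * Im \<tau> > 0" using tau_pos by simp
  show M: "M \<ge> 0" using assms[of 0] norm_ge_zero order_trans by blast
  fix n
  have "norm (p N n) = exp (- (pi * Im \<tau>) * (of_int n)\<^sup>2 + - (2 * pi * Im \<tau> * (of_int n * (of_int N + 1 / 2))))"
  proof -
    have "2 * pi * \<i> * \<tau> * of_int n * (of_int N + 1 / 2) + pi * \<i> * \<tau> * (of_int n)\<^sup>2 =
       \<i> * \<tau> * of_real (2 * pi * of_int n * (of_int N + 1 / 2) + pi * (of_int n)\<^sup>2)" by (simp add: algebra_simps)
    then show ?thesis by (simp add: p_def norm_mult algebra_simps)
  qed
  also have "\<dots> \<le> exp (- (pi * Im \<tau>) * (of_int n)\<^sup>2 + 2 * pi * Im \<tau> * \<bar>of_int N + 1 / 2\<bar> * \<bar>of_int n\<bar>)"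
  proof -
    have "- (of_int n * (of_int N + 1 / 2)) \<le> \<bar>of_int N + 1 / 2\<bar> * \<bar>of_int n :: real\<bar>"
      by (metis abs_ge_minus_self abs_mult mult.commute)
    then have "2 * pi * Im \<tau> * - (of_int n * (of_int N + 1 / 2)) \<le> 2 * pi * Im \<tau> * (\<bar>of_int N + 1 / 2\<bar> * \<bar>of_int n\<bar>)"
      using tau_pos by (intro mult_left_mono) auto
    then have "- (2 * pi * Im \<tau> * (of_int n * (of_int N + 1 / 2))) \<le> 2 * pi * Im \<tau> * \<bar>of_int N + 1 / 2\<bar> * \<bar>of_int n\<bar>"
      by (simp only: mult_minus_right mult.assoc)
    then show ?thesis unfolding exp_le_cancel_iff by (rule add_left_mono)
  qed
  finally have "norm (p N n) * norm (g n) \<le> exp (- (pi * Im \<tau>) * (of_int n)\<^sup>2 + 2 * pi * Im \<tau> * \<bar>of_int N + 1 / 2\<bar> * \<bar>of_int n\<bar>) * M"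
    using assms by (intro mult_mono) auto
  then show "norm (p N n * g n) \<le> M * exp (- (pi * Im \<tau>) * (of_int n + 0)\<^sup>2 + 2 * pi * Im \<tau> * \<bar>of_int N + 1 / 2\<bar> * \<bar>of_int n + 0\<bar>)"
    by (simp add: norm_mult mult.commute)
qed

text \<open>The involution \<open>n \<mapsto> - 1 - 2 N - n\<close> changes the sign of the terms.\<close>

lemma p_sum_zero: "(\<Sum>\<^sub>\<infinity>n. p N n) = 0"
proof -
  have "p N (- 1 - 2 * N - n) = - p N n" for n
  proof -
    have 1: "2 * pi * \<i> * \<tau> * of_int (- 1 - 2 * N - n) * (of_int N + 1 / 2) + pi * \<i> * \<tau> * (of_int (- 1 - 2 * N - n))\<^sup>2 =
        2 * pi * \<i> * \<tau> * of_int n * (of_int N + 1 / 2) + pi * \<i> * \<tau> * (of_int n)\<^sup>2"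
      by (simp add: power2_eq_square algebra_simps)
    have "even (- 1 - 2 * N - n) \<longleftrightarrow> odd n" by presburger
    then have 2: "(-1 :: complex) powi (- 1 - 2 * N - n) = - ((-1) powi n)" by (simp only: power_int_minus_left) auto
    show ?thesis unfolding p_def 1 2 by simp
  qed
  moreover have "bij_betw (\<lambda>n. - 1 - 2 * N - n) (UNIV :: int set) UNIV"
    by (rule bij_betwI[of _ _ _ "\<lambda>n. - 1 - 2 * N - n"]) auto
  ultimately have "(\<Sum>\<^sub>\<infinity>n. p N n) = (\<Sum>\<^sub>\<infinity>n. - p N n)"
    using infsum_reindex_bij_betw[of "\<lambda>n. - 1 - 2 * N - n" UNIV UNIV "p N"] by simp
  then show ?thesis by (simp add: infsum_uminus)
qed

definition B :: "int => complex" where "B N = (\<Sum>\<^sub>\<infinity>n. p N n * h n)"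

lemma p_summable': "p N summable_on UNIV" "(\<lambda>n. p N n * h n) summable_on UNIV"
  using abs_summable_summable[OF p_summable[of "\<lambda>_. 1" 1 N]] abs_summable_summable[OF p_summable[OF norm_h]] by auto

text \<open>Passing from N to N + 1 multiplies \<open>p N n\<close> by \<open>q n\<close>, and
  \<open>e * q n * h n\<close> is \<open>h n - 1\<close>. The two sides thus differ by the vanishing
  sum of the \<open>p N n\<close>.\<close>

lemma B_rec: "e * B (N + 1) = B N"
proof -
  have pq: "p (N + 1) n = p N n * q n" for n
    unfolding p_def q_def mult.assoc exp_add[symmetric]
    by (intro arg_cong2[where f="(*)"] arg_cong[where f=exp] refl) (simp add: algebra_simps)
  have "e * B (N + 1) - B N = (\<Sum>\<^sub>\<infinity>n. e * (p (N + 1) n * h n)) + (\<Sum>\<^sub>\<infinity>n. - (p N n * h n))"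
    unfolding B_def by (simp add: infsum_cmult_right' infsum_uminus)
  also have "\<dots> = (\<Sum>\<^sub>\<infinity>n. e * (p (N + 1) n * h n) + - (p N n * h n))"
    by (rule infsum_add[symmetric]) (intro summable_on_cmult_right summable_on_uminus[THEN iffD2] p_summable')+
  also have "\<dots> = (\<Sum>\<^sub>\<infinity>n. - p N n)"
  proof (rule infsum_cong)
    fix n
    have "e * (p (N + 1) n * h n) + - (p N n * h n) = p N n * (h n * (e * q n - 1))" unfolding pq by (simp add: Rings.ring_distribs(4))
    then show "e * (p (N + 1) n * h n) + - (p N n * h n) = - p N n" by (simp add: h_rel)
  qed
  also have "\<dots> = 0" by (simp add: infsum_uminus p_sum_zero)
  finally show ?thesis by simp
qed

text \<open>The geometric dependence on N is the effect on the theta coefficients of shifting the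
  argument by \<alpha>.\<close>

lemma B_eq: "B N = exp (- 2 * pi * \<i> * \<alpha> * of_int N) * B 0"
proof -
  have step: "B (N + 1) = exp (- 2 * pi * \<i> * \<alpha>) * B N" for N
    using B_rec[of N] e_nonzero by (simp add: e_def exp_minus field_simps)
  show ?thesis
  proof (induction N rule: int_induct[where k=0])
    case (step1 i)
    have "exp (- 2 * pi * \<i> * \<alpha> * of_int (i + 1)) = exp (- 2 * pi * \<i> * \<alpha>) * exp (- 2 * pi * \<i> * \<alpha> * of_int i)"
      unfolding exp_add[symmetric] by (simp add: algebra_simps)
    then show ?case using step[of i] step1 by simp
  next
    case (step2 i)
    have "exp (- 2 * pi * \<i> * \<alpha> * of_int i) = exp (- 2 * pi * \<i> * \<alpha>) * exp (- 2 * pi * \<i> * \<alpha> * of_int (i - 1))"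
      unfolding exp_add[symmetric] by (simp add: algebra_simps)
    then show ?case using step[of "i - 1"] step2 by simp
  qed simp
qed

definition S :: "real => complex" where "S y = (\<Sum>\<^sub>\<infinity>n. s y n)"

text \<open>The coefficient of index N on the left is the theta term times \<open>B N\<close> for
  either sign of y, since the 1 subtracted for y > 0 contributes the vanishing sum of the
  \<open>p N n\<close>.\<close>

lemma theta_S:
  assumes y: "y \<noteq> 0" "\<bar>y\<bar> < Im \<tau>"
  shows "theta (\<i> * y) \<tau> * S y = exp (pi * \<i> * \<alpha>) * B 0 * theta (\<i> * y - \<alpha>) \<tau>"
proof -
  let ?z = "\<i> * complex_of_real y"
  have inner: "(\<Sum>\<^sub>\<infinity>n. theta_term ?z \<tau> (N + n) * s y n) = exp (pi * \<i> * \<alpha>) * B 0 * theta_term (?z - \<alpha>) \<tau> N" for N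
  proof -
    let ?g = "\<lambda>n. h n - (if y > 0 then 1 else 0)"
    have t: "theta_term ?z \<tau> (N + n) * s y n = theta_term ?z \<tau> N * (p N n * ?g n)" for n
    proof -
      have c: "theta_coeff \<tau> (N + n) = theta_coeff \<tau> N * exp (2 * pi * \<i> * \<tau> * of_int n * (of_int N + 1 / 2) + pi * \<i> * \<tau> * (of_int n)\<^sup>2)"
        unfolding theta_coeff_def exp_add[symmetric] by (rule arg_cong[where f=exp]) (simp add: power2_eq_square algebra_simps)
      have d: "exp (pi * \<i> * ?z * (2 * of_int (N + n) + 1)) * exp (of_real (2 * pi * y * of_int n)) = exp (pi * \<i> * ?z * (2 * of_int N + 1))"
        unfolding exp_add[symmetric] by (rule arg_cong[where f=exp]) (simp add: algebra_simps)
      have f: "(-1 :: complex) powi (N + n) = (-1) powi N * (-1) powi n" by (simp add: power_int_add)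
      have "theta_term ?z \<tau> (N + n) * s y n = (-1) powi (N + n) * theta_coeff \<tau> (N + n) *
          (exp (pi * \<i> * ?z * (2 * of_int (N + n) + 1)) * exp (of_real (2 * pi * y * of_int n))) * ?g n"
        by (simp add: theta_term_def s_def mult_ac)
      then show ?thesis unfolding d c f by (simp add: theta_term_def p_def mult_ac)
    qed
    have "(\<Sum>\<^sub>\<infinity>n. p N n * ?g n) = B N"
    proof (cases "y > 0")
      case True
      have "(\<Sum>\<^sub>\<infinity>n. p N n * ?g n) = (\<Sum>\<^sub>\<infinity>n. p N n * h n + - p N n)" using True by (simp add: algebra_simps)
      also have "\<dots> = B N + (\<Sum>\<^sub>\<infinity>n. - p N n)"
        unfolding B_def by (rule infsum_add) (intro summable_on_uminus[THEN iffD2] p_summable')+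
      finally show ?thesis by (simp add: infsum_uminus p_sum_zero)
    qed (simp add: B_def)
    then have "(\<Sum>\<^sub>\<infinity>n. theta_term ?z \<tau> (N + n) * s y n) = theta_term ?z \<tau> N * B N"
      unfolding t by (simp add: infsum_cmult_right')
    also have "\<dots> = exp (pi * \<i> * \<alpha>) * B 0 * theta_term (?z - \<alpha>) \<tau> N"
    proof -
      have "exp (pi * \<i> * ?z * (2 * of_int N + 1)) * exp (- 2 * pi * \<i> * \<alpha> * of_int N) = exp (pi * \<i> * \<alpha>) * exp (pi * \<i> * (?z - \<alpha>) * (2 * of_int N + 1))"
        unfolding exp_add[symmetric] by (rule arg_cong[where f=exp]) (simp add: algebra_simps)
      then show ?thesis unfolding B_eq[of N] theta_term_def by (simp add: mult_ac)
    qed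
    finally show ?thesis .
  qed
  have "(\<Sum>\<^sub>\<infinity>k. theta_term ?z \<tau> k) * S y = (\<Sum>\<^sub>\<infinity>N. \<Sum>\<^sub>\<infinity>n. theta_term ?z \<tau> (N + n) * s y n)"
    unfolding S_def by (rule infsum_product_nested[OF theta_term_summable[OF tau_pos] s_summable[OF y]])
  then show ?thesis unfolding inner by (simp add: theta_altdef infsum_cmult_right' mult_ac)
qed

text \<open>For y < 0, the only part that becomes large as y tends to 0 is the geometric series due
  to the limit 1 of \<open>h n\<close> at plus infinity. The remainder \<open>R\<close> converges
  uniformly near 0.\<close>

lemma S_limit: "((\<lambda>y. of_real y * S y) \<longlongrightarrow> - 1 / (2 * pi)) (at_left 0)"
proof -
  \<comment> \<open>Half of the admissible range of y; on it the terms of \<open>R\<close> decay at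
    rate \<pi> Im \<tau>, uniformly in y.\<close>
  define c where "c = Im \<tau> / 2"
  have c: "c > 0" "c < Im \<tau>" using tau_pos by (auto simp: c_def)
  define f where "f n y = exp (of_real (2 * pi * y * of_int n)) * (if n \<ge> 0 then h n - 1 else h n)" for n :: int and y :: real
  define R where "R y = (\<Sum>\<^sub>\<infinity>n. f n y)" for y
  have fb: "norm (f n y) \<le> K * exp (- (pi * Im \<tau>) * \<bar>of_int n\<bar>)" if y: "y \<in> {-c..c}" for n y
  proof -
    have "norm (f n y) \<le> exp (2 * pi * y * of_int n) * (K * exp (- (2 * pi * Im \<tau>) * \<bar>of_int n\<bar>))"
      unfolding f_def norm_mult using norm_h_minus_one[of n] norm_h'[of n]
      by (intro mult_mono) auto
    also have "\<dots> \<le> K * exp (- (pi * Im \<tau>) * \<bar>of_int n\<bar>)"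
    proof -
      have "y * of_int n \<le> c * \<bar>of_int n\<bar>"
      proof -
        have "y * of_int n \<le> \<bar>y\<bar> * \<bar>of_int n\<bar>" by (metis abs_ge_self abs_mult)
        also have "\<dots> \<le> c * \<bar>of_int n\<bar>" using y by (intro mult_right_mono) auto
        finally show ?thesis .
      qed
      then have "2 * pi * (y * of_int n) \<le> 2 * pi * (c * \<bar>of_int n\<bar>)" by (rule mult_left_mono) simp
      then have "2 * pi * y * of_int n + - (2 * pi * Im \<tau>) * \<bar>of_int n\<bar> \<le> - (pi * Im \<tau>) * \<bar>of_int n\<bar>"
        by (simp add: c_def algebra_simps)
      then have "exp (2 * pi * y * of_int n) * exp (- (2 * pi * Im \<tau>) * \<bar>of_int n\<bar>) \<le> exp (- (pi * Im \<tau>) * \<bar>of_int n\<bar>)"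
        unfolding exp_add[symmetric] by simp
      then have "K * (exp (2 * pi * y * of_int n) * exp (- (2 * pi * Im \<tau>) * \<bar>of_int n\<bar>)) \<le> K * exp (- (pi * Im \<tau>) * \<bar>of_int n\<bar>)"
        using K_bounds(4) by (rule mult_left_mono)
      then show ?thesis by (simp add: mult_ac)
    qed
    finally show ?thesis .
  qed
  have sK: "(\<lambda>n::int. K * exp (- (pi * Im \<tau>) * \<bar>of_int n\<bar>)) summable_on UNIV"
    using tau_pos by (intro summable_on_cmult_right summable_int_exp) simp
  have cR: "continuous_on {-c..c} R"
    unfolding R_def by (rule continuous_on_infsum[OF _ fb sK]) (auto simp: f_def intro!: continuous_intros)
  have geo: "S y = R y + 1 / (1 - exp (of_real (2 * pi * y)))" if y: "y < 0" "y \<ge> - c" for y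
  proof -
    define G where "G n = (if n \<ge> 0 then exp (of_real (2 * pi * y * of_int n)) else (0::complex))" for n :: int
    have ey: "norm (exp (complex_of_real (2 * pi * y))) < 1" using y by (simp add: mult_pos_neg)
    have "summable (\<lambda>n. norm (exp (complex_of_real (2 * pi * y)) ^ n))"
      using ey by (simp add: norm_power summable_geometric)
    then have "((\<lambda>n. exp (complex_of_real (2 * pi * y)) ^ n) has_sum (1 / (1 - exp (of_real (2 * pi * y))))) UNIV"
      using geometric_sums[OF ey] by (intro norm_summable_imp_has_sum) auto
    then have "((\<lambda>n. G (int n)) has_sum (1 / (1 - exp (of_real (2 * pi * y))))) UNIV"
      by (simp add: G_def exp_of_nat_mult[symmetric] mult_ac)
    then have "(G has_sum (1 / (1 - exp (of_real (2 * pi * y))))) (range int)"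
      by (subst has_sum_reindex) (auto simp: o_def)
    then have g: "(G has_sum (1 / (1 - exp (of_real (2 * pi * y))))) UNIV"
      by (rule has_sum_cong_neutral[THEN iffD1, rotated -1]) (auto simp: G_def image_iff intro: nonneg_int_cases)
    have "(\<lambda>n. f n y) summable_on UNIV"
      using fb[of y] y by (intro abs_summable_summable[OF abs_summable_int_exp[of "pi * Im \<tau>"]]) (use tau_pos in auto)
    then have "((\<lambda>n. f n y + G n) has_sum (R y + 1 / (1 - exp (of_real (2 * pi * y))))) UNIV"
      unfolding R_def by (intro has_sum_add g) simp
    moreover have "f n y + G n = s y n" for n using y by (auto simp: f_def G_def s_def algebra_simps)
    ultimately show ?thesis by (simp add: S_def infsumI)
  qed
  have "0 \<in> interior {-c..c}" using c by simp
  then have "isCont R 0" using cR by (rule continuous_on_interior[rotated])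
  then have "(R \<longlongrightarrow> R 0) (at 0)" by (simp only: isCont_def)
  then have "(R \<longlongrightarrow> R 0) (at_left 0)" by (rule tendsto_within_subset) simp
  moreover have "((\<lambda>y::real. complex_of_real y) \<longlongrightarrow> of_real 0) (at_left 0)"
    by (rule tendsto_of_real[OF tendsto_ident_at])
  ultimately have "((\<lambda>y. of_real y * R y) \<longlongrightarrow> of_real 0 * R 0) (at_left 0)"
    by (intro tendsto_mult)
  moreover have "((\<lambda>y::real. y / (1 - exp (2 * pi * y))) \<longlongrightarrow> - 1 / (2 * pi)) (at_left 0)"
  proof -
    have "((\<lambda>y::real. 1 - exp (2 * pi * y)) has_real_derivative - (2 * pi)) (at 0)"
      by (auto intro!: derivative_eq_intros)
    then have "((\<lambda>y::real. (1 - exp (2 * pi * y)) / y) \<longlongrightarrow> - (2 * pi)) (at 0)" by (simp add: has_field_derivative_iff)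
    then have "((\<lambda>y::real. inverse ((1 - exp (2 * pi * y)) / y)) \<longlongrightarrow> inverse (- (2 * pi))) (at 0)"
      by (intro tendsto_inverse) auto
    then have "((\<lambda>y::real. y / (1 - exp (2 * pi * y))) \<longlongrightarrow> inverse (- (2 * pi))) (at 0)"
      by (simp only: inverse_divide)
    then have "((\<lambda>y::real. y / (1 - exp (2 * pi * y))) \<longlongrightarrow> inverse (- (2 * pi))) (at_left 0)"
      by (rule tendsto_within_subset) simp
    moreover have "inverse (- (2 * pi)) = - 1 / (2 * pi)" by (simp add: field_simps)
    ultimately show ?thesis by (simp only:)
  qed
  then have "((\<lambda>y::real. of_real (y / (1 - exp (2 * pi * y))) :: complex) \<longlongrightarrow> of_real (- 1 / (2 * pi))) (at_left 0)"
    by (rule tendsto_of_real)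
  ultimately have "((\<lambda>y. of_real y * R y + of_real (y / (1 - exp (2 * pi * y)))) \<longlongrightarrow> of_real 0 * R 0 + of_real (- 1 / (2 * pi))) (at_left 0)"
    by (rule tendsto_add)
  moreover have "\<forall>\<^sub>F y in at_left 0. of_real y * R y + of_real (y / (1 - exp (2 * pi * y))) = of_real y * S y"
  proof -
    have "\<forall>\<^sub>F y in at_left 0. y \<in> {-c<..<0}" using c by (intro eventually_at_left_real) auto
    then show ?thesis
    proof eventually_elim
      case (elim y)
      then have "S y = R y + 1 / (1 - exp (of_real (2 * pi * y)))" by (intro geo) auto
      moreover have "complex_of_real (y / (1 - exp (2 * pi * y))) = of_real y * (1 / (1 - exp (of_real (2 * pi * y))))"
        by (simp only: of_real_divide of_real_diff of_real_1 exp_of_real times_divide_eq_right mult_1_right)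
      ultimately show ?case by (simp only: distrib_left)
    qed
  qed
  ultimately have "((\<lambda>y. of_real y * S y) \<longlongrightarrow> of_real 0 * R 0 + of_real (- 1 / (2 * pi))) (at_left 0)"
    by (rule Lim_transform_eventually)
  then show ?thesis by (simp only: of_real_0 mult_zero_left add_0_left)
qed

lemma theta_limit: "((\<lambda>y::real. theta (\<i> * y) \<tau> / of_real y) \<longlongrightarrow> \<i> * deriv (\<lambda>w. theta w \<tau>) 0) (at_left 0)"
proof -
  have "((\<lambda>w. theta w \<tau>) has_field_derivative deriv (\<lambda>w. theta w \<tau>) 0) (at 0)"
    using theta_has_derivative[OF tau_pos] by (metis DERIV_imp_deriv)
  then have "((\<lambda>w. theta w \<tau> / w) \<longlongrightarrow> deriv (\<lambda>w. theta w \<tau>) 0) (at 0)"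
    by (simp add: has_field_derivative_iff theta_zero[OF tau_pos])
  moreover have "filterlim (\<lambda>y::real. \<i> * of_real y) (at 0) (at_left 0)"
    by (auto simp: filterlim_at eventually_at_filter intro!: tendsto_eq_intros)
  ultimately have "((\<lambda>y::real. theta (\<i> * of_real y) \<tau> / (\<i> * of_real y)) \<longlongrightarrow> deriv (\<lambda>w. theta w \<tau>) 0) (at_left 0)"
    by (rule filterlim_compose)
  then have "((\<lambda>y::real. \<i> * (theta (\<i> * of_real y) \<tau> / (\<i> * of_real y))) \<longlongrightarrow> \<i> * deriv (\<lambda>w. theta w \<tau>) 0) (at_left 0)"
    by (intro tendsto_intros)
  then show ?thesis by simp
qed

text \<open>The two sides of \<open>theta_S\<close> are compared as y tends to 0 from below, where
  the simple zero of theta meets the simple pole of the series.\<close>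

lemma theta_constant: "exp (pi * \<i> * \<alpha>) * B 0 * theta (- \<alpha>) \<tau> = - \<i> * deriv (\<lambda>w. theta w \<tau>) 0 / (2 * pi)"
proof -
  have "((\<lambda>y::real. (theta (\<i> * y) \<tau> / of_real y) * (of_real y * S y)) \<longlongrightarrow> (\<i> * deriv (\<lambda>w. theta w \<tau>) 0) * (- 1 / (2 * pi))) (at_left 0)"
    by (intro tendsto_mult theta_limit S_limit)
  moreover have "\<forall>\<^sub>F y::real in at_left 0. (theta (\<i> * y) \<tau> / of_real y) * (of_real y * S y) = exp (pi * \<i> * \<alpha>) * B 0 * theta (\<i> * y - \<alpha>) \<tau>"
  proof -
    have "\<forall>\<^sub>F y in at_left 0. y \<in> {- Im \<tau><..<0}" using tau_pos by (intro eventually_at_left_real) auto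
    then show ?thesis by eventually_elim (use theta_S in auto)
  qed
  ultimately have "((\<lambda>y::real. exp (pi * \<i> * \<alpha>) * B 0 * theta (\<i> * y - \<alpha>) \<tau>) \<longlongrightarrow> (\<i> * deriv (\<lambda>w. theta w \<tau>) 0) * (- 1 / (2 * pi))) (at_left 0)"
    by (rule Lim_transform_eventually)
  moreover have "((\<lambda>y::real. exp (pi * \<i> * \<alpha>) * B 0 * theta (\<i> * y - \<alpha>) \<tau>) \<longlongrightarrow> exp (pi * \<i> * \<alpha>) * B 0 * theta (\<i> * of_real 0 - \<alpha>) \<tau>) (at_left 0)"
  proof -
    have "isCont (\<lambda>w. theta w \<tau>) w" for w using theta_has_derivative[OF tau_pos] DERIV_isCont by blast
    then have "isCont (\<lambda>y::real. theta (\<i> * of_real y - \<alpha>) \<tau>) 0"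
      by (rule isCont_o2[where g="\<lambda>w. theta w \<tau>" and f="\<lambda>y::real. \<i> * of_real y - \<alpha>", rotated]) (intro continuous_intros)
    then have "((\<lambda>y::real. theta (\<i> * of_real y - \<alpha>) \<tau>) \<longlongrightarrow> theta (\<i> * of_real 0 - \<alpha>) \<tau>) (at 0)" by (simp only: isCont_def)
    then have "((\<lambda>y::real. theta (\<i> * of_real y - \<alpha>) \<tau>) \<longlongrightarrow> theta (\<i> * of_real 0 - \<alpha>) \<tau>) (at_left 0)"
      by (rule tendsto_within_subset) simp
    then show ?thesis by (rule tendsto_mult_left)
  qed
  ultimately have "(\<i> * deriv (\<lambda>w. theta w \<tau>) 0) * (- 1 / (2 * pi)) = exp (pi * \<i> * \<alpha>) * B 0 * theta (\<i> * of_real 0 - \<alpha>) \<tau>"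
    by (rule tendsto_unique[OF trivial_limit_at_left_real])
  then have "exp (pi * \<i> * \<alpha>) * B 0 * theta (\<i> * of_real 0 - \<alpha>) \<tau> = (\<i> * deriv (\<lambda>w. theta w \<tau>) 0) * (- 1 / (2 * pi))" by (rule sym)
  moreover have "\<i> * of_real 0 - \<alpha> = - \<alpha>" by simp
  moreover have "(\<i> * x) * (- 1 / (2 * pi)) = - \<i> * x / (2 * pi)" for x :: complex by (simp only: of_real_divide of_real_minus of_real_1 times_divide_eq_right mult_minus_right mult_minus_left mult_1_right)
  ultimately show ?thesis by (simp only:)
qed

text \<open>If it vanished, \<open>theta_constant\<close> would force the derivative of theta at 0
  to vanish.\<close>

lemma theta_alpha_nonzero: "theta (- \<alpha>) \<tau> \<noteq> 0"
  using theta_constant deriv_theta_nonzero[of \<tau>] Im_tau by auto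

text \<open>\<open>G\<close> is the theta quotient with its singularity at 0 removed; on the
  imaginary axis, the sum in one lattice direction is this quotient divided by a multiple of
  y.\<close>

lemma kronecker_series:
  obtains G \<rho> where "\<rho> > 0" "\<rho> \<le> Im \<tau>" "G holomorphic_on ball 0 \<rho>" "G 0 = 1" "G has_fps_expansion theta_quotient_fps \<alpha> \<tau>"
    "\<And>y. 0 < \<bar>y\<bar> ==> \<bar>y\<bar> < \<rho> ==> S y = G (\<i> * of_real y) / of_real (- 2 * pi * y)"
proof -
  let ?\<theta> = "\<lambda>z. theta z \<tau>"
  define d where "d = deriv ?\<theta> 0"
  have d0: "d \<noteq> 0" using deriv_theta_nonzero[of \<tau>] Im_tau by (simp add: d_def)
  define k where "k z = (if z = 0 then d else ?\<theta> z / z)" for z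
  have hk: "k holomorphic_on UNIV"
  proof (rule pole_theorem_0[where g="?\<theta>" and a=0])
    show "?\<theta> holomorphic_on UNIV" by (rule theta_holomorphic[OF tau_pos])
    show "?\<theta> z = (z - 0) * k z" if "z \<in> UNIV - {0}" for z using that by (simp add: k_def)
  qed (simp_all add: k_def d_def theta_zero[OF tau_pos])
  have ck: "continuous_on UNIV k" by (rule holomorphic_on_imp_continuous_on[OF hk])
  have "isCont k 0" by (rule continuous_on_interior[OF ck]) simp
  moreover have "k 0 \<noteq> 0" using d0 by (simp add: k_def)
  ultimately obtain \<delta> where \<delta>: "\<delta> > 0" "\<forall>z. dist 0 z < \<delta> --> k z \<noteq> 0"
    using continuous_at_avoid[of 0 k 0] by blast
  \<comment> \<open>Within this radius \<open>k\<close> has no zero, and the series \<open>S\<close>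
    converges.\<close>
  define \<rho> where "\<rho> = min \<delta> (Im \<tau>)"
  have \<rho>: "\<rho> > 0" "\<rho> \<le> Im \<tau>" using \<delta> tau_pos by (auto simp: \<rho>_def)
  have kn: "k z \<noteq> 0" if "z \<in> ball 0 \<rho>" for z using \<delta>(2) that by (simp add: \<rho>_def)
  define G where "G z = ?\<theta> (z - \<alpha>) * d / (k z * theta (- \<alpha>) \<tau>)" for z
  have hG: "G holomorphic_on ball 0 \<rho>"
  proof -
    have "(?\<theta> \<circ> (\<lambda>z. z - \<alpha>)) holomorphic_on ball 0 \<rho>"
      by (rule holomorphic_on_compose_gen[OF _ theta_holomorphic[OF tau_pos, of UNIV]]) (auto intro!: holomorphic_intros)
    then have "(\<lambda>z. ?\<theta> (z - \<alpha>)) holomorphic_on ball 0 \<rho>" by (simp add: o_def)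
    moreover have "k holomorphic_on ball 0 \<rho>" using hk by (rule holomorphic_on_subset) simp
    ultimately show ?thesis unfolding G_def using kn theta_alpha_nonzero by (intro holomorphic_intros) auto
  qed
  define \<Phi> where "\<Phi> z = z * ?\<theta> (z - \<alpha>) * d / (?\<theta> z * theta (- \<alpha>) \<tau>)" for z
  have \<Phi>G: "\<Phi> z = G z" if "z \<noteq> 0" for z using that by (simp add: \<Phi>_def G_def k_def field_simps)
  have rG: "remove_sings \<Phi> z = G z" if z: "z \<in> ball 0 \<rho>" for z
  proof (rule remove_sings_eqI)
    have "isCont G z"
      by (rule continuous_on_interior[OF holomorphic_on_imp_continuous_on[OF hG]]) (use z in simp)
    then have "G \<midarrow>z\<rightarrow> G z" by (simp add: isCont_def)
    moreover have "\<forall>\<^sub>F w in at z. \<Phi> w = G w"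
      using eventually_neq_at_within[of 0 z UNIV] by eventually_elim (simp add: \<Phi>G)
    then have "\<forall>\<^sub>F w in at z. G w = \<Phi> w" by eventually_elim simp
    ultimately show "\<Phi> \<midarrow>z\<rightarrow> G z" using Lim_transform_eventually by blast
  qed
  have "theta_quotient_fps \<alpha> \<tau> = fps_expansion (remove_sings \<Phi>) 0"
    unfolding theta_quotient_fps_def \<Phi>_def[abs_def] d_def ..
  also have "\<dots> = fps_expansion G 0"
  proof (rule fps_expansion_cong)
    have "\<forall>\<^sub>F z in nhds 0. z \<in> ball 0 \<rho>" using \<rho> by (intro eventually_nhds_in_open) auto
    then show "\<forall>\<^sub>F w in nhds 0. remove_sings \<Phi> w = G w" by eventually_elim (rule rG)
  qed
  finally have "theta_quotient_fps \<alpha> \<tau> = fps_expansion G 0" .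
  then have eG: "G has_fps_expansion theta_quotient_fps \<alpha> \<tau>" using has_fps_expansion_fps_expansion[OF _ _ hG] \<rho> by simp
  have G0: "G 0 = 1" using d0 theta_alpha_nonzero by (simp add: G_def k_def)
  have "S y = G (\<i> * of_real y) / of_real (- 2 * pi * y)" if y: "0 < \<bar>y\<bar>" "\<bar>y\<bar> < \<rho>" for y
  proof -
    let ?z = "\<i> * complex_of_real y"
    have z: "?z \<in> ball 0 \<rho>" "?z \<noteq> 0" using y by (auto simp: norm_mult)
    have tz: "?\<theta> ?z = ?z * k ?z" using z by (simp add: k_def)
    have "?\<theta> ?z * S y = (- \<i> * d / (2 * pi)) / theta (- \<alpha>) \<tau> * ?\<theta> (?z - \<alpha>)"
    proof -
      define K where "K = exp (pi * \<i> * \<alpha>) * B 0"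
      have "K * theta (- \<alpha>) \<tau> = - \<i> * d / (2 * pi)" using theta_constant by (simp only: K_def d_def)
      then have "K = (- \<i> * d / (2 * pi)) / theta (- \<alpha>) \<tau>" by (metis theta_alpha_nonzero nonzero_mult_div_cancel_right)
      moreover have "?\<theta> ?z * S y = K * ?\<theta> (?z - \<alpha>)" using theta_S[of y] y \<rho> by (simp add: K_def)
      ultimately show ?thesis by simp
    qed
    then have *: "S y * (?z * k ?z) = (- \<i> * d / (2 * pi)) / theta (- \<alpha>) \<tau> * ?\<theta> (?z - \<alpha>)"
      unfolding tz by (simp only: mult.commute)
    have zk: "?z * k ?z \<noteq> 0" using z kn[OF z(1)] by simp
    have "S y = (- \<i> * d / (2 * pi)) / theta (- \<alpha>) \<tau> * ?\<theta> (?z - \<alpha>) / (?z * k ?z)"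
      using nonzero_eq_divide_eq[OF zk] * by blast
    also have "\<dots> = G ?z / of_real (- 2 * pi * y)"
    proof -
      define K where "K = k ?z"
      define t where "t = theta (- \<alpha>) \<tau>"
      define P where "P = ?\<theta> (?z - \<alpha>)"
      have "K \<noteq> 0" "t \<noteq> 0" using kn[OF z(1)] theta_alpha_nonzero by (auto simp: K_def t_def)
      then have "(- \<i> * d / (2 * pi)) / t * P / (?z * K) = P * d / (K * t) / of_real (- 2 * pi * y)"
        using y by (simp add: divide_simps) (simp add: algebra_simps)?
      then show ?thesis by (simp only: G_def K_def t_def P_def)
    qed
    finally show ?thesis .
  qed
  then show ?thesis by (rule that[OF \<rho> hG G0 eG])
qed
end

section \<open>Transversal intersections\<close>

lemma half_index:
  fixes l r :: nat
  assumes "l \<in> {1..2 * r}"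
  shows "(l + 1) div 2 \<in> {1..r} \<and> (l = 2 * ((l + 1) div 2) - 1 \<or> l = 2 * ((l + 1) div 2))"
  using assms unfolding atLeastAtMost_iff by presburger

text \<open>Each factor lives in degree 2 only, so the simplex is cut into the triangles on the
  vertices 2 j, 2 j + 1, 2 j + 2.\<close>

lemma cup_word_simplex:
  assumes "\<And>i p \<sigma>. i \<in> set w ==> p \<noteq> 2 ==> u i p \<sigma> = 0"
    and "singular_simplex (2 * length w) Y (restrict f (\<Delta> (2 * length w)))"
  shows "cup_word Y u w (2 * length w) (restrict f (\<Delta> (2 * length w))) =
    (\<Prod>j<length w. u (w ! j) 2 (restrict (f \<circ> simplex_shift (2 * j)) (\<Delta> 2)))"
  using assms
proof (induction w arbitrary: f)
  case Nil
  then show ?case by (simp add: const_cochain_def)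
next
  case (Cons i w)
  let ?n = "2 * length w"
  let ?s = "restrict f (\<Delta> (2 * length (i # w)))"
  have n: "2 * length (i # w) = Suc (Suc ?n)" by simp
  have s: "singular_simplex (Suc (Suc ?n)) Y ?s" using Cons.prems(2) unfolding n .
  have ff: "front_face 2 ?s = restrict f (\<Delta> 2)"
    using standard_simplex_mono[of 2 "Suc (Suc ?n)"] by (auto simp: front_face_def fun_eq_iff)
  have bf: "back_face (Suc (Suc ?n)) ?n ?s = restrict (f \<circ> simplex_shift 2) (\<Delta> ?n)"
    using simplex_shift_in[of _ ?n 2] by (auto simp: back_face_alt fun_eq_iff numeral_2_eq_2)
  have sb: "singular_simplex ?n Y (restrict (f \<circ> simplex_shift 2) (\<Delta> ?n))"
    using singular_simplex_back[OF s, of ?n] bf by simp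
  have "cup_word Y u (i # w) (Suc (Suc ?n)) ?s =
      (\<Sum>k\<le>Suc (Suc ?n). u i k (front_face k ?s) * cup_word Y u w (Suc (Suc ?n) - k) (back_face (Suc (Suc ?n)) (Suc (Suc ?n) - k) ?s))"
    using s by (simp add: cup_def del: sum.atMost_Suc)
  also have "\<dots> = (\<Sum>k\<in>{2}. u i k (front_face k ?s) * cup_word Y u w (Suc (Suc ?n) - k) (back_face (Suc (Suc ?n)) (Suc (Suc ?n) - k) ?s))"
    by (rule sum.mono_neutral_right) (use Cons.prems(1) in auto)
  also have "\<dots> = u i 2 (restrict f (\<Delta> 2)) * cup_word Y u w ?n (restrict (f \<circ> simplex_shift 2) (\<Delta> ?n))"
    using ff bf by (simp add: numeral_2_eq_2)
  also have "cup_word Y u w ?n (restrict (f \<circ> simplex_shift 2) (\<Delta> ?n)) =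
      (\<Prod>j<length w. u (w ! j) 2 (restrict ((f \<circ> simplex_shift 2) \<circ> simplex_shift (2 * j)) (\<Delta> 2)))"
    by (rule Cons.IH[OF _ sb]) (rule Cons.prems(1), auto)
  also have "\<dots> = (\<Prod>j<length w. u ((i # w) ! Suc j) 2 (restrict (f \<circ> simplex_shift (2 * Suc j)) (\<Delta> 2)))"
  proof (rule prod.cong[OF refl])
    fix j
    have "simplex_shift 2 \<circ> simplex_shift (2 * j) = simplex_shift (2 * Suc j)"
      by (auto simp: simplex_shift_def fun_eq_iff)
    then show "u (w ! j) 2 (restrict ((f \<circ> simplex_shift 2) \<circ> simplex_shift (2 * j)) (\<Delta> 2)) =
       u ((i # w) ! Suc j) 2 (restrict (f \<circ> simplex_shift (2 * Suc j)) (\<Delta> 2))"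
      by (simp only: comp_assoc nth_Cons_Suc)
  qed
  finally have *: "cup_word Y u (i # w) (Suc (Suc ?n)) ?s = u i 2 (restrict f (\<Delta> 2)) *
      (\<Prod>j<length w. u ((i # w) ! Suc j) 2 (restrict (f \<circ> simplex_shift (2 * Suc j)) (\<Delta> 2)))" .
  have "simplex_shift 0 = (\<lambda>t. t)" by (auto simp: simplex_shift_def)
  then have "u ((i # w) ! 0) 2 (restrict (f \<circ> simplex_shift (2 * 0)) (\<Delta> 2)) = u i 2 (restrict f (\<Delta> 2))"
    by (simp add: o_def)
  then show ?case using * n by (simp only: length_Cons prod.lessThan_Suc_shift)
qed

text \<open>In these coordinates the standard simplex becomes the part 1 \<ge> x 1 \<ge> ... \<ge> x
  n \<ge> 0 of the unit cube.\<close>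

definition tail_sum :: "nat => nat => (nat => real) => real" where
  "tail_sum n k t = (\<Sum>i\<in>{k..n}. t i)"

lemma tail_sum_props:
  assumes "t \<in> \<Delta> n"
  shows tail_sum_0: "tail_sum n 0 t = 1" and tail_sum_1: "tail_sum n (Suc 0) t = 1 - t 0"
    and tail_sum_step: "k \<le> n ==> tail_sum n k t = t k + tail_sum n (Suc k) t"
    and tail_sum_above: "n < k ==> tail_sum n k t = 0"
    and tail_sum_antimono: "k \<le> k' ==> tail_sum n k' t \<le> tail_sum n k t"
    and simplex_nonneg: "0 \<le> t i"
proof -
  show nn: "0 \<le> t i" for i using assms by (simp add: standard_simplex_def)
  show 0: "tail_sum n 0 t = 1" using assms by (simp add: tail_sum_def standard_simplex_def atLeast0AtMost)
  show st: "tail_sum n k t = t k + tail_sum n (Suc k) t" if "k \<le> n" for k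
    using that by (simp add: tail_sum_def sum.atLeast_Suc_atMost)
  show "tail_sum n (Suc 0) t = 1 - t 0" using st[of 0] 0 by simp
  show "n < k ==> tail_sum n k t = 0" by (simp add: tail_sum_def)
  show "k \<le> k' ==> tail_sum n k' t \<le> tail_sum n k t" unfolding tail_sum_def by (intro sum_mono2) (auto simp: nn)
qed

text \<open>The Kuhn triangulation of the unit cube, translated so that the barycentre of the
  simplex of the identity permutation becomes the origin.\<close>

definition kuhn_centre :: "nat => nat => real" where "kuhn_centre n l = 1 - real l / real (n + 1)"

definition kuhn :: "nat => (nat => nat) => (nat => real) => nat => real" where
  "kuhn n \<pi> t l = tail_sum n (inv_into UNIV \<pi> l) t - kuhn_centre n l"

lemma kuhn_centre_bounds: "0 < l ==> l \<le> n ==> 0 < kuhn_centre n l \<and> kuhn_centre n l < 1"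
  by (simp add: kuhn_centre_def)

lemma kuhn_centre_less: "l < l' ==> kuhn_centre n l' < kuhn_centre n l"
  by (simp add: kuhn_centre_def divide_strict_right_mono)

text \<open>The first and the last facet of each simplex lie in faces of the cube, where a
  coordinate is 1 or 0. The centre is strictly inside, so the translation moves neither value to
  0.\<close>

lemma kuhn_facet:
  assumes \<pi>: "\<pi> permutes {1..n}" and n: "0 < n" and t: "t \<in> \<Delta> n"
  shows "t 0 = 0 ==> kuhn n \<pi> t (\<pi> 1) \<noteq> 0" "t n = 0 ==> kuhn n \<pi> t (\<pi> n) \<noteq> 0"
proof -
  have i: "inv_into UNIV \<pi> (\<pi> l) = l" for l using permutes_inverses(2)[OF \<pi>] by simp
  have m: "\<pi> 1 \<in> {1..n}" "\<pi> n \<in> {1..n}" using n by (simp_all only: permutes_in_image[OF \<pi>]) auto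
  show "t 0 = 0 ==> kuhn n \<pi> t (\<pi> 1) \<noteq> 0"
    using tail_sum_1[OF t] kuhn_centre_bounds[of "\<pi> 1" n] m by (simp add: kuhn_def i)
  show "t n = 0 ==> kuhn n \<pi> t (\<pi> n) \<noteq> 0"
    using tail_sum_step[OF t, of n] tail_sum_above[OF t, of "Suc n"] kuhn_centre_bounds[of "\<pi> n" n] m by (simp add: kuhn_def i)
qed

text \<open>When t k = 0, the tail sums k and k + 1 agree, so exchanging the two coordinates that
  carry them has no effect.\<close>

lemma kuhn_swap:
  assumes \<pi>: "\<pi> permutes {1..n}" and k: "0 < k" "k < n" and t: "t \<in> \<Delta> n" "t k = 0"
  shows "kuhn n (\<pi> \<circ> Transposition.transpose k (Suc k)) t = kuhn n \<pi> t"
proof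
  fix l
  have "bij \<pi>" using permutes_bij[OF \<pi>] .
  then have "inv_into UNIV (\<pi> \<circ> Transposition.transpose k (Suc k)) = Transposition.transpose k (Suc k) \<circ> inv_into UNIV \<pi>"
    by (subst o_inv_distrib) auto
  moreover have "tail_sum n (Transposition.transpose k (Suc k) i) t = tail_sum n i t" for i
    using tail_sum_step[OF t(1), of k] t(2) k by (auto simp: Transposition.transpose_def)
  ultimately show "kuhn n (\<pi> \<circ> Transposition.transpose k (Suc k)) t l = kuhn n \<pi> t l" by (simp add: kuhn_def)
qed

text \<open>The centre has strictly decreasing coordinates, whereas the points of the simplex of
  \<pi> have coordinates that decrease weakly in the order \<pi> 1, \<pi> 2, ...\<close>

lemma kuhn_zero_imp_id:
  assumes \<pi>: "\<pi> permutes {1..n}" and t: "t \<in> \<Delta> n" and z: "\<And>l. l \<in> {1..n} ==> kuhn n \<pi> t l = 0"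
  shows "\<pi> = id"
proof -
  have ip: "inv_into UNIV \<pi> permutes {1..n}" using permutes_inv[OF \<pi>] .
  have mono: "inv_into UNIV \<pi> l < inv_into UNIV \<pi> l'" if "l < l'" "l \<in> {1..n}" "l' \<in> {1..n}" for l l'
  proof (rule ccontr)
    assume "\<not> inv_into UNIV \<pi> l < inv_into UNIV \<pi> l'"
    then have "tail_sum n (inv_into UNIV \<pi> l) t \<le> tail_sum n (inv_into UNIV \<pi> l') t" by (intro tail_sum_antimono[OF t]) simp
    then show False using z[OF that(2)] z[OF that(3)] kuhn_centre_less[OF that(1), of n] by (simp add: kuhn_def)
  qed
  have "l \<in> {1..n} --> l \<le> inv_into UNIV \<pi> l" for l
  proof (induction l)
    case (Suc l)
    show ?case
    proof
      assume l: "Suc l \<in> {1..n}"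
      have "inv_into UNIV \<pi> (Suc l) \<in> {1..n}" using permutes_in_image[OF ip] l by simp
      moreover have "l \<noteq> 0 ==> l \<le> inv_into UNIV \<pi> l \<and> inv_into UNIV \<pi> l < inv_into UNIV \<pi> (Suc l)" using Suc mono[of l "Suc l"] l by auto
      ultimately show "Suc l \<le> inv_into UNIV \<pi> (Suc l)" by (cases "l = 0") auto
    qed
  qed simp
  then have "inv_into UNIV \<pi> = id" using permutes_natset_ge[OF ip] by blast
  then show ?thesis by (metis \<pi> inv_id permutes_inv_inv)
qed

text \<open>The origin has equal barycentric coordinates in both simplices. Hence the affine homotopy between
  them does not move the boundary over it.\<close>

lemma kuhn_homotopy_nonzero:
  assumes s: "0 \<le> s" "s \<le> 1" and t: "t \<in> \<Delta> n" "i \<le> n" "t i = 0"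
  shows "\<exists>l\<in>{1..n}. (1 - s) * (t l - t 0) + s * kuhn n id t l \<noteq> 0"
proof (rule ccontr)
  assume "\<not> ?thesis"
  then have z: "(1 - s) * (t l - t 0) + s * kuhn n id t l = 0" if "l \<in> {1..n}" for l using that by auto
  \<comment> \<open>The deviation of the tail sums from those of the barycentre. The assumed zero
    becomes a recursion with zero boundary values. Run downwards from n + 1, it gives every entry,
    \<open>D 1\<close> included, the sign opposite to that of \<open>D 1\<close>. So
    \<open>D\<close> vanishes, and t is the barycentre, which contradicts
    \<open>t i = 0\<close>.\<close>
  define D where "D l = tail_sum n l t - kuhn_centre n l" for l
  have D0: "D 0 = 0" "D (Suc n) = 0" using tail_sum_0[OF t(1)] tail_sum_above[OF t(1), of "Suc n"] by (auto simp: D_def kuhn_centre_def)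
  have dt: "t l = 1 / real (n + 1) + D l - D (Suc l)" if "l \<le> n" for l
    using tail_sum_step[OF t(1) that] by (simp add: D_def kuhn_centre_def diff_divide_distrib[symmetric] field_simps)
  have rec: "D l = (1 - s) * (D (Suc l) - D 1)" if "l \<in> {1..n}" for l
  proof -
    have "(1 - s) * (D l - D (Suc l) + D 1) + s * D l = 0"
    proof -
      have "kuhn n id t l = D l" by (simp add: kuhn_def D_def)
      moreover have "t l - t 0 = D l - D (Suc l) + D 1" using dt[of l] dt[of 0] that D0 by simp
      ultimately show ?thesis using z[OF that] by simp
    qed
    then show ?thesis by (simp add: algebra_simps)
  qed
  have "D 1 = 0"
  proof (cases "n = 0")
    case False
    have neg: "D l \<le> 0" if "D 1 \<ge> 0" "l \<le> Suc n" "1 \<le> l" for l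
      using that(2,3)
    proof (induction l rule: inc_induct)
      case (step m)
      have "D (Suc m) \<le> 0" using step by simp
      then have "(1 - s) * (D (Suc m) - D 1) \<le> 0" using s that(1) by (intro mult_nonneg_nonpos) auto
      then show ?case using rec[of m] step by auto
    qed (use D0 in auto)
    have pos: "D l \<ge> 0" if "D 1 \<le> 0" "l \<le> Suc n" "1 \<le> l" for l
      using that(2,3)
    proof (induction l rule: inc_induct)
      case (step m)
      have "D (Suc m) \<ge> 0" using step by simp
      then have "(1 - s) * (D (Suc m) - D 1) \<ge> 0" using s that(1) by (intro mult_nonneg_nonneg) auto
      then show ?case using rec[of m] step by auto
    qed (use D0 in auto)
    show ?thesis using neg[of 1] pos[of 1] False by fastforce
  qed (use D0 in simp)
  have all: "D l = 0" if "l \<le> Suc n" "1 \<le> l" for l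
    using that
  proof (induction l rule: inc_induct)
    case (step m)
    then show ?case using rec[of m] \<open>D 1 = 0\<close> by auto
  qed (use D0 in auto)
  have "D i = 0" "D (Suc i) = 0" using all[of i] all[of "Suc i"] D0 t(2) by (cases "i = 0"; auto)+
  then show False using dt[OF t(2)] t(3) by simp
qed

lemma tail_sum_shift:
  assumes t: "t \<in> \<Delta> 2" and j: "2 * j + 2 \<le> n"
  shows "tail_sum n i (simplex_shift (2 * j) t) = (if i \<le> 2 * j then 1 else if i = 2 * j + 1 then t 1 + t 2 else if i = 2 * j + 2 then t 2 else 0)"
proof -
  have t2: "t 0 + t 1 + t 2 = 1" "\<And>i. 2 < i ==> t i = 0" using t by (auto simp: standard_simplex_def numeral_2_eq_2)
  have "tail_sum n i (simplex_shift (2 * j) t) = (\<Sum>k\<in>{2 * j, 2 * j + 1, 2 * j + 2} \<inter> {i..n}. t (k - 2 * j))"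
    unfolding tail_sum_def simplex_shift_def
    by (rule sum.mono_neutral_cong_right) (use t2 in \<open>auto intro!: t2(2)\<close>)
  also have "\<dots> = (\<Sum>k\<in>{2 * j, 2 * j + 1, 2 * j + 2}. if k \<in> {i..n} then t (k - 2 * j) else 0)"
    by (simp add: sum.inter_restrict)
  finally show ?thesis using t2 j by auto
qed

lemma kuhn_face_id:
  assumes t: "t \<in> \<Delta> 2" and j: "2 * j + 2 \<le> n"
  shows "kuhn n id (simplex_shift (2 * j) t) (2 * j + 1) = t 1 + t 2 - kuhn_centre n (2 * j + 1)"
    "kuhn n id (simplex_shift (2 * j) t) (2 * j + 2) = t 2 - kuhn_centre n (2 * j + 2)"
  using tail_sum_shift[OF t j] by (simp_all add: kuhn_def)

text \<open>On this triangle, the tail sums before 2 j + 1 are 1 and those after 2 j + 2 are 0. The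
  two coordinates of the centre lie strictly between 0 and 1 and are strictly decreasing, so they
  can be attained only by the tail sums 2 j + 1 and 2 j + 2 in this order.\<close>

lemma kuhn_face_nonid:
  assumes \<pi>: "\<pi> permutes {1..n}" and j: "2 * j + 2 \<le> n" "\<not> (\<pi> (2 * j + 1) = 2 * j + 1 \<and> \<pi> (2 * j + 2) = 2 * j + 2)"
    and t: "t \<in> \<Delta> 2"
  shows "kuhn n \<pi> (simplex_shift (2 * j) t) (2 * j + 1) \<noteq> 0 \<or> kuhn n \<pi> (simplex_shift (2 * j) t) (2 * j + 2) \<noteq> 0"
proof (rule ccontr)
  assume "\<not> ?thesis"
  then have z: "tail_sum n (inv_into UNIV \<pi> (2 * j + 1)) (simplex_shift (2 * j) t) = kuhn_centre n (2 * j + 1)"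
    "tail_sum n (inv_into UNIV \<pi> (2 * j + 2)) (simplex_shift (2 * j) t) = kuhn_centre n (2 * j + 2)" by (auto simp: kuhn_def)
  have b: "0 < kuhn_centre n (2 * j + 1)" "kuhn_centre n (2 * j + 1) < 1" "0 < kuhn_centre n (2 * j + 2)" "kuhn_centre n (2 * j + 2) < 1"
    using kuhn_centre_bounds[of "2 * j + 1" n] kuhn_centre_bounds[of "2 * j + 2" n] j by auto
  have lt: "kuhn_centre n (2 * j + 2) < kuhn_centre n (2 * j + 1)" by (rule kuhn_centre_less) simp
  have t1: "0 \<le> t 1" by (rule simplex_nonneg[OF t])
  have ne: "inv_into UNIV \<pi> (2 * j + 1) \<noteq> inv_into UNIV \<pi> (2 * j + 2)"
    using permutes_inv[OF \<pi>] by (metis Suc_n_not_le_n add_Suc_right add_left_cancel nat.inject one_add_one order_refl permutes_inj inj_eq plus_1_eq_Suc zero_neq_one)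
  have "inv_into UNIV \<pi> (2 * j + 1) \<in> {2 * j + 1, 2 * j + 2}" "inv_into UNIV \<pi> (2 * j + 2) \<in> {2 * j + 1, 2 * j + 2}"
    using z b unfolding tail_sum_shift[OF t j(1)] by (auto split: if_splits)
  then have "inv_into UNIV \<pi> (2 * j + 1) = 2 * j + 1 \<and> inv_into UNIV \<pi> (2 * j + 2) = 2 * j + 2"
    using z lt t1 ne unfolding tail_sum_shift[OF t j(1)] by (auto split: if_splits)
  then have "\<pi> (2 * j + 1) = 2 * j + 1 \<and> \<pi> (2 * j + 2) = 2 * j + 2"
    using permutes_inverses(1)[OF \<pi>] by metis
  then show False using j by simp
qed

lemma permutes_not_id:
  fixes r :: nat
  assumes \<pi>: "\<pi> permutes {1..2 * r}" "\<pi> \<noteq> id"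
  shows "\<exists>j<r. \<not> (\<pi> (2 * j + 1) = 2 * j + 1 \<and> \<pi> (2 * j + 2) = 2 * j + 2)"
proof (rule ccontr)
  assume *: "\<not> ?thesis"
  have "\<pi> l = l" for l
  proof (cases "l \<in> {1..2 * r}")
    case True
    define j where "j = (l - 1) div 2"
    have "j < r" "l = 2 * j + 1 \<or> l = 2 * j + 2" using True by (auto simp: j_def)
    then show ?thesis using * by auto
  qed (use \<pi> in \<open>simp add: permutes_def\<close>)
  then show False using \<pi>(2) by auto
qed

lemma continuous_map_coordinate: "continuous_map (subtopology (powertop_real UNIV) T) euclideanreal (\<lambda>t. t i)"
  by (intro continuous_map_from_subtopology continuous_map_product_projection) simp

lemma continuous_map_tail_sum:
  "continuous_map (subtopology (powertop_real UNIV) T) euclideanreal (\<lambda>t. tail_sum n l t)"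
  unfolding tail_sum_def by (rule continuous_map_sum) (simp, rule continuous_map_coordinate)

lemma continuous_map_kuhn: "continuous_map (subtopology (powertop_real UNIV) T) euclideanreal (\<lambda>t. kuhn n \<pi> t l)"
  unfolding kuhn_def by (intro continuous_map_diff continuous_map_tail_sum) simp

text \<open>The Kuhn triangle with a vertex order going counterclockwise around the origin.\<close>

lemma winding_kuhn_triangle:
  fixes p p' :: real
  assumes "0 < p'" "p' < p" "p < 1"
  defines "a \<equiv> Complex (- p) (- p')" and "b \<equiv> Complex (1 - p) (- p')" and "c \<equiv> Complex (1 - p) (1 - p')"
  shows "winding_number (linepath a b +++ linepath b c +++ linepath c a) 0 = 1"
proof -
  have nc: "\<not> collinear {a, b, c}"
  proof
    assume "collinear {a, b, c}"
    then obtain u where u: "\<forall>x\<in>{a, b, c}. \<forall>y\<in>{a, b, c}. \<exists>k. x - y = k *\<^sub>R u" unfolding collinear_def by blast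
    obtain k1 k2 where "b - a = k1 *\<^sub>R u" "c - b = k2 *\<^sub>R u" using u by blast
    then have "k1 * Re u = 1" "k1 * Im u = 0" "k2 * Re u = 0" "k2 * Im u = 1"
      by (auto simp: a_def b_def c_def complex_eq_iff)
    then show False by auto
  qed
  have "0 \<in> interior (convex hull {a, b, c})"
    unfolding interior_convex_hull_3_minimal[OF nc DIM_complex]
    unfolding mem_Collect_eq
  proof (intro exI conjI)
    show "(1 - p) *\<^sub>R a + (p - p') *\<^sub>R b + p' *\<^sub>R c = 0"
      by (simp add: a_def b_def c_def complex_eq_iff algebra_simps)
  qed (use assms(1-3) in auto)
  then show ?thesis using winding_number_triangle[of 0 a b c] assms by (simp add: a_def b_def)
qed

lemma simplex_edge_in:
  assumes t: "t \<in> {0..1}" and ab: "a \<noteq> b" "a \<le> p" "b \<le> p"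
  shows "simplex_edge a b t \<in> \<Delta> p"
proof -
  have "simplex_edge a b t = (\<lambda>i. (if i = a then 1 - t else 0) + (if i = b then t else 0))"
    using ab by (auto simp: simplex_edge_def fun_eq_iff)
  then have "(\<Sum>i\<le>p. simplex_edge a b t i) = 1" using ab by (simp add: sum.distrib)
  then show ?thesis using t ab by (auto simp: standard_simplex_def simplex_edge_def)
qed

lemma simplex_loop_in:
  assumes "s \<in> {0..1}"
  shows "simplex_loop s \<in> \<Delta> 2 \<and> (simplex_loop s 0 = 0 \<or> simplex_loop s 1 = 0 \<or> simplex_loop s 2 = 0)"
proof -
  have "simplex_edge a b t \<in> \<Delta> 2 \<and> (\<exists>i\<le>2. i \<noteq> a \<and> i \<noteq> b \<and> simplex_edge a b t i = 0)"
    if "t \<in> {0..1}" "(a, b) \<in> {(0,1),(1,2),(2,0)}" for a b t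
  proof -
    have ab: "a \<noteq> b" "a \<le> 2" "b \<le> 2" using that(2) by auto
    have "\<exists>i\<le>2. i \<noteq> a \<and> i \<noteq> b"
      using that(2) by (intro exI[of _ "3 - a - b"]) auto
    then show ?thesis using simplex_edge_in[OF that(1) ab] by (auto simp: simplex_edge_def)
  qed
  moreover have "i \<le> 2 \<longleftrightarrow> i = 0 \<or> i = 1 \<or> i = 2" for i :: nat by auto
  ultimately have "simplex_edge a b t \<in> \<Delta> 2 \<and> (simplex_edge a b t 0 = 0 \<or> simplex_edge a b t 1 = 0 \<or> simplex_edge a b t 2 = 0)"
    if "t \<in> {0..1}" "(a, b) \<in> {(0,1),(1,2),(2,0)}" for a b t
    using that by metis
  then show ?thesis using assms by (auto simp: simplex_loop_def joinpaths_def)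
qed

lemma affine_simplex_loop:
  fixes f :: "(nat => real) => complex"
  assumes "\<And>t. t \<in> \<Delta> 2 ==> f t = of_real (t 0) * a + of_real (t 1) * b + of_real (t 2) * c"
    and s: "s \<in> {0..1}"
  shows "f (simplex_loop s) = (linepath a b +++ linepath b c +++ linepath c a) s"
  using assms(1)[of "simplex_loop s"] simplex_loop_in[OF s]
  by (auto simp: simplex_loop_def joinpaths_def simplex_edge_def linepath_def scaleR_conv_of_real)

section \<open>The triangulated cube around a fixed point\<close>

context smooth_complete_fan begin

context
  fixes S :: "'a set" and g :: "nat => 'a"
  assumes S: "S \<in> max_cones" and g: "bij_betw g {1..r} (gens S)"
begin

abbreviation pt :: "(nat => complex) => 'a toric_point" where
  "pt z \<equiv> gl S (toric_chart N r S g z)"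

lemma SS: "S \<in> \<Sigma>" using S max_cone_in by simp

lemma toric_chart_mk: "toric_chart N r S g z = mk S (\<lambda>b. z (inv_into {1..r} g b))"
proof -
  have "(\<Prod>j=1..r. z j ^ nat \<lfloor>m \<bullet> g j\<rfloor>) = (\<Prod>b\<in>gens S. z (inv_into {1..r} g b) ^ nat \<lfloor>m \<bullet> b\<rfloor>)" for m
    by (subst prod.reindex_bij_betw[OF g, symmetric]) (use g in \<open>auto simp: bij_betw_def inv_into_f_f intro!: prod.cong\<close>)
  then show ?thesis by (simp add: toric_chart_def mk_def cong: restrict_cong)
qed

lemma g_in: "j \<in> {1..r} ==> g j \<in> gens S" using g by (auto simp: bij_betw_def)

lemma g_rays: "j \<in> {1..r} ==> g j \<in> ray_generators N \<Sigma>" using g_in by (auto simp: gens_def)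

lemma pt_U: "pt z \<in> U S" by (simp add: U_def toric_chart_mk mk_in[OF SS])

lemma pt_X: "pt z \<in> topspace X" using pt_U SS by (auto simp: topspace_X)

lemma co_pt: "j \<in> {1..r} ==> co S (pt z) (dv S (g j)) = z j"
  using g by (simp add: toric_chart_mk co_glue[OF SS mk_in[OF SS]] mk_coordinate[OF S g_in] bij_betw_def inv_into_f_f)

lemma pt_V: "j \<in> {1..r} ==> pt z \<in> V (g j) \<longleftrightarrow> z j \<noteq> 0"
  using V_chart[OF S g_rays pt_U] co_pt g_in by simp

lemma continuous_map_pt_affine:
  assumes "\<And>j. j \<in> {1..r} ==> continuous_map Y euclidean (\<lambda>t. z t j)"
  shows "continuous_map Y (affine_toric N S) (\<lambda>t. toric_chart N r S g (z t))"
  unfolding toric_chart_mk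
proof (rule continuous_map_mk[OF SS])
  fix b assume "b \<in> gens S"
  then have "inv_into {1..r} g b \<in> {1..r}" using g by (metis bij_betw_def inv_into_into)
  then show "continuous_map Y euclidean (\<lambda>t. z t (inv_into {1..r} g b))" by (rule assms)
qed

lemma continuous_map_pt:
  assumes "\<And>j. j \<in> {1..r} ==> continuous_map Y euclidean (\<lambda>t. z t j)"
  shows "continuous_map Y X (\<lambda>t. pt (z t))"
  using continuous_map_compose[OF continuous_map_pt_affine[OF assms] continuous_map_glue[OF SS]] by (simp add: o_def)

definition "origin = pt (\<lambda>_. 0)"

lemma pt_origin: "pt z = origin ==> j \<in> {1..r} ==> z j = 0"
  using co_pt[of j z] co_pt[of j "\<lambda>_. 0"] by (simp add: origin_def)

definition kz :: "(nat => real) => nat => complex" where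
  "kz x j = Complex (x (2 * j - 1)) (x (2 * j))"

lemma kz_zero_iff: "(\<forall>j\<in>{1..r}. kz x j = 0) \<longleftrightarrow> (\<forall>l\<in>{1..2 * r}. x l = 0)"
proof
  assume *: "\<forall>j\<in>{1..r}. kz x j = 0"
  show "\<forall>l\<in>{1..2 * r}. x l = 0"
  proof
    fix l assume l: "l \<in> {1..2 * r}"
    have "(l + 1) div 2 \<in> {1..r}" "l = 2 * ((l + 1) div 2) - 1 \<or> l = 2 * ((l + 1) div 2)" using half_index[OF l] by auto
    then show "x l = 0" using * unfolding kz_def by (metis complex.sel complex_eq_0 zero_complex.sel)
  qed
next
  assume *: "\<forall>l\<in>{1..2 * r}. x l = 0"
  have "x (2 * j - 1) = 0" "x (2 * j) = 0" if "j \<in> {1..r}" for j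
  proof -
    have "2 * j - 1 \<in> {1..2 * r}" "2 * j \<in> {1..2 * r}" using that by auto
    then show "x (2 * j - 1) = 0" "x (2 * j) = 0" using * by blast+
  qed
  then show "\<forall>j\<in>{1..r}. kz x j = 0" by (simp add: kz_def complex_eq_iff)
qed

lemma continuous_map_kz:
  assumes "\<And>l. continuous_map Y euclideanreal (\<lambda>t. x t l)"
  shows "continuous_map Y euclidean (\<lambda>t. kz (x t) j)"
proof -
  have "continuous_map Y euclidean (\<lambda>t. of_real (x t (2 * j - 1)) + \<i> * of_real (x t (2 * j)) :: complex)"
    using assms by (simp add: continuous_map_atin tendsto_intros)
  then show ?thesis by (simp add: kz_def Complex_eq)
qed

definition kappa :: "(nat => nat) => (nat => real) => 'a toric_point" where
  "kappa \<pi> = restrict (\<lambda>t. pt (kz (kuhn (2 * r) \<pi> t))) (\<Delta> (2 * r))"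

lemma singular_kappa: "singular_simplex (2 * r) X (kappa \<pi>)"
  using continuous_map_pt[OF continuous_map_kz[OF continuous_map_kuhn]]
  by (simp add: singular_simplex_def kappa_def)

definition Uo :: "'a toric_point set" where "Uo = topspace X - {origin}"

lemma kappa_avoids: "\<pi> permutes {1..2 * r} ==> \<pi> \<noteq> id ==> singular_simplex (2 * r) (subtopology X Uo) (kappa \<pi>)"
proof -
  assume \<pi>: "\<pi> permutes {1..2 * r}" "\<pi> \<noteq> id"
  have "pt (kz (kuhn (2 * r) \<pi> t)) \<noteq> origin" if t: "t \<in> \<Delta> (2 * r)" for t
  proof
    assume "pt (kz (kuhn (2 * r) \<pi> t)) = origin"
    then have "\<forall>j\<in>{1..r}. kz (kuhn (2 * r) \<pi> t) j = 0" using pt_origin by blast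
    then have "\<forall>l\<in>{1..2 * r}. kuhn (2 * r) \<pi> t l = 0" using kz_zero_iff by blast
    then show False using kuhn_zero_imp_id[OF \<pi>(1) t] \<pi>(2) by blast
  qed
  then show ?thesis using singular_kappa pt_X by (auto simp: singular_simplex_subtopology Uo_def kappa_def)
qed

definition perms :: "(nat => nat) set" where "perms = {\<pi>. \<pi> permutes {1..2 * r}}"

abbreviation "facet k \<pi> \<equiv> frag_of (singular_face (2 * r) k (kappa \<pi>))"

definition cube :: "'a toric_point chain" where
  "cube = (\<Sum>\<pi>\<in>perms. frag_cmul (sign \<pi>) (frag_of (kappa \<pi>)))"

lemma finite_perms: "finite perms" by (simp add: perms_def finite_permutations)

lemma id_perms: "id \<in> perms" by (simp add: perms_def permutes_id)

lemma frag_double_zero: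
  fixes F :: "'b \<Rightarrow>\<^sub>0 int"
  assumes "F = - F"
  shows "F = 0"
proof (rule poly_mapping_eqI)
  fix k
  have "Poly_Mapping.lookup F k = Poly_Mapping.lookup (- F) k" using assms by (rule arg_cong)
  then show "Poly_Mapping.lookup F k = Poly_Mapping.lookup 0 k" by simp
qed

text \<open>An inner facet k is shared by the simplices of \<pi> and of \<pi> composed with the
  transposition of k and k + 1, which have opposite signs. The sum over all permutations equals its
  own negative, and a free abelian group has no 2-torsion.\<close>

lemma cube_boundary:
  assumes r: "r > 0"
  shows "chain_boundary (2 * r) cube = (\<Sum>(k, \<pi>)\<in>{0, 2 * r} \<times> perms.
     frag_cmul ((-1) ^ k * sign \<pi>) (frag_of (singular_face (2 * r) k (kappa \<pi>))))"
proof -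
  let ?n = "2 * r"
  define F where "F k = (\<Sum>\<pi>\<in>perms. frag_cmul (sign \<pi>) (facet k \<pi>))" for k
  have inner: "F k = 0" if k: "0 < k" "k < ?n" for k
  proof -
    let ?\<tau> = "Transposition.transpose k (Suc k)"
    have \<tau>: "?\<tau> permutes {1..?n}" using k by (intro permutes_swap_id) auto
    have face: "singular_face ?n k (kappa (\<pi> \<circ> ?\<tau>)) = singular_face ?n k (kappa \<pi>)" if "\<pi> \<in> perms" for \<pi>
    proof
      fix t
      have "kuhn ?n (\<pi> \<circ> ?\<tau>) (simplical_face k t) = kuhn ?n \<pi> (simplical_face k t)" if t: "t \<in> \<Delta> (?n - Suc 0)"
        using \<open>\<pi> \<in> perms\<close> k simplical_face_in_standard_simplex[of ?n k t] t
        by (intro kuhn_swap) (auto simp: perms_def simplical_face_def)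
      then show "singular_face ?n k (kappa (\<pi> \<circ> ?\<tau>)) t = singular_face ?n k (kappa \<pi>) t"
        by (simp add: singular_face_def kappa_def restrict_def)
    qed
    have "F k = (\<Sum>\<pi>\<in>perms. frag_cmul (sign (\<pi> \<circ> ?\<tau>)) (frag_of (singular_face ?n k (kappa (\<pi> \<circ> ?\<tau>)))))"
      unfolding F_def
      by (rule sum.reindex_bij_witness[of _ "\<lambda>\<pi>. \<pi> \<circ> ?\<tau>" "\<lambda>\<pi>. \<pi> \<circ> ?\<tau>"])
        (use permutes_compose[OF \<tau>] in \<open>auto simp: comp_assoc perms_def\<close>)
    also have "\<dots> = (\<Sum>\<pi>\<in>perms. - frag_cmul (sign \<pi>) (facet k \<pi>))"
    proof (rule sum.cong[OF refl])
      fix \<pi> assume \<pi>: "\<pi> \<in> perms"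
      have "permutation \<pi>" using \<pi> permutation_permutes by (auto simp: perms_def)
      then have "sign (\<pi> \<circ> ?\<tau>) = - sign \<pi>" by (simp add: sign_compose permutation_swap_id sign_swap_id)
      then show "frag_cmul (sign (\<pi> \<circ> ?\<tau>)) (frag_of (singular_face ?n k (kappa (\<pi> \<circ> ?\<tau>)))) = - frag_cmul (sign \<pi>) (facet k \<pi>)"
        by (simp add: face[OF \<pi>])
    qed
    also have "\<dots> = - F k" by (simp only: F_def sum_negf)
    finally show ?thesis by (rule frag_double_zero)
  qed
  have "chain_boundary ?n cube = (\<Sum>\<pi>\<in>perms. frag_cmul (sign \<pi>) (\<Sum>k\<le>?n. frag_cmul ((-1) ^ k) (facet k \<pi>)))"
    using r by (simp add: cube_def chain_boundary_sum chain_boundary_cmul chain_boundary_of)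
  also have "\<dots> = (\<Sum>\<pi>\<in>perms. \<Sum>k\<le>?n. frag_cmul ((-1) ^ k) (frag_cmul (sign \<pi>) (facet k \<pi>)))"
    by (simp add: frag_cmul_sum mult.commute)
  also have "\<dots> = (\<Sum>k\<le>?n. \<Sum>\<pi>\<in>perms. frag_cmul ((-1) ^ k) (frag_cmul (sign \<pi>) (facet k \<pi>)))"
    by (rule sum.swap)
  also have "\<dots> = (\<Sum>k\<le>?n. frag_cmul ((-1) ^ k) (F k))"
    by (simp add: F_def frag_cmul_sum)
  also have "\<dots> = (\<Sum>k\<in>{0, ?n}. frag_cmul ((-1) ^ k) (F k))"
    by (rule sum.mono_neutral_right) (use inner in auto)
  also have "\<dots> = (\<Sum>k\<in>{0, ?n}. \<Sum>\<pi>\<in>perms. frag_cmul ((-1) ^ k * sign \<pi>) (facet k \<pi>))"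
    by (rule sum.cong) (auto simp: F_def frag_cmul_sum)
  finally show ?thesis by (simp add: sum.cartesian_product)
qed

text \<open>One real coordinate is nonzero on the whole facet, hence so is the complex coordinate
  containing it, and the facet misses the corresponding divisor.\<close>

lemma cube_facet:
  assumes r: "r > 0" and \<pi>: "\<pi> \<in> perms" and k: "k \<in> {0, 2 * r}"
  shows "\<exists>j\<in>{1..r}. singular_simplex (2 * r - 1) (subtopology X (V (g j))) (singular_face (2 * r) k (kappa \<pi>))"
proof -
  let ?n = "2 * r"
  have p: "\<pi> permutes {1..?n}" using \<pi> by (simp add: perms_def)
  define l where "l = (if k = 0 then \<pi> 1 else \<pi> ?n)"
  have l: "l \<in> {1..?n}" using permutes_in_image[OF p] r by (auto simp: l_def)
  define j where "j = (l + 1) div 2"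
  have j: "j \<in> {1..r}" "l = 2 * j - 1 \<or> l = 2 * j" using half_index[OF l] by (auto simp: j_def)
  have "singular_face ?n k (kappa \<pi>) t \<in> V (g j)" if t: "t \<in> \<Delta> (?n - 1)" for t
  proof -
    let ?t = "simplical_face k t"
    have tt: "?t \<in> \<Delta> ?n" "?t k = 0"
      using simplical_face_in_standard_simplex[of ?n k t] t r k by (auto simp: simplical_face_def)
    have "kuhn ?n \<pi> ?t l \<noteq> 0" using kuhn_facet[OF p _ tt(1)] tt(2) r k by (auto simp: l_def)
    then have "kz (kuhn ?n \<pi> ?t) j \<noteq> 0" using j(2) by (auto simp: kz_def complex_eq_iff)
    then show ?thesis using pt_V[OF j(1)] t tt by (simp add: singular_face_def kappa_def)
  qed
  moreover have "singular_simplex (?n - 1) X (singular_face ?n k (kappa \<pi>))"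
    using singular_simplex_singular_face[OF singular_kappa, of k \<pi>] r k by auto
  ultimately show ?thesis by (intro bexI[OF _ j(1)]) (simp add: singular_simplex_subtopology image_subset_iff)
qed

lemma local_eq: "j \<in> {1..r} ==> local_equation N \<Sigma> S (g j) (dv S (g j))"
  using dv_dual_monoid[OF S g_in] dv_inner[OF SS] g_in by (auto simp: local_equation_def gens_def)

text \<open>The word splits into factors on triangles. For \<pi> other than the identity, some
  triangle misses its divisor and the factor is 0; for the identity, each triangle winds once around
  0 in its own coordinate.\<close>

lemma cube_value:
  fixes u :: "'a => 'a toric_point cochain" and w :: "'a list"
  assumes w: "length w = r" "\<And>j. j < r ==> w ! j = g (Suc j)"
    and deg: "\<And>i p \<sigma>. i \<in> set w ==> p \<noteq> 2 ==> u i p \<sigma> = 0"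
    and van: "\<And>i. i \<in> set w ==> vanishes_on X (u i) (V i)"
    and wind: "\<And>i m \<sigma>. i \<in> set w ==> local_equation N \<Sigma> S i m ==> singular_simplex 2 (affine_toric N S) \<sigma> ==>
       punctured \<sigma> m ==>
       u i 2 (simplex_map 2 (gl S) \<sigma>) = loop_winding \<sigma> m"
    and \<pi>: "\<pi> \<in> perms"
  shows "cup_word X u w (2 * r) (kappa \<pi>) = (if \<pi> = id then 1 else 0)"
proof -
  let ?n = "2 * r"
  let ?f = "\<lambda>t. pt (kz (kuhn ?n \<pi> t))"
  let ?F = "\<lambda>j. restrict (?f \<circ> simplex_shift (2 * j)) (\<Delta> 2)"
  have p: "\<pi> permutes {1..?n}" using \<pi> by (simp add: perms_def)
  have wj: "w ! j \<in> set w" if "j < r" for j using that w(1) nth_mem by blast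
  have val: "cup_word X u w ?n (kappa \<pi>) = (\<Prod>j<r. u (w ! j) 2 (?F j))"
    using cup_word_simplex[of w u X ?f, OF deg] singular_kappa[of \<pi>] w(1) by (simp add: kappa_def)
  have inS: "simplex_shift (2 * j) t \<in> \<Delta> ?n" if "j < r" "t \<in> \<Delta> 2" for j t
    using simplex_shift_in[OF that(2), of "2 * j"] standard_simplex_mono[of "2 * j + 2" ?n] that(1) by auto
  have cz: "continuous_map (simplex_space 2) euclidean (\<lambda>t. kz (kuhn ?n \<pi> (simplex_shift (2 * j) t)) i)" for j i
  proof (rule continuous_map_kz)
    fix l
    have "continuous_map (simplex_space 2) euclideanreal (\<lambda>t. simplex_shift (2 * j) t i)" for i
      by (cases "i < 2 * j") (auto simp: simplex_shift_def intro: continuous_map_coordinate)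
    then show "continuous_map (simplex_space 2) euclideanreal (\<lambda>t. kuhn ?n \<pi> (simplex_shift (2 * j) t) l)"
      unfolding kuhn_def tail_sum_def by (intro continuous_map_diff, intro continuous_map_sum) auto
  qed
  show ?thesis
  proof (cases "\<pi> = id")
    case False
    obtain j where j: "j < r" "\<not> (\<pi> (2 * j + 1) = 2 * j + 1 \<and> \<pi> (2 * j + 2) = 2 * j + 2)"
      using permutes_not_id[OF p False] by auto
    have "?F j t \<in> V (g (Suc j))" if t: "t \<in> \<Delta> 2" for t
    proof -
      have "kz (kuhn ?n \<pi> (simplex_shift (2 * j) t)) (Suc j) \<noteq> 0"
        using kuhn_face_nonid[OF p _ j(2) t] j(1) by (auto simp: kz_def complex_eq_iff)
      then show ?thesis using pt_V[of "Suc j"] j(1) t by simp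
    qed
    moreover have "singular_simplex 2 X (?F j)"
      using continuous_map_pt[OF cz] by (simp add: singular_simplex_def o_def)
    ultimately have "u (w ! j) 2 (?F j) = 0"
      using van[OF wj[OF j(1)]] w(2)[OF j(1)] unfolding vanishes_on_def image_subset_iff by (metis (no_types, lifting))
    then have "(\<Prod>j<r. u (w ! j) 2 (?F j)) = 0" using j(1) by (intro prod_zero) auto
    then show ?thesis using False val by simp
  next
    case True
    have "u (w ! j) 2 (?F j) = 1" if j: "j < r" for j
    proof -
      define p1 where "p1 = kuhn_centre ?n (2 * j + 1)"
      define p2 where "p2 = kuhn_centre ?n (2 * j + 2)"
      have pp: "0 < p2" "p2 < p1" "p1 < 1"
        using kuhn_centre_bounds[of "2 * j + 1" ?n] kuhn_centre_bounds[of "2 * j + 2" ?n] kuhn_centre_less[of "2 * j + 1" "2 * j + 2" ?n] j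
        by (auto simp: p1_def p2_def)
      define \<sigma> where "\<sigma> = restrict (\<lambda>t. toric_chart N r S g (kz (kuhn ?n \<pi> (simplex_shift (2 * j) t)))) (\<Delta> 2)"
      let ?m = "dv S (g (Suc j))"
      have j1: "Suc j \<in> {1..r}" using j by simp
      have \<sigma>m: "\<sigma> t ?m = Complex (t 1 + t 2 - p1) (t 2 - p2)" if t: "t \<in> \<Delta> 2" for t
      proof -
        have "\<sigma> t ?m = kz (kuhn ?n \<pi> (simplex_shift (2 * j) t)) (Suc j)"
          using t co_pt[OF j1] by (simp add: \<sigma>_def toric_chart_mk co_glue[OF SS mk_in[OF SS]])
        also have "\<dots> = Complex (kuhn ?n id (simplex_shift (2 * j) t) (2 * j + 1)) (kuhn ?n id (simplex_shift (2 * j) t) (2 * j + 2))"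
          using True by (simp add: kz_def)
        finally show ?thesis using kuhn_face_id[OF t, of j ?n] j by (simp add: p1_def p2_def)
      qed
      have s\<sigma>: "singular_simplex 2 (affine_toric N S) \<sigma>"
        using continuous_map_pt_affine[OF cz] by (simp add: singular_simplex_def \<sigma>_def)
      have F: "?F j = simplex_map 2 (gl S) \<sigma>" by (auto simp: simplex_map_def \<sigma>_def fun_eq_iff)
      have sum1: "t 0 = 1 - t 1 - t 2" if "t \<in> \<Delta> 2" for t using that by (auto simp: standard_simplex_def numeral_2_eq_2)
      have "u (w ! j) 2 (?F j) = winding_number ((\<lambda>t. \<sigma> t ?m) \<circ> simplex_loop) 0"
        unfolding F
      proof (rule wind[OF wj[OF j] _ s\<sigma>])
        show "local_equation N \<Sigma> S (w ! j) ?m" using local_eq[OF j1] w(2)[OF j] by simp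
        show "\<forall>t\<in>\<Delta> 2. t 0 = 0 \<or> t 1 = 0 \<or> t 2 = 0 --> \<sigma> t ?m \<noteq> 0"
        proof (intro ballI impI notI)
          fix t assume t: "t \<in> \<Delta> 2" "t 0 = 0 \<or> t 1 = 0 \<or> t 2 = 0" "\<sigma> t ?m = 0"
          then have "t 1 + t 2 = p1" "t 2 = p2" using \<sigma>m[OF t(1)] by (auto simp: complex_eq_iff)
          then show False using pp sum1[OF t(1)] t(2) by auto
        qed
      qed
      also have "\<dots> = winding_number (linepath (Complex (- p1) (- p2)) (Complex (1 - p1) (- p2)) +++
         linepath (Complex (1 - p1) (- p2)) (Complex (1 - p1) (1 - p2)) +++ linepath (Complex (1 - p1) (1 - p2)) (Complex (- p1) (- p2))) 0"
      proof (rule winding_number_cong)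
        fix s :: real assume "0 \<le> s" "s \<le> 1"
        then show "((\<lambda>t. \<sigma> t ?m) \<circ> simplex_loop) s = (linepath (Complex (- p1) (- p2)) (Complex (1 - p1) (- p2)) +++
         linepath (Complex (1 - p1) (- p2)) (Complex (1 - p1) (1 - p2)) +++ linepath (Complex (1 - p1) (1 - p2)) (Complex (- p1) (- p2))) s"
          unfolding o_apply
          by (intro affine_simplex_loop) (auto simp: \<sigma>m sum1 complex_eq_iff algebra_simps)
      qed
      also have "\<dots> = 1" by (rule winding_kuhn_triangle[OF pp])
      finally show ?thesis .
    qed
    then show ?thesis using True val by simp
  qed
qed

text \<open>\<open>orientation_simplex\<close> has the real coordinates t l - t 0. The affine
  homotopy to the Kuhn simplex of the identity keeps the boundary away from the fixed point.\<close>

lemma orientation_kappa: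
  "homologous_rel (2 * r) X Uo (frag_of (orientation_simplex N r \<Sigma> S g (\<lambda>_. 0))) (frag_of (kappa id))"
proof -
  let ?n = "2 * r"
  let ?D = "simplex_space ?n"
  let ?B = "{t. \<exists>i\<le>?n. t i = (0::real)}"
  let ?y = "\<lambda>s t l. (1 - s) * (t l - t 0) + s * kuhn ?n id t l"
  let ?h = "\<lambda>(s, t). pt (kz (?y s t))"
  let ?f = "\<lambda>t. pt (kz (?y 0 t))" and ?k = "\<lambda>t. pt (kz (?y 1 t))"
  have "homotopic_with (\<lambda>h. h \<in> ?B \<inter> \<Delta> ?n \<rightarrow> Uo) ?D X ?f ?k"
    unfolding homotopic_with_def
  proof (intro exI[of _ ?h] conjI ballI allI)
    have c1: "continuous_map (cylinder ?D) euclideanreal (\<lambda>x. fst x)"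
      using continuous_map_fst[of "top_of_set {0..1}" ?D] continuous_map_in_subtopology by blast
    have c2: "continuous_map (cylinder ?D) euclideanreal (\<lambda>x. snd x i)" for i
      using continuous_map_compose[OF continuous_map_snd[of "top_of_set {0..1}" ?D] continuous_map_coordinate[of "\<Delta> ?n" i]] by (simp add: o_def)
    have c3: "continuous_map (cylinder ?D) euclideanreal (\<lambda>x. ?y (fst x) (snd x) l)" for l
    proof -
      have "continuous_map (cylinder ?D) euclideanreal (\<lambda>x. tail_sum ?n (inv_into UNIV id l) (snd x))"
        unfolding tail_sum_def by (rule continuous_map_sum) (simp, rule c2)
      then show ?thesis unfolding kuhn_def
        by (intro continuous_map_add continuous_map_real_mult continuous_map_diff c1 c2) auto
    qed
    show "continuous_map (cylinder ?D) X ?h"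
      using continuous_map_pt[OF continuous_map_kz[OF c3]] by (simp add: case_prod_unfold)
    fix s :: real assume s: "s \<in> {0..1}"
    show "(\<lambda>t. ?h (s, t)) \<in> ?B \<inter> \<Delta> ?n \<rightarrow> Uo"
    proof
      fix t assume t: "t \<in> ?B \<inter> \<Delta> ?n"
      then obtain i where i: "i \<le> ?n" "t i = 0" by auto
      have "pt (kz (?y s t)) \<noteq> origin"
      proof
        assume "pt (kz (?y s t)) = origin"
        then have "\<forall>j\<in>{1..r}. kz (?y s t) j = 0" using pt_origin by blast
        then have "\<forall>l\<in>{1..?n}. ?y s t l = 0" by (rule kz_zero_iff[THEN iffD1])
        then show False using kuhn_homotopy_nonzero[of s t ?n i] s t i by auto
      qed
      then show "?h (s, t) \<in> Uo" using pt_X by (simp add: Uo_def)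
    qed
  qed auto
  \<comment> \<open>The identity simplex is a cycle relative to the boundary of the standard
    simplex; its images under the two ends of the homotopy are the simplices to be compared.\<close>
  moreover have "singular_relcycle ?n ?D (?B \<inter> \<Delta> ?n) (frag_of (restrict id (\<Delta> ?n)))"
    unfolding singular_relcycle
  proof (intro conjI)
    have sid: "singular_simplex ?n ?D (restrict id (\<Delta> ?n))"
      unfolding singular_simplex_def
      by (intro conjI continuous_map_eq[OF continuous_map_id]) auto
    then show "singular_chain ?n ?D (frag_of (restrict id (\<Delta> ?n)))" by (simp add: singular_chain_of)
    show "singular_chain (?n - 1) (subtopology ?D (?B \<inter> \<Delta> ?n)) (chain_boundary ?n (frag_of (restrict id (\<Delta> ?n))))"
    proof (cases "?n = 0")
      case False
      have "singular_simplex (?n - 1) (subtopology ?D (?B \<inter> \<Delta> ?n)) (singular_face ?n k (restrict id (\<Delta> ?n)))" if k: "k \<le> ?n" for k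
      proof -
        have "singular_face ?n k (restrict id (\<Delta> ?n)) ` \<Delta> (?n - 1) \<subseteq> ?B \<inter> \<Delta> ?n"
          using simplical_face_in_standard_simplex[of ?n k] k False by (auto simp: singular_face_def simplical_face_def intro!: exI[of _ k])
        then show ?thesis using singular_simplex_singular_face[OF sid _ k] False by (auto simp: singular_simplex_subtopology)
      qed
      then show ?thesis using False
        by (auto simp: chain_boundary_of intro!: singular_chain_sum singular_chain_cmul simp: singular_chain_of)
    qed (simp add: chain_boundary_def)
  qed
  ultimately have "homologous_rel ?n X Uo (chain_map ?n ?f (frag_of (restrict id (\<Delta> ?n)))) (chain_map ?n ?k (frag_of (restrict id (\<Delta> ?n))))"
    by (rule homotopic_imp_homologous_rel_chain_maps)
  moreover have "simplex_map ?n ?f (restrict id (\<Delta> ?n)) = orientation_simplex N r \<Sigma> S g (\<lambda>_. 0)"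
  proof -
    have "kz (?y 0 t) = (\<lambda>j. 0 + of_real (t (2 * j - 1) - t 0) + \<i> * of_real (t (2 * j) - t 0))" for t
      by (rule ext) (simp add: kz_def complex_eq_iff)
    then have "?f = (\<lambda>t. pt (\<lambda>j. 0 + of_real (t (2 * j - 1) - t 0) + \<i> * of_real (t (2 * j) - t 0)))"
      by (simp only:)
    then show ?thesis
      by (simp only: simplex_map_def orientation_simplex_def) (auto simp: restrict_def fun_eq_iff)
  qed
  moreover have "simplex_map ?n ?k (restrict id (\<Delta> ?n)) = kappa id"
    by (auto simp: simplex_map_def kappa_def fun_eq_iff)
  ultimately show ?thesis by simp
qed

text \<open>A point on all divisors of \<open>S\<close> lies in the chart of a maximal cone
  containing all generators of \<open>S\<close>, so in the chart of \<open>S\<close> itself, where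
  all its coordinates vanish.\<close>

lemma cover_Uo: "Uo \<subseteq> (\<Union>j\<in>{1..r}. V (g j))"
proof
  fix p assume p: "p \<in> Uo"
  show "p \<in> (\<Union>j\<in>{1..r}. V (g j))"
  proof (rule ccontr)
    assume "p \<notin> (\<Union>j\<in>{1..r}. V (g j))"
    then have n: "p \<notin> V d" if "d \<in> gens S" for d
    proof -
      have "d \<in> g ` {1..r}" using that by (simp only: bij_betw_imp_surj_on[OF g])
      then obtain j where "j \<in> {1..r}" "d = g j" by (rule imageE)
      then show ?thesis using \<open>p \<notin> (\<Union>j\<in>{1..r}. V (g j))\<close> by blast
    qed
    obtain S' where S': "S' \<in> max_cones" "p \<in> U S'" using p by (auto simp: Uo_def max_cover)
    have "gens S \<subseteq> gens S'" using V_chart[OF S'(1) _ S'(2)] n by (auto simp: gens_def)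
    then have pS: "p \<in> U S" using max_cone_unique[OF S S'(1)] S' by simp
    have "co S p (dv S d) = 0" if "d \<in> gens S" for d using V_chart[OF S _ pS, of d] n that by (auto simp: gens_def)
    then have "mk S (\<lambda>b. co S p (dv S b)) = mk S (\<lambda>b. 0)" by (simp add: mk_def cong: prod.cong restrict_cong)
    then have "co S p = toric_chart N r S g (\<lambda>_. 0)" using point_eq_mk[OF S co_in[OF pS]] by (simp add: toric_chart_mk)
    then have "p = origin" using pS by (metis glue_co origin_def)
    then show False using p by (simp add: Uo_def)
  qed
qed

text \<open>Up to a boundary, the cycle is the cube plus a chain off the fixed point whose boundary
  consists of outer facets of the cube. Each of these facets, and each small simplex of that chain,
  misses one of the divisors, so only the cube counts.\<close>

lemma cup_word_max_cone:
  fixes u :: "'a => 'a toric_point cochain" and w :: "'a list"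
  assumes w: "length w = r" "\<And>j. j < r ==> w ! j = g (Suc j)"
    and coc: "\<And>i. i \<in> set w ==> u i \<in> cocycles X"
    and deg: "\<And>i p \<sigma>. i \<in> set w ==> p \<noteq> 2 ==> u i p \<sigma> = 0"
    and van: "\<And>i. i \<in> set w ==> vanishes_on X (u i) (V i)"
    and wind: "\<And>i m \<sigma>. i \<in> set w ==> local_equation N \<Sigma> S i m ==> singular_simplex 2 (affine_toric N S) \<sigma> ==>
       punctured \<sigma> m ==>
       u i 2 (simplex_map 2 (gl S) \<sigma>) = loop_winding \<sigma> m"
    and c: "singular_relcycle (2 * r) X {} c"
    and fund: "homologous_rel (2 * r) X Uo c (frag_of (orientation_simplex N r \<Sigma> S g (\<lambda>_. 0)))"
  shows "cochain_eval (cup_word X u w (2 * r)) c = 1"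
proof -
  let ?n = "2 * r" and ?a = "cup_word X u w"
  have a: "?a \<in> cocycles X" using coc by (rule cocycles_cup_word)
  have cyc: "singular_chain ?n X c" "chain_boundary ?n c = 0" using c by (auto simp: singular_cycle)
  have gw: "g j \<in> set w" if "j \<in> {1..r}" for j
    using w(2)[of "j - 1"] w(1) that by (metis Suc_pred' Suc_le_lessD atLeastAtMost_iff less_eq_Suc_le nth_mem One_nat_def diff_less_Suc le_imp_less_Suc not_less_eq)
  have "homologous_rel ?n X Uo c (frag_of (kappa id))" using homologous_rel_trans[OF orientation_kappa fund] .
  then obtain d e where de: "singular_chain (Suc ?n) X d" "singular_chain ?n (subtopology X Uo) e"
    "chain_boundary (Suc ?n) d + e = c - frag_of (kappa id)"
    by (auto simp: homologous_rel_def singular_relboundary)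
  \<comment> \<open>The remaining simplices of the cube avoid the fixed point. Subtracting them here
    compensates for completing \<open>kappa id\<close> to the cube.\<close>
  define e' where "e' = e - (\<Sum>\<pi>\<in>perms - {id}. frag_cmul (sign \<pi>) (frag_of (kappa \<pi>)))"
  have e': "singular_chain ?n (subtopology X Uo) e'" unfolding e'_def
    using kappa_avoids by (intro singular_chain_diff de singular_chain_sum singular_chain_cmul) (auto simp: singular_chain_of perms_def)
  have "cube = frag_of (kappa id) + (\<Sum>\<pi>\<in>perms - {id}. frag_cmul (sign \<pi>) (frag_of (kappa \<pi>)))"
    unfolding cube_def by (subst sum.remove[OF finite_perms id_perms]) (simp add: sign_id)
  then have ce: "c = cube + chain_boundary (Suc ?n) d + e'" using de(3) by (simp add: e'_def algebra_simps)
  have cb: "chain_boundary ?n e' = - chain_boundary ?n cube"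
  proof -
    have "chain_boundary ?n c = chain_boundary ?n cube + chain_boundary ?n (chain_boundary (Suc ?n) d) + chain_boundary ?n e'"
      by (subst ce) (simp add: chain_boundary_add)
    then show ?thesis using cyc(2) chain_boundary_boundary_alt[OF de(1)] by (simp add: eq_neg_iff_add_eq_0 add.commute)
  qed
  \<comment> \<open>For r = 0 the chain has degree 0 and there are no boundary pieces, hence the
    case distinction in the index set.\<close>
  have ev: "cochain_eval (?a ?n) e' = 0"
  proof (rule cocycle_eval_small[where \<U>="(\<lambda>j. V (g j)) ` {1..r}" and Y="subtopology X Uo" and T=Uo and p="?n"
        and I="if r = 0 then {} else {0, ?n} \<times> perms"
        and e="\<lambda>(k, \<pi>). - frag_cmul ((-1) ^ k * sign \<pi>) (facet k \<pi>)", OF a])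
    fix W assume "W \<in> (\<lambda>j. V (g j)) ` {1..r}"
    then obtain j where j: "j \<in> {1..r}" "W = V (g j)" by auto
    have "W \<subseteq> Uo" using pt_V[OF j(1), of "\<lambda>_. 0"] j by (auto simp: Uo_def V_def origin_def)
    then show "openin (subtopology X Uo) W" using open_V[OF g_rays[OF j(1)]] j by (metis inf.absorb1 openin_subtopology)
    show "?a ?n \<sigma> = 0" if "singular_simplex ?n X \<sigma>" "\<sigma> ` \<Delta> ?n \<subseteq> W" for \<sigma>
      using vanishes_on_cup_word[OF gw[OF j(1)], of X u "V (g j)"] van[OF gw[OF j(1)]] that j(2) by (auto simp: vanishes_on_def)
  next
    show "topspace (subtopology X Uo) \<subseteq> \<Union> ((\<lambda>j. V (g j)) ` {1..r})" using cover_Uo by auto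
    show "chain_boundary ?n e' = (\<Sum>i\<in>(if r = 0 then {} else {0, ?n} \<times> perms). case i of (k, \<pi>) => - frag_cmul ((-1) ^ k * sign \<pi>) (facet k \<pi>))"
    proof (cases "r = 0")
      case True then show ?thesis by (simp add: chain_boundary_def)
    next
      case False
      then have "chain_boundary ?n cube = (\<Sum>(k, \<pi>)\<in>{0, ?n} \<times> perms. frag_cmul ((-1) ^ k * sign \<pi>) (facet k \<pi>))"
        by (intro cube_boundary) simp
      then show ?thesis unfolding cb using False by (simp only: if_False sum_negf[symmetric] case_prod_unfold)
    qed
    fix i assume "i \<in> (if r = 0 then {} else {0, ?n} \<times> perms)"
    then obtain k \<pi> where i: "i = (k, \<pi>)" "r > 0" "k \<in> {0, ?n}" "\<pi> \<in> perms" by (auto split: if_splits)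
    obtain j where j: "j \<in> {1..r}" "singular_simplex (?n - 1) (subtopology X (V (g j))) (singular_face ?n k (kappa \<pi>))"
      using cube_facet[OF i(2,4,3)] by auto
    then show "\<exists>q Ua. ?n = Suc q \<and> Ua \<in> (\<lambda>j. V (g j)) ` {1..r} \<and>
       singular_chain q (subtopology X Ua) (case i of (k, \<pi>) => - frag_cmul ((-1) ^ k * sign \<pi>) (facet k \<pi>))"
      using i by (intro exI[of _ "?n - 1"] exI[of _ "V (g j)"]) (auto simp: singular_chain_of singular_chain_minus intro!: singular_chain_cmul simp del: minus_frag_cmul)
  qed (use e' in auto)
  have "cochain_eval (?a ?n) c = cochain_eval (?a ?n) cube"
    by (subst ce) (simp add: cochain_eval_add ev cocycle_eval_boundary[OF a de(1)])
  also have "\<dots> = (\<Sum>\<pi>\<in>perms. of_int (sign \<pi>) * (if \<pi> = id then 1 else 0))"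
    unfolding cube_def cochain_eval_sum cochain_eval_cmul cochain_eval_of
    by (intro sum.cong refl arg_cong2[where f="(*)"] cube_value[OF w deg van wind])
  also have "\<dots> = 1" using finite_perms id_perms by (simp add: sign_id if_distrib cong: if_cong)
  finally show ?thesis .
qed

end

end

section \<open>Paths and retractions in the charts\<close>

lemma contractible_cycle_boundary:
  assumes Y: "contractible_space Y" and p: "0 < p" and c: "singular_chain p Y c" "chain_boundary p c = 0"
  shows "\<exists>d. singular_chain (Suc p) Y d \<and> chain_boundary (Suc p) d = c"
proof -
  have "trivial_group (homology_group (int p) Y)"
    using trivial_reduced_homology_group_contractible_space[OF Y, of "int p"] p by (simp add: un_reduced_homology_group)
  moreover have "homologous_rel_set p Y {} c \<in> carrier (homology_group (int p) Y)"
    using c by (auto simp: carrier_relative_homology_group singular_cycle)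
  ultimately have "homologous_rel_set p Y {} c = singular_relboundary_set p Y {}"
    by (simp add: trivial_group_def one_relative_homology_group)
  then have "singular_relboundary p Y {} c" by (simp add: homologous_rel_set_eq_relboundary)
  then show ?thesis by (simp add: singular_boundary)
qed

text \<open>Continuous logarithms of the two paths add up.\<close>

lemma winding_number_mult:
  assumes "path p" "0 \<notin> path_image p" "path q" "0 \<notin> path_image q"
  shows "winding_number (\<lambda>t. p t * q t) 0 = winding_number p 0 + winding_number q 0"
proof -
  obtain a where a: "path a" "pathfinish a - pathstart a = 2 * of_real pi * \<i> * winding_number p 0" "\<And>t. t \<in> {0..1} ==> p t = 0 + exp (a t)"
    using winding_number_as_continuous_log[OF assms(1,2)] by blast
  obtain b where b: "path b" "pathfinish b - pathstart b = 2 * of_real pi * \<i> * winding_number q 0" "\<And>t. t \<in> {0..1} ==> q t = 0 + exp (b t)"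
    using winding_number_as_continuous_log[OF assms(3,4)] by blast
  have ab: "path (\<lambda>t. a t + b t)" using a b unfolding path_def by (intro continuous_on_add)
  have "winding_number (\<lambda>t. p t * q t) 0 = winding_number (exp \<circ> (\<lambda>t. a t + b t)) 0"
    by (rule winding_number_cong) (use a b in \<open>simp add: exp_add\<close>)
  also have "\<dots> = ((pathfinish a - pathstart a) + (pathfinish b - pathstart b)) / (2 * of_real pi * \<i>)"
    unfolding winding_number_compose_exp[OF ab] by (simp add: pathfinish_def pathstart_def algebra_simps)
  also have "\<dots> = winding_number p 0 + winding_number q 0" unfolding a b by (simp add: field_simps)
  finally show ?thesis .
qed

text \<open>The quotient need not converge where the first coordinate vanishes, but the factor in
  front forces the product to 0 because \<open>f\<close> is bounded. This gives the continuity of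
  \<open>tri\<close> at its apex.\<close>

lemma continuous_cone:
  fixes f :: "real => complex"
  assumes f: "continuous_on UNIV f" and K: "\<And>x. norm (f x) \<le> K"
  shows "continuous_on UNIV (\<lambda>z::real \<times> real. of_real (fst z) * f (snd z / fst z))"
  unfolding continuous_on_eq_continuous_at[OF open_UNIV]
proof
  fix z :: "real \<times> real"
  show "isCont (\<lambda>z. of_real (fst z) * f (snd z / fst z)) z"
  proof (cases "fst z = 0")
    case False
    have "isCont f (snd z / fst z)" using f by (simp add: continuous_on_eq_continuous_at)
    moreover have "isCont (\<lambda>z::real \<times> real. snd z / fst z) z" using False by (intro continuous_intros) auto
    ultimately have "isCont (\<lambda>z. f (snd z / fst z)) z" by (rule isCont_o2[rotated])
    then show ?thesis by (intro continuous_intros)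
  next
    case True
    have "((\<lambda>z::real \<times> real. K * \<bar>fst z\<bar>) \<longlongrightarrow> K * \<bar>fst z\<bar>) (at z)" by (intro tendsto_intros)
    then have "((\<lambda>z::real \<times> real. K * \<bar>fst z\<bar>) \<longlongrightarrow> 0) (at z)" using True by simp
    moreover have "\<forall>\<^sub>F z in at z. norm (of_real (fst z) * f (snd z / fst z)) \<le> K * \<bar>fst z\<bar>"
    proof (intro always_eventually allI)
      fix z :: "real \<times> real"
      have "norm (of_real (fst z) * f (snd z / fst z)) = \<bar>fst z\<bar> * norm (f (snd z / fst z))" by (simp add: norm_mult)
      also have "\<dots> \<le> \<bar>fst z\<bar> * K" by (intro mult_left_mono K) simp
      finally show "norm (of_real (fst z) * f (snd z / fst z)) \<le> K * \<bar>fst z\<bar>" by (simp only: mult.commute)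
    qed
    ultimately have "((\<lambda>z. of_real (fst z) * f (snd z / fst z)) \<longlongrightarrow> 0) (at z)" by (rule Lim_null_comparison[rotated])
    then show ?thesis using True by (simp add: isCont_def)
  qed
qed

lemma chain_boundary_2: "chain_boundary 2 (frag_of \<sigma>) =
    frag_of (singular_face 2 0 \<sigma>) - frag_of (singular_face 2 1 \<sigma>) + frag_of (singular_face 2 2 \<sigma>)"
proof -
  have "{..2::nat} = {0, 1, 2}" by auto
  then show ?thesis by (simp add: chain_boundary_of)
qed

lemma chain_boundary_1: "chain_boundary 1 (frag_of \<sigma>) = frag_of (singular_face 1 0 \<sigma>) - frag_of (singular_face 1 1 \<sigma>)"
proof -
  have "{..1::nat} = {0, 1}" by auto
  then show ?thesis by (simp add: chain_boundary_of)
qed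

lemma singular_face_face_2:
  shows "singular_face 1 0 (singular_face 2 0 \<sigma>) = singular_face 1 0 (singular_face 2 1 \<sigma>)"
    "singular_face 1 1 (singular_face 2 0 \<sigma>) = singular_face 1 0 (singular_face 2 2 \<sigma>)"
    "singular_face 1 1 (singular_face 2 1 \<sigma>) = singular_face 1 1 (singular_face 2 2 \<sigma>)"
proof -
  have e: "singular_face 1 i (singular_face 2 (Suc j) \<sigma>) = singular_face 1 j (singular_face 2 i \<sigma>)" if "i \<le> j" "j \<le> 1" for i j
  proof (rule ext)
    fix t
    show "singular_face 1 i (singular_face 2 (Suc j) \<sigma>) t = singular_face 1 j (singular_face 2 i \<sigma>) t"
    proof (cases "t \<in> \<Delta> 0")
      case True
      have fi: "simplical_face i t \<in> \<Delta> 1" and fj: "simplical_face j t \<in> \<Delta> 1"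
        using simplical_face_in_standard_simplex[of 1 _ t] True that by auto
      have "simplical_face (Suc j) (simplical_face i t) = simplical_face i (simplical_face j t)"
        unfolding simplical_face_def using that by fastforce
      then show ?thesis using fi fj by (simp add: singular_face_def)
    qed (simp add: singular_face_def)
  qed
  show "singular_face 1 0 (singular_face 2 0 \<sigma>) = singular_face 1 0 (singular_face 2 1 \<sigma>)" using e[of 0 0] by simp
  show "singular_face 1 1 (singular_face 2 0 \<sigma>) = singular_face 1 0 (singular_face 2 2 \<sigma>)" using e[of 0 1] by (simp add: numeral_2_eq_2)
  show "singular_face 1 1 (singular_face 2 1 \<sigma>) = singular_face 1 1 (singular_face 2 2 \<sigma>)" using e[of 1 1] by (simp add: numeral_2_eq_2)
qed

definition vtx :: "((nat => real) => 'a) => 'a" where "vtx f = f (\<lambda>i. if i = 0 then 1 else 0)"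

definition point_simplex :: "'a => (nat => real) => 'a" where "point_simplex x = restrict (\<lambda>_. x) (\<Delta> 0)"

abbreviation "src e \<equiv> vtx (singular_face 1 1 e)"

abbreviation "tgt e \<equiv> vtx (singular_face 1 0 e)"

lemma standard_simplex_0_eq: "\<Delta> 0 = {\<lambda>i. if i = 0 then 1 else 0}"
  by (auto simp: standard_simplex_def fun_eq_iff)

lemma vtx_point_simplex [simp]: "vtx (point_simplex x) = x"
  by (simp add: vtx_def point_simplex_def standard_simplex_0_eq)

lemma vtx_face: "tgt e = e (\<lambda>i. if i = 1 then 1 else 0)" "src e = e (\<lambda>i. if i = 0 then 1 else 0)"
  by (auto simp: vtx_def singular_face_def standard_simplex_0_eq simplical_face_def intro!: arg_cong[where f=e])

lemma face_point_simplex: "singular_face 1 k e = point_simplex (vtx (singular_face 1 k e))"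
  by (rule ext) (simp add: vtx_def point_simplex_def singular_face_def standard_simplex_0_eq restrict_def)

lemma standard_simplex_1_edge: "t \<in> \<Delta> 1 ==> t = simplex_edge 0 1 (t 1)"
proof
  fix i assume t: "t \<in> \<Delta> 1"
  have "{..1::nat} = {0, 1}" by auto
  then have "t 0 + t 1 = 1" "i > 1 ==> t i = 0" using t by (auto simp: standard_simplex_def)
  then show "t i = simplex_edge 0 1 (t 1) i" by (cases "i = 0"; cases "i = 1") (auto simp: simplex_edge_def)
qed

lemma vertices_in: "(\<lambda>i. if i = 1 then 1 else 0) \<in> \<Delta> 1" "(\<lambda>i. if i = 0 then 1 else 0) \<in> \<Delta> 1"
  by (auto simp: standard_simplex_def)

section \<open>The torus, its characters, and paths to its unit\<close>

context smooth_complete_fan begin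

lemma lattice_induct:
  assumes S: "S \<in> max_cones" and m: "m \<in> \<M>" and 0: "P 0"
    and add: "\<And>m b. m \<in> \<M> ==> b \<in> gens S ==> P m ==> P (m + dv S b)"
    and diff: "\<And>m b. m \<in> \<M> ==> b \<in> gens S ==> P m ==> P (m - dv S b)"
  shows "P m"
proof -
  have step: "P (x + of_int k *\<^sub>R dv S b) \<and> x + of_int k *\<^sub>R dv S b \<in> \<M>"
    if "P x" "x \<in> \<M>" "b \<in> gens S" for x k b
  proof (induction k rule: int_induct[where k=0])
    case (step1 i)
    have "x + of_int (i + 1) *\<^sub>R dv S b = (x + of_int i *\<^sub>R dv S b) + dv S b" by (simp add: scaleR_add_left)
    then show ?case using step1 add[OF _ that(3)] dv_dual[OF S that(3)] by (metis dual_lattice_add)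
  next
    case (step2 i)
    have "x + of_int (i - 1) *\<^sub>R dv S b = (x + of_int i *\<^sub>R dv S b) - dv S b" by (simp add: scaleR_diff_left)
    then show ?case using step2 diff[OF _ that(3)] dv_dual[OF S that(3)] by (metis dual_lattice_diff)
  qed (use that in auto)
  have "P (\<Sum>b\<in>J. of_int \<lfloor>m \<bullet> b\<rfloor> *\<^sub>R dv S b) \<and> (\<Sum>b\<in>J. of_int \<lfloor>m \<bullet> b\<rfloor> *\<^sub>R dv S b) \<in> \<M>" if "J \<subseteq> gens S" for J
    using finite_subset[OF that gens_finite[OF max_cone_in[OF S]]] that
  proof (induction J rule: finite_induct)
    case (insert b J)
    then have "P ((\<Sum>b\<in>J. of_int \<lfloor>m \<bullet> b\<rfloor> *\<^sub>R dv S b) + of_int \<lfloor>m \<bullet> b\<rfloor> *\<^sub>R dv S b) \<and>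
      (\<Sum>b\<in>J. of_int \<lfloor>m \<bullet> b\<rfloor> *\<^sub>R dv S b) + of_int \<lfloor>m \<bullet> b\<rfloor> *\<^sub>R dv S b \<in> \<M>"
      by (intro step) auto
    then show ?case using insert by (simp add: add.commute)
  qed (use 0 in auto)
  moreover have "(\<Sum>b\<in>gens S. of_int \<lfloor>m \<bullet> b\<rfloor> *\<^sub>R dv S b) = m"
  proof -
    have "(\<Sum>b\<in>gens S. of_int \<lfloor>m \<bullet> b\<rfloor> *\<^sub>R dv S b) = (\<Sum>b\<in>gens S. (m \<bullet> b) *\<^sub>R dv S b)"
    proof (rule sum.cong[OF refl])
      fix b assume "b \<in> gens S"
      then have "m \<bullet> b \<in> \<int>" using dual_lattice_Ints[OF m] gens_subset_N[OF max_cone_in[OF S]] by auto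
      then show "of_int \<lfloor>m \<bullet> b\<rfloor> *\<^sub>R dv S b = (m \<bullet> b) *\<^sub>R dv S b" by (auto elim!: Ints_cases)
    qed
    also have "\<dots> = m" using dual_expand[OF S] m by (simp add: dual_lattice_def)
    finally show ?thesis .
  qed
  ultimately show ?thesis by (metis order_refl)
qed

lemma zero_cone: "{0} \<in> \<Sigma>" "gens {0} = {}"
proof -
  obtain C where C: "C \<in> \<Sigma>" using union span_zero[of N] by blast
  have "convex_cone hull {} = {0::'a}" by simp
  then show "{0} \<in> \<Sigma>" "gens {0} = {}" using subset_gens_cone[OF C, of "{}"] by auto
qed

lemma zero_subset: "C \<in> \<Sigma> ==> {0} \<subseteq> C" using zero_in_cone by auto

lemma dm_zero: "dm {0} = \<M>" by (auto simp: dual_monoid_def)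

abbreviation T :: "'a toric_point set" where "T \<equiv> U {0}"

lemma char_props:
  assumes "y \<in> A {0}"
  shows char_add: "m \<in> \<M> ==> m' \<in> \<M> ==> y (m + m') = y m * y m'"
    and char_0: "y 0 = 1" and char_nonzero: "m \<in> \<M> ==> y m \<noteq> 0"
proof -
  show *: "m \<in> \<M> ==> m' \<in> \<M> ==> y (m + m') = y m * y m'" for m m'
    using affine_pointsD(2)[OF assms] by (simp add: dm_zero)
  show "y 0 = 1" using affine_pointsD(1)[OF assms] .
  then show "m \<in> \<M> ==> y m \<noteq> 0"
    using *[of m "- m"] dual_lattice_diff[of 0 N m] by auto
qed

lemma glue_mk_char: "y \<in> A {0} ==> S \<in> max_cones ==> gl S (mk S (\<lambda>b. y (dv S b))) = gl {0} y"
proof -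
  assume y: "y \<in> A {0}" and S: "S \<in> max_cones"
  note SS = max_cone_in[OF S]
  have r: "restrict y (dm S) \<in> A S" using restrict_point[OF zero_subset[OF SS] y] .
  have "mk S (\<lambda>b. y (dv S b)) = mk S (\<lambda>b. restrict y (dm S) (dv S b))"
    using dv_dual_monoid[OF S] by (simp add: mk_def cong: restrict_cong prod.cong)
  also have "\<dots> = restrict y (dm S)" using point_eq_mk[OF S r] by (rule sym)
  finally show ?thesis using glue_restrict[OF SS zero_cone(1) zero_subset[OF SS] y] by simp
qed

lemma exp_char: 
  assumes "\<And>m m'. m \<in> \<M> ==> m' \<in> \<M> ==> l (m + m') = l m + l m'"
  shows "(\<lambda>m\<in>\<M>. exp (l m)) \<in> A {0}"
proof -
  have "l 0 = 0" using assms[of 0 0] by simp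
  then show ?thesis using assms by (auto simp: affine_toric_points_def dm_zero exp_add dual_lattice_add)
qed

abbreviation zc :: "'a set => 'a => 'a toric_point => complex" where "zc S b p \<equiv> co S p (dv S b)"

lemma glue_mk_zc: "S \<in> max_cones ==> p \<in> U S ==> gl S (mk S (\<lambda>b. zc S b p)) = p"
  using point_eq_mk[OF _ co_in] by fastforce

lemma zc_glue_mk: "S \<in> max_cones ==> b \<in> gens S ==> zc S b (gl S (mk S z)) = z b"
  by (simp add: max_cone_in mk_in mk_coordinate)

lemma glue_mk_U: "S \<in> max_cones ==> gl S (mk S z) \<in> U S"
  by (simp add: U_def max_cone_in mk_in)

lemma glue_mk_cong: "(\<And>b. b \<in> gens S ==> z b = z' b) ==> gl S (mk S z) = gl S (mk S z')"
  by (simp add: mk_def cong: prod.cong)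

lemma continuous_zc:
  "S \<in> max_cones ==> b \<in> gens S ==> continuous_map (subtopology X (U S)) euclidean (zc S b)"
  using continuous_map_compose[OF continuous_map_co[OF max_cone_in] continuous_map_affine_coordinate[OF dv_dual_monoid]]
  by (simp add: o_def)

lemma continuous_glue_mk:
  assumes "S \<in> max_cones" "\<And>b. b \<in> gens S ==> continuous_map Y euclidean (\<lambda>t. z t b)"
  shows "continuous_map Y X (\<lambda>t. gl S (mk S (z t)))"
  using continuous_map_compose[OF continuous_map_mk[OF max_cone_in[OF assms(1)] assms(2)] continuous_map_glue[OF max_cone_in[OF assms(1)]]]
  by (simp add: o_def)

lemma U_face_zc:
  assumes S: "S \<in> max_cones" and F: "F \<in> \<Sigma>" "F \<subseteq> S" and p: "p \<in> U S"
  shows "p \<in> U F \<longleftrightarrow> (\<forall>b\<in>gens S - gens F. zc S b p \<noteq> 0)"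
proof -
  note SS = max_cone_in[OF S]
  have "co S p (loc S F) = mk S (\<lambda>b. zc S b p) (loc S F)" using point_eq_mk[OF S co_in[OF p]] by simp
  also have "\<dots> = (\<Prod>b\<in>gens S. zc S b p ^ nat \<lfloor>loc S F \<bullet> b\<rfloor>)" using loc(4)[OF SS F] by (simp add: mk_def)
  also have "\<dots> = (\<Prod>b\<in>gens S. if b \<in> gens F then 1 else zc S b p)"
    by (rule prod.cong) (use loc(2,3)[OF SS F] in auto)
  finally have "co S p (loc S F) \<noteq> 0 \<longleftrightarrow> (\<forall>b\<in>gens S. (if b \<in> gens F then 1 else zc S b p) \<noteq> 0)"
    using gens_finite[OF SS] by simp
  then show ?thesis using U_face_iff[OF SS F p] by auto
qed

lemma continuous_prod_snd:
  assumes "continuous_map Y euclidean f"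
  shows "continuous_map (cylinder Y) euclidean (\<lambda>x. f (snd x))"
  using continuous_map_compose[OF continuous_map_snd assms] by (simp add: o_def)

lemma continuous_prod_fst: "continuous_map (cylinder Y) euclidean (\<lambda>x. complex_of_real (fst x))"
proof -
  have "continuous_map (top_of_set {0..1::real}) euclidean complex_of_real" by (simp add: continuous_intros)
  from continuous_map_compose[OF continuous_map_fst this] show ?thesis by (simp add: o_def)
qed

lemma contractible_U:
  assumes S: "S \<in> max_cones" shows "contractible_space (subtopology X (U S))"
proof -
  note SS = max_cone_in[OF S]
  let ?Y = "subtopology X (U S)"
  let ?h = "\<lambda>x. gl S (mk S (\<lambda>b. (1 - of_real (fst x)) * zc S b (snd x)))"
  have top: "topspace ?Y = U S" using SS by (auto simp: topspace_X)
  have "continuous_map (cylinder ?Y) X ?h"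
    by (intro continuous_glue_mk[OF S] continuous_map_mult continuous_map_diff continuous_prod_fst continuous_prod_snd continuous_zc[OF S]) auto
  then have "continuous_map (cylinder ?Y) ?Y ?h"
    by (auto simp: continuous_map_in_subtopology glue_mk_U[OF S])
  moreover have "?h (0, p) = id p" if "p \<in> topspace ?Y" for p using that glue_mk_zc[OF S] top by simp
  moreover have "?h (1, p) = gl S (mk S (\<lambda>b. 0))" for p by simp
  ultimately have "homotopic_with (\<lambda>x. True) ?Y ?Y id (\<lambda>p. gl S (mk S (\<lambda>b. 0)))"
    by (subst homotopic_with) (auto intro!: exI[of _ ?h])
  then show ?thesis by (auto simp: contractible_space_def)
qed

text \<open>On the chart of \<open>F\<close> only the coordinates of the generators of
  \<open>F\<close> can vanish. Moving these to 1 brings the chart into the torus.\<close>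

definition retr :: "'a set => 'a set => 'a toric_point => 'a toric_point" where
  "retr S F p = gl S (mk S (\<lambda>b. if b \<in> gens F then 1 else zc S b p))"

lemma retr:
  assumes S: "S \<in> max_cones" and F: "F \<in> \<Sigma>" "F \<subseteq> S"
  shows retr_homotopic: "homotopic_with (\<lambda>_. True) (subtopology X (U F)) (subtopology X (U F)) id (retr S F)"
    and retr_T: "continuous_map (subtopology X (U F)) (subtopology X T) (retr S F)"
proof -
  note SS = max_cone_in[OF S]
  let ?Y = "subtopology X (U F)"
  have sub: "U F \<subseteq> U S" using U_mono[OF SS F] .
  have top: "topspace ?Y = U F" using F by (auto simp: topspace_X)
  have cz: "continuous_map ?Y euclidean (zc S b)" if "b \<in> gens S" for b
    using continuous_map_from_subtopology_mono[OF continuous_zc[OF S that] sub] .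
  let ?z = "\<lambda>s p b. if b \<in> gens F then (1 - of_real s) * zc S b p + of_real s else zc S b p"
  let ?h = "\<lambda>x. gl S (mk S (?z (fst x) (snd x)))"
  have "continuous_map (cylinder ?Y) X ?h"
  proof (rule continuous_glue_mk[OF S])
    fix b assume b: "b \<in> gens S"
    show "continuous_map (cylinder ?Y) euclidean (\<lambda>x. ?z (fst x) (snd x) b)"
    proof (cases "b \<in> gens F")
      case True
      then show ?thesis
        by simp (intro continuous_map_add continuous_map_mult continuous_map_diff continuous_prod_fst continuous_prod_snd cz b, auto)
    next
      case False
      then show ?thesis using continuous_prod_snd[OF cz[OF b]] by simp
    qed
  qed
  moreover have hF: "gl S (mk S (?z s p)) \<in> U F" if "p \<in> U F" for s p
    using U_face_zc[OF S F, of p] U_face_zc[OF S F glue_mk_U[OF S], of "?z s p"] that sub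
    by (auto simp: zc_glue_mk[OF S])
  ultimately have "continuous_map (cylinder ?Y) ?Y ?h"
    by (auto simp: continuous_map_in_subtopology)
  moreover have "?h (0, p) = id p" if "p \<in> topspace ?Y" for p
  proof -
    have "?h (0, p) = gl S (mk S (\<lambda>b. zc S b p))" by (rule glue_mk_cong) simp
    then show ?thesis using glue_mk_zc[OF S, of p] that sub top by auto
  qed
  moreover have "?h (1, p) = retr S F p" for p unfolding retr_def by (rule glue_mk_cong) simp
  ultimately show "homotopic_with (\<lambda>_. True) ?Y ?Y id (retr S F)"
    by (subst homotopic_with) (auto intro!: exI[of _ ?h])
  have "continuous_map ?Y X (retr S F)" unfolding retr_def[abs_def]
  proof (rule continuous_glue_mk[OF S])
    fix b assume b: "b \<in> gens S"
    show "continuous_map ?Y euclidean (\<lambda>p. if b \<in> gens F then 1 else zc S b p)"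
      using cz[OF b] by (cases "b \<in> gens F") auto
  qed
  moreover have "retr S F p \<in> T" if "p \<in> U F" for p
    using U_face_zc[OF S F, of p] U_face_zc[OF S zero_cone(1) zero_subset[OF SS] glue_mk_U[OF S], of "\<lambda>b. if b \<in> gens F then 1 else zc S b p"] that sub
    by (auto simp: zc_glue_mk[OF S] zero_cone retr_def)
  ultimately show "continuous_map ?Y (subtopology X T) (retr S F)" by (auto simp: continuous_map_in_subtopology)
qed

definition base :: "'a toric_point" where "base = gl {0} (\<lambda>m\<in>\<M>. 1)"

lemma base_chart: "S \<in> max_cones ==> gl S (mk S (\<lambda>b. 1)) = base"
proof -
  assume S: "S \<in> max_cones"
  have "(\<lambda>m\<in>\<M>. 1) \<in> A {0}" using exp_char[of "\<lambda>_. 0"] by simp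
  then have "gl S (mk S (\<lambda>b. (\<lambda>m\<in>\<M>. 1) (dv S b))) = base" unfolding base_def using S by (rule glue_mk_char)
  moreover have "gl S (mk S (\<lambda>b. (\<lambda>m\<in>\<M>. 1) (dv S b))) = gl S (mk S (\<lambda>b. 1))"
    by (rule glue_mk_cong) (simp add: dv_dual[OF S])
  ultimately show ?thesis by simp
qed

lemma minimal_chart:
  assumes "x \<in> topspace X"
  shows "\<exists>F\<in>\<Sigma>. x \<in> U F \<and> (\<forall>C\<in>\<Sigma>. x \<in> U C --> F \<subseteq> C)"
proof -
  have "\<exists>F. F \<in> \<Sigma> \<and> x \<in> U F" using assms by (auto simp: topspace_X)
  then obtain F where F: "F \<in> \<Sigma> \<and> x \<in> U F" and min: "\<And>C. C \<in> \<Sigma> \<and> x \<in> U C ==> card (gens F) \<le> card (gens C)"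
    using ex_has_least_nat[of "\<lambda>F. F \<in> \<Sigma> \<and> x \<in> U F" _ "\<lambda>F. card (gens F)"] by blast
  have "F \<subseteq> C" if C: "C \<in> \<Sigma>" "x \<in> U C" for C
  proof -
    have FC: "F \<inter> C \<in> \<Sigma>" "x \<in> U (F \<inter> C)" using F C Int_in_fan[of F C] U_Int[of F C] by auto
    have "gens (F \<inter> C) = gens F"
      using card_subset_eq[of "gens F" "gens (F \<inter> C)"] min[of "F \<inter> C"] FC F gens_finite card_mono[of "gens F" "gens (F \<inter> C)"]
      by (simp add: gens_Int le_antisym)
    then show ?thesis using gens_inj[OF FC(1)] F by blast
  qed
  then show ?thesis using F by blast
qed

lemma continuous_simplex_coordinate:
  "continuous_map (subtopology (powertop_real UNIV) D) euclidean (\<lambda>t. complex_of_real (t i))"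
proof -
  have "continuous_map euclideanreal euclidean complex_of_real" by (simp add: continuous_intros)
  from continuous_map_compose[OF continuous_map_coordinate this] show ?thesis by (simp add: o_def)
qed

lemma continuous_map_exp:
  fixes f :: "'b => complex"
  shows "continuous_map Y euclidean f ==> continuous_map Y euclidean (\<lambda>x. exp (f x))"
  by (simp add: continuous_map_atin tendsto_exp)

text \<open>The path is built in the smallest chart around \<open>x\<close>, so that it stays in
  every chart containing \<open>x\<close>. Coordinates that may vanish are joined to 1 linearly; the
  others are nonzero at \<open>x\<close> and are joined to 1 along a logarithm, which keeps them
  nonzero.\<close>

lemma path_to_base:
  assumes x: "x \<in> topspace X"
  shows "\<exists>\<rho>. singular_simplex 1 X \<rho> \<and> singular_face 1 0 \<rho> = point_simplex x \<and> singular_face 1 1 \<rho> = point_simplex base \<and>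
    (\<forall>C\<in>\<Sigma>. x \<in> U C --> \<rho> ` \<Delta> 1 \<subseteq> U C)"
proof -
  obtain F where F: "F \<in> \<Sigma>" "x \<in> U F" "\<And>C. C \<in> \<Sigma> ==> x \<in> U C ==> F \<subseteq> C" using minimal_chart[OF x] by blast
  obtain S where S: "S \<in> max_cones" "gens F \<subseteq> gens S" using max_cone_above[OF F(1)] by blast
  note SS = max_cone_in[OF S(1)]
  have FS: "F \<subseteq> S" using gens_mono_iff[OF F(1) SS] S by simp
  have xS: "x \<in> U S" using U_mono[OF SS F(1) FS] F by auto
  define z where "z t b = (if b \<in> gens F then 1 - of_real (t 1) + of_real (t 1) * zc S b x else exp (of_real (t 1) * Ln (zc S b x)))"
    for t :: "nat => real" and b
  define \<rho> where "\<rho> = restrict (\<lambda>t. gl S (mk S (z t))) (\<Delta> 1)"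
  have "continuous_map (simplex_space 1) X (\<lambda>t. gl S (mk S (z t)))"
  proof (rule continuous_glue_mk[OF S(1)])
    fix b assume "b \<in> gens S"
    show "continuous_map (simplex_space 1) euclidean (\<lambda>t. z t b)"
      unfolding z_def
      by (cases "b \<in> gens F"; simp; intro continuous_map_add continuous_map_diff continuous_map_mult continuous_map_exp continuous_simplex_coordinate; simp)
  qed
  then have "singular_simplex 1 X \<rho>" by (simp add: singular_simplex_def \<rho>_def)
  moreover have "gl S (mk S (z (\<lambda>i. if i = 1 then 1 else 0))) = x"
  proof -
    have "gl S (mk S (z (\<lambda>i. if i = 1 then 1 else 0))) = gl S (mk S (\<lambda>b. zc S b x))"
      using U_face_zc[OF S(1) F(1) FS xS] F(2) by (intro glue_mk_cong) (auto simp: z_def)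
    then show ?thesis using glue_mk_zc[OF S(1) xS] by simp
  qed
  then have "singular_face 1 0 \<rho> = point_simplex x"
    using face_point_simplex[of 0 \<rho>] vtx_face(1)[of \<rho>] vertices_in by (simp add: \<rho>_def)
  moreover have "gl S (mk S (z (\<lambda>i. if i = 0 then 1 else 0))) = base"
    unfolding base_chart[OF S(1), symmetric] by (rule glue_mk_cong) (simp add: z_def)
  then have "singular_face 1 1 \<rho> = point_simplex base"
    using face_point_simplex[of 1 \<rho>] vtx_face(2)[of \<rho>] vertices_in by (simp add: \<rho>_def)
  moreover have "\<rho> ` \<Delta> 1 \<subseteq> U C" if C: "C \<in> \<Sigma>" "x \<in> U C" for C
  proof -
    have "gl S (mk S (z t)) \<in> U F" for t
      using U_face_zc[OF S(1) F(1) FS glue_mk_U[OF S(1)], of "z t"] by (auto simp: zc_glue_mk[OF S(1)] z_def)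
    then have "\<rho> ` \<Delta> 1 \<subseteq> U F" by (auto simp: \<rho>_def)
    then show ?thesis using U_mono[OF C(1) F(1) F(3)[OF C]] by blast
  qed
  ultimately show ?thesis by blast
qed

end

section \<open>Principal divisors\<close>

lemma continuous_map_Pair_euclidean:
  "continuous_map Y euclidean f ==> continuous_map Y euclidean g ==> continuous_map Y euclidean (\<lambda>x. (f x, g x))"
  for f :: "'b => 'c::topological_space" and g :: "'b => 'd::topological_space"
  by (simp add: continuous_map_atin tendsto_Pair)

lemma edge_vertices: "simplex_edge 0 1 0 = (\<lambda>i. if i = 0 then 1 else 0)" "simplex_edge 0 1 1 = (\<lambda>i. if i = 1 then 1 else 0)"
  by (auto simp: simplex_edge_def fun_eq_iff)

lemma continuous_simplex_edge: "continuous_map (top_of_set {0..1}) (simplex_space 1) (simplex_edge 0 1)"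
proof -
  have "continuous_map (top_of_set {0..1}) euclideanreal (\<lambda>s. simplex_edge 0 1 s k)" for k
    by (cases "k = 0"; cases "k = 1") (auto simp: simplex_edge_def intro!: continuous_intros)
  then show ?thesis using simplex_edge_in[of _ 0 1 1]
    by (auto simp: continuous_map_in_subtopology continuous_map_componentwise_UNIV)
qed

lemma continuous_simplex_loop: "continuous_map (top_of_set {0..1}) (simplex_space 2) simplex_loop"
proof -
  have "continuous_map (top_of_set {0..1}) euclideanreal (\<lambda>s. simplex_loop s k)" for k
  proof -
    have p: "path (\<lambda>t. simplex_edge a b t k)" for a b
      by (cases "k = a"; cases "k = b") (auto simp: path_def simplex_edge_def intro!: continuous_intros)
    have "path ((\<lambda>t. simplex_edge 0 1 t k) +++ ((\<lambda>t. simplex_edge 1 2 t k) +++ (\<lambda>t. simplex_edge 2 0 t k)))"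
      by (intro path_join_imp p) (auto simp: pathfinish_def pathstart_def joinpaths_def simplex_edge_def)
    moreover have "(\<lambda>s. simplex_loop s k) = (\<lambda>t. simplex_edge 0 1 t k) +++ ((\<lambda>t. simplex_edge 1 2 t k) +++ (\<lambda>t. simplex_edge 2 0 t k))"
      by (auto simp: simplex_loop_def joinpaths_def)
    ultimately show ?thesis by (simp add: path_def)
  qed
  then show ?thesis using simplex_loop_in
    by (auto simp: continuous_map_in_subtopology continuous_map_componentwise_UNIV)
qed

text \<open>Keeps the argument of \<open>edge_ratio\<close> within the edge, whatever quotient
  \<open>tri\<close> supplies, so that the ratio is continuous and bounded on the whole real
  line.\<close>

definition clamp01 :: "real => real" where "clamp01 s = max 0 (min 1 s)"

lemma clamp01: "clamp01 s \<in> {0..1}" "s \<in> {0..1} ==> clamp01 s = s" by (auto simp: clamp01_def)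

lemma standard_simplex_2D:
  assumes "t \<in> \<Delta> 2" shows "t 0 + t 1 + t 2 = 1" "0 \<le> t i"
proof -
  have "{..2::nat} = {0, 1, 2}" by auto
  then show "t 0 + t 1 + t 2 = 1" "0 \<le> t i" using assms by (auto simp: standard_simplex_def)
qed

context smooth_complete_fan begin

text \<open>Logarithms of the characters at \<open>x\<close> that are additive in the character:
  principal values on a basis, extended linearly. Principal values for all characters would not be
  additive.\<close>

definition lam :: "'a toric_point => 'a => complex" where
  "lam x m = (let S = (SOME S. S \<in> max_cones) in \<Sum>b\<in>gens S. of_real (m \<bullet> b) * Ln (co {0} x (dv S b)))"

lemma lam_add: "lam x (m + m') = lam x m + lam x m'"
  by (simp add: lam_def Let_def inner_add_left sum.distrib distrib_right)

lemma exp_lam: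
  assumes x: "x \<in> T" and m: "m \<in> \<M>" shows "exp (lam x m) = co {0} x m"
proof -
  define S where "S = (SOME S. S \<in> max_cones)"
  have S: "S \<in> max_cones" using max_cone_above[OF zero_cone(1)] someI_ex[of "\<lambda>S. S \<in> max_cones"] unfolding S_def by blast
  note y = co_in[OF x]
  have lb: "exp (lam x (dv S b)) = co {0} x (dv S b)" if b: "b \<in> gens S" for b
  proof -
    have "lam x (dv S b) = (\<Sum>b'\<in>gens S. if b' = b then Ln (co {0} x (dv S b')) else 0)"
      unfolding lam_def S_def[symmetric] Let_def using dv_inner[OF max_cone_in[OF S] b] by (intro sum.cong) auto
    then show ?thesis using b gens_finite[OF max_cone_in[OF S]] char_nonzero[OF y dv_dual[OF S b]] by simp
  qed
  show ?thesis
  proof (rule lattice_induct[OF S m, where P="\<lambda>m. exp (lam x m) = co {0} x m"])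
    show "exp (lam x 0) = co {0} x 0" using char_0[OF y] by (simp add: lam_def Let_def)
    fix m b assume mb: "m \<in> \<M>" "b \<in> gens S" "exp (lam x m) = co {0} x m"
    show "exp (lam x (m + dv S b)) = co {0} x (m + dv S b)"
      using mb lb[OF mb(2)] char_add[OF y mb(1) dv_dual[OF S mb(2)]] by (simp add: lam_add exp_add)
    have "lam x m = lam x (m - dv S b) + lam x (dv S b)" using lam_add[of x "m - dv S b" "dv S b"] by simp
    then have "exp (lam x (m - dv S b)) * co {0} x (dv S b) = co {0} x m"
      using mb(3) lb[OF mb(2)] by (simp add: exp_add)
    moreover have "co {0} x m = co {0} x (m - dv S b) * co {0} x (dv S b)"
      using char_add[OF y dual_lattice_diff[OF mb(1) dv_dual[OF S mb(2)]] dv_dual[OF S mb(2)]] by simp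
    ultimately show "exp (lam x (m - dv S b)) = co {0} x (m - dv S b)"
      using char_nonzero[OF y dv_dual[OF S mb(2)]] by simp
  qed
qed

text \<open>By additivity of \<open>lam\<close>, the exponentials form a character for every t, so
  this is a path in the torus.\<close>

definition gam :: "'a toric_point => (nat => real) => 'a toric_point" where
  "gam x = restrict (\<lambda>t. gl {0} (\<lambda>m\<in>\<M>. exp (of_real (t 1) * lam x m))) (\<Delta> 1)"

text \<open>The edge compared with the path between its end points that is straight in the
  logarithms \<open>lam\<close>. It equals 1 at both ends.\<close>

definition edge_ratio :: "((nat => real) => 'a toric_point) => 'a => real => complex" where
  "edge_ratio e m s = co {0} (e (simplex_edge 0 1 (clamp01 s))) m *
     exp (- (of_real (1 - clamp01 s) * lam (src e) m + of_real (clamp01 s) * lam (tgt e) m))"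

text \<open>In each character, a filling of the loop formed by the edge \<open>e\<close> and the two paths
  \<^term>\<open>gam\<close> from the unit of the torus to the end points of \<open>e\<close>.\<close>

definition tri :: "((nat => real) => 'a toric_point) => 'a => (nat => real) => complex" where
  "tri e m t = (of_real (t 0) + of_real (t 1 + t 2) * edge_ratio e m (t 2 / (t 1 + t 2))) *
     exp (of_real (t 1) * lam (src e) m + of_real (t 2) * lam (tgt e) m)"

context
  fixes e :: "(nat => real) => 'a toric_point"
  assumes e: "singular_simplex 1 (subtopology X T) e"
begin

lemma e_in: "t \<in> \<Delta> 1 ==> e t \<in> T"
  using e by (auto simp: singular_simplex_subtopology)

lemma vertices_T: "tgt e \<in> T" "src e \<in> T"
  unfolding vtx_face using e_in vertices_in by auto

lemma continuous_edge_character: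
  assumes m: "m \<in> \<M>"
  shows "continuous_on {0..1} (\<lambda>s. co {0} (e (simplex_edge 0 1 s)) m)"
proof -
  have "continuous_map (simplex_space 1) (subtopology X T) e"
    using e by (simp add: singular_simplex_def)
  from continuous_map_compose[OF continuous_map_compose[OF continuous_map_compose[OF continuous_simplex_edge this] continuous_map_co[OF zero_cone(1)]]
     continuous_map_affine_coordinate[of m N "{0}"]]
  show ?thesis using m by (simp add: dm_zero o_def)
qed

lemma continuous_tri:
  assumes m: "m \<in> \<M>"
  shows "continuous_map (subtopology (powertop_real UNIV) D) euclidean (tri e m)"
proof -
  define h where "h s = co {0} (e (simplex_edge 0 1 s)) m *
     exp (- (of_real (1 - s) * lam (src e) m + of_real s * lam (tgt e) m))" for s
  have h: "continuous_on {0..1} h" unfolding h_def by (intro continuous_intros continuous_edge_character m)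
  have eh: "edge_ratio e m = h \<circ> clamp01" by (auto simp: edge_ratio_def h_def)
  have "continuous_on UNIV clamp01" unfolding clamp01_def by (intro continuous_intros)
  then have c: "continuous_on UNIV (edge_ratio e m)"
    unfolding eh using clamp01(1) by (intro continuous_on_compose continuous_on_subset[OF h]) auto
  have "bounded (h ` {0..1})" by (intro compact_imp_bounded compact_continuous_image h) simp
  then obtain K where "\<forall>x\<in>h ` {0..1}. norm x \<le> K" unfolding bounded_iff by blast
  then have K: "norm (edge_ratio e m x) \<le> K" for x using clamp01(1) by (simp add: eh)
  have "continuous_map euclidean euclidean (\<lambda>z::real \<times> real. of_real (fst z) * edge_ratio e m (snd z / fst z))"
    using continuous_cone[OF c K] by simp
  from continuous_map_compose[OF continuous_map_Pair_euclidean[OF continuous_map_add[OF continuous_map_coordinate continuous_map_coordinate] continuous_map_coordinate] this]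
  have cc: "continuous_map (subtopology (powertop_real UNIV) D) euclidean (\<lambda>t. of_real (t 1 + t 2) * edge_ratio e m (t 2 / (t 1 + t 2)))"
    by (simp add: o_def)
  show ?thesis unfolding tri_def[abs_def]
    by (intro continuous_map_mult continuous_map_add continuous_map_exp continuous_simplex_coordinate cc) auto
qed

lemma tri_boundary:
  assumes m: "m \<in> \<M>" and t: "t \<in> \<Delta> 2"
  shows tri_0: "t 0 = 0 ==> tri e m t = co {0} (e (simplex_edge 0 1 (t 2))) m"
    and tri_1: "t 1 = 0 ==> tri e m t = exp (of_real (t 2) * lam (tgt e) m)"
    and tri_2: "t 2 = 0 ==> tri e m t = exp (of_real (t 1) * lam (src e) m)"
proof -
  note s = standard_simplex_2D[OF t]
  have e1: "edge_ratio e m 1 = 1" "edge_ratio e m 0 = 1"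
    using exp_lam[OF vertices_T(1) m] exp_lam[OF vertices_T(2) m] vtx_face[of e] edge_vertices clamp01(2)[of 0] clamp01(2)[of 1]
    by (simp_all add: edge_ratio_def exp_minus)
      (metis exp_not_eq_zero right_inverse)+
  show "tri e m t = co {0} (e (simplex_edge 0 1 (t 2))) m" if "t 0 = 0"
  proof -
    have s12: "t 1 + t 2 = 1" "1 - t 2 = t 1" "t 2 \<in> {0..1}" using s(1) s(2)[of 1] s(2)[of 2] that by auto
    have c: "clamp01 (t 2 / 1) = t 2" using clamp01(2)[OF s12(3)] by simp
    let ?x = "of_real (t 1) * lam (src e) m + of_real (t 2) * lam (tgt e) m"
    have "tri e m t = co {0} (e (simplex_edge 0 1 (t 2))) m * (exp (- ?x) * exp ?x)"
      by (simp only: tri_def edge_ratio_def c that s12 of_real_0 of_real_1 add_0_left mult_1_left mult.assoc)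
    moreover have "exp (- ?x) * exp ?x = 1" unfolding exp_minus by (rule left_inverse) simp
    ultimately show ?thesis by (simp only: mult_1_right)
  qed
  show "tri e m t = exp (of_real (t 2) * lam (tgt e) m)" if "t 1 = 0"
  proof -
    have "of_real (t 0) + of_real (t 1 + t 2) * edge_ratio e m (t 2 / (t 1 + t 2)) = (1 :: complex)"
    proof (cases "t 2 = 0")
      case False
      then have "of_real (t 0) + of_real (t 1 + t 2) * edge_ratio e m (t 2 / (t 1 + t 2)) = complex_of_real (t 0 + t 1 + t 2)"
        using that e1 by simp
      then show ?thesis by (simp only: s(1) of_real_1)
    qed (use that s in simp)
    then show ?thesis unfolding tri_def using that by simp
  qed
  show "tri e m t = exp (of_real (t 1) * lam (src e) m)" if "t 2 = 0"
  proof -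
    have "of_real (t 0) + of_real (t 1 + t 2) * edge_ratio e m (t 2 / (t 1 + t 2)) = complex_of_real (t 0 + t 1 + t 2)"
      using that e1 by simp
    also have "\<dots> = 1" by (simp only: s(1) of_real_1)
    finally have *: "of_real (t 0) + of_real (t 1 + t 2) * edge_ratio e m (t 2 / (t 1 + t 2)) = (1 :: complex)" .
    show ?thesis unfolding tri_def * using that by simp
  qed
qed

text \<open>On the boundary, \<open>tri\<close> consists of values of characters along paths in the
  torus. In the interior it is filled separately for each character and may vanish, hence the
  restriction to the boundary.\<close>

lemma tri_mult:
  assumes m: "m \<in> \<M>" "m' \<in> \<M>" and t: "t \<in> \<Delta> 2" "t 0 = 0 \<or> t 1 = 0 \<or> t 2 = 0"
  shows "tri e (m + m') t = tri e m t * tri e m' t" "tri e m t \<noteq> 0"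
proof -
  have t2: "t 2 \<in> {0..1}" unfolding atLeastAtMost_iff using standard_simplex_2D(1)[OF t(1)] standard_simplex_2D(2)[OF t(1), of 0] standard_simplex_2D(2)[OF t(1), of 1]
    standard_simplex_2D(2)[OF t(1), of 2] by linarith
  have y: "co {0} (e (simplex_edge 0 1 (t 2))) \<in> A {0}"
    using co_in[OF e_in[OF simplex_edge_in[OF t2]]] by simp
  show "tri e (m + m') t = tri e m t * tri e m' t"
    using t(2) tri_boundary[OF m(1) t(1)] tri_boundary[OF m(2) t(1)] tri_boundary[OF dual_lattice_add[OF m] t(1)] char_add[OF y m]
    by (auto simp: lam_add distrib_left exp_add)
  show "tri e m t \<noteq> 0"
    using t(2) tri_boundary[OF m(1) t(1)] char_nonzero[OF y m(1)] by auto
qed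

definition wind :: "'a => complex" where "wind m = winding_number (tri e m \<circ> simplex_loop) 0"

lemma tri_loop: "m \<in> \<M> ==> path (tri e m \<circ> simplex_loop) \<and> 0 \<notin> path_image (tri e m \<circ> simplex_loop)"
  using continuous_map_compose[OF continuous_simplex_loop continuous_tri] tri_mult(2)[OF _ dual_lattice_0] simplex_loop_in
  by (auto simp: path_def path_image_def)

lemma wind_add: "m \<in> \<M> ==> m' \<in> \<M> ==> wind (m + m') = wind m + wind m'"
proof -
  assume m: "m \<in> \<M>" "m' \<in> \<M>"
  have "wind (m + m') = winding_number (\<lambda>s. (tri e m \<circ> simplex_loop) s * (tri e m' \<circ> simplex_loop) s) 0"
    unfolding wind_def by (rule winding_number_cong) (use tri_mult(1)[OF m] simplex_loop_in in auto)
  also have "\<dots> = wind m + wind m'" unfolding wind_def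
    using tri_loop[OF m(1)] tri_loop[OF m(2)] by (elim conjE) (rule winding_number_mult)
  finally show ?thesis .
qed

text \<open>Winding numbers add up under multiplication, so they are linear in the character. The
  weighted sum over the coordinates of any maximal chart is therefore the winding number of one and
  the same character.\<close>

lemma wind_expand:
  assumes S: "S \<in> max_cones" and m: "m \<in> \<M>"
  shows "wind m = (\<Sum>b\<in>gens S. of_real (m \<bullet> b) * wind (dv S b))"
proof (rule lattice_induct[OF S m, where P="\<lambda>m. wind m = (\<Sum>b\<in>gens S. of_real (m \<bullet> b) * wind (dv S b))"])
  show "wind 0 = (\<Sum>b\<in>gens S. of_real (0 \<bullet> b) * wind (dv S b))" using wind_add[of 0 0] by simp
  fix m b assume mb: "m \<in> \<M>" "b \<in> gens S" "wind m = (\<Sum>b\<in>gens S. of_real (m \<bullet> b) * wind (dv S b))"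
  have d: "(\<Sum>b'\<in>gens S. of_real (dv S b \<bullet> b') * wind (dv S b')) = wind (dv S b)"
  proof -
    have "(\<Sum>b'\<in>gens S. of_real (dv S b \<bullet> b') * wind (dv S b')) = (\<Sum>b'\<in>gens S. if b' = b then wind (dv S b') else 0)"
      using dv_inner[OF max_cone_in[OF S] mb(2)] by (intro sum.cong) auto
    then show ?thesis using mb(2) gens_finite[OF max_cone_in[OF S]] by simp
  qed
  show "wind (m + dv S b) = (\<Sum>b'\<in>gens S. of_real ((m + dv S b) \<bullet> b') * wind (dv S b'))"
    using wind_add[OF mb(1) dv_dual[OF S mb(2)]] mb(3) d by (simp add: inner_add_left distrib_right sum.distrib)
  show "wind (m - dv S b) = (\<Sum>b'\<in>gens S. of_real ((m - dv S b) \<bullet> b') * wind (dv S b'))"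
    using wind_add[OF dual_lattice_diff[OF mb(1) dv_dual[OF S mb(2)]] dv_dual[OF S mb(2)]] mb(3) d
    by (simp add: inner_diff_left left_diff_distrib sum_subtractf)
qed

text \<open>Only the coordinate characters of \<open>S\<close> are filled. Zeros of the fillings are
  allowed in the affine chart, and they are what the divisor cocycles count.\<close>

definition tri_chart :: "'a set => (nat => real) => 'a => complex" where
  "tri_chart S = restrict (\<lambda>t. mk S (\<lambda>b. tri e (dv S b) t)) (\<Delta> 2)"

lemma tri_chart_simplex: "S \<in> max_cones ==> singular_simplex 2 (affine_toric N S) (tri_chart S)"
  unfolding tri_chart_def singular_simplex_def
  using continuous_map_mk[OF max_cone_in, of S "simplex_space 2" "\<lambda>t b. tri e (dv S b) t"]
    continuous_tri dv_dual by auto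

lemma tri_chart_faces:
  assumes S: "S \<in> max_cones"
  shows "singular_face 2 0 (simplex_map 2 (gl S) (tri_chart S)) = e"
    "singular_face 2 1 (simplex_map 2 (gl S) (tri_chart S)) = gam (tgt e)"
    "singular_face 2 2 (simplex_map 2 (gl S) (tri_chart S)) = gam (src e)"
proof -
  have f: "singular_face 2 k (simplex_map 2 (gl S) (tri_chart S)) =
     restrict (\<lambda>t. gl S (mk S (\<lambda>b. tri e (dv S b) (simplical_face k t)))) (\<Delta> 1)" if "k \<le> 2" for k
    using simplical_face_in_standard_simplex[of 2 k] that
    by (auto simp: singular_face_def simplex_map_def tri_chart_def fun_eq_iff)
  have sf: "simplical_face k t \<in> \<Delta> 2" if "k \<le> 2" "t \<in> \<Delta> 1" for k t
    using simplical_face_in_standard_simplex[of 2 k t] that by simp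
  have v: "simplical_face 0 t 0 = 0" "simplical_face 0 t 2 = t 1" "simplical_face 1 t 1 = 0" "simplical_face 1 t 2 = t 1"
    "simplical_face 2 t 2 = 0" "simplical_face 2 t 1 = t 1" for t :: "nat => real"
    by (auto simp: simplical_face_def)
  have ex: "(\<lambda>m\<in>\<M>. exp (of_real c * lam x m)) \<in> A {0}" for c x
    by (rule exp_char) (simp add: lam_add distrib_left)
  show "singular_face 2 0 (simplex_map 2 (gl S) (tri_chart S)) = e"
  proof
    fix t
    show "singular_face 2 0 (simplex_map 2 (gl S) (tri_chart S)) t = e t"
    proof (cases "t \<in> \<Delta> 1")
      case True
      have "gl S (mk S (\<lambda>b. tri e (dv S b) (simplical_face 0 t))) = gl S (mk S (\<lambda>b. co {0} (e t) (dv S b)))"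
        using tri_0[OF dv_dual[OF S] sf[OF _ True]] standard_simplex_1_edge[OF True] v by (intro glue_mk_cong) auto
      also have "\<dots> = e t" using glue_mk_char[OF co_in[OF e_in[OF True]] S] e_in[OF True] by simp
      finally show ?thesis using True by (simp add: f)
    next
      case False
      then show ?thesis using e by (auto simp: f singular_simplex_def extensional_def)
    qed
  qed
  show "singular_face 2 1 (simplex_map 2 (gl S) (tri_chart S)) = gam (tgt e)"
  proof -
    have "gl S (mk S (\<lambda>b. tri e (dv S b) (simplical_face 1 t))) = gl {0} (\<lambda>m\<in>\<M>. exp (of_real (t 1) * lam (tgt e) m))"
      if t: "t \<in> \<Delta> 1" for t
    proof -
      have "gl S (mk S (\<lambda>b. tri e (dv S b) (simplical_face 1 t))) =
        gl S (mk S (\<lambda>b. (\<lambda>m\<in>\<M>. exp (of_real (t 1) * lam (tgt e) m)) (dv S b)))"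
        using tri_1[OF dv_dual[OF S] sf[OF _ t]] v dv_dual[OF S] by (intro glue_mk_cong) auto
      then show ?thesis using glue_mk_char[OF ex S] by simp
    qed
    then show ?thesis by (auto simp: f gam_def fun_eq_iff)
  qed
  show "singular_face 2 2 (simplex_map 2 (gl S) (tri_chart S)) = gam (src e)"
  proof -
    have "gl S (mk S (\<lambda>b. tri e (dv S b) (simplical_face 2 t))) = gl {0} (\<lambda>m\<in>\<M>. exp (of_real (t 1) * lam (src e) m))"
      if t: "t \<in> \<Delta> 1" for t
    proof -
      have "gl S (mk S (\<lambda>b. tri e (dv S b) (simplical_face 2 t))) =
        gl S (mk S (\<lambda>b. (\<lambda>m\<in>\<M>. exp (of_real (t 1) * lam (src e) m)) (dv S b)))"
        using tri_2[OF dv_dual[OF S] sf[OF _ t]] v dv_dual[OF S] by (intro glue_mk_cong) auto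
      then show ?thesis using glue_mk_char[OF ex S] by simp
    qed
    then show ?thesis by (auto simp: f gam_def fun_eq_iff)
  qed
qed

end

section \<open>Fillings of loops and the cochain of a character\<close>

context
  fixes m :: 'a and u :: "'a => 'a toric_point cochain"
  assumes m: "m \<in> \<M>"
    and coc: "\<And>i. i \<in> rays ==> u i \<in> cocycles X"
    and van: "\<And>i. i \<in> rays ==> vanishes_on X (u i) (V i)"
    and wind: "\<And>i S m \<sigma>. i \<in> gens S ==> S \<in> max_cones ==> local_equation N \<Sigma> S i m ==> singular_simplex 2 (affine_toric N S) \<sigma> ==>
       punctured \<sigma> m ==>
       u i 2 (simplex_map 2 (gl S) \<sigma>) = loop_winding \<sigma> m"
begin

definition prin :: "((nat => real) => 'a toric_point) => complex" where
  "prin \<sigma> = (\<Sum>i\<in>rays. of_real (m \<bullet> i) * u i 2 \<sigma>)"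

lemma prin_boundary: "singular_chain 3 X d ==> cochain_eval prin (chain_boundary 3 d) = 0"
proof -
  assume d: "singular_chain 3 X d"
  have "cochain_eval (u i 2) (chain_boundary 3 d) = 0" if "i \<in> rays" for i
    using cocycle_eval_boundary[OF coc[OF that], of 2 d] d by (simp add: numeral_3_eq_3 numeral_2_eq_2)
  then show ?thesis by (simp add: prin_def[abs_def] cochain_eval_sum_left cochain_eval_mult_left)
qed

text \<open>Since the chart of \<open>S\<close> is contractible, every loop in it has a filling, and
  any two fillings differ by a boundary, so the value depends only on the loop and the
  chart.\<close>

definition fills :: "'a set => 'a toric_point chain => complex => bool" where
  "fills S L v \<longleftrightarrow> (\<exists>B. singular_chain 2 (subtopology X (U S)) B \<and> chain_boundary 2 B = L \<and> cochain_eval prin B = v)"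

lemma fills_diff: "fills S L v ==> fills S L' v' ==> fills S (L - L') (v - v')"
proof -
  assume "fills S L v" "fills S L' v'"
  then obtain B B' where "singular_chain 2 (subtopology X (U S)) B" "chain_boundary 2 B = L" "cochain_eval prin B = v"
    "singular_chain 2 (subtopology X (U S)) B'" "chain_boundary 2 B' = L'" "cochain_eval prin B' = v'" by (auto simp: fills_def)
  then show ?thesis unfolding fills_def
    by (intro exI[of _ "B - B'"]) (simp add: singular_chain_diff chain_boundary_diff cochain_eval_diff)
qed

lemma fills_zero: "fills S 0 0" unfolding fills_def by (intro exI[of _ 0]) simp

lemma fills_minus: "fills S L v ==> fills S (- L) (- v)" using fills_diff[OF fills_zero] by fastforce

lemma fills_add: "fills S L v ==> fills S L' v' ==> fills S (L + L') (v + v')"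
  using fills_diff[OF _ fills_minus] by fastforce

lemma fills_unique:
  assumes S: "S \<in> max_cones" and f: "fills S L v" "fills S L v'" shows "v = v'"
proof -
  have "fills S 0 (v - v')" using fills_diff[OF f] by simp
  then obtain B where B: "singular_chain 2 (subtopology X (U S)) B" "chain_boundary 2 B = 0" "cochain_eval prin B = v - v'"
    by (auto simp: fills_def)
  obtain d where d: "singular_chain (Suc 2) (subtopology X (U S)) d" "chain_boundary (Suc 2) d = B"
    using contractible_cycle_boundary[OF contractible_U[OF S] _ B(1,2)] by auto
  have "singular_chain 3 X d" using d(1) by (simp add: singular_chain_subtopology)
  from prin_boundary[OF this] show ?thesis using d(2) B(3) by simp
qed

lemma fills_exists:
  assumes S: "S \<in> max_cones" and L: "singular_chain 1 (subtopology X (U S)) L" "chain_boundary 1 L = 0"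
  shows "\<exists>v. fills S L v"
  using contractible_cycle_boundary[OF contractible_U[OF S] _ L] by (auto simp: fills_def numeral_2_eq_2)

text \<open>The filling \<open>tri_chart\<close> meets only the divisors of \<open>S\<close>, and
  each contributes the winding number of its coordinate. The resulting value does not mention the
  chart.\<close>

lemma fills_edge:
  assumes e: "singular_simplex 1 (subtopology X T) e" and S: "S \<in> max_cones"
  shows "fills S (frag_of e - frag_of (gam (tgt e)) + frag_of (gam (src e))) (wind e m)"
proof -
  note SS = max_cone_in[OF S]
  let ?\<sigma> = "simplex_map 2 (gl S) (tri_chart e S)"
  have s: "singular_simplex 2 X ?\<sigma>"
    using singular_simplex_simplex_map[OF tri_chart_simplex[OF e S] continuous_map_glue[OF SS]] .
  have im: "?\<sigma> ` \<Delta> 2 \<subseteq> U S"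
    by (auto simp: simplex_map_def tri_chart_def[OF e] glue_mk_U[OF S])
  have u0: "u i 2 ?\<sigma> = 0" if i: "i \<in> rays - gens S" for i
  proof -
    have "U S \<subseteq> V i" using V_chart[OF S, of i] i unfolding rays_def by blast
    then show ?thesis using van[of i] i s im by (auto simp: vanishes_on_def)
  qed
  have ui: "u i 2 ?\<sigma> = wind e (dv S i)" if i: "i \<in> gens S" for i
  proof -
    have t: "tri_chart e S t (dv S i) = tri e (dv S i) t" if "t \<in> \<Delta> 2" for t
      using that mk_coordinate[OF S i] by (simp add: tri_chart_def[OF e])
    have "local_equation N \<Sigma> S i (dv S i)"
      using dv_dual_monoid[OF S i] dv_inner[OF SS i] i by (auto simp: local_equation_def gens_def)
    then have "u i 2 ?\<sigma> = winding_number ((\<lambda>t. tri_chart e S t (dv S i)) \<circ> simplex_loop) 0"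
      using i tri_mult(2)[OF e dv_dual[OF S i] dual_lattice_0]
      by (intro wind[OF _ S _ tri_chart_simplex[OF e S]]) (auto simp: t subsetD[OF gens_rays])
    also have "\<dots> = wind e (dv S i)" unfolding wind_def[OF e]
      by (rule winding_number_cong) (use simplex_loop_in t in auto)
    finally show ?thesis .
  qed
  have "prin ?\<sigma> = (\<Sum>i\<in>gens S. of_real (m \<bullet> i) * u i 2 ?\<sigma>)"
    unfolding prin_def by (rule sum.mono_neutral_right[OF finite_rays]) (use u0 gens_rays in auto)
  also have "\<dots> = wind e m" using wind_expand[OF e S m] ui by simp
  finally show ?thesis
    unfolding fills_def using s im tri_chart_faces[OF e S]
    by (intro exI[of _ "frag_of ?\<sigma>"]) (simp add: singular_chain_of singular_simplex_subtopology chain_boundary_2)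
qed

definition cone_off :: "'a toric_point chain => 'a toric_point chain" where
  "cone_off = frag_extend (\<lambda>f. frag_of (gam (vtx f)))"

text \<open>The correction \<open>cone_off\<close> makes the claim additive over single edges. It
  vanishes for cycles, so a cycle in the torus has one value, valid in all charts
  simultaneously.\<close>

lemma fills_torus:
  assumes L: "singular_chain 1 (subtopology X T) L"
  shows "\<exists>v. \<forall>S\<in>max_cones. fills S (L - cone_off (chain_boundary 1 L)) v"
  using L unfolding singular_chain_def
proof (induction L rule: frag_induction)
  case zero
  show ?case using fills_zero by (intro exI[of _ 0]) (simp add: cone_off_def)
next
  case (one e)
  then have e: "singular_simplex 1 (subtopology X T) e" by simp
  have *: "frag_of e - cone_off (chain_boundary 1 (frag_of e)) =
      frag_of e - frag_of (gam (tgt e)) + frag_of (gam (src e))"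
    unfolding cone_off_def chain_boundary_1 frag_extend_diff frag_extend_of by (simp only: diff_diff_eq2 diff_add_eq)
  show ?case unfolding * using fills_edge[OF e] by blast
next
  case (diff a b)
  then obtain v v' where "\<forall>S\<in>max_cones. fills S (a - cone_off (chain_boundary 1 a)) v" "\<forall>S\<in>max_cones. fills S (b - cone_off (chain_boundary 1 b)) v'"
    by blast
  then have "\<forall>S\<in>max_cones. fills S ((a - cone_off (chain_boundary 1 a)) - (b - cone_off (chain_boundary 1 b))) (v - v')"
    using fills_diff by blast
  then show ?case by (intro exI[of _ "v - v'"]) (simp add: cone_off_def chain_boundary_diff frag_extend_diff algebra_simps)
qed

text \<open>The loop lies in the chart of the common face and is homologous there to a loop in the
  torus. The homology lies in both charts and contributes the same to both values; the loop in the
  torus is covered by \<open>fills_torus\<close>.\<close>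

lemma fills_independent:
  assumes S: "S \<in> max_cones" "S' \<in> max_cones"
    and L: "singular_chain 1 (subtopology X (U S)) L" "singular_chain 1 (subtopology X (U S')) L" "chain_boundary 1 L = 0"
    and f: "fills S L v"
  shows "fills S' L v"
proof -
  let ?F = "S \<inter> S'"
  note SS = max_cone_in[OF S(1)] max_cone_in[OF S(2)]
  have F: "?F \<in> \<Sigma>" "?F \<subseteq> S" "?F \<subseteq> S'" using Int_in_fan SS by auto
  have sub: "U ?F \<subseteq> U S" "U ?F \<subseteq> U S'" using U_mono SS F by auto
  have LF: "singular_chain 1 (subtopology X (U ?F)) L"
    using L unfolding U_Int[OF SS, symmetric] by (auto simp: singular_chain_subtopology)
  let ?R = "chain_map 1 (retr S ?F) L"
  have RT: "singular_chain 1 (subtopology X T) ?R"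
    using singular_chain_chain_map[OF LF retr_T[OF S(1) F(1,2)]] .
  have bR: "chain_boundary 1 ?R = 0" using chain_boundary_chain_map[OF LF, of "retr S ?F"] L(3) by simp
  obtain w where w: "\<forall>S\<in>max_cones. fills S ?R w" using fills_torus[OF RT] bR by (auto simp: cone_off_def)
  have "homologous_rel 1 (subtopology X (U ?F)) {} (chain_map 1 id L) ?R"
  proof (rule homotopic_imp_homologous_rel_chain_maps)
    show "homotopic_with (\<lambda>h. h \<in> {} \<rightarrow> {}) (subtopology X (U ?F)) (subtopology X (U ?F)) id (retr S ?F)"
      using retr_homotopic[OF S(1) F(1,2)] by simp
    show "singular_relcycle 1 (subtopology X (U ?F)) {} L" using LF L(3) by (simp add: singular_cycle)
  qed
  then have "homologous_rel 1 (subtopology X (U ?F)) {} L ?R" using chain_map_id_gen[OF LF] by simp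
  then obtain d where d: "singular_chain 2 (subtopology X (U ?F)) d" "chain_boundary 2 d = L - ?R"
    by (auto simp: homologous_rel_def singular_boundary numeral_2_eq_2)
  have dS: "fills S (L - ?R) (cochain_eval prin d)" "fills S' (L - ?R) (cochain_eval prin d)"
  proof -
    have "singular_chain 2 (subtopology X (U S)) d" "singular_chain 2 (subtopology X (U S')) d"
      using d(1) sub unfolding singular_chain_subtopology by blast+
    then show "fills S (L - ?R) (cochain_eval prin d)" "fills S' (L - ?R) (cochain_eval prin d)"
      unfolding fills_def using d(2) by blast+
  qed
  have "fills S L (cochain_eval prin d + w)" "fills S' L (cochain_eval prin d + w)"
    using fills_add[OF dS(1), of ?R w] fills_add[OF dS(2), of ?R w] w S by auto
  then show ?thesis using fills_unique[OF S(1) f] by metis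
qed

text \<open>Each edge is closed to a loop by paths to the base point, which stay in every chart
  containing the vertex; the cochain is the value of a filling. Around a triangle the paths cancel,
  and the triangle itself is a filling.\<close>

lemma relation_cochain:
  "\<exists>\<phi>. \<forall>S\<in>max_cones. \<forall>\<sigma>. singular_simplex 2 X \<sigma> --> \<sigma> ` \<Delta> 2 \<subseteq> U S -->
     prin \<sigma> = \<phi> (singular_face 2 0 \<sigma>) - \<phi> (singular_face 2 1 \<sigma>) + \<phi> (singular_face 2 2 \<sigma>)"
proof -
  obtain R where R: "\<And>x. x \<in> topspace X ==> singular_simplex 1 X (R x) \<and> singular_face 1 0 (R x) = point_simplex x \<and>
     singular_face 1 1 (R x) = point_simplex base \<and> (\<forall>C\<in>\<Sigma>. x \<in> U C --> R x ` \<Delta> 1 \<subseteq> U C)"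
    using path_to_base by metis
  define L where "L e = frag_of e - frag_of (R (tgt e)) + frag_of (R (src e))" for e
  have L: "singular_chain 1 (subtopology X (U S)) (L e) \<and> chain_boundary 1 (L e) = 0"
    if S: "S \<in> max_cones" and e: "singular_simplex 1 X e" "e ` \<Delta> 1 \<subseteq> U S" for S e
  proof -
    note SS = max_cone_in[OF S]
    have v: "tgt e \<in> U S" "src e \<in> U S"
      unfolding vtx_face using e vertices_in by auto
    then have vX: "tgt e \<in> topspace X" "src e \<in> topspace X" using SS by (auto simp: topspace_X)
    have "singular_chain 1 (subtopology X (U S)) (L e)" unfolding L_def
      using R[OF vX(1)] R[OF vX(2)] v SS e
      by (intro singular_chain_add singular_chain_diff) (auto simp: singular_chain_of singular_simplex_subtopology)
    moreover have "chain_boundary 1 (L e) = 0"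
      unfolding L_def chain_boundary_add chain_boundary_diff chain_boundary_1
      using R[OF vX(1)] R[OF vX(2)] face_point_simplex[of 0 e] face_point_simplex[of 1 e] by simp
    ultimately show ?thesis by blast
  qed
  \<comment> \<open>The value in some maximal chart containing the edge; any other such chart gives
    the same one by \<open>fills_independent\<close>.\<close>
  define \<phi> where "\<phi> e = (SOME v. \<exists>S\<in>max_cones. e ` \<Delta> 1 \<subseteq> U S \<and> fills S (L e) v)" for e
  have \<phi>: "fills S (L e) (\<phi> e)" if S: "S \<in> max_cones" and e: "singular_simplex 1 X e" "e ` \<Delta> 1 \<subseteq> U S" for S e
  proof -
    obtain v where "fills S (L e) v" using fills_exists[OF S] L[OF S e] by blast
    then have "\<exists>v. \<exists>S\<in>max_cones. e ` \<Delta> 1 \<subseteq> U S \<and> fills S (L e) v" using S e by blast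
    from someI_ex[OF this] obtain S' where S': "S' \<in> max_cones" "e ` \<Delta> 1 \<subseteq> U S'" "fills S' (L e) (\<phi> e)"
      unfolding \<phi>_def by blast
    show ?thesis
      using fills_independent[OF S'(1) S _ _ _ S'(3)] L[OF S'(1) e(1) S'(2)] L[OF S e] by blast
  qed
  have "prin \<sigma> = \<phi> (singular_face 2 0 \<sigma>) - \<phi> (singular_face 2 1 \<sigma>) + \<phi> (singular_face 2 2 \<sigma>)"
    if S: "S \<in> max_cones" and \<sigma>: "singular_simplex 2 X \<sigma>" "\<sigma> ` \<Delta> 2 \<subseteq> U S" for S \<sigma>
  proof -
    let ?e = "\<lambda>k. singular_face 2 k \<sigma>"
    have ek: "singular_simplex 1 X (?e k) \<and> ?e k ` \<Delta> 1 \<subseteq> U S" if "k \<le> 2" for k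
    proof -
      have "singular_simplex 2 (subtopology X (U S)) \<sigma>" using \<sigma> by (simp add: singular_simplex_subtopology)
      from singular_simplex_singular_face[OF this _ that] have "singular_simplex 1 (subtopology X (U S)) (?e k)" by simp
      then show ?thesis by (simp add: singular_simplex_subtopology)
    qed
    have "fills S (L (?e 0) - L (?e 1) + L (?e 2)) (\<phi> (?e 0) - \<phi> (?e 1) + \<phi> (?e 2))"
      using ek by (intro fills_add fills_diff \<phi>[OF S]) auto
    moreover have "L (?e 0) - L (?e 1) + L (?e 2) = chain_boundary 2 (frag_of \<sigma>)"
      unfolding L_def chain_boundary_2 singular_face_face_2 by simp
    moreover have "fills S (chain_boundary 2 (frag_of \<sigma>)) (prin \<sigma>)"
      unfolding fills_def using \<sigma> by (intro exI[of _ "frag_of \<sigma>"]) (simp add: singular_chain_of singular_simplex_subtopology)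
    ultimately show ?thesis using fills_unique[OF S] by metis
  qed
  then show ?thesis by blast
qed

end

end

section \<open>Summation of the toric form\<close>

text \<open>Existence of the limit forces the coefficients below degree r to vanish, one after the
  other; what remains at degree r is the limit. In this way the poles of the single fixed points
  cancel.\<close>

lemma fps_coefficient_limit:
  fixes H :: "complex => complex" and c :: real
  assumes H: "H has_fps_expansion F" and c: "c \<noteq> 0"
    and lim: "((\<lambda>t. H (of_real (c * t)) / of_real (c * t) ^ r) \<longlongrightarrow> L) (at_right 0)"
  shows "fps_nth F r = L"
proof -
  have z: "filterlim (\<lambda>t. complex_of_real (c * t)) (at 0) (at_right 0)"
    unfolding filterlim_at
  proof
    show "((\<lambda>t. complex_of_real (c * t)) \<longlongrightarrow> 0) (at_right 0)" by (intro tendsto_eq_intros) auto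
    show "\<forall>\<^sub>F t in at_right 0. complex_of_real (c * t) \<in> UNIV \<and> complex_of_real (c * t) \<noteq> 0"
      using eventually_at_right_less[of "0::real"] by eventually_elim (use c in auto)
  qed
  have t0: "\<forall>\<^sub>F t in at_right 0. (t::real) > 0" by (rule eventually_at_right_less)
  show ?thesis
  proof (cases "F = 0")
    case True
    then have "\<forall>\<^sub>F z in nhds 0. H z = 0" using H by (simp add: has_fps_expansion_0_iff)
    then have "\<forall>\<^sub>F z in at 0. H z = 0" by (simp add: eventually_nhds_conv_at)
    then have "\<forall>\<^sub>F t in at_right 0. H (of_real (c * t)) = 0" using z by (rule eventually_compose_filterlim)
    then have "\<forall>\<^sub>F t in at_right 0. H (of_real (c * t)) / of_real (c * t) ^ r = 0" by eventually_elim simp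
    then have "((\<lambda>t. H (of_real (c * t)) / of_real (c * t) ^ r) \<longlongrightarrow> 0) (at_right 0)" by (rule tendsto_eventually)
    then have "L = 0" using tendsto_unique[OF trivial_limit_at_right_real lim] by blast
    then show ?thesis using True by simp
  next
    case False
    have "k \<le> r --> fps_nth F k = (if k = r then L else 0)" for k
    proof (induction k rule: less_induct)
      case (less k)
      show ?case
      proof
        assume k: "k \<le> r"
        have "k \<le> subdegree F" using False less k by (intro subdegree_geI) auto
        then have "(\<lambda>x. if x = 0 then fps_nth F k else H x / x ^ k) has_fps_expansion fps_shift k F"
          by (intro has_fps_expansion_shift H) auto
        then have "isCont (\<lambda>x. if x = 0 then fps_nth F k else H x / x ^ k) 0"
          using has_fps_expansion_imp_continuous[where A=UNIV] by blast
        then have "((\<lambda>x. if x = 0 then fps_nth F k else H x / x ^ k) \<longlongrightarrow> fps_nth F k) (at 0)" by (simp add: isCont_def)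
        then have "((\<lambda>t. if complex_of_real (c * t) = 0 then fps_nth F k else H (of_real (c * t)) / of_real (c * t) ^ k) \<longlongrightarrow> fps_nth F k) (at_right 0)"
          by (rule filterlim_compose[OF _ z])
        moreover have "((\<lambda>t. if complex_of_real (c * t) = 0 then fps_nth F k else H (of_real (c * t)) / of_real (c * t) ^ k) \<longlongrightarrow> L * 0 ^ (r - k)) (at_right 0)"
        proof (rule Lim_transform_eventually)
          have "((\<lambda>t. complex_of_real (c * t)) \<longlongrightarrow> 0) (at_right 0)" using z by (simp add: filterlim_at)
          then show "((\<lambda>t. H (of_real (c * t)) / of_real (c * t) ^ r * of_real (c * t) ^ (r - k)) \<longlongrightarrow> L * 0 ^ (r - k)) (at_right 0)"
            by (intro tendsto_mult lim tendsto_power)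
          show "\<forall>\<^sub>F t in at_right 0. H (of_real (c * t)) / of_real (c * t) ^ r * of_real (c * t) ^ (r - k) =
              (if complex_of_real (c * t) = 0 then fps_nth F k else H (of_real (c * t)) / of_real (c * t) ^ k)"
            using t0
          proof eventually_elim
            case (elim t)
            define w where "w = complex_of_real (c * t)"
            have "w \<noteq> 0" using elim c by (simp add: w_def)
            then have "H w / w ^ r * w ^ (r - k) = H w / w ^ k" using k by (simp add: power_diff)
            then show ?case using \<open>w \<noteq> 0\<close> unfolding w_def[symmetric] by simp
          qed
        qed
        ultimately have "fps_nth F k = L * 0 ^ (r - k)" by (rule tendsto_unique[OF trivial_limit_at_right_real])
        then show "fps_nth F k = (if k = r then L else 0)" using k by simp
      qed
    qed
    then show ?thesis by simp
  qed
qed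

lemma has_fps_expansion_scale:
  fixes f :: "complex => complex"
  assumes "f has_fps_expansion F"
  shows "(\<lambda>z. f (c * z)) has_fps_expansion Abs_fps (\<lambda>n. c ^ n * fps_nth F n)"
proof -
  have "(\<lambda>z. c * z) has_fps_expansion fps_const c * fps_X" by (intro fps_expansion_intros)
  then have "(f \<circ> (\<lambda>z. c * z)) has_fps_expansion fps_compose F (fps_const c * fps_X)"
    by (intro has_fps_expansion_compose assms) auto
  moreover have "fps_compose F (fps_const c * fps_X) = Abs_fps (\<lambda>n. c ^ n * fps_nth F n)" by (rule fps_ext) simp
  ultimately show ?thesis by (simp add: o_def)
qed

lemma has_sum_sum_finite:
  fixes f :: "'i => 'b => 'c::{topological_comm_monoid_add}"
  assumes "\<And>i. i \<in> I ==> (f i has_sum g i) A" and "finite I"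
  shows "((\<lambda>x. \<Sum>i\<in>I. f i x) has_sum (\<Sum>i\<in>I. g i)) A"
  using assms(2,1) by (induction I rule: finite_induct) (auto intro!: has_sum_add)

lemma summable_on_sum_finite:
  fixes f :: "'i => 'b => 'c::{topological_comm_monoid_add}"
  assumes "\<And>i. i \<in> I ==> f i summable_on A" and "finite I"
  shows "(\<lambda>x. \<Sum>i\<in>I. f i x) summable_on A"
  using assms(2,1) by (induction I rule: finite_induct) (auto intro!: summable_on_add)

section \<open>The twisted sum over the dual lattice\<close>

context smooth_complete_fan begin

context
  fixes dg :: "'a => complex" and \<tau> :: complex and v :: 'a
  assumes pl: "piecewise_linear N \<Sigma> dg"
    and kron: "\<And>d. d \<in> rays ==> kronecker (dg d) \<tau>"
    and v: "generic v"
begin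

abbreviation "hh d \<equiv> kronecker.h (dg d) \<tau>"
abbreviation "ss d \<equiv> kronecker.s (dg d) \<tau>"
abbreviation "term \<equiv> toric_form_term N r \<Sigma> dg (exp (2 * pi * \<i> * \<tau>))"
abbreviation "sprod S t m \<equiv> (\<Prod>j\<in>gens S. ss j (t * (dv S j \<bullet> v)) \<lfloor>m \<bullet> j\<rfloor>)"
abbreviation "Sprod S t \<equiv> (\<Prod>j\<in>gens S. kronecker.S (dg j) \<tau> (t * (dv S j \<bullet> v)))"
abbreviation "twist t m \<equiv> exp (of_real (2 * pi * t * (m \<bullet> v))) * term m"
abbreviation "twist_sum t \<equiv> (\<Sum>\<^sub>\<infinity>m\<in>dual_lattice N. twist t m)"

lemma q_powi: "d \<in> rays ==> exp (2 * pi * \<i> * \<tau>) powi n = kronecker.q \<tau> n"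
  by (simp add: exp_power_int kronecker.q_def[OF kron] mult_ac)

lemma term_eq:
  assumes m: "m \<in> \<M>"
  shows "term m = (\<Sum>C\<in>\<Sigma>. (-1) ^ (r - card (gens C)) * (\<Prod>d\<in>gens C. hh d \<lfloor>m \<bullet> d\<rfloor>))"
  unfolding toric_form_term_def
proof (rule sum.cong[OF refl])
  fix C assume C: "C \<in> \<Sigma>"
  have k: "kronecker (dg d) \<tau>" if "d \<in> gens C" for d using kron that gens_rays by auto
  have e: "exp (2 * pi * \<i> * dg d) * exp (2 * pi * \<i> * \<tau>) powi n = kronecker.e (dg d) * kronecker.q \<tau> n" if "d \<in> gens C" for d n
    using that gens_rays[of C] by (subst q_powi[of d]) (auto simp: kronecker.e_def[OF k])
  have "cone_function N dg C (exp (2 * pi * \<i> * \<tau>)) m = (\<Prod>d\<in>gens C. 1 / (1 - exp (2 * pi * \<i> * dg d) * exp (2 * pi * \<i> * \<tau>) powi \<lfloor>m \<bullet> d\<rfloor>))"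
    using kronecker.denominator_nonzero[OF k] by (intro cone_function_product[OF C pl _ m]) (simp_all only: e exp_not_eq_zero not_False_eq_True)
  also have "\<dots> = (\<Prod>d\<in>gens C. hh d \<lfloor>m \<bullet> d\<rfloor>)"
    by (rule prod.cong) (simp_all only: e kronecker.h_def[OF k])
  finally show "(- 1) ^ (r - dim C) * cone_function N dg C (exp (2 * pi * \<i> * \<tau>)) m = (- 1) ^ (r - card (gens C)) * (\<Prod>d\<in>gens C. hh d \<lfloor>m \<bullet> d\<rfloor>)"
    by (simp add: dim_cone[OF C])
qed

lemma inner_expand:
  assumes S: "S \<in> max_cones" shows "m \<bullet> v = (\<Sum>j\<in>gens S. (dv S j \<bullet> v) * (m \<bullet> j))"
proof -
  have "v = (\<Sum>j\<in>gens S. (dv S j \<bullet> v) *\<^sub>R j)" using v by (intro vector_expand[OF S]) (simp add: generic_def)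
  then have "m \<bullet> v = m \<bullet> (\<Sum>j\<in>gens S. (dv S j \<bullet> v) *\<^sub>R j)" by (rule arg_cong)
  then show ?thesis by (simp add: inner_sum_right)
qed

text \<open>In each maximal cone the exponent splits along the coordinates of \<open>v\<close>,
  giving one exponential per generator.\<close>

lemma term_exp:
  assumes m: "m \<in> \<M>" and t: "t \<noteq> 0"
  shows "twist t m = (\<Sum>S\<in>max_cones. sprod S t m)"
proof -
  \<comment> \<open>The subtraction in \<open>s\<close> depends on the sign of t times a coordinate
    of \<open>v\<close>; for negative t this is the sign pattern of \<open>- v\<close>.\<close>
  define v' where "v' = (if t > 0 then v else - v)"
  have v': "generic v'" using v generic_minus by (simp add: v'_def)
  have sg: "dv S j \<bullet> v' > 0 \<longleftrightarrow> t * (dv S j \<bullet> v) > 0" for S j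
    using t by (auto simp: v'_def zero_less_mult_iff)
  have "twist t m = (\<Sum>S\<in>max_cones. exp (of_real (2 * pi * t * (m \<bullet> v))) * (\<Prod>j\<in>gens S. (hh j \<lfloor>m \<bullet> j\<rfloor> - (if t * (dv S j \<bullet> v) > 0 then 1 else 0))))"
    unfolding term_eq[OF m] alternating_sum_max_cones[OF v'] sg by (rule sum_distrib_left)
  also have "\<dots> = (\<Sum>S\<in>max_cones. sprod S t m)"
  proof (rule sum.cong[OF refl])
    fix S assume S: "S \<in> max_cones"
    have "complex_of_real (2 * pi * t * (m \<bullet> v)) = (\<Sum>j\<in>gens S. of_real (2 * pi * (t * (dv S j \<bullet> v)) * of_int \<lfloor>m \<bullet> j\<rfloor>))"
    proof -
      have fl: "of_int \<lfloor>m \<bullet> j\<rfloor> = m \<bullet> j" if "j \<in> gens S" for j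
      proof -
        have "m \<bullet> j \<in> \<int>" using dual_lattice_Ints[OF m] gens_subset_N[OF max_cone_in[OF S]] that by blast
        then obtain z where "m \<bullet> j = of_int z" by (rule Ints_cases)
        then show ?thesis by (simp only: floor_of_int)
      qed
      have "2 * pi * t * (m \<bullet> v) = (\<Sum>j\<in>gens S. 2 * pi * (t * (dv S j \<bullet> v)) * of_int \<lfloor>m \<bullet> j\<rfloor>)"
        unfolding inner_expand[OF S, of m] sum_distrib_left by (rule sum.cong[OF refl]) (simp only: fl mult.assoc)
      then show ?thesis by (simp only: of_real_sum)
    qed
    then have ex: "exp (complex_of_real (2 * pi * t * (m \<bullet> v))) = (\<Prod>j\<in>gens S. exp (of_real (2 * pi * (t * (dv S j \<bullet> v)) * of_int \<lfloor>m \<bullet> j\<rfloor>)))"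
      using exp_sum[OF gens_finite[OF max_cone_in[OF S]]] by simp
    show "exp (of_real (2 * pi * t * (m \<bullet> v))) * (\<Prod>j\<in>gens S. (hh j \<lfloor>m \<bullet> j\<rfloor> - (if t * (dv S j \<bullet> v) > 0 then 1 else 0))) =
        (sprod S t m)"
    proof -
      have "ss j y n = exp (of_real (2 * pi * y * of_int n)) * (hh j n - (if y > 0 then 1 else 0))" if "j \<in> gens S" for j y n
        using kronecker.s_def[OF kron] that gens_rays[of S] by auto
      then have "(sprod S t m) =
          (\<Prod>j\<in>gens S. exp (of_real (2 * pi * (t * (dv S j \<bullet> v)) * of_int \<lfloor>m \<bullet> j\<rfloor>)) * (hh j \<lfloor>m \<bullet> j\<rfloor> - (if t * (dv S j \<bullet> v) > 0 then 1 else 0)))"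
        by (intro prod.cong) auto
      then show ?thesis unfolding ex prod.distrib by (rule sym)
    qed
  qed
  finally show ?thesis .
qed

lemma dual_bij:
  assumes S: "S \<in> max_cones"
  shows "bij_betw (\<lambda>m. \<lambda>j\<in>gens S. \<lfloor>m \<bullet> j\<rfloor>) \<M> (gens S \<rightarrow>\<^sub>E UNIV)"
proof (rule bij_betwI[where g="\<lambda>k. \<Sum>j\<in>gens S. of_int (k j) *\<^sub>R dv S j"])
  note SS = max_cone_in[OF S]
  show "(\<lambda>m. \<lambda>j\<in>gens S. \<lfloor>m \<bullet> j\<rfloor>) \<in> \<M> \<rightarrow> (gens S \<rightarrow>\<^sub>E UNIV)" by auto
  show "(\<lambda>k. \<Sum>j\<in>gens S. of_int (k j) *\<^sub>R dv S j) \<in> (gens S \<rightarrow>\<^sub>E UNIV) \<rightarrow> \<M>"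
    using dv_dual[OF S] by (auto intro!: dual_lattice_sum dual_lattice_scale)
  fix m assume m: "m \<in> \<M>"
  have "(\<Sum>j\<in>gens S. of_int ((\<lambda>j\<in>gens S. \<lfloor>m \<bullet> j\<rfloor>) j) *\<^sub>R dv S j) = (\<Sum>j\<in>gens S. (m \<bullet> j) *\<^sub>R dv S j)"
  proof (rule sum.cong[OF refl])
    fix j assume j: "j \<in> gens S"
    have "m \<bullet> j \<in> \<int>" using dual_lattice_Ints[OF m] gens_subset_N[OF SS] j by auto
    then show "of_int ((\<lambda>j\<in>gens S. \<lfloor>m \<bullet> j\<rfloor>) j) *\<^sub>R dv S j = (m \<bullet> j) *\<^sub>R dv S j" using j by (auto elim!: Ints_cases)
  qed
  also have "\<dots> = m" using dual_expand[OF S] m by (simp add: dual_lattice_def)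
  finally show "(\<Sum>j\<in>gens S. of_int ((\<lambda>j\<in>gens S. \<lfloor>m \<bullet> j\<rfloor>) j) *\<^sub>R dv S j) = m" .
next
  note SS = max_cone_in[OF S]
  fix k :: "'a => int" assume k: "k \<in> gens S \<rightarrow>\<^sub>E UNIV"
  have "(\<Sum>j\<in>gens S. of_int (k j) *\<^sub>R dv S j) \<bullet> i = of_int (k i)" if i: "i \<in> gens S" for i
  proof -
    have "(\<Sum>j\<in>gens S. of_int (k j) *\<^sub>R dv S j) \<bullet> i = (\<Sum>j\<in>gens S. if j = i then of_int (k j) else 0)"
      unfolding inner_sum_left using dv_inner[OF SS _ i] by (intro sum.cong) auto
    then show ?thesis using i gens_finite[OF SS] by simp
  qed
  then show "(\<lambda>j\<in>gens S. \<lfloor>(\<Sum>j\<in>gens S. of_int (k j) *\<^sub>R dv S j) \<bullet> j\<rfloor>) = k"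
    using k by (auto simp: fun_eq_iff PiE_def extensional_def)
qed

text \<open>The range of t in which all the one-variable series converge.\<close>

definition safe :: "real => bool" where
  "safe t \<longleftrightarrow> t \<noteq> 0 \<and> (\<forall>S\<in>max_cones. \<forall>j\<in>gens S. \<bar>t * (dv S j \<bullet> v)\<bar> < Im \<tau>)"

text \<open>The generators of \<open>S\<close> identify the dual lattice with a product of copies of
  the integers, so the absolutely convergent sum of a product is the product of the one-variable
  sums.\<close>

lemma product_sum:
  assumes S: "S \<in> max_cones" and t: "safe t"
  shows product_summable: "(\<lambda>m. norm (sprod S t m)) summable_on \<M>"
    and product_infsum: "(\<Sum>\<^sub>\<infinity>m\<in>\<M>. sprod S t m) = (Sprod S t)"
proof -
  note SS = max_cone_in[OF S]
  let ?g = "\<lambda>k. \<Prod>j\<in>gens S. ss j (t * (dv S j \<bullet> v)) (k j)"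
  have a: "(\<lambda>n. norm (ss j (t * (dv S j \<bullet> v)) n)) summable_on UNIV" if j: "j \<in> gens S" for j
  proof (rule kronecker.s_summable)
    show "kronecker (dg j) \<tau>" using kron j gens_rays by auto
    show "t * (dv S j \<bullet> v) \<noteq> 0" using t generic_dv_nonzero[OF v S j] by (simp add: safe_def)
    show "\<bar>t * (dv S j \<bullet> v)\<bar> < Im \<tau>" using t S j by (auto simp: safe_def)
  qed
  have e: "(sprod S t m) = ?g (\<lambda>j\<in>gens S. \<lfloor>m \<bullet> j\<rfloor>)" for m
    by (rule prod.cong) auto
  have "Infinite_Set_Sum.abs_summable_on ?g (gens S \<rightarrow>\<^sub>E UNIV)"
    using a by (intro Infinite_Set_Sum.abs_summable_on_prod_PiE gens_finite[OF SS]) (auto simp flip: abs_summable_equivalent)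
  then have sg: "(\<lambda>k. norm (?g k)) summable_on (gens S \<rightarrow>\<^sub>E UNIV)" by (simp only: abs_summable_equivalent[symmetric])
  show "(\<lambda>m. norm (sprod S t m)) summable_on \<M>"
    unfolding e using summable_on_reindex_bij_betw[OF dual_bij[OF S], of "\<lambda>k. norm (?g k)"] sg by blast
  have "(\<Sum>\<^sub>\<infinity>m\<in>\<M>. sprod S t m) = infsum ?g (gens S \<rightarrow>\<^sub>E UNIV)"
    unfolding e by (rule infsum_reindex_bij_betw[OF dual_bij[OF S]])
  also have "\<dots> = (\<Prod>j\<in>gens S. infsum (ss j (t * (dv S j \<bullet> v))) UNIV)"
    by (rule infsum_prod_PiE_abs[OF gens_finite[OF SS]]) (use a in auto)
  also have "\<dots> = (Sprod S t)"
    using kronecker.S_def[OF kron] gens_rays[of S] by (intro prod.cong) auto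
  finally show "(\<Sum>\<^sub>\<infinity>m\<in>\<M>. sprod S t m) = (Sprod S t)" .
qed

lemma twisted_sum:
  assumes t: "safe t"
  shows twisted_summable: "(\<lambda>m. norm (twist t m)) summable_on \<M>"
    and twisted_infsum: "(twist_sum t) =
      (\<Sum>S\<in>max_cones. Sprod S t)"
proof -
  let ?p = "\<lambda>S m. sprod S t m"
  have t0: "t \<noteq> 0" using t by (simp add: safe_def)
  have "(\<lambda>m. \<Sum>S\<in>max_cones. norm (?p S m)) summable_on \<M>"
    using product_summable[OF _ t] by (intro summable_on_sum_finite finite_max_cones)
  then have "(\<lambda>m. norm (\<Sum>S\<in>max_cones. ?p S m)) summable_on \<M>"
    by (rule summable_on_comparison_test) (auto intro: norm_sum)
  then show "(\<lambda>m. norm (twist t m)) summable_on \<M>"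
    by (rule summable_on_cong[THEN iffD2, rotated]) (simp only: term_exp[OF _ t0])
  have hs: "(?p S has_sum (Sprod S t)) \<M>" if S: "S \<in> max_cones" for S
    using has_sum_infsum[OF abs_summable_summable[OF product_summable[OF S t]]] product_infsum[OF S t] by simp
  have "((\<lambda>m. \<Sum>S\<in>max_cones. ?p S m) has_sum (\<Sum>S\<in>max_cones. Sprod S t)) \<M>"
    using hs by (intro has_sum_sum_finite finite_max_cones)
  then have "((\<lambda>m. twist t m) has_sum (\<Sum>S\<in>max_cones. Sprod S t)) \<M>"
    by (rule has_sum_cong[THEN iffD2, rotated]) (simp only: term_exp[OF _ t0])
  then show "(twist_sum t) =
      (\<Sum>S\<in>max_cones. Sprod S t)" by (rule infsumI)
qed

lemma small_factor:
  assumes "\<And>j. j \<in> rays ==> \<rho> j > (0::real)"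
  shows "\<exists>t0>0. \<forall>t S j. \<bar>t\<bar> \<le> t0 --> S \<in> max_cones --> j \<in> gens S --> \<bar>t * (dv S j \<bullet> v)\<bar> < \<rho> j"
proof -
  let ?I = "Sigma max_cones gens"
  have fI: "finite ?I" using finite_max_cones gens_finite max_cone_in by auto
  define t0 where "t0 = Min (insert 1 ((\<lambda>(S, j). \<rho> j / (\<bar>dv S j \<bullet> v\<bar> + 1)) ` ?I))"
  have pos: "t0 > 0" unfolding t0_def using fI assms gens_rays by (subst Min_gr_iff) (auto intro!: divide_pos_pos)
  have "\<bar>t * (dv S j \<bullet> v)\<bar> < \<rho> j" if t: "\<bar>t\<bar> \<le> t0" and S: "S \<in> max_cones" "j \<in> gens S" for t S j
  proof -
    have "t0 \<le> \<rho> j / (\<bar>dv S j \<bullet> v\<bar> + 1)" unfolding t0_def using fI S by (intro Min_le) (auto intro!: image_eqI[of _ _ "(S, j)"])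
    then have *: "t0 * (\<bar>dv S j \<bullet> v\<bar> + 1) \<le> \<rho> j" by (simp add: pos_le_divide_eq)
    have "\<bar>t * (dv S j \<bullet> v)\<bar> \<le> t0 * \<bar>dv S j \<bullet> v\<bar>" using t by (simp add: abs_mult mult_right_mono)
    also have "\<dots> < t0 * (\<bar>dv S j \<bullet> v\<bar> + 1)" using pos by simp
    finally show ?thesis using * by linarith
  qed
  then show ?thesis using pos by blast
qed

lemma tau_pos_rays: "j \<in> rays ==> Im \<tau> > 0" using kronecker.tau_pos[OF kron] .

text \<open>Since exp |x| is at most exp x + exp (- x), the twisted sums at t0 and - t0 dominate all
  twists in between, the untwisted one included. This gives absolute convergence at t = 0 and
  continuity there.\<close>

lemma toric_sum:
  shows toric_summable: "(\<lambda>m. norm (term m)) summable_on \<M>"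
    and toric_continuous: "((\<lambda>t. twist_sum t) \<longlongrightarrow> toric_form N r \<Sigma> dg (exp (2 * pi * \<i> * \<tau>))) (at_right 0)"
proof -
  obtain t0 where t0: "t0 > 0" "\<And>t S j. \<bar>t\<bar> \<le> t0 ==> S \<in> max_cones ==> j \<in> gens S ==> \<bar>t * (dv S j \<bullet> v)\<bar> < Im \<tau>"
    using small_factor[of "\<lambda>_. Im \<tau>"] tau_pos_rays by blast
  have safe: "safe t0" "safe (- t0)" using t0 t0(2)[of "- t0"] by (auto simp: safe_def)
  define M where "M m = norm (exp (of_real (2 * pi * t0 * (m \<bullet> v))) * term m) + norm (exp (of_real (2 * pi * (- t0) * (m \<bullet> v))) * term m)" for m
  have M: "M summable_on \<M>" unfolding M_def
    by (intro summable_on_add twisted_summable safe)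
  have bound: "norm (twist t m) \<le> M m" if t: "\<bar>t\<bar> \<le> t0" for t m
  proof -
    have x: "\<bar>2 * pi * t * (m \<bullet> v)\<bar> \<le> \<bar>2 * pi * t0 * (m \<bullet> v)\<bar>"
    proof -
      have "\<bar>2 * pi * t * (m \<bullet> v)\<bar> = \<bar>t\<bar> * (2 * pi * \<bar>m \<bullet> v\<bar>)" by (simp add: abs_mult)
      also have "\<dots> \<le> t0 * (2 * pi * \<bar>m \<bullet> v\<bar>)" using t by (intro mult_right_mono) auto
      also have "\<dots> = \<bar>2 * pi * t0 * (m \<bullet> v)\<bar>" using t0 by (simp add: abs_mult)
      finally show ?thesis .
    qed
    have "exp (2 * pi * t * (m \<bullet> v)) \<le> exp \<bar>2 * pi * t0 * (m \<bullet> v)\<bar>" using x by simp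
    also have "\<dots> \<le> exp (2 * pi * t0 * (m \<bullet> v)) + exp (- (2 * pi * t0 * (m \<bullet> v)))" by (simp add: abs_if)
    finally have "exp (2 * pi * t * (m \<bullet> v)) * norm (term m) \<le> (exp (2 * pi * t0 * (m \<bullet> v)) + exp (- (2 * pi * t0 * (m \<bullet> v)))) * norm (term m)"
      by (rule mult_right_mono) simp
    then show ?thesis by (simp add: M_def norm_mult distrib_right)
  qed
  show "(\<lambda>m. norm (term m)) summable_on \<M>"
    by (rule summable_on_comparison_test[OF M]) (use bound[of 0] t0 in auto)
  \<comment> \<open>Extended by zero, because the continuity lemma sums over a whole type.\<close>
  define f where "f m t = (if m \<in> \<M> then twist t m else 0)" for m t
  define M' where "M' m = (if m \<in> \<M> then M m else 0)" for m
  have "M' summable_on UNIV" using M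
    by (rule summable_on_cong_neutral[THEN iffD1, rotated -1]) (auto simp: M'_def)
  then have "continuous_on {-t0..t0} (\<lambda>t. \<Sum>\<^sub>\<infinity>m. f m t)"
  proof (rule continuous_on_infsum[rotated -1])
    show "continuous_on {-t0..t0} (f m)" for m unfolding f_def by (cases "m \<in> \<M>") (auto intro!: continuous_intros)
    show "norm (f m t) \<le> M' m" if "t \<in> {-t0..t0}" for m t using bound[of t m] that by (auto simp: f_def M'_def)
  qed
  moreover have fs: "(\<Sum>\<^sub>\<infinity>m. f m t) = (twist_sum t)" for t
    by (rule infsum_cong_neutral) (auto simp: f_def)
  ultimately have "continuous_on {-t0..t0} (\<lambda>t. twist_sum t)" by simp
  moreover have "0 \<in> interior {-t0..t0}" using t0 by simp
  ultimately have "isCont (\<lambda>t. twist_sum t) 0"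
    by (rule continuous_on_interior)
  then have "((\<lambda>t. twist_sum t) \<longlongrightarrow> (\<Sum>\<^sub>\<infinity>m\<in>\<M>. exp (of_real (2 * pi * 0 * (m \<bullet> v))) * term m)) (at 0)"
    by (simp only: isCont_def)
  then have "((\<lambda>t. twist_sum t) \<longlongrightarrow> (\<Sum>\<^sub>\<infinity>m\<in>\<M>. exp (of_real (2 * pi * 0 * (m \<bullet> v))) * term m)) (at_right 0)"
    by (rule tendsto_within_subset) simp
  moreover have "(\<Sum>\<^sub>\<infinity>m\<in>\<M>. exp (of_real (2 * pi * 0 * (m \<bullet> v))) * term m) = toric_form N r \<Sigma> dg (exp (2 * pi * \<i> * \<tau>))"
    by (simp add: toric_form_def)
  ultimately show "((\<lambda>t. twist_sum t) \<longlongrightarrow> toric_form N r \<Sigma> dg (exp (2 * pi * \<i> * \<tau>))) (at_right 0)"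
    by (simp only:)
qed

text \<open>For small t > 0, a maximal cone contributes a product of theta quotients at arguments
  proportional to t, divided by a multiple of t^r. The limit picks out the coefficient of degree
  r.\<close>

lemma toric_form_coefficient:
  "toric_form N r \<Sigma> dg (exp (2 * pi * \<i> * \<tau>)) =
    (\<Sum>S\<in>max_cones. 1 / (\<Prod>j\<in>gens S. of_real (dv S j \<bullet> v)) *
       fps_nth (\<Prod>j\<in>gens S. Abs_fps (\<lambda>n. (1 / (2 * pi * \<i>) * of_real (dv S j \<bullet> v)) ^ n * fps_nth (theta_quotient_fps (dg j) \<tau>) n)) r)"
proof -
  let ?\<kappa> = "1 / (2 * pi * \<i>)"
  have "\<exists>G \<rho>. \<rho> > 0 \<and> \<rho> \<le> Im \<tau> \<and> G has_fps_expansion theta_quotient_fps (dg j) \<tau> \<and>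
    (\<forall>y. 0 < \<bar>y\<bar> --> \<bar>y\<bar> < \<rho> --> kronecker.S (dg j) \<tau> y = G (\<i> * of_real y) / of_real (- 2 * pi * y))" if "j \<in> rays" for j
    using kronecker.kronecker_series[OF kron[OF that]] by metis
  then obtain G \<rho> where G: "\<And>j. j \<in> rays ==> \<rho> j > 0 \<and> \<rho> j \<le> Im \<tau> \<and> G j has_fps_expansion theta_quotient_fps (dg j) \<tau> \<and>
    (\<forall>y. 0 < \<bar>y\<bar> --> \<bar>y\<bar> < \<rho> j --> kronecker.S (dg j) \<tau> y = G j (\<i> * of_real y) / of_real (- 2 * pi * y))"
    by metis
  obtain t0 where t0: "t0 > 0" "\<And>t S j. \<bar>t\<bar> \<le> t0 ==> S \<in> max_cones ==> j \<in> gens S ==> \<bar>t * (dv S j \<bullet> v)\<bar> < \<rho> j"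
    using small_factor[of \<rho>] G by blast
  define H where "H z = (\<Sum>S\<in>max_cones. 1 / (\<Prod>j\<in>gens S. of_real (dv S j \<bullet> v)) * (\<Prod>j\<in>gens S. G j (?\<kappa> * of_real (dv S j \<bullet> v) * z)))" for z
  define F where "F = (\<Sum>S\<in>max_cones. fps_const (1 / (\<Prod>j\<in>gens S. of_real (dv S j \<bullet> v))) *
       (\<Prod>j\<in>gens S. Abs_fps (\<lambda>n. (?\<kappa> * of_real (dv S j \<bullet> v)) ^ n * fps_nth (theta_quotient_fps (dg j) \<tau>) n)))"
  have "H has_fps_expansion F" unfolding H_def[abs_def] F_def
    using G gens_rays by (intro has_fps_expansion_sum has_fps_expansion_cmult_left has_fps_expansion_prod has_fps_expansion_scale) auto
  moreover have "((\<lambda>t. H (of_real (- 2 * pi * t)) / of_real (- 2 * pi * t) ^ r) \<longlongrightarrow> toric_form N r \<Sigma> dg (exp (2 * pi * \<i> * \<tau>))) (at_right 0)"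
  proof (rule Lim_transform_eventually[OF toric_continuous])
    have "\<forall>\<^sub>F t in at_right 0. t \<in> {0<..<t0}" using t0 by (intro eventually_at_right_real) auto
    then show "\<forall>\<^sub>F t in at_right 0. (twist_sum t) = H (of_real (- 2 * pi * t)) / of_real (- 2 * pi * t) ^ r"
    proof eventually_elim
      case (elim t)
      have b: "\<bar>t * (dv S j \<bullet> v)\<bar> < \<rho> j" if "S \<in> max_cones" "j \<in> gens S" for S j using t0(2) elim that by auto
      have sf: "safe t" using b G gens_rays elim by (fastforce simp: safe_def)
      \<comment> \<open>With this choice \<open>?\<kappa> * ?w\<close> is i t, so both the argument
        i y of \<open>G\<close> and the denominator - 2 \<pi> y are expressed by \<open>?w\<close>
        and the weight, and r factors produce the power \<open>?w ^ r\<close>.\<close>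
      let ?w = "complex_of_real (- 2 * pi * t)"
      have "(Sprod S t) =
         1 / (\<Prod>j\<in>gens S. of_real (dv S j \<bullet> v)) * (\<Prod>j\<in>gens S. G j (?\<kappa> * of_real (dv S j \<bullet> v) * ?w)) / ?w ^ r" if S: "S \<in> max_cones" for S
      proof -
        have "kronecker.S (dg j) \<tau> (t * (dv S j \<bullet> v)) = G j (?\<kappa> * of_real (dv S j \<bullet> v) * ?w) / (of_real (dv S j \<bullet> v) * ?w)" if j: "j \<in> gens S" for j
        proof -
          have "t * (dv S j \<bullet> v) \<noteq> 0" using elim generic_dv_nonzero[OF v S j] by simp
          then have "kronecker.S (dg j) \<tau> (t * (dv S j \<bullet> v)) = G j (\<i> * of_real (t * (dv S j \<bullet> v))) / of_real (- 2 * pi * (t * (dv S j \<bullet> v)))"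
            using G[of j] b[OF S j] j gens_rays[of S] by auto
          moreover have "\<i> * of_real (t * (dv S j \<bullet> v)) = ?\<kappa> * of_real (dv S j \<bullet> v) * ?w"
            by (simp add: field_simps)
          moreover have "complex_of_real (- 2 * pi * (t * (dv S j \<bullet> v))) = of_real (dv S j \<bullet> v) * ?w" by simp
          ultimately show ?thesis by (simp only:)
        qed
        then have "(Sprod S t) =
          (\<Prod>j\<in>gens S. G j (?\<kappa> * of_real (dv S j \<bullet> v) * ?w)) / ((\<Prod>j\<in>gens S. of_real (dv S j \<bullet> v)) * ?w ^ card (gens S))"
          by (simp only: prod_dividef prod.distrib prod_constant cong: prod.cong)
        also have "card (gens S) = r" using S by (simp add: max_cones_def)
        finally show ?thesis by simp
      qed
      then show ?case unfolding twisted_infsum[OF sf] H_def sum_divide_distrib by (intro sum.cong) auto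
    qed
  qed
  ultimately have "fps_nth F r = toric_form N r \<Sigma> dg (exp (2 * pi * \<i> * \<tau>))"
    by (intro fps_coefficient_limit[where c="- 2 * pi"]) auto
  then show ?thesis by (simp add: F_def fps_sum_nth)
qed

end
end

section \<open>The integral\<close>

lemma cup_word_map: "cup_word X u (map f w) = cup_word X (\<lambda>i. u (f i)) w"
  by (induction w) auto

lemma prod_list_of_real: "(\<Prod>i\<leftarrow>w. of_real (f i)) = (of_real (\<Prod>i\<leftarrow>w. f i) :: complex)"
  by (induction w) auto

section \<open>Intersection numbers of the divisors\<close>

context smooth_complete_fan begin

text \<open>The condition on the fundamental class at the fixed point z = 0, translated from
  homology classes to chains.\<close>

lemma fundamental_orientation:
  assumes S: "S \<in> max_cones" and g: "bij_betw g {1..r} (gens S)"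
    and c: "singular_relcycle (2 * r) X {} c"
    and fund: "fundamental_class N r \<Sigma> (homologous_rel_set (2 * r) X {} c)"
  shows "homologous_rel (2 * r) X (Uo S g) c (frag_of (orientation_simplex N r \<Sigma> S g (\<lambda>_. 0)))"
proof -
  let ?U = "topspace X - {gl S (toric_chart N r S g (\<lambda>_. 0))}"
  have U: "Uo S g = ?U" by (simp add: Uo_def[OF S g] origin_def[OF S g])
  have e1: "hom_induced (int (2 * r)) X {} X ?U id (homologous_rel_set (2 * r) X {} c) =
      homologous_rel_set (2 * r) X ?U (frag_of (orientation_simplex N r \<Sigma> S g (\<lambda>_. 0)))"
    using fund max_cone_in[OF S] g unfolding fundamental_class_def Let_def gens_def by blast
  have e2: "hom_induced (int (2 * r)) X {} X ?U id (homologous_rel_set (2 * r) X {} c) =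
      homologous_rel_set (2 * r) X ?U (chain_map (2 * r) id c)"
    by (rule hom_induced_chain_map) (use c in auto)
  have e3: "chain_map (2 * r) id c = c" using c chain_map_id_gen[of "2 * r" X c id] by (simp add: singular_cycle)
  have "homologous_rel_set (2 * r) X ?U c = homologous_rel_set (2 * r) X ?U (frag_of (orientation_simplex N r \<Sigma> S g (\<lambda>_. 0)))"
    by (rule trans[OF sym[OF e2[unfolded e3]] e1])
  then show ?thesis unfolding U homologous_rel_set_eq .
qed

definition divisor_cocycle :: "'a => 'a toric_point cochain => bool" where
  "divisor_cocycle d u \<longleftrightarrow> u \<in> cocycles X \<and> (\<forall>p \<sigma>. p \<noteq> 2 --> u p \<sigma> = 0) \<and> vanishes_on X u (V d) \<and>
    (\<forall>S m \<sigma>. d \<in> gens S --> S \<in> max_cones --> local_equation N \<Sigma> S d m --> singular_simplex 2 (affine_toric N S) \<sigma> -->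
       punctured \<sigma> m -->
       u 2 (simplex_map 2 (gl S) \<sigma>) = loop_winding \<sigma> m)"

context
  fixes u :: "'a => 'a toric_point cochain" and c :: "'a toric_point chain"
  assumes u: "\<And>i. i \<in> rays ==> divisor_cocycle i (u i)"
    and c: "singular_relcycle (2 * r) X {} c"
    and fund: "fundamental_class N r \<Sigma> (homologous_rel_set (2 * r) X {} c)"
begin

lemma coc: "i \<in> rays ==> u i \<in> cocycles X"
  and deg: "i \<in> rays ==> p \<noteq> 2 ==> u i p \<sigma> = 0"
  and van: "i \<in> rays ==> vanishes_on X (u i) (V i)"
  using u by (simp_all add: divisor_cocycle_def)

lemma wind: "i \<in> gens S ==> S \<in> max_cones ==> local_equation N \<Sigma> S i m ==> singular_simplex 2 (affine_toric N S) \<sigma> ==>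
   punctured \<sigma> m ==>
   u i 2 (simplex_map 2 (gl S) \<sigma>) = loop_winding \<sigma> m"
proof -
  assume *: "i \<in> gens S" "S \<in> max_cones" "local_equation N \<Sigma> S i m" "singular_simplex 2 (affine_toric N S) \<sigma>"
    "punctured \<sigma> m"
  have "divisor_cocycle i (u i)" using u *(1) gens_rays by blast
  from this[unfolded divisor_cocycle_def, THEN conjunct2, THEN conjunct2, THEN conjunct2, rule_format, OF *(1-4)] *(5)
  show "u i 2 (simplex_map 2 (gl S) \<sigma>) = loop_winding \<sigma> m" by blast
qed

lemma cycle: "singular_chain (2 * r) X c" "chain_boundary (2 * r) c = 0"
  using c by (auto simp: singular_cycle)

lemma intersection_relation:
  assumes m: "m \<in> \<M>" and w: "set w1 \<subseteq> rays" "set w2 \<subseteq> rays"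
  shows "(\<Sum>i\<in>rays. of_real (m \<bullet> i) * cochain_eval (cup_word X u (w1 @ i # w2) (2 * r)) c) = 0"
proof -
  have "\<exists>\<phi>. \<forall>S\<in>max_cones. \<forall>\<sigma>. singular_simplex 2 X \<sigma> --> \<sigma> ` \<Delta> 2 \<subseteq> U S -->
     prin m u \<sigma> = \<phi> (singular_face 2 0 \<sigma>) - \<phi> (singular_face 2 1 \<sigma>) + \<phi> (singular_face 2 2 \<sigma>)"
    by (rule relation_cochain[OF m coc van wind])
  moreover have "prin m u \<sigma> = (\<Sum>i\<in>rays. of_real (m \<bullet> i) * u i 2 \<sigma>)" for \<sigma>
    by (rule prin_def[OF m coc van wind])
  ultimately obtain \<phi> where \<phi>: "\<forall>S\<in>max_cones. \<forall>\<sigma>. singular_simplex 2 X \<sigma> --> \<sigma> ` \<Delta> 2 \<subseteq> U S -->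
     (\<Sum>i\<in>rays. of_real (m \<bullet> i) * u i 2 \<sigma>) = \<phi> (singular_face 2 0 \<sigma>) - \<phi> (singular_face 2 1 \<sigma>) + \<phi> (singular_face 2 2 \<sigma>)"
    by auto
  show ?thesis
  proof (rule cup_word_eval_relation[where \<U>="U ` max_cones" and \<phi>=\<phi>, OF coc deg finite_rays w _ _ _ cycle])
    show "openin X W" if "W \<in> U ` max_cones" for W using that open_U max_cone_in by auto
    show "topspace X \<subseteq> \<Union> (U ` max_cones)" using max_cover by simp
  qed (use \<phi> in auto)
qed

lemma intersection_disjoint:
  assumes w: "set w \<subseteq> rays" and S: "\<And>S. S \<in> max_cones ==> \<not> set w \<subseteq> gens S"
  shows "cochain_eval (cup_word X u w (2 * r)) c = 0"
proof (rule cup_word_eval_disjoint[where U=V, OF _ _ _ _ cycle])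
  show "topspace X \<subseteq> (\<Union>i\<in>set w. V i)" using V_common_gens[of "set w"] w S unfolding rays_def by blast
  show "openin X (V i)" if "i \<in> set w" for i using open_V that w unfolding rays_def by blast
qed (use coc van w in auto)

lemma intersection_point:
  assumes w: "distinct w" "set w = gens S" and S: "S \<in> max_cones"
  shows "cochain_eval (cup_word X u w (2 * r)) c = 1"
proof -
  have l: "length w = r" using w S distinct_card[of w] by (simp add: max_cones_def)
  define g where "g j = w ! (j - 1)" for j
  have "bij_betw (\<lambda>j. j - 1) {1..r} {..<r}"
    by (rule bij_betw_byWitness[where f'=Suc]) force+
  then have "bij_betw ((!) w \<circ> (\<lambda>j. j - 1)) {1..r} (set w)"
    by (rule bij_betw_trans) (use bij_betw_nth[OF w(1)] l in auto)
  then have g: "bij_betw g {1..r} (gens S)" using w(2) by (simp add: g_def[abs_def] o_def)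
  have sub: "i \<in> rays" if "i \<in> set w" for i using that w(2) gens_rays by auto
  show ?thesis
    by (rule cup_word_max_cone[OF S g l _ coc deg van _ c fundamental_orientation[OF S g c fund]])
      (use sub wind[OF _ S] w(2) in \<open>auto simp: g_def\<close>)
qed

lemma intersection_number:
  assumes v: "generic v" and w: "set w \<subseteq> rays" "length w = r"
  shows "cochain_eval (cup_word X u w (2 * r)) c = of_real (J v w)"
  by (rule word_functional_eq_J[where I="\<lambda>w. cochain_eval (cup_word X u w (2 * r)) c", OF v _ _ _ w])
    (use intersection_relation intersection_disjoint intersection_point in auto)

end

lemma divisor_class_cocycle:
  assumes D: "divisor_class N \<Sigma> d Z"
  obtains u where "divisor_cocycle d u" "Z = coh_class X u"
proof -
  obtain u where Z: "Z \<in> carrier (cohomology_ring X)" and u: "u \<in> Z" "\<forall>p. p \<noteq> 2 --> (\<forall>\<sigma>. u p \<sigma> = 0)"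
    "\<forall>\<sigma>. singular_simplex 2 (subtopology X (topspace X - toric_divisor N \<Sigma> d)) \<sigma> --> u 2 \<sigma> = 0"
    and w: "\<forall>C\<in>\<Sigma>. d \<in> C --> (\<forall>m. local_equation N \<Sigma> C d m --> (\<forall>\<sigma>. singular_simplex 2 (affine_toric N C) \<sigma> \<and>
                punctured \<sigma> m -->
              u 2 (simplex_map 2 (glue N \<Sigma> C) \<sigma>) = loop_winding \<sigma> m))"
    using D unfolding divisor_class_def Let_def by (elim conjE bexE) (rule that)
  have "vanishes_on X u (V d)"
    unfolding vanishes_on_def
  proof (intro allI impI)
    fix p \<sigma> assume s: "singular_simplex p X \<sigma>" "\<sigma> ` \<Delta> p \<subseteq> V d"
    show "u p \<sigma> = 0"
    proof (cases "p = 2")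
      case True
      then show ?thesis using s u(3) unfolding V_def by (simp add: singular_simplex_subtopology)
    qed (use u in blast)
  qed
  moreover have "\<forall>S m \<sigma>. d \<in> gens S --> S \<in> max_cones --> local_equation N \<Sigma> S d m --> singular_simplex 2 (affine_toric N S) \<sigma> -->
       punctured \<sigma> m -->
       u 2 (simplex_map 2 (gl S) \<sigma>) = loop_winding \<sigma> m"
  proof (intro allI impI)
    fix S m \<sigma>
    assume *: "d \<in> gens S" "S \<in> max_cones" "local_equation N \<Sigma> S d m" "singular_simplex 2 (affine_toric N S) \<sigma>"
      "punctured \<sigma> m"
    have "S \<in> \<Sigma>" "d \<in> S" using *(1,2) max_cone_in by (auto simp: gens_def)
    from w[rule_format, OF this *(3) conjI[OF *(4,5)]]
    show "u 2 (simplex_map 2 (gl S) \<sigma>) = loop_winding \<sigma> m" .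
  qed
  ultimately have "divisor_cocycle d u" using coh_class_rep(1)[OF Z u(1)] u(2) unfolding divisor_cocycle_def by blast
  then show ?thesis using coh_class_rep(2)[OF Z u(1)] by (rule that)
qed

lemma theta_quotient_0: "kronecker \<alpha> \<tau> ==> fps_nth (theta_quotient_fps \<alpha> \<tau>) 0 = 1"
  using kronecker.kronecker_series[of \<alpha> \<tau>] has_fps_expansion_imp_0_eq_fps_nth_0 by metis

text \<open>A divisor away from the fixed point restricts to 0 there, and a theta quotient has
  constant term 1, so only the generators of \<open>S\<close> contribute factors.\<close>

lemma theta_product_rays:
  assumes d: "bij_betw d {1..s} rays" and k: "\<And>x. x \<in> rays ==> kronecker (dg x) \<tau>"
  shows "(\<Prod>i\<leftarrow>[1..<Suc s]. Abs_fps (\<lambda>n. (\<kappa> * of_real (yv v S (d i))) ^ n * fps_nth (theta_quotient_fps (dg (d i)) \<tau>) n)) =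
    (\<Prod>j\<in>gens S. Abs_fps (\<lambda>n. (\<kappa> * of_real (dv S j \<bullet> v)) ^ n * fps_nth (theta_quotient_fps (dg j) \<tau>) n))"
proof -
  let ?f = "\<lambda>x. Abs_fps (\<lambda>n. (\<kappa> * of_real (yv v S x)) ^ n * fps_nth (theta_quotient_fps (dg x) \<tau>) n)"
  have "(\<Prod>i\<leftarrow>[1..<Suc s]. ?f (d i)) = (\<Prod>i\<in>set [1..<Suc s]. ?f (d i))"
    by (rule prod.distinct_set_conv_list[symmetric]) simp
  also have "set [1..<Suc s] = {1..s}" by auto
  also have "(\<Prod>i\<in>{1..s}. ?f (d i)) = (\<Prod>x\<in>rays. ?f x)" by (rule prod.reindex_bij_betw[OF d])
  also have "\<dots> = (\<Prod>j\<in>gens S. ?f j)"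
  proof (rule prod.mono_neutral_right[OF finite_rays gens_rays])
    show "\<forall>x\<in>rays - gens S. ?f x = 1"
    proof
      fix x assume x: "x \<in> rays - gens S"
      show "?f x = 1"
      proof (rule fps_ext)
        fix n show "fps_nth (?f x) n = fps_nth 1 n"
          using x theta_quotient_0[OF k] by (cases n) (auto simp: yv_def)
      qed
    qed
  qed
  also have "\<dots> = (\<Prod>j\<in>gens S. Abs_fps (\<lambda>n. (\<kappa> * of_real (dv S j \<bullet> v)) ^ n * fps_nth (theta_quotient_fps (dg j) \<tau>) n))"
    by (rule prod.cong) (simp_all add: yv_def)
  finally show ?thesis .
qed

lemma toric_form_integral:
  assumes pl: "piecewise_linear N \<Sigma> dg"
    and d: "bij_betw d {1..s} rays"
    and k: "\<And>x. x \<in> rays ==> kronecker (dg x) \<tau>"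
    and D: "\<And>i. i \<in> {1..s} ==> divisor_class N \<Sigma> (d i) (D i)"
    and fund: "fundamental_class N r \<Sigma> K"
  shows "toric_form N r \<Sigma> dg (exp (2 * pi * \<i> * \<tau>)) = cohomology_pairing (2 * r) (theta_class N r \<Sigma> s (\<lambda>i. dg (d i)) D \<tau>) K"
proof -
  obtain v where v: "generic v" using generic_exists by blast
  have "K \<in> carrier (homology_group (int (2 * r)) X)" using fund unfolding fundamental_class_def by blast
  then obtain c where c: "singular_relcycle (2 * r) X {} c" "K = homologous_rel_set (2 * r) X {} c"
    unfolding carrier_relative_homology_group by blast
  have dr: "d i \<in> rays" if "i \<in> {1..s}" for i using d that by (auto simp: bij_betw_def)
  have im: "d ` {1..s} = rays" using d by (rule bij_betw_imp_surj_on)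
  \<comment> \<open>The cocycles are indexed by the rays themselves, as in the computation of the
    intersection numbers.\<close>
  have "\<exists>u. divisor_cocycle x u \<and> D (inv_into {1..s} d x) = coh_class X u" if x: "x \<in> rays" for x
  proof -
    have x': "x \<in> d ` {1..s}" using x by (simp only: im)
    have "divisor_class N \<Sigma> x (D (inv_into {1..s} d x))" using D[OF inv_into_into[OF x']] unfolding f_inv_into_f[OF x'] .
    then obtain u where "divisor_cocycle x u" "D (inv_into {1..s} d x) = coh_class X u" by (rule divisor_class_cocycle)
    then show ?thesis by blast
  qed
  then obtain u where u: "\<And>x. x \<in> rays ==> divisor_cocycle x (u x) \<and> D (inv_into {1..s} d x) = coh_class X (u x)" by metis
  have Du: "D i = coh_class X (u (d i))" if "i \<in> {1..s}" for i
    using u[OF dr[OF that]] inv_into_f_f[of d "{1..s}" i] d that by (simp add: bij_betw_def)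
  have coc: "u (d i) \<in> cocycles X" if "i \<in> {1..s}" for i using u[OF dr[OF that]] by (simp add: divisor_cocycle_def)
  let ?\<kappa> = "1 / (2 * pi * \<i>)" and ?F = "\<lambda>i. theta_quotient_fps (dg (d i)) \<tau>"
  let ?A = "\<lambda>S. 1 / (\<Prod>j\<in>gens S. complex_of_real (dv S j \<bullet> v))" and ?y = "\<lambda>S i. complex_of_real (yv v S (d i))"
  let ?t = "theta_cocycle X r ?F (\<lambda>i. u (d i)) ?\<kappa> [1..<Suc s]"
  have t: "?t \<in> cocycles X" using coc by (intro cocycles_theta_cocycle) auto
  have tc: "theta_class N r \<Sigma> s (\<lambda>i. dg (d i)) D \<tau> = coh_class X ?t"
    by (rule theta_class_coset[OF coc Du])
  have "cohomology_pairing (2 * r) (theta_class N r \<Sigma> s (\<lambda>i. dg (d i)) D \<tau>) K = cochain_eval (?t (2 * r)) c"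
    unfolding c(2) tc by (rule cohomology_pairing_coset[OF t c(1)])
  also have "\<dots> = cochain_eval (cup X (cup_word X (\<lambda>i. u (d i)) []) ?t (2 * r)) c"
    by (simp only: cup_word.simps cup_const_left cocycles_cochains[OF t]) (simp add: cup_const_left cocycles_cochains[OF t])?
  also have "\<dots> = (\<Sum>S\<in>max_cones. ?A S * (\<Prod>i\<leftarrow>[]. ?y S i) *
       fps_nth (\<Prod>i\<leftarrow>[1..<Suc s]. Abs_fps (\<lambda>n. (?\<kappa> * ?y S i) ^ n * fps_nth (?F i) n)) (r - length ([]::nat list)))"
  proof (rule theta_cocycle_eval[where V="{1..s}"])
    fix w :: "nat list" assume w: "set w \<subseteq> {1..s}" "length w = r"
    have "cochain_eval (cup_word X u (map d w) (2 * r)) c = of_real (J v (map d w))"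
      using u w dr fund unfolding c(2)
      by (intro intersection_number[OF _ c(1) _ v]) auto
    then show "cochain_eval (cup_word X (\<lambda>i. u (d i)) w (2 * r)) c = (\<Sum>S\<in>max_cones. ?A S * (\<Prod>i\<leftarrow>w. ?y S i))"
      unfolding cup_word_map J_def by (simp add: o_def prod_list_of_real mult.commute)
  qed (use u dr in \<open>auto simp: divisor_cocycle_def\<close>)
  also have "\<dots> = toric_form N r \<Sigma> dg (exp (2 * pi * \<i> * \<tau>))"
  proof -
    have tp: "(\<Prod>i\<leftarrow>[1..<Suc s]. Abs_fps (\<lambda>n. (?\<kappa> * ?y S i) ^ n * fps_nth (?F i) n)) =
      (\<Prod>j\<in>gens S. Abs_fps (\<lambda>n. (?\<kappa> * of_real (dv S j \<bullet> v)) ^ n * fps_nth (theta_quotient_fps (dg j) \<tau>) n))" for S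
      by (rule theta_product_rays[OF d k])
    have tf: "toric_form N r \<Sigma> dg (exp (2 * pi * \<i> * \<tau>)) = (\<Sum>S\<in>max_cones. ?A S *
       fps_nth (\<Prod>j\<in>gens S. Abs_fps (\<lambda>n. (?\<kappa> * of_real (dv S j \<bullet> v)) ^ n * fps_nth (theta_quotient_fps (dg j) \<tau>) n)) r)"
      by (rule toric_form_coefficient[OF pl k v])
    show ?thesis unfolding tf tp by simp
  qed
  finally show ?thesis by simp
qed

end

theorem theorem3p4:
  fixes N :: "'a::euclidean_space set" and r s :: nat
    and \<Sigma> :: "'a set set" and dg :: "'a \<Rightarrow> complex" and d :: "nat \<Rightarrow> 'a"
    and D :: "nat \<Rightarrow> 'a toric_point cochain set"
    and fundX :: "'a toric_point chain set"
  assumes "lattice_of_rank N r"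
    and "complete_fan N \<Sigma>"
    and "nonsingular_fan N \<Sigma>"
    and "piecewise_linear N \<Sigma> dg"
    and "bij_betw d {1..s} (ray_generators N \<Sigma>)"
    and "\<forall>i\<in>{1..s}. dg (d i) \<notin> \<int>"
    and "\<forall>i\<in>{1..s}. divisor_class N \<Sigma> (d i) (D i)"
    and "fundamental_class N r \<Sigma> fundX"
  shows "\<exists>T>0. \<forall>\<tau>::complex. Im \<tau> > T \<longrightarrow>
    (\<lambda>m. norm (toric_form_term N r \<Sigma> dg (exp (2 * pi * \<i> * \<tau>)) m)) summable_on dual_lattice N \<and>
    toric_form N r \<Sigma> dg (exp (2 * pi * \<i> * \<tau>)) =
      cohomology_pairing (2 * r) (theta_class N r \<Sigma> s (\<lambda>i. dg (d i)) D \<tau>) fundX"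
proof -
  interpret smooth_complete_fan N r \<Sigma> by unfold_locales (fact assms(1-3))+
  have d: "bij_betw d {1..s} rays" using assms(5) by (simp add: rays_def)
  \<comment> \<open>The sum dominates each |Im (deg x)| + 1, and the extra 1 keeps the bound
    positive even if there are no rays, as for r = 0.\<close>
  define t0 where "t0 = 1 + (\<Sum>x\<in>rays. \<bar>Im (dg x)\<bar> + 1)"
  have "t0 > 0" unfolding t0_def by (intro add_pos_nonneg sum_nonneg) auto
  moreover have "(\<lambda>m. norm (toric_form_term N r \<Sigma> dg (exp (2 * pi * \<i> * \<tau>)) m)) summable_on dual_lattice N \<and>
    toric_form N r \<Sigma> dg (exp (2 * pi * \<i> * \<tau>)) =
      cohomology_pairing (2 * r) (theta_class N r \<Sigma> s (\<lambda>i. dg (d i)) D \<tau>) fundX" if \<tau>: "Im \<tau> > t0" for \<tau>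
  proof -
    have k: "kronecker (dg x) \<tau>" if x: "x \<in> rays" for x
    proof
      obtain i where "i \<in> {1..s}" "x = d i" using x bij_betw_imp_surj_on[OF d] by blast
      then show "dg x \<notin> \<int>" using assms(6) by blast
      have "\<bar>Im (dg x)\<bar> + 1 \<le> (\<Sum>x\<in>rays. \<bar>Im (dg x)\<bar> + 1)"
        using x by (intro member_le_sum finite_rays) auto
      then show "\<bar>Im (dg x)\<bar> + 1 < Im \<tau>" using \<tau> by (simp add: t0_def)
    qed
    obtain v where "generic v" using generic_exists by blast
    then show ?thesis
      using toric_summable[OF assms(4) k] toric_form_integral[OF assms(4) d k _ assms(8)] assms(7) by blast
  qed
  ultimately show ?thesis by blast
qed

end
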